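(* Let $\mathbf{P}\rightrightarrows\mathbf{Q}$ be a principal $2$-bundle over a manifold $M$ and let $(F,\tau_0)$ be a $2$-connection on it, where $F=(F_1,F_0)$ with $F_1=\mathtt u\circ F_0$, and let $\tau$ be the natural transformation determined by $\tau_0$. Then $(F,\tau)$ determines a quasi LA-groupoid morphism $$(F,\tau):(TM\rightrightarrows TM)\to(\mathbb{A}_{\mathbf{P}}\rightrightarrows\mathbb{A}_{\mathbf{Q}})$$ if and only if the $3$-form curvature $\Omega_{(F,\tau)}:=d\tau_0+[F_0,\tau_0]$ vanishes.
   Context: A principal $2$-bundle is a Lie groupoid $\mathbf{P}\rightrightarrows\mathbf{Q}$ with a multiplicative free and proper action of a strict Lie $2$-group $H\rtimes K\rightrightarrows K$ whose quotient is the unit groupoid $M\rightrightarrows M$ of a manifold. The Atiyah algebroids $\mathbb{A}_{\mathbf{P}}=T\mathbf{P}/(H\rtimes K)$ and $\mathbb{A}_{\mathbf{Q}}=T\mathbf{Q}/K$ form an LA-groupoid $\mathbb{A}_{\mathbf{P}}\rightrightarrows\mathbb{A}_{\mathbf{Q}}$ over $M\rightrightarrows M$ (unit $\mathtt u$), with core $C=\ker(\mathtt s:\mathbb{A}_{\mathbf P}\to\mathbb{A}_{\mathbf Q})$ and core map $\partial=\mathtt t|_C:C\to\mathbb{A}_{\mathbf{Q}}$; the anchors $\pi_1:\mathbb{A}_{\mathbf{P}}\to TM$, $\pi_0:\mathbb{A}_{\mathbf{Q}}\to TM$ form a morphism of LA-groupoids onto $TM\rightrightarrows TM$. $\Gamma(\mathbb{A}_{\mathbf{Q}})$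 acts on $\Gamma(C)$ by $[a,c]:=[\mathtt u(a),c]_{\mathbb{A}_{\mathbf{P}}}$. A splitting of $(\pi_1,\pi_0)$ by VB-groupoid morphisms is the same as a bundle map $F_0:TM\to\mathbb{A}_{\mathbf{Q}}$ with $\pi_0F_0=\mathrm{id}$, together with $F_1=\mathtt u\circ F_0$. A $2$-connection on $\mathbf{P}\rightrightarrows\mathbf{Q}$ is such a splitting $F$ with a bundle map $\tau_0:\wedge^2TM\to C$ such that $dF_0+\tfrac12[F_0,F_0]=\partial\tau_0$, i.e. $[F_0X,F_0Y]-F_0[X,Y]=\partial\tau_0(X,Y)$ for $X,Y\in\mathfrak{X}(M)$. The $3$-form curvature is $(d\tau_0+[F_0,\tau_0])(X,Y,Z)=\sum_{cyc}\bigl([F_0X,\tau_0(Y,Z)]-\tau_0([X,Y],Z)\bigr)$. LA-groupoids $(V\rightrightarrows W;G\rightrightarrows M)$ are quasi LA-groupoids with $q=0$: $V[1]\rightrightarrows W[1]$ is a $1$-graded Lie groupoid with functions $\Gamma(\wedge^\bullet V^* )$ and degree $1$ multiplicative vector field $Q$, the Chevalley-Eilenberg differential. A quasi LA-groupoid morphism between two such objects $(\mathcal{G},Q_{\mathcal{G}})$, $(\mathcal{H},Q_{\mathcal{H}})$ is $(F,\tau)$ with $F$ a graded groupoid morphism and $\tau:T[1]F\circ Q_{\mathcal{G}}\Rightarrow Q_{\mathcal{H}}\circ F$ a natural transformation lying over the units, satisfying the coherence law that the composite natural transformation $(1_{T[1]Q_{\mathcal{H}}}\diamond\tau)\bullet(T[1]\tau\diamond1_{Q_{\mathcal{G}}})$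 from $0$ to $Q_{\mathcal{H}}^2\circ F=0$ is the trivial one (the one induced by $q=0$); $\diamond$ and $\bullet$ are horizontal and vertical composition. For $\mathcal{G}=T[1]M$ (unit groupoid) and $\mathcal{H}=\mathbb{A}_{\mathbf{P}}[1]$, a natural transformation $\tau$ over the units is determined by a bundle map $\wedge^2TM\to C$, which here is $\tau_0$ up to the sign fixed by conventions. *)

theory Defs
  imports "HOL-Analysis.Analysis" "HOL-Algebra.Group"
begin

section \<open>Smooth manifolds\<close>

text \<open>A manifold is a Hausdorff second countable space (the whole type) with a smooth atlas
  valued in a linear subspace \<open>model\<close> of a Euclidean space. The subspace is there to allow every
  dimension, including 0, although a type of class \<open>euclidean_space\<close> has positive dimension.\<close>

primrec Ck_on :: "nat \<Rightarrow> 'e::euclidean_space set \<Rightarrow> ('e \<Rightarrow> real) \<Rightarrow> bool" where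
  "Ck_on 0 W f \<longleftrightarrow> continuous_on W f"
| "Ck_on (Suc k) W f \<longleftrightarrow> (\<forall>x\<in>W. f differentiable (at x)) \<and>
     (\<forall>v. Ck_on k W (\<lambda>x. frechet_derivative f (at x) v))"

text \<open>Smoothness on an arbitrary subset: local extendability to a smooth function on an open set.\<close>

definition smooth_fun_on :: "'e::euclidean_space set \<Rightarrow> ('e \<Rightarrow> real) \<Rightarrow> bool" where
  "smooth_fun_on V f \<longleftrightarrow>
     (\<forall>x\<in>V. \<exists>W h. open W \<and> x \<in> W \<and> (\<forall>k. Ck_on k W h) \<and> (\<forall>y\<in>V \<inter> W. h y = f y))"

record ('a, 'e) manifold =
  model :: "'e set"
  charts :: "('a set \<times> ('a \<Rightarrow> 'e)) set"

definition is_manifold ::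
    "('a::{t2_space,second_countable_topology}, 'e::euclidean_space) manifold \<Rightarrow> bool" where
  "is_manifold M \<longleftrightarrow>
     subspace (model M) \<and>
     (\<Union>(U, \<phi>)\<in>charts M. U) = UNIV \<and>
     (\<forall>(U, \<phi>)\<in>charts M. open U \<and> openin (top_of_set (model M)) (\<phi> ` U) \<and>
        (\<exists>\<psi>. homeomorphism U (\<phi> ` U) \<phi> \<psi>)) \<and>
     (\<forall>(U, \<phi>)\<in>charts M. \<forall>(V, \<psi>)\<in>charts M. \<forall>b\<in>Basis.
        smooth_fun_on (\<phi> ` (U \<inter> V)) (\<lambda>x. \<psi> (inv_into U \<phi> x) \<bullet> b))"

definition cinf :: "('a, 'e::euclidean_space) manifold \<Rightarrow> ('a \<Rightarrow> real) set" where
  "cinf M = {f. \<forall>(U, \<phi>)\<in>charts M. smooth_fun_on (\<phi> ` U) (\<lambda>x. f (inv_into U \<phi> x))}"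

definition smooth_map :: "('a, 'e::euclidean_space) manifold \<Rightarrow> ('b, 'f::euclidean_space) manifold \<Rightarrow>
    ('a \<Rightarrow> 'b) \<Rightarrow> bool" where
  "smooth_map M N f \<longleftrightarrow> (\<forall>g\<in>cinf N. g \<circ> f \<in> cinf M)"

text \<open>Smooth maps on an embedded submanifold \<open>A\<close> of \<open>M\<close>, used for \<open>P \<times>\<^sub>Q P \<subseteq> P \<times> P\<close>.\<close>

definition cinf_on :: "('a::topological_space, 'e::euclidean_space) manifold \<Rightarrow> 'a set \<Rightarrow>
    ('a \<Rightarrow> real) set" where
  "cinf_on M A = {f. \<forall>x\<in>A. \<exists>W. \<exists>g\<in>cinf M. open W \<and> x \<in> W \<and> (\<forall>y\<in>A \<inter> W. f y = g y)}"

definition smooth_map_on :: "('a::topological_space, 'e::euclidean_space) manifold \<Rightarrow> 'a set \<Rightarrow>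
    ('b, 'f::euclidean_space) manifold \<Rightarrow> ('a \<Rightarrow> 'b) \<Rightarrow> bool" where
  "smooth_map_on M A N f \<longleftrightarrow> (\<forall>g\<in>cinf N. g \<circ> f \<in> cinf_on M A)"

definition prod_manifold :: "('a, 'e::euclidean_space) manifold \<Rightarrow> ('b, 'f::euclidean_space) manifold \<Rightarrow>
    ('a \<times> 'b, 'e \<times> 'f) manifold" where
  "prod_manifold M N =
     \<lparr>model = model M \<times> model N,
      charts = {(U \<times> V, map_prod \<phi> \<psi>) | U \<phi> V \<psi>. (U, \<phi>) \<in> charts M \<and> (V, \<psi>) \<in> charts N}\<rparr>"

type_synonym 'a tvec = "('a \<Rightarrow> real) \<Rightarrow> real"

text \<open>Tangent vectors are derivations of the algebra of smooth functions, set to 0 on functions that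
  are not smooth so that a derivation is determined by its values on smooth functions.\<close>

definition tangent_space :: "('a, 'e::euclidean_space) manifold \<Rightarrow> 'a \<Rightarrow> 'a tvec set" where
  "tangent_space M p = {v.
     (\<forall>f\<in>cinf M. \<forall>g\<in>cinf M. v (\<lambda>x. f x + g x) = v f + v g) \<and>
     (\<forall>c. \<forall>f\<in>cinf M. v (\<lambda>x. c * f x) = c * v f) \<and>
     (\<forall>f\<in>cinf M. \<forall>g\<in>cinf M. v (\<lambda>x. f x * g x) = v f * g p + f p * v g) \<and>
     (\<forall>f. f \<notin> cinf M \<longrightarrow> v f = 0)}"

text \<open>The differential of a map \<open>f\<close> into \<open>N\<close>, at any point of its domain.\<close>

definition tmap :: "('b, 'f::euclidean_space) manifold \<Rightarrow> ('a \<Rightarrow> 'b) \<Rightarrow> 'a tvec \<Rightarrow> 'b tvec" where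
  "tmap N f v = (\<lambda>g. if g \<in> cinf N then v (g \<circ> f) else 0)"

definition submersion :: "('a, 'e::euclidean_space) manifold \<Rightarrow> ('b, 'f::euclidean_space) manifold \<Rightarrow>
    ('a \<Rightarrow> 'b) \<Rightarrow> bool" where
  "submersion M N f \<longleftrightarrow> smooth_map M N f \<and>
     (\<forall>p. tmap N f ` tangent_space M p = tangent_space N (f p))"

definition vector_fields :: "('a, 'e::euclidean_space) manifold \<Rightarrow> ('a \<Rightarrow> 'a tvec) set" where
  "vector_fields M = {X. (\<forall>p. X p \<in> tangent_space M p) \<and> (\<forall>f\<in>cinf M. (\<lambda>p. X p f) \<in> cinf M)}"

definition vf_bracket :: "('a \<Rightarrow> 'a tvec) \<Rightarrow> ('a \<Rightarrow> 'a tvec) \<Rightarrow> 'a \<Rightarrow> 'a tvec" where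
  "vf_bracket X Y = (\<lambda>p f. X p (\<lambda>q. Y q f) - Y p (\<lambda>q. X q f))"


section \<open>Lie groups, Lie groupoids, Lie 2-groups\<close>

definition is_lie_group ::
    "('g::{t2_space,second_countable_topology}, 'e::euclidean_space) manifold \<Rightarrow> 'g monoid \<Rightarrow> bool" where
  "is_lie_group M G \<longleftrightarrow> is_manifold M \<and> group G \<and> carrier G = UNIV \<and>
     smooth_map (prod_manifold M M) M (\<lambda>(a, b). a \<otimes>\<^bsub>G\<^esub> b) \<and> smooth_map M M (\<lambda>a. inv\<^bsub>G\<^esub> a)"

text \<open>\<open>comp x y\<close> is the composite of \<open>x\<close> after \<open>y\<close>, meaningful when \<open>src x = tgt y\<close>.\<close>

record ('p, 'q) groupoid_str =
  src :: "'p \<Rightarrow> 'q"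
  tgt :: "'p \<Rightarrow> 'q"
  unt :: "'q \<Rightarrow> 'p"
  comp :: "'p \<Rightarrow> 'p \<Rightarrow> 'p"
  ginv :: "'p \<Rightarrow> 'p"

definition is_groupoid :: "('p, 'q) groupoid_str \<Rightarrow> bool" where
  "is_groupoid G \<longleftrightarrow>
     (\<forall>q. src G (unt G q) = q \<and> tgt G (unt G q) = q) \<and>
     (\<forall>x y. src G x = tgt G y \<longrightarrow>
        src G (comp G x y) = src G y \<and> tgt G (comp G x y) = tgt G x) \<and>
     (\<forall>x y z. src G x = tgt G y \<and> src G y = tgt G z \<longrightarrow>
        comp G (comp G x y) z = comp G x (comp G y z)) \<and>
     (\<forall>x. comp G x (unt G (src G x)) = x \<and> comp G (unt G (tgt G x)) x = x) \<and>
     (\<forall>x. src G (ginv G x) = tgt G x \<and> tgt G (ginv G x) = src G x \<and>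
        comp G (ginv G x) x = unt G (src G x) \<and> comp G x (ginv G x) = unt G (tgt G x))"

definition is_lie_groupoid ::
    "('p::{t2_space,second_countable_topology}, 'e::euclidean_space) manifold \<Rightarrow>
     ('q::{t2_space,second_countable_topology}, 'f::euclidean_space) manifold \<Rightarrow>
     ('p, 'q) groupoid_str \<Rightarrow> bool" where
  "is_lie_groupoid P Q G \<longleftrightarrow> is_manifold P \<and> is_manifold Q \<and> is_groupoid G \<and>
     submersion P Q (src G) \<and> submersion P Q (tgt G) \<and>
     smooth_map Q P (unt G) \<and> smooth_map P P (ginv G) \<and>
     smooth_map_on (prod_manifold P P) {(x, y). src G x = tgt G y} P (\<lambda>(x, y). comp G x y)"

text \<open>A strict Lie 2-group \<open>H \<rtimes> K \<rightrightarrows> K\<close>, given by its crossed module \<open>bd : H \<rightarrow> K\<close>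
  with left action \<open>act\<close> of \<open>K\<close> on \<open>H\<close>. Arrows are pairs \<open>(h, k) : k \<rightarrow> bd h \<cdot> k\<close>.\<close>

record ('h, 'k) crossed_module =
  hgrp :: "'h monoid"
  kgrp :: "'k monoid"
  bd :: "'h \<Rightarrow> 'k"
  act :: "'k \<Rightarrow> 'h \<Rightarrow> 'h"

definition is_lie_crossed_module ::
    "('h::{t2_space,second_countable_topology}, 'e::euclidean_space) manifold \<Rightarrow>
     ('k::{t2_space,second_countable_topology}, 'f::euclidean_space) manifold \<Rightarrow>
     ('h, 'k) crossed_module \<Rightarrow> bool" where
  "is_lie_crossed_module Hm Km X \<longleftrightarrow>
     is_lie_group Hm (hgrp X) \<and> is_lie_group Km (kgrp X) \<and>
     bd X \<in> hom (hgrp X) (kgrp X) \<and> smooth_map Hm Km (bd X) \<and>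
     smooth_map (prod_manifold Km Hm) Hm (\<lambda>(k, h). act X k h) \<and>
     (\<forall>k x y. act X k (x \<otimes>\<^bsub>hgrp X\<^esub> y) = act X k x \<otimes>\<^bsub>hgrp X\<^esub> act X k y) \<and>
     (\<forall>h. act X \<one>\<^bsub>kgrp X\<^esub> h = h) \<and>
     (\<forall>k l h. act X (k \<otimes>\<^bsub>kgrp X\<^esub> l) h = act X k (act X l h)) \<and>
     (\<forall>k h. bd X (act X k h) = k \<otimes>\<^bsub>kgrp X\<^esub> bd X h \<otimes>\<^bsub>kgrp X\<^esub> inv\<^bsub>kgrp X\<^esub> k) \<and>
     (\<forall>x y. act X (bd X x) y = x \<otimes>\<^bsub>hgrp X\<^esub> y \<otimes>\<^bsub>hgrp X\<^esub> inv\<^bsub>hgrp X\<^esub> x)"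

definition semidirect :: "('h, 'k) crossed_module \<Rightarrow> ('h \<times> 'k) monoid" where
  "semidirect X =
     \<lparr>carrier = UNIV,
      mult = (\<lambda>(h, k) (h', k'). (h \<otimes>\<^bsub>hgrp X\<^esub> act X k h', k \<otimes>\<^bsub>kgrp X\<^esub> k')),
      one = (\<one>\<^bsub>hgrp X\<^esub>, \<one>\<^bsub>kgrp X\<^esub>)\<rparr>"

definition two_group :: "('h, 'k) crossed_module \<Rightarrow> ('h \<times> 'k, 'k) groupoid_str" where
  "two_group X =
     \<lparr>src = snd,
      tgt = (\<lambda>(h, k). bd X h \<otimes>\<^bsub>kgrp X\<^esub> k),
      unt = (\<lambda>k. (\<one>\<^bsub>hgrp X\<^esub>, k)),
      comp = (\<lambda>(h', k') (h, k). (h' \<otimes>\<^bsub>hgrp X\<^esub> h, k)),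
      ginv = (\<lambda>(h, k). (inv\<^bsub>hgrp X\<^esub> h, bd X h \<otimes>\<^bsub>kgrp X\<^esub> k))\<rparr>"


section \<open>Principal 2-bundles\<close>

definition smooth_right_action :: "('p, 'e::euclidean_space) manifold \<Rightarrow>
    ('g, 'f::euclidean_space) manifold \<Rightarrow> 'g monoid \<Rightarrow> ('p \<Rightarrow> 'g \<Rightarrow> 'p) \<Rightarrow> bool" where
  "smooth_right_action P Gm G a \<longleftrightarrow>
     smooth_map (prod_manifold P Gm) P (\<lambda>(p, g). a p g) \<and>
     (\<forall>p. a p \<one>\<^bsub>G\<^esub> = p) \<and> (\<forall>p g h. a p (g \<otimes>\<^bsub>G\<^esub> h) = a (a p g) h)"

definition free_action :: "'g monoid \<Rightarrow> ('p \<Rightarrow> 'g \<Rightarrow> 'p) \<Rightarrow> bool" where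
  "free_action G a \<longleftrightarrow> (\<forall>p g. a p g = p \<longrightarrow> g = \<one>\<^bsub>G\<^esub>)"

definition proper_action :: "('p::topological_space \<Rightarrow> 'g::topological_space \<Rightarrow> 'p) \<Rightarrow> bool" where
  "proper_action a \<longleftrightarrow> (\<forall>L. compact L \<longrightarrow> compact {(p, g). (p, a p g) \<in> L})"

text \<open>\<open>M\<close> is the quotient manifold of \<open>P\<close> by the action, with projection \<open>\<pi>\<close>.\<close>

definition is_quotient :: "('p, 'e::euclidean_space) manifold \<Rightarrow> ('p \<Rightarrow> 'g \<Rightarrow> 'p) \<Rightarrow>
    ('m, 'f::euclidean_space) manifold \<Rightarrow> ('p \<Rightarrow> 'm) \<Rightarrow> bool" where
  "is_quotient P a M \<pi> \<longleftrightarrow> surj \<pi> \<and> submersion P M \<pi> \<and>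
     (\<forall>p p'. \<pi> p = \<pi> p' \<longleftrightarrow> (\<exists>g. p' = a p g))"

record ('p, 'pe, 'q, 'qe, 'm, 'me, 'h, 'he, 'k, 'ke) two_bundle =
  Pman :: "('p, 'pe) manifold"
  Qman :: "('q, 'qe) manifold"
  Mman :: "('m, 'me) manifold"
  Hman :: "('h, 'he) manifold"
  Kman :: "('k, 'ke) manifold"
  grpd :: "('p, 'q) groupoid_str"
  xmod :: "('h, 'k) crossed_module"
  actP :: "'p \<Rightarrow> 'h \<times> 'k \<Rightarrow> 'p"
  actQ :: "'q \<Rightarrow> 'k \<Rightarrow> 'q"
  projQ :: "'q \<Rightarrow> 'm"

definition projP where
  "projP B = projQ B \<circ> src (grpd B)"

text \<open>The last three conjuncts say that the quotient groupoid \<open>P / (H \<rtimes> K) \<rightrightarrows> Q / K\<close> is the unit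
  groupoid of \<open>M\<close>: both source and target induce the identity of \<open>M\<close>.\<close>

definition principal_2_bundle ::
    "('p::{t2_space,second_countable_topology}, 'pe::euclidean_space,
      'q::{t2_space,second_countable_topology}, 'qe::euclidean_space,
      'm::{t2_space,second_countable_topology}, 'me::euclidean_space,
      'h::{t2_space,second_countable_topology}, 'he::euclidean_space,
      'k::{t2_space,second_countable_topology}, 'ke::euclidean_space) two_bundle \<Rightarrow> bool" where
  "principal_2_bundle B \<longleftrightarrow>
     is_lie_groupoid (Pman B) (Qman B) (grpd B) \<and>
     is_manifold (Mman B) \<and>
     is_lie_crossed_module (Hman B) (Kman B) (xmod B) \<and>
     smooth_right_action (Pman B) (prod_manifold (Hman B) (Kman B)) (semidirect (xmod B)) (actP B) \<and>
     smooth_right_action (Qman B) (Kman B) (kgrp (xmod B)) (actQ B) \<and>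
     (\<forall>p g. src (grpd B) (actP B p g) = actQ B (src (grpd B) p) (src (two_group (xmod B)) g)) \<and>
     (\<forall>p g. tgt (grpd B) (actP B p g) = actQ B (tgt (grpd B) p) (tgt (two_group (xmod B)) g)) \<and>
     (\<forall>q k. unt (grpd B) (actQ B q k) = actP B (unt (grpd B) q) (unt (two_group (xmod B)) k)) \<and>
     (\<forall>p p' g g'. src (grpd B) p = tgt (grpd B) p' \<and>
        src (two_group (xmod B)) g = tgt (two_group (xmod B)) g' \<longrightarrow>
        comp (grpd B) (actP B p g) (actP B p' g') =
          actP B (comp (grpd B) p p') (comp (two_group (xmod B)) g g')) \<and>
     free_action (semidirect (xmod B)) (actP B) \<and> proper_action (actP B) \<and>
     free_action (kgrp (xmod B)) (actQ B) \<and> proper_action (actQ B) \<and>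
     is_quotient (Pman B) (actP B) (Mman B) (projP B) \<and>
     is_quotient (Qman B) (actQ B) (Mman B) (projQ B) \<and>
     (\<forall>p. projQ B (tgt (grpd B) p) = projQ B (src (grpd B) p))"


section \<open>Vector bundles and Lie algebroids\<close>

text \<open>A vector bundle is recorded by its fibres, their operations, and its smooth sections.
  Bundle maps over the identity take the base point as an extra argument, since elements of
  different fibres need not be distinct as elements of the type.\<close>

record ('m, 'e, 'v) vbundle =
  vbase :: "('m, 'e) manifold"
  fibre :: "'m \<Rightarrow> 'v set"
  vzero :: "'m \<Rightarrow> 'v"
  vadd :: "'v \<Rightarrow> 'v \<Rightarrow> 'v"
  vscale :: "real \<Rightarrow> 'v \<Rightarrow> 'v"
  sections :: "('m \<Rightarrow> 'v) set"

record ('m, 'e, 'v) lie_algebroid = "('m, 'e, 'v) vbundle" +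
  anchor :: "'m \<Rightarrow> 'v \<Rightarrow> 'm tvec"
  bracket :: "('m \<Rightarrow> 'v) \<Rightarrow> ('m \<Rightarrow> 'v) \<Rightarrow> 'm \<Rightarrow> 'v"

definition secadd where
  "secadd E a b = (\<lambda>m. vadd E (a m) (b m))"

definition secscale where
  "secscale E g a = (\<lambda>m. vscale E (g m) (a m))"

definition secdiff where
  "secdiff E a b = secadd E a (secscale E (\<lambda>_. -1) b)"

definition secmap :: "('m \<Rightarrow> 'v \<Rightarrow> 'w) \<Rightarrow> ('m \<Rightarrow> 'v) \<Rightarrow> 'm \<Rightarrow> 'w" where
  "secmap \<phi> a = (\<lambda>m. \<phi> m (a m))"

definition bundle_map :: "('m, 'e, 'v, 'z) vbundle_scheme \<Rightarrow> ('m, 'e, 'w, 'y) vbundle_scheme \<Rightarrow>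
    ('m \<Rightarrow> 'v \<Rightarrow> 'w) \<Rightarrow> bool" where
  "bundle_map E E' \<phi> \<longleftrightarrow>
     (\<forall>m. \<forall>x\<in>fibre E m. \<phi> m x \<in> fibre E' m \<and>
        (\<forall>y\<in>fibre E m. \<phi> m (vadd E x y) = vadd E' (\<phi> m x) (\<phi> m y)) \<and>
        (\<forall>c. \<phi> m (vscale E c x) = vscale E' c (\<phi> m x))) \<and>
     (\<forall>a\<in>sections E. secmap \<phi> a \<in> sections E')"

definition tangent_algebroid :: "('m, 'e::euclidean_space) manifold \<Rightarrow>
    ('m, 'e, 'm tvec) lie_algebroid" where
  "tangent_algebroid M =
     \<lparr>vbase = M,
      fibre = tangent_space M,
      vzero = (\<lambda>m f. 0),
      vadd = (\<lambda>v w f. v f + w f),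
      vscale = (\<lambda>c v f. c * v f),
      sections = vector_fields M,
      anchor = (\<lambda>m v. v),
      bracket = vf_bracket\<rparr>"

text \<open>The Atiyah algebroid \<open>TP / G\<close> of a principal bundle \<open>\<pi> : P \<rightarrow> M\<close>: its elements are the orbits
  of \<open>G\<close> on the total space \<open>TP\<close> (pairs of a point and a tangent vector). Over \<open>m\<close>, such an orbit is
  the graph of an invariant vector field along \<open>\<pi> -` {m}\<close>, so a section is the same as an invariant
  vector field on \<open>P\<close>, its lift; smoothness and bracket are those of the lifts.\<close>

definition torbit :: "('p, 'e::euclidean_space) manifold \<Rightarrow> ('p \<Rightarrow> 'g \<Rightarrow> 'p) \<Rightarrow> 'p \<times> 'p tvec \<Rightarrow>
    ('p \<times> 'p tvec) set" where
  "torbit P a x = {(a (fst x) g, tmap P (\<lambda>p. a p g) (snd x)) | g. True}"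

definition lift :: "('p \<Rightarrow> 'm) \<Rightarrow> ('m \<Rightarrow> ('p \<times> 'p tvec) set) \<Rightarrow> 'p \<Rightarrow> 'p tvec" where
  "lift \<pi> a p = (THE v. (p, v) \<in> a (\<pi> p))"

definition atiyah_fibre :: "('p, 'pe::euclidean_space) manifold \<Rightarrow> ('p \<Rightarrow> 'g \<Rightarrow> 'p) \<Rightarrow>
    ('p \<Rightarrow> 'm) \<Rightarrow> 'm \<Rightarrow> ('p \<times> 'p tvec) set set" where
  "atiyah_fibre P a \<pi> m = {torbit P a (p, v) | p v. \<pi> p = m \<and> v \<in> tangent_space P p}"

definition atiyah_algebroid :: "('p, 'pe::euclidean_space) manifold \<Rightarrow> ('p \<Rightarrow> 'g \<Rightarrow> 'p) \<Rightarrow>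
    ('m, 'me::euclidean_space) manifold \<Rightarrow> ('p \<Rightarrow> 'm) \<Rightarrow>
    ('m, 'me, ('p \<times> 'p tvec) set) lie_algebroid" where
  "atiyah_algebroid P a M \<pi> =
     \<lparr>vbase = M,
      fibre = atiyah_fibre P a \<pi>,
      vzero = (\<lambda>m. {(p, \<lambda>f. 0) | p. \<pi> p = m}),
      vadd = (\<lambda>A B. {(p, \<lambda>f. v f + w f) | p v w. (p, v) \<in> A \<and> (p, w) \<in> B}),
      vscale = (\<lambda>c A. {(p, \<lambda>f. c * v f) | p v. (p, v) \<in> A}),
      sections = {\<alpha>. (\<forall>m. \<alpha> m \<in> atiyah_fibre P a \<pi> m) \<and> lift \<pi> \<alpha> \<in> vector_fields P},
      anchor = (\<lambda>m A. THE w. \<exists>(p, v)\<in>A. w = tmap M \<pi> v),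
      bracket = (\<lambda>\<alpha> \<beta> m. {(p, vf_bracket (lift \<pi> \<alpha>) (lift \<pi> \<beta>) p) | p. \<pi> p = m})\<rparr>"


section \<open>LA-groupoids over a unit groupoid\<close>

text \<open>The structure \<open>V \<rightrightarrows> W\<close> over \<open>M \<rightrightarrows> M\<close>.\<close>

record ('m, 'e, 'v, 'w) LA_groupoid =
  arr :: "('m, 'e, 'v) lie_algebroid"
  obj :: "('m, 'e, 'w) lie_algebroid"
  vsrc :: "'m \<Rightarrow> 'v \<Rightarrow> 'w"
  vtgt :: "'m \<Rightarrow> 'v \<Rightarrow> 'w"
  vunt :: "'m \<Rightarrow> 'w \<Rightarrow> 'v"
  vcomp :: "'m \<Rightarrow> 'v \<Rightarrow> 'v \<Rightarrow> 'v"

definition tangent_LA_groupoid :: "('m, 'e::euclidean_space) manifold \<Rightarrow>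
    ('m, 'e, 'm tvec, 'm tvec) LA_groupoid" where
  "tangent_LA_groupoid M =
     \<lparr>arr = tangent_algebroid M, obj = tangent_algebroid M,
      vsrc = (\<lambda>m v. v), vtgt = (\<lambda>m v. v), vunt = (\<lambda>m v. v), vcomp = (\<lambda>m v w. v)\<rparr>"

text \<open>The value of the differential of the groupoid multiplication of \<open>P\<close> on a composable pair of
  tangent vectors \<open>(v, v')\<close> at \<open>(p, p')\<close>. The multiplication is only defined on \<open>P \<times>\<^sub>Q P\<close>, so
  \<open>g \<circ> comp\<close> is differentiated through its local smooth extensions \<open>E\<close> to \<open>P \<times> P\<close>; on the set
  described here there is exactly one vector when \<open>(v, v')\<close> is tangent to \<open>P \<times>\<^sub>Q P\<close>.\<close>

definition tcomp :: "('p::topological_space, 'e::euclidean_space) manifold \<Rightarrow>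
    ('p, 'q) groupoid_str \<Rightarrow> 'p \<Rightarrow> 'p tvec \<Rightarrow> 'p \<Rightarrow> 'p tvec \<Rightarrow> 'p tvec set" where
  "tcomp P G p v p' v' = {w \<in> tangent_space P (comp G p p').
     \<forall>g\<in>cinf P. \<forall>W. \<forall>E\<in>cinf (prod_manifold P P).
       open W \<and> (p, p') \<in> W \<and> (\<forall>(x, y)\<in>W. src G x = tgt G y \<longrightarrow> E (x, y) = g (comp G x y)) \<longrightarrow>
       w g = v (\<lambda>x. E (x, p')) + v' (\<lambda>y. E (p, y))}"

text \<open>All structure maps are induced on orbits by the differentials of those of \<open>P \<rightrightarrows> Q\<close>. The image
  of an orbit under the differential of the unit is not saturated, so its orbit is taken.\<close>

definition atiyah_LA_groupoid ::
    "('p::topological_space, 'pe::euclidean_space, 'q, 'qe::euclidean_space, 'm, 'me::euclidean_space,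
      'h, 'he, 'k, 'ke) two_bundle \<Rightarrow>
     ('m, 'me, ('p \<times> 'p tvec) set, ('q \<times> 'q tvec) set) LA_groupoid" where
  "atiyah_LA_groupoid B = (let P = Pman B; Q = Qman B; G = grpd B in
     \<lparr>arr = atiyah_algebroid P (actP B) (Mman B) (projP B),
      obj = atiyah_algebroid Q (actQ B) (Mman B) (projQ B),
      vsrc = (\<lambda>m A. {(src G p, tmap Q (src G) v) | p v. (p, v) \<in> A}),
      vtgt = (\<lambda>m A. {(tgt G p, tmap Q (tgt G) v) | p v. (p, v) \<in> A}),
      vunt = (\<lambda>m A. \<Union>(q, v)\<in>A. torbit P (actP B) (unt G q, tmap P (unt G) v)),
      vcomp = (\<lambda>m A A'. {(comp G p p', w) | p v p' v' w.
        (p, v) \<in> A \<and> (p', v') \<in> A' \<and> src G p = tgt G p' \<and>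
        tmap Q (src G) v = tmap Q (tgt G) v' \<and> w \<in> tcomp P G p v p' v'})\<rparr>)"

definition core_fibre :: "('m, 'e, 'v, 'w) LA_groupoid \<Rightarrow> 'm \<Rightarrow> 'v set" where
  "core_fibre L m = {x \<in> fibre (arr L) m. vsrc L m x = vzero (obj L) m}"

text \<open>The bundle \<open>V \<times>\<^sub>W V\<close> of composable pairs.\<close>

definition composables :: "('m, 'e, 'v, 'w) LA_groupoid \<Rightarrow> ('m, 'e, 'v \<times> 'v) vbundle" where
  "composables L = (let V = arr L in
     \<lparr>vbase = vbase V,
      fibre = (\<lambda>m. {(x, y). x \<in> fibre V m \<and> y \<in> fibre V m \<and> vsrc L m x = vtgt L m y}),
      vzero = (\<lambda>m. (vzero V m, vzero V m)),
      vadd = (\<lambda>(x, y) (x', y'). (vadd V x x', vadd V y y')),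
      vscale = (\<lambda>c (x, y). (vscale V c x, vscale V c y)),
      sections = {\<lambda>m. (a m, b m) | a b. a \<in> sections V \<and> b \<in> sections V \<and>
        secmap (vsrc L) a = secmap (vtgt L) b}\<rparr>)"


section \<open>Graded manifolds\<close>

text \<open>Graded manifolds are given by their graded algebras of functions, recorded by homogeneous
  components; graded maps are degree preserving algebra morphisms in the opposite direction.\<close>

record 'c galg =
  gdeg :: "nat \<Rightarrow> 'c set"
  gzero :: 'c
  gone :: 'c
  gadd :: "'c \<Rightarrow> 'c \<Rightarrow> 'c"
  gscale :: "real \<Rightarrow> 'c \<Rightarrow> 'c"
  gmul :: "'c \<Rightarrow> 'c \<Rightarrow> 'c"

definition gsign :: "nat \<Rightarrow> real" where
  "gsign n = (-1) ^ n"

definition agree :: "'c galg \<Rightarrow> ('c \<Rightarrow> 'd) \<Rightarrow> ('c \<Rightarrow> 'd) \<Rightarrow> bool" where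
  "agree A f g \<longleftrightarrow> (\<forall>k. \<forall>a\<in>gdeg A k. f a = g a)"

definition graded_linear :: "nat \<Rightarrow> 'c galg \<Rightarrow> 'd galg \<Rightarrow> ('c \<Rightarrow> 'd) \<Rightarrow> bool" where
  "graded_linear n A X f \<longleftrightarrow> (\<forall>k. \<forall>a\<in>gdeg A k. f a \<in> gdeg X (k + n) \<and>
     (\<forall>b\<in>gdeg A k. f (gadd A a b) = gadd X (f a) (f b)) \<and>
     (\<forall>c. f (gscale A c a) = gscale X c (f a)))"

definition galg_hom :: "'c galg \<Rightarrow> 'd galg \<Rightarrow> ('c \<Rightarrow> 'd) \<Rightarrow> bool" where
  "galg_hom A X f \<longleftrightarrow> graded_linear 0 A X f \<and> f (gone A) = gone X \<and>
     (\<forall>i j. \<forall>a\<in>gdeg A i. \<forall>b\<in>gdeg A j. f (gmul A a b) = gmul X (f a) (f b))"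

text \<open>Let \<open>A\<close>, \<open>X\<close> be the functions on graded manifolds \<open>N\<close>, \<open>S\<close>. A graded map \<open>S \<rightarrow> T[1]N\<close> is a graded
  map \<open>S \<rightarrow> N\<close> with pullback \<open>f\<close> together with a degree 1 derivation \<open>D\<close> along \<open>f\<close>: functions on
  \<open>T[1]N\<close> are generated by those \<open>a\<close> on \<open>N\<close> and their differentials \<open>\<delta>a\<close>, of degree one higher, and
  \<open>a\<close>, \<open>\<delta>a\<close> pull back to \<open>f a\<close>, \<open>D a\<close>.\<close>

definition T1_map :: "'c galg \<Rightarrow> 'd galg \<Rightarrow> ('c \<Rightarrow> 'd) \<times> ('c \<Rightarrow> 'd) \<Rightarrow> bool" where
  "T1_map A X = (\<lambda>(f, D). galg_hom A X f \<and> graded_linear 1 A X D \<and>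
     (\<forall>i j. \<forall>a\<in>gdeg A i. \<forall>b\<in>gdeg A j.
        D (gmul A a b) = gadd X (gmul X (D a) (f b)) (gscale X (gsign i) (gmul X (f a) (D b)))))"

text \<open>Iterating, a graded map \<open>S \<rightarrow> T[1](T[1]N)\<close> is a quadruple: the underlying map \<open>S \<rightarrow> T[1]N\<close> is
  \<open>(f, D1)\<close>, and the derivation along it sends \<open>a\<close> to \<open>D2 a\<close> and \<open>\<delta>a\<close> to \<open>D12 a\<close>. The product rule for
  \<open>D12\<close> is the one obtained by applying this derivation to
  \<open>\<delta>(a b) = \<delta>a b + (-1)^i a \<delta>b\<close>, with \<open>i\<close> the degree of \<open>a\<close>.\<close>

type_synonym ('c, 'd) T11 = "('c \<Rightarrow> 'd) \<times> ('c \<Rightarrow> 'd) \<times> ('c \<Rightarrow> 'd) \<times> ('c \<Rightarrow> 'd)"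

definition T11_map :: "'c galg \<Rightarrow> 'd galg \<Rightarrow> ('c, 'd) T11 \<Rightarrow> bool" where
  "T11_map A X = (\<lambda>(f, D1, D2, D12).
     T1_map A X (f, D1) \<and> T1_map A X (f, D2) \<and> graded_linear 2 A X D12 \<and>
     (\<forall>i j. \<forall>a\<in>gdeg A i. \<forall>b\<in>gdeg A j.
        D12 (gmul A a b) =
          gadd X (gadd X (gmul X (D12 a) (f b)) (gmul X (f a) (D12 b)))
            (gscale X (gsign i)
              (gadd X (gmul X (D2 a) (D1 b)) (gscale X (-1) (gmul X (D1 a) (D2 b)))))))"

definition T1_agree :: "'c galg \<Rightarrow> ('c \<Rightarrow> 'd) \<times> ('c \<Rightarrow> 'd) \<Rightarrow> ('c \<Rightarrow> 'd) \<times> ('c \<Rightarrow> 'd) \<Rightarrow> bool" where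
  "T1_agree A = (\<lambda>(f, D) (g, E). agree A f g \<and> agree A D E)"

definition T11_agree :: "'c galg \<Rightarrow> ('c, 'd) T11 \<Rightarrow> ('c, 'd) T11 \<Rightarrow> bool" where
  "T11_agree A = (\<lambda>(f, D1, D2, D12) (g, E1, E2, E12).
     agree A f g \<and> agree A D1 E1 \<and> agree A D2 E2 \<and> agree A D12 E12)"

text \<open>Postcomposition with \<open>T[1]\<phi>\<close>, \<open>T[1](T[1]\<phi>)\<close>, where \<open>r\<close> is the pullback along \<open>\<phi>\<close>.\<close>

definition T1_push :: "('c' \<Rightarrow> 'c) \<Rightarrow> ('c \<Rightarrow> 'd) \<times> ('c \<Rightarrow> 'd) \<Rightarrow> ('c' \<Rightarrow> 'd) \<times> ('c' \<Rightarrow> 'd)" where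
  "T1_push r = (\<lambda>(f, D). (f \<circ> r, D \<circ> r))"

definition T11_push :: "('c' \<Rightarrow> 'c) \<Rightarrow> ('c, 'd) T11 \<Rightarrow> ('c', 'd) T11" where
  "T11_push r = (\<lambda>(f, D1, D2, D12). (f \<circ> r, D1 \<circ> r, D2 \<circ> r, D12 \<circ> r))"

text \<open>Precomposition of \<open>x : S \<rightarrow> T[1]N\<close> with a map \<open>S' \<rightarrow> S\<close> whose pullback is \<open>r\<close>.\<close>

definition T1_pull :: "('d \<Rightarrow> 'd') \<Rightarrow> ('c \<Rightarrow> 'd) \<times> ('c \<Rightarrow> 'd) \<Rightarrow> ('c \<Rightarrow> 'd') \<times> ('c \<Rightarrow> 'd')" where
  "T1_pull r = (\<lambda>(f, D). (r \<circ> f, r \<circ> D))"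

text \<open>For vector fields \<open>Q : N \<rightarrow> T[1]N\<close> and \<open>Q : S \<rightarrow> T[1]S\<close>, and \<open>x : S \<rightarrow> T[1]N\<close>, these are
  \<open>T[1]Q \<circ> x\<close> and \<open>T[1]x \<circ> Q\<close>, maps \<open>S \<rightarrow> T[1](T[1]N)\<close>. In the first case
  \<open>Q\<close> pulls \<open>\<delta>a\<close> back to \<open>Q a\<close>, whence the underlying map \<open>(f, f \<circ> Q)\<close>.\<close>

definition T1_Q_after :: "('c \<Rightarrow> 'c) \<Rightarrow> ('c \<Rightarrow> 'd) \<times> ('c \<Rightarrow> 'd) \<Rightarrow> ('c, 'd) T11" where
  "T1_Q_after Q = (\<lambda>(f, D). (f, f \<circ> Q, D, D \<circ> Q))"

definition T1_before_Q :: "('d \<Rightarrow> 'd) \<Rightarrow> ('c \<Rightarrow> 'd) \<times> ('c \<Rightarrow> 'd) \<Rightarrow> ('c, 'd) T11" where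
  "T1_before_Q Q = (\<lambda>(f, D). (f, D, Q \<circ> f, Q \<circ> D))"


section \<open>Quasi LA-groupoid morphisms\<close>

text \<open>A graded groupoid with a degree 1 multiplicative vector field: functions on objects, arrows,
  and composable pairs, with the pullbacks along the structure maps.\<close>

record ('c0, 'c1, 'c2) qgroupoid =
  fun0 :: "'c0 galg"
  fun1 :: "'c1 galg"
  fun2 :: "'c2 galg"
  gsrc :: "'c0 \<Rightarrow> 'c1"
  gtgt :: "'c0 \<Rightarrow> 'c1"
  gunt :: "'c1 \<Rightarrow> 'c0"
  gcomp :: "'c1 \<Rightarrow> 'c2"
  gpr1 :: "'c1 \<Rightarrow> 'c2"
  gpr2 :: "'c1 \<Rightarrow> 'c2"
  gQ0 :: "'c0 \<Rightarrow> 'c0"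
  gQ1 :: "'c1 \<Rightarrow> 'c1"

text \<open>The pair \<open>(f0, f1)\<close> consists of pullbacks along a graded groupoid morphism from \<open>G\<close> to \<open>H\<close>.\<close>

definition ggroupoid_morphism :: "('a0, 'a1, 'a2) qgroupoid \<Rightarrow> ('b0, 'b1, 'b2) qgroupoid \<Rightarrow>
    ('b0 \<Rightarrow> 'a0) \<times> ('b1 \<Rightarrow> 'a1) \<Rightarrow> bool" where
  "ggroupoid_morphism G H = (\<lambda>(f0, f1).
     galg_hom (fun0 H) (fun0 G) f0 \<and> galg_hom (fun1 H) (fun1 G) f1 \<and>
     agree (fun0 H) (f1 \<circ> gsrc H) (gsrc G \<circ> f0) \<and>
     agree (fun0 H) (f1 \<circ> gtgt H) (gtgt G \<circ> f0) \<and>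
     agree (fun1 H) (f0 \<circ> gunt H) (gunt G \<circ> f1) \<and>
     (\<exists>f2. galg_hom (fun2 H) (fun2 G) f2 \<and>
        agree (fun1 H) (f2 \<circ> gpr1 H) (gpr1 G \<circ> f1) \<and>
        agree (fun1 H) (f2 \<circ> gpr2 H) (gpr2 G \<circ> f1) \<and>
        agree (fun1 H) (f2 \<circ> gcomp H) (gcomp G \<circ> f1)))"

text \<open>\<open>z\<close> is the product of the composable maps \<open>x\<close>, \<open>y\<close> from the graded manifold with functions \<open>X\<close>
  to the arrows of \<open>T[1]H\<close>, respectively \<open>T[1](T[1]H)\<close>: the pair \<open>(x, y)\<close> is a map \<open>w\<close> into the
  composable pairs, and \<open>z\<close> is its image under the multiplication.\<close>

definition T1_product where
  "T1_product H X x y z \<longleftrightarrow> (\<exists>w. T1_map (fun2 H) X w \<and>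
     T1_agree (fun1 H) (T1_push (gpr1 H) w) x \<and>
     T1_agree (fun1 H) (T1_push (gpr2 H) w) y \<and>
     T1_agree (fun1 H) (T1_push (gcomp H) w) z)"

definition T11_product where
  "T11_product H X x y z \<longleftrightarrow> (\<exists>w. T11_map (fun2 H) X w \<and>
     T11_agree (fun1 H) (T11_push (gpr1 H) w) x \<and>
     T11_agree (fun1 H) (T11_push (gpr2 H) w) y \<and>
     T11_agree (fun1 H) (T11_push (gcomp H) w) z)"

text \<open>A natural transformation \<open>\<tau>\<close> from \<open>\<Phi> = (\<Phi>0, \<Phi>1)\<close> to \<open>\<Psi> = (\<Psi>0, \<Psi>1)\<close>, both functors from \<open>G\<close>
  to \<open>T[1]H\<close>: a map from the objects of \<open>G\<close> to the arrows of \<open>T[1]H\<close> with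
  \<open>\<tau>(tgt g) \<Phi>1(g) = \<Psi>1(g) \<tau>(src g)\<close> for the arrows \<open>g\<close> of \<open>G\<close>.\<close>

definition nat_transformation :: "('a0, 'a1, 'a2) qgroupoid \<Rightarrow> ('b0, 'b1, 'b2) qgroupoid \<Rightarrow>
    (('b0 \<Rightarrow> 'a0) \<times> ('b0 \<Rightarrow> 'a0)) \<times> (('b1 \<Rightarrow> 'a1) \<times> ('b1 \<Rightarrow> 'a1)) \<Rightarrow>
    (('b0 \<Rightarrow> 'a0) \<times> ('b0 \<Rightarrow> 'a0)) \<times> (('b1 \<Rightarrow> 'a1) \<times> ('b1 \<Rightarrow> 'a1)) \<Rightarrow>
    ('b1 \<Rightarrow> 'a0) \<times> ('b1 \<Rightarrow> 'a0) \<Rightarrow> bool" where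
  "nat_transformation G H = (\<lambda>(\<Phi>0, \<Phi>1) (\<Psi>0, \<Psi>1) \<tau>.
     T1_map (fun1 H) (fun0 G) \<tau> \<and>
     T1_agree (fun0 H) (T1_push (gsrc H) \<tau>) \<Phi>0 \<and>
     T1_agree (fun0 H) (T1_push (gtgt H) \<tau>) \<Psi>0 \<and>
     (\<exists>z. T1_product H (fun1 G) (T1_pull (gtgt G) \<tau>) \<Phi>1 z \<and>
          T1_product H (fun1 G) \<Psi>1 (T1_pull (gsrc G) \<tau>) z))"

text \<open>Morphisms of quasi LA-groupoids with \<open>q = 0\<close>. Lying over the units means that the map underlying
  \<open>\<tau>\<close> is the unit after \<open>F\<close>. The composite in the coherence law is a map \<open>(f, D1, D2, D12)\<close>
  into \<open>T[1](T[1]H)\<close>, and a natural transformation from 0 to \<open>Q\<^sup>2 \<circ> F = 0\<close> by way of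
  its last component, which is a degree 2 derivation along \<open>f\<close> because \<open>D1 = D2\<close>; the trivial
  transformation is the zero derivation.\<close>

definition quasi_LA_morphism :: "('a0, 'a1, 'a2) qgroupoid \<Rightarrow> ('b0, 'b1, 'b2) qgroupoid \<Rightarrow>
    ('b0 \<Rightarrow> 'a0) \<times> ('b1 \<Rightarrow> 'a1) \<Rightarrow> ('b1 \<Rightarrow> 'a0) \<times> ('b1 \<Rightarrow> 'a0) \<Rightarrow> bool" where
  "quasi_LA_morphism G H = (\<lambda>(f0, f1) \<tau>.
     ggroupoid_morphism G H (f0, f1) \<and>
     nat_transformation G H
       ((f0, gQ0 G \<circ> f0), (f1, gQ1 G \<circ> f1))
       ((f0, f0 \<circ> gQ0 H), (f1, f1 \<circ> gQ1 H)) \<tau> \<and>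
     agree (fun1 H) (fst \<tau>) (f0 \<circ> gunt H) \<and>
     (\<exists>f D1 D2 D12.
        T11_product H (fun0 G) (T1_Q_after (gQ1 H) \<tau>) (T1_before_Q (gQ0 G) \<tau>) (f, D1, D2, D12) \<and>
        agree (fun1 H) D1 D2 \<and>
        agree (fun1 H) D12 (\<lambda>_. gzero (fun0 G))))"


section \<open>The graded groupoid of an LA-groupoid\<close>

text \<open>Forms on \<open>E\<close>, i.e. functions on \<open>E[1]\<close>: the elements of \<open>\<Gamma>(\<wedge>\<^sup>k E\<^sup>*)\<close> are the alternating
  function-multilinear maps on lists of \<open>k\<close> sections, set to 0 on all other lists.\<close>

type_synonym ('m, 'v) form = "('m \<Rightarrow> 'v) list \<Rightarrow> 'm \<Rightarrow> real"

definition forms :: "('m, 'e::euclidean_space, 'v, 'z) vbundle_scheme \<Rightarrow> nat \<Rightarrow> ('m, 'v) form set" where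
  "forms E k = {\<omega>.
     (\<forall>l. \<not> (length l = k \<and> set l \<subseteq> sections E) \<longrightarrow> \<omega> l = (\<lambda>m. 0)) \<and>
     (\<forall>l. length l = k \<and> set l \<subseteq> sections E \<longrightarrow>
        \<omega> l \<in> cinf (vbase E) \<and>
        (\<forall>i<k. \<forall>a\<in>sections E. \<forall>b\<in>sections E.
           \<omega> (l[i := secadd E a b]) = (\<lambda>m. \<omega> (l[i := a]) m + \<omega> (l[i := b]) m)) \<and>
        (\<forall>i<k. \<forall>g\<in>cinf (vbase E). \<forall>a\<in>sections E.
           \<omega> (l[i := secscale E g a]) = (\<lambda>m. g m * \<omega> (l[i := a]) m)) \<and>
        (\<forall>i<k. \<forall>j<k. i \<noteq> j \<and> l ! i = l ! j \<longrightarrow> \<omega> l = (\<lambda>m. 0)))}"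

text \<open>The sum is over all ways of distributing the arguments, with the sign of the shuffle.\<close>

definition wedge :: "('m, 'v) form \<Rightarrow> ('m, 'v) form \<Rightarrow> ('m, 'v) form" where
  "wedge \<omega> \<eta> = (\<lambda>l m. \<Sum>S\<in>Pow {..<length l}.
     (-1) ^ card {(i, j). i \<in> S \<and> j < i \<and> j \<notin> S} * \<omega> (nths l S) m * \<eta> (nths l (- S)) m)"

definition form_alg :: "('m, 'e::euclidean_space, 'v, 'z) vbundle_scheme \<Rightarrow> ('m, 'v) form galg" where
  "form_alg E =
     \<lparr>gdeg = forms E,
      gzero = (\<lambda>l m. 0),
      gone = (\<lambda>l m. if l = [] then 1 else 0),
      gadd = (\<lambda>\<omega> \<eta> l m. \<omega> l m + \<eta> l m),
      gscale = (\<lambda>c \<omega> l m. c * \<omega> l m),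
      gmul = wedge\<rparr>"

definition pullback :: "('m, 'e, 'v, 'z) vbundle_scheme \<Rightarrow> ('m \<Rightarrow> 'v \<Rightarrow> 'w) \<Rightarrow>
    ('m, 'w) form \<Rightarrow> ('m, 'v) form" where
  "pullback E \<phi> \<omega> = (\<lambda>l. if set l \<subseteq> sections E then \<omega> (map (secmap \<phi>) l) else (\<lambda>m. 0))"

text \<open>The Chevalley-Eilenberg differential.\<close>

definition ce_diff :: "('m, 'e, 'v) lie_algebroid \<Rightarrow> ('m, 'v) form \<Rightarrow> ('m, 'v) form" where
  "ce_diff E \<omega> = (\<lambda>l m. if set l \<subseteq> sections E then
     (\<Sum>i<length l. (-1) ^ i * anchor E m ((l ! i) m) (\<omega> (nths l (- {i})))) +
     (\<Sum>(i, j) | i < j \<and> j < length l.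
        (-1) ^ (i + j) * \<omega> (bracket E (l ! i) (l ! j) # nths l (- {i, j})) m)
     else 0)"

definition shift_groupoid :: "('m, 'e::euclidean_space, 'v, 'w) LA_groupoid \<Rightarrow>
    (('m, 'w) form, ('m, 'v) form, ('m, 'v \<times> 'v) form) qgroupoid" where
  "shift_groupoid L =
     \<lparr>fun0 = form_alg (obj L),
      fun1 = form_alg (arr L),
      fun2 = form_alg (composables L),
      gsrc = pullback (arr L) (vsrc L),
      gtgt = pullback (arr L) (vtgt L),
      gunt = pullback (obj L) (vunt L),
      gcomp = pullback (composables L) (\<lambda>m (x, y). vcomp L m x y),
      gpr1 = pullback (composables L) (\<lambda>m. fst),
      gpr2 = pullback (composables L) (\<lambda>m. snd),
      gQ0 = ce_diff (obj L),
      gQ1 = ce_diff (arr L)\<rparr>"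


section \<open>2-connections\<close>

definition F1_of where
  "F1_of B F0 = (\<lambda>m v. vunt (atiyah_LA_groupoid B) m (F0 m v))"

definition secmap2 :: "('m \<Rightarrow> 'v \<Rightarrow> 'v \<Rightarrow> 'w) \<Rightarrow> ('m \<Rightarrow> 'v) \<Rightarrow> ('m \<Rightarrow> 'v) \<Rightarrow> 'm \<Rightarrow> 'w" where
  "secmap2 \<tau> a b = (\<lambda>m. \<tau> m (a m) (b m))"

text \<open>\<open>F0\<close> is a splitting of the anchor and \<open>\<tau>0\<close> a bundle map from \<open>\<wedge>\<^sup>2 TM\<close> to the core, i.e. an
  alternating bilinear one, with \<open>[F0 X, F0 Y] - F0 [X, Y] = \<partial> \<tau>0(X, Y)\<close>.\<close>

definition two_connection ::
    "('p::topological_space, 'pe::euclidean_space, 'q, 'qe::euclidean_space, 'm, 'me::euclidean_space,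
      'h, 'he, 'k, 'ke) two_bundle \<Rightarrow>
     ('m \<Rightarrow> 'm tvec \<Rightarrow> ('q \<times> 'q tvec) set) \<Rightarrow>
     ('m \<Rightarrow> 'm tvec \<Rightarrow> 'm tvec \<Rightarrow> ('p \<times> 'p tvec) set) \<Rightarrow> bool" where
  "two_connection B F0 \<tau>0 \<longleftrightarrow>
     (let L = atiyah_LA_groupoid B; T = tangent_algebroid (Mman B) in
       bundle_map T (obj L) F0 \<and>
       (\<forall>m. \<forall>v\<in>fibre T m. anchor (obj L) m (F0 m v) = v) \<and>
       (\<forall>m. \<forall>v\<in>fibre T m. \<forall>w\<in>fibre T m. \<tau>0 m v w \<in> core_fibre L m \<and>
          (\<forall>w'\<in>fibre T m.
             \<tau>0 m v (vadd T w w') = vadd (arr L) (\<tau>0 m v w) (\<tau>0 m v w') \<and>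
             \<tau>0 m (vadd T w w') v = vadd (arr L) (\<tau>0 m w v) (\<tau>0 m w' v)) \<and>
          (\<forall>c. \<tau>0 m (vscale T c v) w = vscale (arr L) c (\<tau>0 m v w) \<and>
             \<tau>0 m v (vscale T c w) = vscale (arr L) c (\<tau>0 m v w))) \<and>
       (\<forall>m. \<forall>v\<in>fibre T m. \<tau>0 m v v = vzero (arr L) m) \<and>
       (\<forall>X\<in>sections T. \<forall>Y\<in>sections T. secmap2 \<tau>0 X Y \<in> sections (arr L)) \<and>
       (\<forall>X\<in>sections T. \<forall>Y\<in>sections T.
          secdiff (obj L) (bracket (obj L) (secmap F0 X) (secmap F0 Y)) (secmap F0 (bracket T X Y)) =
          secmap (vtgt L) (secmap2 \<tau>0 X Y)))"

text \<open>The 3-form curvature \<open>\<Omega>(X, Y, Z)\<close>, the cyclic sum of \<open>[F0 X, \<tau>0(Y, Z)] - \<tau>0([X, Y], Z)\<close>, where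
  \<open>[a, c] = [u a, c]\<close>.\<close>

definition curvature3 where
  "curvature3 B F0 \<tau>0 X Y Z =
     (let L = atiyah_LA_groupoid B; V = arr L; T = tangent_algebroid (Mman B);
          t3 = (\<lambda>X Y Z. secdiff V
            (bracket V (secmap (vunt L) (secmap F0 X)) (secmap2 \<tau>0 Y Z))
            (secmap2 \<tau>0 (bracket T X Y) Z))
      in secadd V (t3 X Y Z) (secadd V (t3 Y Z X) (t3 Z X Y)))"

definition curvature3_vanishes where
  "curvature3_vanishes B F0 \<tau>0 \<longleftrightarrow>
     (\<forall>X\<in>vector_fields (Mman B). \<forall>Y\<in>vector_fields (Mman B). \<forall>Z\<in>vector_fields (Mman B).
        curvature3 B F0 \<tau>0 X Y Z = vzero (arr (atiyah_LA_groupoid B)))"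

text \<open>The natural transformation determined by \<open>\<tau>0\<close>: the map from \<open>T[1]M\<close> to \<open>T[1]A\<^sub>P[1]\<close> over the
  units which differs from \<open>d \<circ> F1\<^sup>*\<close> by contraction with \<open>\<tau>0\<close>, the derivation along \<open>F1\<^sup>*\<close> that
  vanishes on functions and takes a 1-form \<open>\<xi>\<close> to \<open>\<xi> \<circ> \<tau>0\<close>. The sign is forced by the target being
  \<open>Q \<circ> F\<close>: on 1-forms, \<open>F0\<^sup>* Q \<xi> - d F0\<^sup>* \<xi> = - \<xi> \<circ> \<partial> \<circ> \<tau>0\<close>.\<close>

definition contract2 where
  "contract2 T F1 \<tau>0 \<omega> = (\<lambda>l m. if set l \<subseteq> sections T then
     (\<Sum>(i, j) | i < j \<and> j < length l.
        (-1) ^ (i + j + 1) *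
          \<omega> (secmap2 \<tau>0 (l ! i) (l ! j) # map (secmap F1) (nths l (- {i, j}))) m)
     else (0::real))"

definition nat_trans_of where
  "nat_trans_of B F0 \<tau>0 =
     (let T = tangent_algebroid (Mman B); F1 = F1_of B F0 in
       (pullback T F1,
        \<lambda>\<omega> l m. ce_diff T (pullback T F1 \<omega>) l m - contract2 T F1 \<tau>0 \<omega> l m))"

definition graded_map_of where
  "graded_map_of B F0 =
     (let T = tangent_algebroid (Mman B) in (pullback T F0, pullback T (F1_of B F0)))"

end

theory Submission
  imports Defs
begin

text \<open>On the algebroid side a natural transformation over the units is the pullback along \<open>F1\<close> together with
  \<open>sd \<circ> F1\<^sup>* - con\<close>, where \<open>con\<close> contracts with \<open>\<tau>0\<close>; the 2-connection equation says precisely that it runs from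
  \<open>Q \<circ> F\<close> to \<open>F \<circ> Q\<close>. In the coherence law the mixed component of the composite is the commutator of the differentials with
  \<open>con\<close>, plus a term quadratic in \<open>\<tau>0\<close>. By the Jacobi identity in the algebroid of pairs of sections it is the
  contraction with the 3-form curvature. Conversely, its value on 1-forms is the curvature, and 1-forms
  separate sections.\<close>

text \<open>Contraction with \<open>\<tau>0\<close> sends forms on the Atiyah algebroid to forms on
  \<open>TM\<close>, so by itself it can neither be iterated nor be commuted with a differential.
  Hence the pairs (X, a) of sections with equal anchors: there \<open>\<tau>0\<close> extends to a
  vertical alternating map acting on a single module, the splitting becomes the graph X -> (X,
  \<open>F1\<close> X), and the quadratic term is what the failure of this graph to be closed under
  brackets contributes. The geometric obstacle is that fibres are sets of orbits and smoothness is
  tested on functions: neither a local trivialisation, nor smoothness of the unit on sections, nor a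
  formula for the multiplication is given. All of it comes from one parametrisation (q, h) -> u(q)
  j(h) of \<open>P\<close> by \<open>Q\<close> times \<open>H\<close>, where j runs through the
  kernel of the target of the 2-group. It is onto and injective in h. That its differential is onto
  follows from injectivity, spread by left translation, and from a measure argument that compares
  dimensions. It yields smooth units and the rule x y = x + y - u(s x), through which every
  computation with composable pairs passes.\<close>

abbreviation (input) "TS \<equiv> tangent_space"
abbreviation (input) "VF \<equiv> vector_fields"
abbreviation (input) "frd \<equiv> frechet_derivative"
abbreviation (input) "secs \<equiv> sections"
abbreviation (input) "PM \<equiv> prod_manifold"

section \<open>Alternating forms on a module of sections\<close>

record ('m, 's) smod =
 rng :: "('m => real) set"
 car :: "'s set"
 sadd :: "'s => 's => 's"
 sscl :: "('m => real) => 's => 's"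

definition func_ring :: "('m => real) set => bool" where
 "func_ring R \<longleftrightarrow> (ALL c. (%_. c) : R) &
  (ALL f:R. ALL g:R. (%m. f m + g m) : R & (%m. f m * g m) : R)"

text \<open>Only closure is asked. In the abstract part, laws such as commutativity of
  \<open>sadd\<close> are used after a form has been evaluated, where they are laws of real-valued
  functions.\<close>

definition smodule :: "('m, 's, 'z) smod_scheme => bool" where
 "smodule E \<longleftrightarrow> func_ring (rng E) &
  (ALL a:car E. ALL b:car E. sadd E a b : car E) &
  (ALL g:rng E. ALL a:car E. sscl E g a : car E)"

type_synonym ('m, 's) sform = "'s list => 'm => real"

text \<open>Inhomogeneous forms: one \<open>om\<close> has a component for every list length, so no
  degree is carried through the inductions. Alternation is asked for neighbouring equal arguments,
  which is what a recursion on the front of the list can check; \<open>AF_alt_far\<close> extends it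
  to distant ones.\<close>

definition AF :: "('m, 's, 'z) smod_scheme => ('m, 's) sform set" where
 "AF E = {om. (ALL l. ~ set l <= car E --> om l = (%m. 0)) & (ALL l. om l : rng E) &
  (ALL l1 l2 a b. set l1 <= car E --> set l2 <= car E --> a : car E --> b : car E -->
    om (l1 @ sadd E a b # l2) = (%m. om (l1 @ a # l2) m + om (l1 @ b # l2) m)) &
  (ALL l1 l2 g a. set l1 <= car E --> set l2 <= car E --> g : rng E --> a : car E -->
    om (l1 @ sscl E g a # l2) = (%m. g m * om (l1 @ a # l2) m)) &
  (ALL l1 l2 a. set l1 <= car E --> set l2 <= car E --> a : car E -->
    om (l1 @ a # a # l2) = (%m. 0))}"

definition ic :: "'s => ('m, 's) sform => ('m, 's) sform" where
 "ic x om = (%l. om (x # l))"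

text \<open>The grading involution. It supplies the Koszul signs for inhomogeneous forms, where no
  single degree is available.\<close>

definition galt :: "('m, 's) sform => ('m, 's) sform" where
 "galt om = (%l m. (-1) ^ length l * om l m)"

lemma func_ring_const: "func_ring R ==> (%_. c) : R"
 and func_ring_add: "func_ring R ==> f : R ==> g : R ==> (%m. f m + g m) : R"
 and func_ring_mult: "func_ring R ==> f : R ==> g : R ==> (%m. f m * g m) : R"
 by (auto simp: func_ring_def)

lemma func_ring_cmult: "func_ring R ==> f : R ==> (%m. c * f m) : R"
 using func_ring_mult[OF _ func_ring_const] by metis

lemma func_ring_uminus: "func_ring R ==> f : R ==> (%m. - f m) : R"
 using func_ring_cmult[of R f "-1"] by simp

lemma smodule_rng: "smodule E ==> func_ring (rng E)"
 and smodule_add: "smodule E ==> a : car E ==> b : car E ==> sadd E a b : car E"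
 and smodule_scl: "smodule E ==> g : rng E ==> a : car E ==> sscl E g a : car E"
 by (auto simp: smodule_def)

lemma AF_off: "om : AF E ==> ~ set l <= car E ==> om l = (%m. 0)"
 and AF_rng: "om : AF E ==> om l : rng E"
 unfolding AF_def by blast+

lemma AF_add: "om : AF E ==> set l1 <= car E ==> set l2 <= car E ==> a : car E ==> b : car E ==>
  om (l1 @ sadd E a b # l2) m = om (l1 @ a # l2) m + om (l1 @ b # l2) m"
 unfolding AF_def by (auto dest!: spec[of _ l1])

lemma AF_scl: "om : AF E ==> set l1 <= car E ==> set l2 <= car E ==> g : rng E ==> a : car E ==>
  om (l1 @ sscl E g a # l2) m = g m * om (l1 @ a # l2) m"
 unfolding AF_def by (auto dest!: spec[of _ l1])

lemma AF_alt: "om : AF E ==> set l1 <= car E ==> set l2 <= car E ==> a : car E ==>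
  om (l1 @ a # a # l2) m = 0"
 unfolding AF_def by (auto dest!: spec[of _ l1])

lemmas AF_add1 = AF_add[where ?l1.0 = "[]", simplified]
lemmas AF_scl1 = AF_scl[where ?l1.0 = "[]", simplified]
lemmas AF_alt1 = AF_alt[where ?l1.0 = "[]", simplified]

lemma AF_swap:
 assumes "smodule E" "om : AF E" "set l1 <= car E" "set l2 <= car E" "a : car E" "b : car E"
 shows "om (l1 @ a # b # l2) m = - om (l1 @ b # a # l2) m"
proof -
 let ?s = "sadd E a b"
 have s: "?s : car E" using smodule_add[OF assms(1,5,6)] .
 have "0 = om (l1 @ ?s # ?s # l2) m" using AF_alt[OF assms(2-4) s] by simp
 also have "... = om (l1 @ a # ?s # l2) m + om (l1 @ b # ?s # l2) m"
  using AF_add[OF assms(2,3), of "?s # l2" a b m] assms s by simp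
 also have "om (l1 @ a # ?s # l2) m = om (l1 @ a # a # l2) m + om (l1 @ a # b # l2) m"
  using AF_add[OF assms(2), of "l1 @ [a]" l2 a b m] assms by simp
 also have "om (l1 @ b # ?s # l2) m = om (l1 @ b # a # l2) m + om (l1 @ b # b # l2) m"
  using AF_add[OF assms(2), of "l1 @ [b]" l2 a b m] assms by simp
 finally show ?thesis using AF_alt[OF assms(2-4)] assms by simp
qed

lemmas AF_swap1 = AF_swap[where ?l1.0 = "[]", simplified]

lemma AFI:
 assumes "!!l. ~ set l <= car E ==> om l = (%m. 0)" "!!l. om l : rng E"
  "!!l1 l2 a b m. set l1 <= car E ==> set l2 <= car E ==> a : car E ==> b : car E ==>
    om (l1 @ sadd E a b # l2) m = om (l1 @ a # l2) m + om (l1 @ b # l2) m"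
  "!!l1 l2 g a m. set l1 <= car E ==> set l2 <= car E ==> g : rng E ==> a : car E ==>
    om (l1 @ sscl E g a # l2) m = g m * om (l1 @ a # l2) m"
  "!!l1 l2 a m. set l1 <= car E ==> set l2 <= car E ==> a : car E ==> om (l1 @ a # a # l2) m = 0"
 shows "om : AF E"
 unfolding AF_def by (intro CollectI conjI allI impI ext) (erule fun_cong[OF assms(1)] | simp only: assms(2-))+

lemma AF_ic:
 assumes "om : AF E" "x : car E" shows "ic x om : AF E"
proof (rule AFI)
 fix l1 l2 a b m assume *: "set l1 <= car E" "set l2 <= car E" "a : car E"
 { assume "b : car E" then show "ic x om (l1 @ sadd E a b # l2) m = ic x om (l1 @ a # l2) m + ic x om (l1 @ b # l2) m"
  using AF_add[OF assms(1), of "x # l1" l2 a b m] * assms(2) by (simp add: ic_def) }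
 { fix g assume "g : rng E" then show "ic x om (l1 @ sscl E g a # l2) m = g m * ic x om (l1 @ a # l2) m"
  using AF_scl[OF assms(1), of "x # l1" l2 g a m] * assms(2) by (simp add: ic_def) }
 show "ic x om (l1 @ a # a # l2) m = 0"
  using AF_alt[OF assms(1), of "x # l1" l2 a m] * assms(2) by (simp add: ic_def)
qed (use assms in "auto simp: ic_def AF_off AF_rng")

lemma AF_lin:
 assumes "smodule E" "om : AF E" "et : AF E" "f : rng E" "g : rng E"
 shows "(%l m. f m * om l m + g m * et l m) : AF E"
proof (rule AFI)
 fix l show "(%m. f m * om l m + g m * et l m) : rng E"
  by (intro func_ring_add func_ring_mult smodule_rng[OF assms(1)] assms(4,5)
    AF_rng[OF assms(2)] AF_rng[OF assms(3)])
qed (use assms in "auto simp: AF_off AF_add AF_scl AF_alt algebra_simps")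

lemma AF_plus: "smodule E ==> om : AF E ==> et : AF E ==> (%l m. om l m + et l m) : AF E"
 using AF_lin[of E om et "%_. 1" "%_. 1"] by (simp add: smodule_rng func_ring_const)

lemma AF_minus: "smodule E ==> om : AF E ==> et : AF E ==> (%l m. om l m - et l m) : AF E"
 using AF_lin[of E om et "%_. 1" "%_. -1"] by (simp add: smodule_rng func_ring_const)

lemma AF_mult: "smodule E ==> om : AF E ==> g : rng E ==> (%l m. g m * om l m) : AF E"
 using AF_lin[of E om om g "%_. 0"] by (simp add: smodule_rng func_ring_const)

lemma AF_galt: "smodule E ==> om : AF E ==> galt om : AF E"
 by (rule AFI) (auto simp: galt_def AF_off AF_add AF_scl AF_alt distrib_left
   intro: func_ring_cmult[OF smodule_rng AF_rng])

lemma galt_galt [simp]: "galt (galt om) = om"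
 by (simp add: galt_def fun_eq_iff mult.assoc[symmetric])

lemma ic_galt: "ic x (galt om) = (%l m. - galt (ic x om) l m)"
 by (simp add: galt_def ic_def)

text \<open>A family of functions of lists is a family of forms once this can be checked in the first
 argument, the contractions being expressed through forms and the family itself.\<close>

lemma AF_family:
 fixes O' :: "'i => ('m, 's) sform" and E :: "('m, 's, 'z) smod_scheme"
 assumes E: "smodule E" and i: "i : I"
  and off: "!!i l. i : I ==> ~ set l <= car E ==> O' i l = (%m. 0)"
  and nil: "!!i. i : I ==> O' i [] : rng E"
  and add: "!!i l a b m. i : I ==> set l <= car E ==> a : car E ==> b : car E ==>
    O' i (sadd E a b # l) m = O' i (a # l) m + O' i (b # l) m"
  and scl: "!!i l g a m. i : I ==> set l <= car E ==> g : rng E ==> a : car E ==>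
    O' i (sscl E g a # l) m = g m * O' i (a # l) m"
  and alt: "!!i l a m. i : I ==> set l <= car E ==> a : car E ==> O' i (a # a # l) m = 0"
  and step: "!!i x. i : I ==> x : car E ==>
    EX et:AF E. EX j:I. EX k:I. EX s t. ALL l m. set l <= car E --> O' i (x # l) m = et l m + s * O' j l m + t * O' k l m"
 shows "O' i : AF E"
proof (rule AFI)
 note R = smodule_rng[OF E]
 fix l show "O' i l : rng E"
  using i
 proof (induction l arbitrary: i)
  case (Cons x l)
  show ?case
  proof (cases "set (x # l) <= car E")
   case True
   then obtain et j k s t where *: "et : AF E" "j : I" "k : I"
    "!!m. O' i (x # l) m = et l m + s * O' j l m + t * O' k l m"
    using step[OF Cons.prems, of x] by auto
   have "(%m. et l m + s * O' j l m + t * O' k l m) : rng E"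
    by (intro func_ring_add[OF R] func_ring_cmult[OF R] AF_rng * Cons.IH)
   moreover have "O' i (x # l) = (%m. et l m + s * O' j l m + t * O' k l m)" using *(4) by (rule ext)
   ultimately show ?thesis by simp
  next
   case False then show ?thesis using off[OF Cons.prems False] func_ring_const[OF R] by simp
  qed
 qed (rule nil)
next
 fix l1 l2 a b m assume "set l1 <= car E" "set l2 <= car E" "a : car E" "b : car E"
 then show "O' i (l1 @ sadd E a b # l2) m = O' i (l1 @ a # l2) m + O' i (l1 @ b # l2) m"
  using i
 proof (induction l1 arbitrary: i)
  case (Cons x l)
  then obtain et j k s t where *: "et : AF E" "j : I" "k : I"
   "!!l m. set l <= car E ==> O' i (x # l) m = et l m + s * O' j l m + t * O' k l m"
   using step[of i x] by auto
  then show ?case using Cons smodule_add[OF E] AF_add[OF *(1)] by (simp add: algebra_simps)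
 qed (simp add: add)
next
 fix l1 l2 g a m assume "set l1 <= car E" "set l2 <= car E" "g : rng E" "a : car E"
 then show "O' i (l1 @ sscl E g a # l2) m = g m * O' i (l1 @ a # l2) m"
  using i
 proof (induction l1 arbitrary: i)
  case (Cons x l)
  then obtain et j k s t where *: "et : AF E" "j : I" "k : I"
   "!!l m. set l <= car E ==> O' i (x # l) m = et l m + s * O' j l m + t * O' k l m"
   using step[of i x] by auto
  then show ?case using Cons smodule_scl[OF E] AF_scl[OF *(1)] by (simp add: algebra_simps)
 qed (simp add: scl)
next
 fix l1 l2 a m assume "set l1 <= car E" "set l2 <= car E" "a : car E"
 then show "O' i (l1 @ a # a # l2) m = 0"
  using i
 proof (induction l1 arbitrary: i)
  case (Cons x l)
  then obtain et j k s t where *: "et : AF E" "j : I" "k : I"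
   "!!l m. set l <= car E ==> O' i (x # l) m = et l m + s * O' j l m + t * O' k l m"
   using step[of i x] by auto
  then show ?case using Cons AF_alt[OF *(1)] by simp
 qed (simp add: alt)
qed (rule off[OF i])

subsection \<open>Wedge products\<close>

text \<open>A subset of the first \<open>Suc n\<close> numbers contains 0 or does not, and the rest
  is a shifted subset of the first \<open>n\<close>. This is the head recursion behind the shuffle
  sum in \<open>wedge\<close>.\<close>

lemma sum_Pow_lessThan_Suc:
 fixes f :: "nat set => real"
 shows "(\<Sum>S\<in>Pow {..<Suc n}. f S) =
  (\<Sum>S\<in>Pow {..<n}. f (insert 0 (Suc ` S))) + (\<Sum>S\<in>Pow {..<n}. f (Suc ` S))"
proof -
 have P: "Pow {..<Suc n} = (%S. insert 0 (Suc ` S)) ` Pow {..<n} Un (%S. Suc ` S) ` Pow {..<n}"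
  unfolding lessThan_Suc_eq_insert_0 Pow_insert image_Pow_surj[OF refl, symmetric]
  by (auto simp: image_image)
 have "inj_on (%S. insert 0 (Suc ` S)) (Pow {..<n})"
 proof (rule inj_onI)
  fix S T assume "insert 0 (Suc ` S) = insert 0 (Suc ` T)"
  then have "Suc ` S = Suc ` T" by (metis image_iff insert_ident nat.distinct(1))
  then show "S = T" by (simp add: inj_image_eq_iff)
 qed
 moreover have "inj_on (%S. Suc ` S) (Pow {..<n})"
  by (simp add: inj_on_def inj_image_eq_iff)
 moreover have "(%S. insert 0 (Suc ` S)) ` Pow {..<n} Int (%S. Suc ` S) ` Pow {..<n} = {}"
  by auto
 ultimately show ?thesis
  unfolding P by (subst sum.union_disjoint) (auto simp: sum.reindex)
qed

lemma nths_Cons_Suc: "nths (x # l) (Suc ` S) = nths l S"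
 and nths_Cons_insert_Suc: "nths (x # l) (insert 0 (Suc ` S)) = x # nths l S"
 and nths_Cons_Compl_Suc: "nths (x # l) (- Suc ` S) = x # nths l (- S)"
 and nths_Cons_Compl_insert_Suc: "nths (x # l) (- insert 0 (Suc ` S)) = nths l (- S)"
 by (auto simp: nths_Cons image_iff Compl_eq intro!: arg_cong[of _ _ "nths l"])

text \<open>The sign of a shuffle when a new front position is added: given to the first factor it
  costs nothing, given to the second every element of \<open>S\<close> has to pass it.\<close>

lemma card_inversions_Suc:
 assumes "finite S"
 shows "card {(i, j). i : insert 0 (Suc ` S) & j < i & j ~: insert 0 (Suc ` S)} = card {(i, j). i : S & j < i & j ~: S}"
  and "card {(i, j). i : Suc ` S & j < i & j ~: Suc ` S} = card S + card {(i, j). i : S & j < i & j ~: S}"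
proof -
 let ?I = "{(i, j). i : S & j < i & j ~: S}"
 have fin: "finite ?I"
  by (rule finite_subset[of _ "S \<times> (\<Union>i\<in>S. {..<i})"]) (use assms in auto)
 have 1: "{(i, j). i : insert 0 (Suc ` S) & j < i & j ~: insert 0 (Suc ` S)} = map_prod Suc Suc ` ?I"
  unfolding set_eq_iff split_paired_All
 proof (intro allI)
  fix a b show "((a, b) : {(i, j). i : insert 0 (Suc ` S) & j < i & j ~: insert 0 (Suc ` S)}) =
   ((a, b) : map_prod Suc Suc ` ?I)"
   by (cases a; cases b) (auto simp: image_iff)
 qed
 have inj: "inj_on (map_prod Suc Suc) X" for X by (auto simp: inj_on_def)
 show "card {(i, j). i : insert 0 (Suc ` S) & j < i & j ~: insert 0 (Suc ` S)} = card ?I"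
  unfolding 1 by (rule card_image[OF inj])
 have 2: "{(i, j). i : Suc ` S & j < i & j ~: Suc ` S} = (%i. (Suc i, 0)) ` S Un map_prod Suc Suc ` ?I"
  unfolding set_eq_iff split_paired_All
 proof (intro allI)
  fix a b show "((a, b) : {(i, j). i : Suc ` S & j < i & j ~: Suc ` S}) =
   ((a, b) : (%i. (Suc i, 0)) ` S Un map_prod Suc Suc ` ?I)"
   by (cases a; cases b) (auto simp: image_iff)
 qed
 show "card {(i, j). i : Suc ` S & j < i & j ~: Suc ` S} = card S + card ?I"
  unfolding 2 by (subst card_Un_disjoint)
   (auto simp: card_image[OF inj] card_image inj_on_def assms fin)
qed

lemma wedge_Nil: "wedge om et [] m = om [] m * et [] m"
 by (simp add: wedge_def)

lemma length_nths_card: "S <= {..<length l} ==> length (nths l S) = card S"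
 by (auto simp: length_nths intro!: arg_cong[of _ _ card])

text \<open>Insertion of \<open>x\<close> is an antiderivation of the wedge product. The factor
  \<open>(-1) ^ card S\<close> in the second summand is the parity of the degree of the first factor
  and is absorbed in \<open>galt\<close>. Most later proofs about \<open>wedge\<close> use this
  recursion in place of the shuffle sum.\<close>

lemma wedge_Cons: "wedge om et (x # l) m = wedge (ic x om) et l m + wedge (galt om) (ic x et) l m"
proof -
 have "wedge om et (x # l) m =
  (\<Sum>S\<in>Pow {..<length l}. (-1) ^ card {(i, j). i : S & j < i & j ~: S} * om (x # nths l S) m * et (nths l (- S)) m) +
  (\<Sum>S\<in>Pow {..<length l}. (-1) ^ (card S + card {(i, j). i : S & j < i & j ~: S}) * om (nths l S) m * et (x # nths l (- S)) m)"
  unfolding wedge_def list.size add_Suc_right add_0_right sum_Pow_lessThan_Suc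
 proof (intro arg_cong2[of _ _ _ _ "(+)"] sum.cong refl)
  fix S assume "S : Pow {..<length l}"
  then have "finite S" by (auto intro: finite_subset)
  note * = card_inversions_Suc[OF this] nths_Cons_Suc nths_Cons_insert_Suc
    nths_Cons_Compl_Suc nths_Cons_Compl_insert_Suc
  show "(-1) ^ card {(i, j). i : insert 0 (Suc ` S) & j < i & j ~: insert 0 (Suc ` S)} *
    om (nths (x # l) (insert 0 (Suc ` S))) m * et (nths (x # l) (- insert 0 (Suc ` S))) m =
   (-1) ^ card {(i, j). i : S & j < i & j ~: S} * om (x # nths l S) m * et (nths l (- S)) m"
   "(-1) ^ card {(i, j). i : Suc ` S & j < i & j ~: Suc ` S} *
    om (nths (x # l) (Suc ` S)) m * et (nths (x # l) (- Suc ` S)) m =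
   (-1) ^ (card S + card {(i, j). i : S & j < i & j ~: S}) * om (nths l S) m * et (x # nths l (- S)) m"
   by (simp_all only: *)
 qed
 also have "... = wedge (ic x om) et l m + wedge (galt om) (ic x et) l m"
  unfolding wedge_def ic_def galt_def
  by (intro arg_cong2[of _ _ _ _ "(+)"] sum.cong refl) (auto simp: length_nths_card power_add)
 finally show ?thesis .
qed

lemma wedge_add1: "wedge (%l m. f m * om l m + g m * om' l m) et l m = f m * wedge om et l m + g m * wedge om' et l m"
 and wedge_add2: "wedge et (%l m. f m * om l m + g m * om' l m) l m = f m * wedge et om l m + g m * wedge et om' l m"
 unfolding wedge_def sum_distrib_left
 by (subst sum.distrib[symmetric], rule sum.cong, simp, simp add: algebra_simps)+

lemma wedge_plus1: "wedge (%l m. om l m + om' l m) et l m = wedge om et l m + wedge om' et l m"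
 and wedge_plus2: "wedge et (%l m. om l m + om' l m) l m = wedge et om l m + wedge et om' l m"
 using wedge_add1[of "%_. 1" om "%_. 1"] wedge_add2[of _ "%_. 1" om "%_. 1"] by simp_all

lemma wedge_diff1: "wedge (%l m. om l m - om' l m) et l m = wedge om et l m - wedge om' et l m"
 and wedge_diff2: "wedge et (%l m. om l m - om' l m) l m = wedge et om l m - wedge et om' l m"
 using wedge_add1[of "%_. 1" om "%_. -1"] wedge_add2[of _ "%_. 1" om "%_. -1"] by simp_all

lemma wedge_mult1: "wedge (%l m. g m * om l m) et l m = g m * wedge om et l m"
 and wedge_mult2: "wedge et (%l m. g m * om l m) l m = g m * wedge et om l m"
 using wedge_add1[of g om "%_. 0"] wedge_add2[of _ g om "%_. 0"] by simp_all

lemma wedge_uminus1: "wedge (%l m. - om l m) et l m = - wedge om et l m"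
 and wedge_uminus2: "wedge et (%l m. - om l m) l m = - wedge et om l m"
 using wedge_mult1[of "%_. -1"] wedge_mult2[of _ "%_. -1"] by simp_all

lemma wedge_zero1: "wedge (%l m. 0) et l m = 0"
 and wedge_zero2: "wedge et (%l m. 0) l m = 0"
 by (simp_all add: wedge_def)

lemma wedge_cong:
 assumes "set l <= A" "!!l. set l <= A ==> om l m = om' l m" "!!l. set l <= A ==> et l m = et' l m"
 shows "wedge om et l m = wedge om' et' l m"
 unfolding wedge_def by (intro sum.cong refl arg_cong2[of _ _ _ _ "(*)"] assms)
  (use assms(1) set_nths_subset in fastforce)+

text \<open>The family for \<open>AF_family\<close> consists of all products: inserting a section
  into a product gives a sum of two products of forms, so pairs of forms serve as indices.\<close>

lemma AF_wedge:
 assumes E: "smodule E" and "om : AF E" "et : AF E" shows "wedge om et : AF E"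
proof -
 let ?O = "%(om, et). wedge om et" and ?I = "AF E \<times> AF E"
 have "?O (om, et) : AF E"
 proof (rule AF_family[of E _ ?I])
  fix i l assume "i : ?I" "~ set l <= car E"
  then have "set (nths l S) Un set (nths l (- S)) = set l" for S
   unfolding set_nths set_conv_nth[of l] by blast
  then have "~ set (nths l S) <= car E | ~ set (nths l (- S)) <= car E" for S
   using \<open>~ set l <= car E\<close> by (metis Un_least)
  then have "fst i (nths l S) = (%m. 0) | snd i (nths l (- S)) = (%m. 0)" for S
   using \<open>i : ?I\<close> AF_off by (metis mem_Times_iff)
  then have "fst i (nths l S) m = 0 | snd i (nths l (- S)) m = 0" for S m
   by metis
  then have "wedge (fst i) (snd i) l m = 0" for m
   unfolding wedge_def by (intro sum.neutral) auto
  then show "?O i l = (%m. 0)"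
   by (simp add: case_prod_beta fun_eq_iff)
 next
  fix i assume "i : ?I" then show "?O i [] : rng E"
   using func_ring_mult[OF smodule_rng[OF E] AF_rng[of "fst i" E "[]"] AF_rng[of "snd i" E "[]"]]
   by (auto simp: wedge_Nil[abs_def] case_prod_beta)
 next
  fix i l a b m assume *: "i : ?I" "set l <= car E" "a : car E" "b : car E"
  have "wedge (ic (sadd E a b) om) et l m = wedge (%l m. ic a om l m + ic b om l m) et l m"
   "wedge et (ic (sadd E a b) om) l m = wedge et (%l m. ic a om l m + ic b om l m) l m" if "om : AF E" for om et
   by (rule wedge_cong[OF *(2)]; simp add: ic_def AF_add1[OF that] *)+
  then show "?O i (sadd E a b # l) m = ?O i (a # l) m + ?O i (b # l) m"
   using *(1) by (auto simp: wedge_Cons wedge_plus1 wedge_plus2)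
 next
  fix i l g a m assume *: "i : ?I" "set l <= car E" "g : rng E" "a : car E"
  have "wedge (ic (sscl E g a) om) et l m = wedge (%l m. g m * ic a om l m) et l m"
   "wedge et (ic (sscl E g a) om) l m = wedge et (%l m. g m * ic a om l m) l m" if "om : AF E" for om et
   by (rule wedge_cong[OF *(2)]; simp add: ic_def AF_scl1[OF that] *)+
  then show "?O i (sscl E g a # l) m = g m * ?O i (a # l) m"
   using *(1) by (auto simp: wedge_Cons wedge_mult1 wedge_mult2 algebra_simps)
 next
  fix i l a m assume *: "i : ?I" "set l <= car E" "a : car E"
  have "wedge (ic a (ic a om)) et l m = wedge (%l m. 0) et l m"
   "wedge et (ic a (ic a om)) l m = wedge et (%l m. 0) l m" if "om : AF E" for om et
   by (rule wedge_cong[OF *(2)]; simp add: ic_def AF_alt1[OF that] *)+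
  then show "?O i (a # a # l) m = 0"
   using *(1) by (auto simp: wedge_Cons ic_galt wedge_uminus1 wedge_zero1 wedge_zero2)
 next
  fix i x assume *: "i : ?I" "x : car E"
  obtain om et where i: "i = (om, et)" "om : AF E" "et : AF E" using * by auto
  show "EX ze:AF E. EX j:?I. EX k:?I. EX s t. ALL l m. set l <= car E -->
   ?O i (x # l) m = ze l m + s * ?O j l m + t * ?O k l m"
  proof (intro bexI exI allI impI)
   fix l m show "?O i (x # l) m = (0 * om l m) + 1 * ?O (ic x om, et) l m + 1 * ?O (galt om, ic x et) l m"
    by (simp add: wedge_Cons i)
  next
   show "(%l m. 0 * om l m) : AF E"
    using i(2) by (intro AF_mult func_ring_const smodule_rng E)
  qed (use i * AF_ic AF_galt[OF E] in auto)
 qed (use assms in auto)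
 then show ?thesis by simp
qed

subsection \<open>Pullbacks, contractions and their commutation with \<open>ic\<close>\<close>

text \<open>Head-recursive versions of the alternating sums over one index, respectively two indices, of a
 list that occur in \<^const>\<open>ce_diff\<close> and \<^const>\<open>contract2\<close>.\<close>

primrec ssum :: "'s list => ('s => 's list => real) => real" where
 "ssum [] G = 0"
| "ssum (x # l) G = G x l - ssum l (%a r. G a (x # r))"

primrec psum :: "'s list => ('s => 's => 's list => real) => real" where
 "psum [] G = 0"
| "psum (x # l) G = psum l (%a b r. G a b (x # r)) - ssum l (%b r. G x b r)"

lemma ssum_cong:
 "set l <= A ==> (!!a r. a : A ==> set r <= A ==> length l = Suc (length r) ==> G a r = H a r) ==> ssum l G = ssum l H"
proof (induction l arbitrary: G H)
 case (Cons x l)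
 have "ssum l (%a r. G a (x # r)) = ssum l (%a r. H a (x # r))"
  by (rule Cons.IH) (use Cons.prems in auto)
 then show ?case using Cons.prems by simp
qed simp

lemma psum_cong:
 "set l <= A ==> (!!a b r. a : A ==> b : A ==> set r <= A ==> length l = Suc (Suc (length r)) ==> G a b r = H a b r) ==> psum l G = psum l H"
proof (induction l arbitrary: G H)
 case (Cons x l)
 have "psum l (%a b r. G a b (x # r)) = psum l (%a b r. H a b (x # r))"
  by (rule Cons.IH) (use Cons.prems in auto)
 moreover have "ssum l (%b r. G x b r) = ssum l (%b r. H x b r)"
  by (rule ssum_cong[of _ A]) (use Cons.prems in auto)
 ultimately show ?case by simp
qed simp

lemma ssum_lin: "ssum l (%a r. c * G a r + d * H a r) = c * ssum l G + d * ssum l H"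
 by (induction l arbitrary: G H) (simp_all add: algebra_simps)

lemma psum_lin: "psum l (%a b r. c * G a b r + d * H a b r) = c * psum l G + d * psum l H"
 by (induction l arbitrary: G H) (simp_all add: algebra_simps ssum_lin)

lemma ssum_0 [simp]: "ssum l (%a r. 0) = 0"
 using ssum_lin[of l 0 "%a r. 0" 0 "%a r. 0"] by simp

lemma psum_0 [simp]: "psum l (%a b r. 0) = 0"
 using psum_lin[of l 0 "%a b r. 0" 0 "%a b r. 0"] by simp

lemma ssum_plus: "ssum l (%a r. G a r + H a r) = ssum l G + ssum l H"
 using ssum_lin[of l 1 G 1 H] by simp

lemma psum_plus: "psum l (%a b r. G a b r + H a b r) = psum l G + psum l H"
 using psum_lin[of l 1 G 1 H] by simp

lemma ssum_cmult: "ssum l (%a r. c * G a r) = c * ssum l G"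
 using ssum_lin[of l c G 0 G] by simp

lemma psum_cmult: "psum l (%a b r. c * G a b r) = c * psum l G"
 using psum_lin[of l c G 0 G] by simp

lemma ssum_uminus: "ssum l (%a r. - G a r) = - ssum l G"
 using ssum_cmult[of l "-1" G] by simp

lemma psum_uminus: "psum l (%a b r. - G a b r) = - psum l G"
 using psum_cmult[of l "-1" G] by simp

lemma ssum_map: "ssum (map ph l) G = ssum l (%a r. G (ph a) (map ph r))"
 by (induction l arbitrary: G) simp_all

lemma psum_map: "psum (map ph l) G = psum l (%a b r. G (ph a) (ph b) (map ph r))"
 by (induction l arbitrary: G) (simp_all add: ssum_map)

definition pbk :: "'s set => ('s => 't) => ('m, 't) sform => ('m, 's) sform" where
 "pbk A ph om = (%l. if set l <= A then om (map ph l) else (%m. 0))"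

text \<open>Each argument in turn is replaced by its image under \<open>th\<close>, the others by
  theirs under \<open>ph\<close>; the sign in \<open>ssum\<close> undoes moving that argument to the
  front. This is the degree 0 derivation along the pullback by \<open>ph\<close> that
  \<open>th\<close> determines. With \<open>th\<close> a bracket it is the algebraic part of a Lie
  derivative.\<close>

definition kap :: "'s set => ('s => 't) => ('s => 't) => ('m, 't) sform => ('m, 's) sform" where
 "kap A ph th om = (%l m. if set l <= A then ssum l (%b r. om (th b # map ph r) m) else 0)"

text \<open>Insertion of a 2-form with values in sections, a derivation of degree 1. The minus sign
  makes the value on x, y equal to \<open>om [ta x y]\<close>, because \<open>psum\<close> begins
  with the sign -1.\<close>

definition con :: "'s set => ('s => 't) => ('s => 's => 't) => ('m, 't) sform => ('m, 's) sform" where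
 "con A ph ta om = (%l m. if set l <= A then - psum l (%a b r. om (ta a b # map ph r) m) else 0)"

text \<open>Homomorphisms of modules of sections, and alternating bilinear maps. In the latter,
 \<open>ta X X = 0\<close> is expressed as \<open>ta X X = 0 \<cdot> ta X X\<close>.\<close>

definition shom :: "('m, 's, 'z) smod_scheme => ('m, 't, 'y) smod_scheme => ('s => 't) => bool" where
 "shom E V ph \<longleftrightarrow> (ALL a:car E. ph a : car V) &
  (ALL a:car E. ALL b:car E. ph (sadd E a b) = sadd V (ph a) (ph b)) &
  (ALL g:rng E. ALL a:car E. ph (sscl E g a) = sscl V g (ph a))"

definition snull :: "('m, 't, 'y) smod_scheme => 't => bool" where
 "snull V z \<longleftrightarrow> z : car V & sscl V (%_. 0) z = z"

definition alt2 :: "('m, 's, 'z) smod_scheme => ('m, 't, 'y) smod_scheme => ('s => 's => 't) => bool" where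
 "alt2 E V ta \<longleftrightarrow> (ALL x:car E. shom E V (ta x) & shom E V (%y. ta y x) & snull V (ta x x))"

lemma shom_car: "shom E V ph ==> a : car E ==> ph a : car V"
 and shom_add: "shom E V ph ==> a : car E ==> b : car E ==> ph (sadd E a b) = sadd V (ph a) (ph b)"
 and shom_scl: "shom E V ph ==> g : rng E ==> a : car E ==> ph (sscl E g a) = sscl V g (ph a)"
 by (auto simp: shom_def)

lemma shom_map: "shom E V ph ==> set l <= car E ==> set (map ph l) <= car V"
 by (auto simp: shom_def)

lemma shom_id: "shom E E (%x. x)"
 by (simp add: shom_def)

lemma alt2_shom: "alt2 E V ta ==> x : car E ==> shom E V (ta x)"
 and alt2_car: "alt2 E V ta ==> x : car E ==> y : car E ==> ta x y : car V"
 and alt2_add: "alt2 E V ta ==> x : car E ==> y : car E ==> z : car E ==> ta (sadd E x y) z = sadd V (ta x z) (ta y z)"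
 and alt2_scl: "alt2 E V ta ==> g : rng E ==> x : car E ==> z : car E ==> ta (sscl E g x) z = sscl V g (ta x z)"
 by (auto simp: alt2_def shom_def)

lemma AF_snull: "smodule V ==> om : AF V ==> snull V z ==> set l1 <= car V ==> set l2 <= car V ==> om (l1 @ z # l2) m = 0"
 unfolding snull_def using AF_scl[of om V l1 l2 "%_. 0" z m] func_ring_const[OF smodule_rng] by auto

lemmas AF_snull1 = AF_snull[where ?l1.0 = "[]", simplified]

lemma AF_pbk:
 assumes ph: "shom E V ph" and R: "rng E = rng V" and E: "smodule E" and om: "om : AF V"
 shows "pbk (car E) ph om : AF E"
proof (rule AFI)
 fix l show "pbk (car E) ph om l : rng E"
  using AF_rng[OF om, of "map ph l"] func_ring_const[OF smodule_rng[OF E], of 0] R by (simp add: pbk_def)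
 fix l1 l2 a m assume l: "set l1 <= car E" "set l2 <= car E" "a : car E"
 note l' = shom_map[OF ph l(1)] shom_map[OF ph l(2)] shom_car[OF ph l(3)]
 note ** = shom_add[OF ph] shom_scl[OF ph] smodule_add[OF E] smodule_scl[OF E]
 show "pbk (car E) ph om (l1 @ a # a # l2) m = 0"
  using l AF_alt[OF om l'] by (simp add: pbk_def)
 { fix b assume "b : car E"
  then show "pbk (car E) ph om (l1 @ sadd E a b # l2) m = pbk (car E) ph om (l1 @ a # l2) m + pbk (car E) ph om (l1 @ b # l2) m"
   using l AF_add[OF om l', of "ph b"] shom_car[OF ph] by (simp add: pbk_def **) }
 { fix g assume "g : rng E"
  then show "pbk (car E) ph om (l1 @ sscl E g a # l2) m = g m * pbk (car E) ph om (l1 @ a # l2) m"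
   using l AF_scl[OF om l'(1,2) _ l'(3), of g] R by (simp add: pbk_def **) }
qed (simp add: pbk_def)

lemma galt_pbk: "galt (pbk A ph om) = pbk A ph (galt om)"
 by (auto simp: galt_def pbk_def fun_eq_iff)

lemma pbk_uminus: "pbk A ph (%l m. - om l m) = (%l m. - pbk A ph om l m)"
 by (auto simp: pbk_def fun_eq_iff)

lemma pbk_wedge:
 fixes A :: "('m => 's) set" and om :: "('m, 'm => 't) sform"
 shows "pbk A ph (wedge om et) = wedge (pbk A ph om) (pbk A ph et)"
proof (intro ext)
 fix l m show "pbk A ph (wedge om et) l m = wedge (pbk A ph om) (pbk A ph et) l m"
 proof (cases "set l <= A")
  case True then show ?thesis
  proof (induction l arbitrary: om et)
   case (Cons x l)
   have *: "wedge (ic x (pbk A ph om)) ze l m = wedge (pbk A ph (ic (ph x) om)) ze l m"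
    "wedge ze (ic x (pbk A ph om)) l m = wedge ze (pbk A ph (ic (ph x) om)) l m" for om ze
    by (rule wedge_cong[of _ A]; use Cons.prems in "simp add: ic_def pbk_def")+
   have "pbk A ph (wedge om et) (x # l) m = pbk A ph (wedge (ic (ph x) om) et) l m + pbk A ph (wedge (galt om) (ic (ph x) et)) l m"
    using Cons.prems by (simp add: pbk_def wedge_Cons)
   then show ?case using Cons.prems by (simp add: Cons.IH wedge_Cons[of "pbk _ _ _"] * galt_pbk)
  qed (simp add: wedge_Nil pbk_def)
 next
  case False
  have "set (nths l S) Un set (nths l (- S)) = set l" for S
   unfolding set_nths set_conv_nth[of l] by blast
  then have "~ set (nths l S) <= A | ~ set (nths l (- S)) <= A" for S
   using False by (metis Un_least)
  then have "pbk A ph om (nths l S) m = 0 | pbk A ph et (nths l (- S)) m = 0" for S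
   by (auto simp: pbk_def)
  then have "wedge (pbk A ph om) (pbk A ph et) l m = 0"
   unfolding wedge_def by (intro sum.neutral) auto
  then show ?thesis using False by (simp add: pbk_def)
 qed
qed

lemma kap_Nil [simp]: "kap A ph th om [] m = 0"
 by (simp add: kap_def)

lemma con_Nil [simp]: "con A ph ta om [] m = 0"
 by (simp add: con_def)

lemma kap_off: "~ set l <= A ==> kap A ph th om l = (%m. 0)"
 and con_off: "~ set l <= A ==> con A ph ta om l = (%m. 0)"
 and pbk_off: "~ set l <= A ==> pbk A ph om l = (%m. 0)"
 by (auto simp: kap_def con_def pbk_def)

text \<open>Only the images of \<open>ph\<close> and \<open>th\<close> have to be sections: \<open>th\<close> need not be linear, as for \<open>th = [X, -]\<close>.\<close>

lemma kap_Cons: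
 assumes V: "smodule V" "om : AF V" and ph: "ph ` A <= car V" "th ` A <= car V" and l: "x : A" "set l <= A"
 shows "kap A ph th om (x # l) m = om (th x # map ph l) m + kap A ph th (ic (ph x) om) l m"
proof -
 have "ssum l (%b r. om (th b # ph x # map ph r) m) = ssum l (%b r. - om (ph x # th b # map ph r) m)"
  by (rule ssum_cong[OF l(2)], rule AF_swap1[OF V]) (use ph l in auto)
 then show ?thesis using l by (simp add: kap_def ic_def ssum_uminus)
qed

text \<open>Pairing the new front argument with each of the others leaves the substitution by
  \<open>ta x\<close>; the pairs that avoid it see it as a further argument, which moves to the
  front of \<open>om\<close> at the cost of a sign.\<close>

lemma con_Cons:
 assumes V: "smodule V" "om : AF V" and ph: "ph ` A <= car V" and ta: "ALL x:A. ALL y:A. ta x y : car V"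
  and l: "x : A" "set l <= A"
 shows "con A ph ta om (x # l) m = kap A ph (ta x) om l m - con A ph ta (ic (ph x) om) l m"
proof -
 have "psum l (%a b r. om (ta a b # ph x # map ph r) m) = psum l (%a b r. - om (ph x # ta a b # map ph r) m)"
  by (rule psum_cong[OF l(2)], rule AF_swap1[OF V]) (use ph ta l in auto)
 then show ?thesis using l by (simp add: con_def kap_def ic_def psum_uminus)
qed

lemma kap_lin:
 "kap A ph th (%l m. f m * om l m + g m * et l m) l m = f m * kap A ph th om l m + g m * kap A ph th et l m"
 by (simp add: kap_def ssum_lin)

lemma con_lin:
 "con A ph ta (%l m. f m * om l m + g m * et l m) l m = f m * con A ph ta om l m + g m * con A ph ta et l m"
 by (simp add: con_def psum_lin)

lemma kap_plus: "kap A ph th (%l m. om l m + et l m) l m = kap A ph th om l m + kap A ph th et l m"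
 and con_plus: "con A ph ta (%l m. om l m + et l m) l m = con A ph ta om l m + con A ph ta et l m"
 and kap_minus: "kap A ph th (%l m. om l m - et l m) l m = kap A ph th om l m - kap A ph th et l m"
 and con_minus: "con A ph ta (%l m. om l m - et l m) l m = con A ph ta om l m - con A ph ta et l m"
 using kap_lin[of A ph th "%_. 1" om "%_. 1" et] con_lin[of A ph ta "%_. 1" om "%_. 1" et]
  kap_lin[of A ph th "%_. 1" om "%_. -1" et] con_lin[of A ph ta "%_. 1" om "%_. -1" et] by simp_all

lemma kap_uminus: "kap A ph th (%l m. - om l m) l m = - kap A ph th om l m"
 and con_uminus: "con A ph ta (%l m. - om l m) l m = - con A ph ta om l m"
 by (simp_all add: kap_def con_def ssum_uminus psum_uminus)

lemma kap_mult: "kap A ph th (%l m. g m * om l m) l m = g m * kap A ph th om l m"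
 and con_mult: "con A ph ta (%l m. g m * om l m) l m = g m * con A ph ta om l m"
 by (simp_all add: kap_def con_def ssum_cmult psum_cmult)

lemma kap_cong:
 assumes "ph ` A <= B" "th ` A <= B" and eq: "!!l. set l <= B ==> om l m = et l m"
 shows "kap A ph th om l m = kap A ph th et l m"
proof (cases "set l <= A")
 case True
 have "ssum l (%b r. om (th b # map ph r) m) = ssum l (%b r. et (th b # map ph r) m)"
  by (rule ssum_cong[OF True], rule eq) (use assms(1,2) in auto)
 then show ?thesis by (simp add: kap_def)
qed (simp add: kap_off)

lemma con_cong:
 assumes "ph ` A <= B" "ALL x:A. ALL y:A. ta x y : B" and eq: "!!l. set l <= B ==> om l m = et l m"
 shows "con A ph ta om l m = con A ph ta et l m"
proof (cases "set l <= A")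
 case True
 have "psum l (%a b r. om (ta a b # map ph r) m) = psum l (%a b r. et (ta a b # map ph r) m)"
  by (rule psum_cong[OF True], rule eq) (use assms(1,2) in auto)
 then show ?thesis by (simp add: con_def)
qed (simp add: con_off)

lemma galt_kap: "galt (kap A ph th om) = kap A ph th (galt om)"
proof (intro ext)
 fix l m
 have "ssum l (%b r. (-1) ^ Suc (length r) * om (th b # map ph r) m) = ssum l (%b r. (-1) ^ length l * om (th b # map ph r) m)"
  by (rule ssum_cong[of _ UNIV]) auto
 then show "galt (kap A ph th om) l m = kap A ph th (galt om) l m"
  by (simp add: galt_def kap_def ssum_cmult)
qed

lemma galt_con: "galt (con A ph ta om) = (%l m. - con A ph ta (galt om) l m)"
proof (intro ext)
 fix l m
 have "psum l (%a b r. (-1) ^ Suc (length r) * om (ta a b # map ph r) m) = psum l (%a b r. - ((-1) ^ length l * om (ta a b # map ph r) m))"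
  by (rule psum_cong[of _ UNIV]) auto
 then show "galt (con A ph ta om) l m = - con A ph ta (galt om) l m"
  by (simp add: galt_def con_def psum_cmult psum_uminus)
qed

lemma AF_kap:
 assumes E: "smodule E" and V: "smodule V" and R: "rng E = rng V" and ph: "shom E V ph" and th: "shom E V th" and om: "om : AF V"
 shows "kap (car E) ph th om : AF E"
proof (rule AF_family[of E _ "AF V" "kap (car E) ph th"])
 have im: "ph ` car E <= car V" "th ` car E <= car V" using shom_car ph th by auto
 note K = kap_Cons[OF V _ im]
 note Es = smodule_add[OF E] smodule_scl[OF E]
 fix om assume om: "om : AF V"
 show "kap (car E) ph th om [] : rng E" using func_ring_const[OF smodule_rng[OF E]] by (simp add: kap_def)
 { fix l assume "~ set l <= car E" then show "kap (car E) ph th om l = (%m. 0)" by (rule kap_off) }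
 { fix x assume x: "x : car E"
  have "EX k:AF V. EX s t. ALL l m. set l <= car E --> kap (car E) ph th om (x # l) m =
   pbk (car E) ph (ic (th x) om) l m + s * kap (car E) ph th (ic (ph x) om) l m + t * kap (car E) ph th k l m"
   by (rule bexI[OF _ om], rule exI[of _ 1], rule exI[of _ 0]) (simp add: K[OF om x] pbk_def, simp add: ic_def)
  then show "EX et:AF E. EX j:AF V. EX k:AF V. EX s t. ALL l m. set l <= car E --> kap (car E) ph th om (x # l) m =
   et l m + s * kap (car E) ph th j l m + t * kap (car E) ph th k l m"
   using AF_pbk[OF ph R E AF_ic[OF om shom_car[OF th x]]] AF_ic[OF om shom_car[OF ph x]] by blast }
 fix l a m assume l: "set l <= car E" "a : car E"
 note c = shom_car[OF ph l(2)] shom_car[OF th l(2)] shom_map[OF ph l(1)]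
 { fix b assume b: "b : car E"
  have "kap (car E) ph th (ic (ph (sadd E a b)) om) l m = kap (car E) ph th (%l m. ic (ph a) om l m + ic (ph b) om l m) l m"
   by (rule kap_cong[OF im]) (simp add: ic_def shom_add[OF ph l(2) b] AF_add1[OF om _ c(1) shom_car[OF ph b]])
  then show "kap (car E) ph th om (sadd E a b # l) m = kap (car E) ph th om (a # l) m + kap (car E) ph th om (b # l) m"
   using AF_add1[OF om c(3,2) shom_car[OF th b]] by (simp add: K[OF om] Es b l kap_plus shom_add[OF th l(2) b]) }
 { fix g assume g: "g : rng E"
  have "kap (car E) ph th (ic (ph (sscl E g a)) om) l m = kap (car E) ph th (%l m. g m * ic (ph a) om l m) l m"
   by (rule kap_cong[OF im]) (use g R in "simp add: ic_def shom_scl[OF ph g l(2)] AF_scl1[OF om _ _ c(1)]")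
  then show "kap (car E) ph th om (sscl E g a # l) m = g m * kap (car E) ph th om (a # l) m"
   using AF_scl1[OF om c(3) _ c(2), of g] g R by (simp add: K[OF om] Es l kap_mult shom_scl[OF th _ l(2)] algebra_simps) }
 have "kap (car E) ph th (ic (ph a) (ic (ph a) om)) l m = kap (car E) ph th (%l m. 0) l m"
  by (rule kap_cong[OF im]) (simp add: ic_def AF_alt1[OF om _ c(1)])
 moreover have "om (th a # ph a # map ph l) m = - om (ph a # th a # map ph l) m"
  by (rule AF_swap1[OF V om c(3,2,1)])
 ultimately show "kap (car E) ph th om (a # a # l) m = 0"
  using l by (simp add: K[OF om] K[OF AF_ic[OF om c(1)]]) (simp add: ic_def kap_def)
qed (rule E, rule om)

lemma AF_con:
 assumes E: "smodule E" and V: "smodule V" and R: "rng E = rng V" and ph: "shom E V ph" and ta: "alt2 E V ta" and om: "om : AF V"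
 shows "con (car E) ph ta om : AF E"
proof (rule AF_family[of E _ "AF V" "con (car E) ph ta"])
 have im: "ph ` car E <= car V" using shom_car ph by auto
 have im2: "ALL x:car E. ALL y:car E. ta x y : car V" using alt2_car[OF ta] by simp
 have im3: "ta x ` car E <= car V" if "x : car E" for x using alt2_car[OF ta that] by auto
 note K = con_Cons[OF V _ im im2]
 note Es = smodule_add[OF E] smodule_scl[OF E]
 fix om assume om: "om : AF V"
 show "con (car E) ph ta om [] : rng E" using func_ring_const[OF smodule_rng[OF E]] by (simp add: con_def)
 { fix l assume "~ set l <= car E" then show "con (car E) ph ta om l = (%m. 0)" by (rule con_off) }
 { fix x assume x: "x : car E"
  have "EX k:AF V. EX s t. ALL l m. set l <= car E --> con (car E) ph ta om (x # l) m =
   kap (car E) ph (ta x) om l m + s * con (car E) ph ta (ic (ph x) om) l m + t * con (car E) ph ta k l m"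
   by (rule bexI[OF _ om], rule exI[of _ "-1"], rule exI[of _ 0]) (simp add: K[OF om x])
  then show "EX et:AF E. EX j:AF V. EX k:AF V. EX s t. ALL l m. set l <= car E --> con (car E) ph ta om (x # l) m =
   et l m + s * con (car E) ph ta j l m + t * con (car E) ph ta k l m"
   using AF_kap[OF E V R ph alt2_shom[OF ta x] om] AF_ic[OF om shom_car[OF ph x]] by blast }
 fix l a m assume l: "set l <= car E" "a : car E"
 note c = shom_car[OF ph l(2)] shom_map[OF ph l(1)]
 { fix b assume b: "b : car E"
  have "con (car E) ph ta (ic (ph (sadd E a b)) om) l m = con (car E) ph ta (%l m. ic (ph a) om l m + ic (ph b) om l m) l m"
   by (rule con_cong[OF im im2]) (simp_all add: ic_def shom_add[OF ph l(2) b] AF_add1[OF om _ c(1) shom_car[OF ph b]])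
  moreover have "kap (car E) ph (ta (sadd E a b)) om l m = kap (car E) ph (ta a) om l m + kap (car E) ph (ta b) om l m"
  proof -
   have "ssum l (%c r. om (ta (sadd E a b) c # map ph r) m) =
    ssum l (%c r. om (ta a c # map ph r) m + om (ta b c # map ph r) m)"
    by (rule ssum_cong[OF l(1)]) (use l b in "simp add: alt2_add[OF ta] AF_add1[OF om shom_map[OF ph]] alt2_car[OF ta]")
   then show ?thesis by (simp add: kap_def ssum_plus)
  qed
  ultimately show "con (car E) ph ta om (sadd E a b # l) m = con (car E) ph ta om (a # l) m + con (car E) ph ta om (b # l) m"
   by (simp add: K[OF om] Es b l con_plus) }
 { fix g assume g: "g : rng E"
  have "con (car E) ph ta (ic (ph (sscl E g a)) om) l m = con (car E) ph ta (%l m. g m * ic (ph a) om l m) l m"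
   by (rule con_cong[OF im im2]) (use g R in "simp_all add: ic_def shom_scl[OF ph g l(2)] AF_scl1[OF om _ _ c(1)]")
  moreover have "kap (car E) ph (ta (sscl E g a)) om l m = g m * kap (car E) ph (ta a) om l m"
  proof -
   have "ssum l (%c r. om (ta (sscl E g a) c # map ph r) m) = ssum l (%c r. g m * om (ta a c # map ph r) m)"
    by (rule ssum_cong[OF l(1)]) (use l g R in "simp add: alt2_scl[OF ta] AF_scl1[OF om shom_map[OF ph]] alt2_car[OF ta]")
   then show ?thesis by (simp add: kap_def ssum_cmult)
  qed
  ultimately show "con (car E) ph ta om (sscl E g a # l) m = g m * con (car E) ph ta om (a # l) m"
   using g by (simp add: K[OF om] Es l con_mult algebra_simps) }
 have "con (car E) ph ta (ic (ph a) (ic (ph a) om)) l m = con (car E) ph ta (%l m. 0) l m"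
  by (rule con_cong[OF im im2]) (simp_all add: ic_def AF_alt1[OF om _ c(1)])
 moreover have "om (ta a a # map ph l) m = 0"
  using ta l c by (intro AF_snull1[OF V om]) (auto simp: alt2_def)
 ultimately show "con (car E) ph ta om (a # a # l) m = 0"
  using l by (simp add: K[OF om] K[OF AF_ic[OF om c(1)]] kap_Cons[OF V om im im3]) (simp add: con_def)
qed (rule E, rule om)

lemma kap_wedge:
 fixes V :: "('m, 'm => 't, 'y) smod_scheme" and E :: "('m, 'm => 's, 'z) smod_scheme"
 assumes V: "smodule V" and ph: "ph ` A <= car V" "th ` A <= car V"
  and "om : AF V" "et : AF V" "set l <= (A :: ('m => 's) set)"
 shows "kap A ph th (wedge om et) l m = wedge (kap A ph th om) (pbk A ph et) l m + wedge (pbk A ph om) (kap A ph th et) l m"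
 using assms(4-6)
proof (induction l arbitrary: om et)
 case (Cons x l)
 then have x: "x : A" "set l <= A" "ph x : car V" "th x : car V" using ph by auto
 note AF = AF_ic[OF _ x(3)] AF_ic[OF _ x(4)] AF_galt[OF V] Cons.prems(1,2)
 note K = kap_Cons[OF V _ ph x(1)]
 have wk: "wedge (ic x (kap A ph th om)) ze l m = wedge (pbk A ph (ic (th x) om)) ze l m + wedge (kap A ph th (ic (ph x) om)) ze l m"
  "wedge ze (ic x (kap A ph th om)) l m = wedge ze (pbk A ph (ic (th x) om)) l m + wedge ze (kap A ph th (ic (ph x) om)) l m"
  if "om : AF V" for om ze
  unfolding wedge_plus1[symmetric] wedge_plus2[symmetric]
  by (rule wedge_cong[OF x(2) _ refl] wedge_cong[OF x(2) refl], simp add: ic_def[of x] K[OF that], simp add: pbk_def ic_def)+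
 have wp: "wedge (ic x (pbk A ph om)) ze l m = wedge (pbk A ph (ic (ph x) om)) ze l m"
  "wedge ze (ic x (pbk A ph om)) l m = wedge ze (pbk A ph (ic (ph x) om)) l m" for om ze
  by (rule wedge_cong[OF x(2) _ refl] wedge_cong[OF x(2) refl], simp add: ic_def pbk_def x(1))+
 have "kap A ph th (wedge om et) (x # l) m = wedge om et (th x # map ph l) m + kap A ph th (ic (ph x) (wedge om et)) l m"
  by (rule K[OF AF_wedge[OF V Cons.prems(1,2)] x(2)])
 also have "ic (ph x) (wedge om et) = (%l m. wedge (ic (ph x) om) et l m + wedge (galt om) (ic (ph x) et) l m)"
  by (intro ext) (simp add: ic_def[of _ "wedge _ _"] wedge_Cons)
 also have "wedge om et (th x # map ph l) m = pbk A ph (wedge (ic (th x) om) et) l m + pbk A ph (wedge (galt om) (ic (th x) et)) l m"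
  using x(2) by (simp add: wedge_Cons pbk_def)
 finally show ?case
  by (simp add: kap_plus Cons.IH AF x(2) wedge_Cons[of "kap _ _ _ _"] wedge_Cons[of "pbk _ _ _"] wk wp galt_pbk galt_kap pbk_wedge)
qed (simp add: wedge_Nil kap_def)

text \<open>The degree 1 of \<open>con\<close> is the source of \<open>galt\<close> on the first
  factor. Commuting with an insertion produces substitutions, whose own product rule
  \<open>kap_wedge\<close> closes the induction.\<close>

lemma con_wedge:
 fixes V :: "('m, 'm => 't, 'y) smod_scheme"
 assumes V: "smodule V" and ph: "ph ` A <= car V" and ta: "ALL x:A. ALL y:A. ta x y : car V"
  and "om : AF V" "et : AF V" "set l <= (A :: ('m => 's) set)"
 shows "con A ph ta (wedge om et) l m = wedge (con A ph ta om) (pbk A ph et) l m + wedge (galt (pbk A ph om)) (con A ph ta et) l m"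
 using assms(4-6)
proof (induction l arbitrary: om et)
 case (Cons x l)
 then have x: "x : A" "set l <= A" "ph x : car V" using ph by auto
 have tx: "ta x ` A <= car V" using ta x(1) by auto
 note AF = AF_ic[OF _ x(3)] AF_galt[OF V] Cons.prems(1,2)
 note K = con_Cons[OF V _ ph ta x(1)]
 have wk: "wedge (ic x (con A ph ta om)) ze l m = wedge (kap A ph (ta x) om) ze l m - wedge (con A ph ta (ic (ph x) om)) ze l m"
  "wedge ze (ic x (con A ph ta om)) l m = wedge ze (kap A ph (ta x) om) l m - wedge ze (con A ph ta (ic (ph x) om)) l m"
  if "om : AF V" for om ze
  unfolding wedge_diff1[symmetric] wedge_diff2[symmetric]
  by (rule wedge_cong[OF x(2) _ refl] wedge_cong[OF x(2) refl], simp add: ic_def[of x] K[OF that])+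
 have wp: "wedge (ic x (pbk A ph om)) ze l m = wedge (pbk A ph (ic (ph x) om)) ze l m"
  "wedge ze (ic x (pbk A ph om)) l m = wedge ze (pbk A ph (ic (ph x) om)) l m" for om ze
  by (rule wedge_cong[OF x(2) _ refl] wedge_cong[OF x(2) refl], simp add: ic_def pbk_def x(1))+
 have "con A ph ta (wedge om et) (x # l) m = kap A ph (ta x) (wedge om et) l m - con A ph ta (ic (ph x) (wedge om et)) l m"
  by (rule K[OF AF_wedge[OF V Cons.prems(1,2)] x(2)])
 also have "ic (ph x) (wedge om et) = (%l m. wedge (ic (ph x) om) et l m + wedge (galt om) (ic (ph x) et) l m)"
  by (intro ext) (simp add: ic_def[of _ "wedge _ _"] wedge_Cons)
 finally show ?case
  by (simp add: con_plus kap_wedge[OF V ph tx] Cons.IH AF x(2) wedge_Cons[of "con _ _ _ _"] wedge_Cons[of "pbk _ _ _"]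
    wedge_Cons[of "galt (pbk _ _ _)"] wk wp ic_galt galt_con galt_pbk pbk_uminus wedge_uminus1)
qed (simp add: wedge_Nil con_def)

subsection \<open>Lie algebroids in terms of sections\<close>

record ('m, 's) slie = "('m, 's) smod" +
 sanc :: "'s => 'm => ('m => real) => real"
 sbr :: "'s => 's => 's"

definition br_closed :: "('m, 's, 'z) slie_scheme => bool" where
 "br_closed E \<longleftrightarrow> smodule E & (ALL x:car E. ALL y:car E. sbr E x y : car E)"

text \<open>Everything of a Lie algebroid except the Jacobi identity and the compatibility of anchor
  and bracket. At this level \<open>sd\<close> maps forms to forms and is a derivation, and at this
  level the algebroid of pairs is treated.\<close>

definition slie_alg :: "('m, 's, 'z) slie_scheme => bool" where
 "slie_alg E \<longleftrightarrow> br_closed E &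
  (ALL x:car E. ALL f:rng E. (%m. sanc E x m f) : rng E &
   (ALL m. (ALL c. sanc E x m (%p. c * f p) = c * sanc E x m f) &
    (ALL g:rng E. sanc E x m (%p. f p + g p) = sanc E x m f + sanc E x m g &
     sanc E x m (%p. f p * g p) = sanc E x m f * g m + f m * sanc E x m g &
     sanc E (sscl E g x) m f = g m * sanc E x m f) &
    (ALL y:car E. sanc E (sadd E x y) m f = sanc E x m f + sanc E y m f))) &
  (ALL x:car E. ALL y:car E.
   (ALL z:car E. sbr E (sadd E x y) z = sadd E (sbr E x z) (sbr E y z) &
    sbr E z (sadd E x y) = sadd E (sbr E z x) (sbr E z y)) &
   (ALL g:rng E. sbr E (sscl E g x) y = sadd E (sscl E g (sbr E x y)) (sscl E (%m. - sanc E y m g) x) &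
    sbr E x (sscl E g y) = sadd E (sscl E g (sbr E x y)) (sscl E (%m. sanc E x m g) y))) &
  (ALL x:car E. snull E (sbr E x x))"

definition lder :: "('m, 's, 'z) slie_scheme => 's => ('m, 's) sform => ('m, 's) sform" where
 "lder E x om = (%l m. sanc E x m (om l) - kap (car E) (%y. y) (sbr E x) om l m)"

definition sd :: "('m, 's, 'z) slie_scheme => ('m, 's) sform => ('m, 's) sform" where
 "sd E om = (%l m. if set l <= car E then
  ssum l (%a r. sanc E a m (om r)) + psum l (%a b r. om (sbr E a b # r) m) else 0)"

lemma ssum_minus: "ssum l (%a r. G a r - H a r) = ssum l G - ssum l H"
 using ssum_lin[of l 1 G "-1" H] by simp

lemma psum_minus: "psum l (%a b r. G a b r - H a b r) = psum l G - psum l H"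
 using psum_lin[of l 1 G "-1" H] by simp

lemma br_closed_smodule: "br_closed E ==> smodule E"
 and br_closed_br: "br_closed E ==> x : car E ==> y : car E ==> sbr E x y : car E"
 and slie_br_closed: "slie_alg E ==> br_closed E"
 and slie_smodule: "slie_alg E ==> smodule E"
 and slie_br: "slie_alg E ==> x : car E ==> y : car E ==> sbr E x y : car E"
 by (auto simp: slie_alg_def br_closed_def)

lemma slie_anc:
 assumes "slie_alg E" "x : car E" "f : rng E"
 shows "(%m. sanc E x m f) : rng E" "sanc E x m (%p. c * f p) = c * sanc E x m f"
  "g : rng E ==> sanc E x m (%p. f p + g p) = sanc E x m f + sanc E x m g"
  "g : rng E ==> sanc E x m (%p. f p * g p) = sanc E x m f * g m + f m * sanc E x m g"
  "g : rng E ==> sanc E (sscl E g x) m f = g m * sanc E x m f"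
  "y : car E ==> sanc E (sadd E x y) m f = sanc E x m f + sanc E y m f"
 using assms unfolding slie_alg_def by blast+

lemma slie_anc_0: "slie_alg E ==> x : car E ==> sanc E x m (%p. 0) = 0"
 using slie_anc(2)[of E x "%_. 0" m 0] func_ring_const[OF smodule_rng[OF slie_smodule]] by auto

lemma slie_anc_uminus: "slie_alg E ==> x : car E ==> f : rng E ==> sanc E x m (%p. - f p) = - sanc E x m f"
 using slie_anc(2)[of E x f m "-1"] by simp

lemma slie_anc_minus: "slie_alg E ==> x : car E ==> f : rng E ==> g : rng E ==>
  sanc E x m (%p. f p - g p) = sanc E x m f - sanc E x m g"
 using slie_anc(3)[of E x f "%p. - g p" m] slie_anc_uminus[of E x g m]
  func_ring_uminus[OF smodule_rng[OF slie_smodule], of E g] by simp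

lemma slie_bracket:
 assumes "slie_alg E" "x : car E" "y : car E"
 shows "z : car E ==> sbr E (sadd E x y) z = sadd E (sbr E x z) (sbr E y z)"
  "z : car E ==> sbr E z (sadd E x y) = sadd E (sbr E z x) (sbr E z y)"
  "g : rng E ==> sbr E (sscl E g x) y = sadd E (sscl E g (sbr E x y)) (sscl E (%m. - sanc E y m g) x)"
  "g : rng E ==> sbr E x (sscl E g y) = sadd E (sscl E g (sbr E x y)) (sscl E (%m. sanc E x m g) y)"
  "snull E (sbr E x x)"
 using assms unfolding slie_alg_def by blast+

lemma lder_Cons:
 assumes E: "br_closed E" and om: "om : AF E" and x: "x : car E" "y : car E" "set l <= car E"
 shows "lder E x om (y # l) m = lder E x (ic y om) l m - om (sbr E x y # l) m"
proof -
 have "sbr E x ` car E <= car E" using br_closed_br[OF E x(1)] by auto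
 from kap_Cons[OF br_closed_smodule[OF E] om _ this x(2,3), of "%y. y" m]
 show ?thesis by (simp add: lder_def ic_def)
qed

text \<open>Cartan's formula. With \<open>lder_Cons\<close> it gives a recursion on the list of
  arguments, so that statements about the differential become commutation rules with
  insertions.\<close>

lemma sd_Cons:
 assumes E: "br_closed E" and om: "om : AF E" and x: "x : car E" "set l <= car E"
 shows "sd E om (x # l) m = lder E x om l m - sd E (ic x om) l m"
proof -
 have "ALL x:car E. ALL y:car E. sbr E x y : car E" using br_closed_br[OF E] by auto
 from con_Cons[OF br_closed_smodule[OF E] om _ this x, of "%y. y" m]
 show ?thesis using x by (simp add: lder_def sd_def con_def ic_def)
qed

lemma sd_Nil [simp]: "sd E om [] m = 0"
 by (simp add: sd_def)

lemma sd_off: "~ set l <= car E ==> sd E om l = (%m. 0)"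
 by (auto simp: sd_def)

lemma lder_cong:
 assumes "br_closed E" "x : car E" "!!l m. set l <= car E ==> om l m = et l m" "set l <= car E"
 shows "lder E x om l m = lder E x et l m"
proof -
 have "sbr E x ` car E <= car E" using br_closed_br[OF assms(1,2)] by auto
 then have "kap (car E) (%y. y) (sbr E x) om l m = kap (car E) (%y. y) (sbr E x) et l m"
  by (intro kap_cong) (use assms(3) in auto)
 moreover have "om l = et l" using assms(3)[OF assms(4)] by (rule ext)
 ultimately show ?thesis by (simp add: lder_def)
qed

lemma sd_cong:
 assumes "br_closed E" "!!l m. set l <= car E ==> om l m = et l m"
 shows "sd E om l m = sd E et l m"
proof (cases "set l <= car E")
 case True
 have "om l = et l" if "set l <= car E" for l using assms(2)[OF that] by (rule ext)
 then show ?thesis using True unfolding sd_def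
  by (auto intro!: arg_cong2[of _ _ _ _ "(+)"] ssum_cong[OF True] psum_cong[OF True] assms(2) br_closed_br[OF assms(1)])
qed (simp add: sd_off)

lemma lder_lin:
 assumes E: "slie_alg E" "x : car E" and "om : AF E" "et : AF E"
 shows "lder E x (%l m. om l m + et l m) l m = lder E x om l m + lder E x et l m"
  "lder E x (%l m. om l m - et l m) l m = lder E x om l m - lder E x et l m"
  "lder E x (%l m. - om l m) l m = - lder E x om l m"
  "g : rng E ==> lder E x (%l m. g m * om l m) l m = g m * lder E x om l m + sanc E x m g * om l m"
 unfolding lder_def
 using slie_anc(3)[OF E AF_rng[OF assms(3)] AF_rng[OF assms(4)]] slie_anc_minus[OF E AF_rng[OF assms(3)] AF_rng[OF assms(4)]]
  slie_anc_uminus[OF E AF_rng[OF assms(3)]] slie_anc(4)[OF E _ AF_rng[OF assms(3)], of g]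
 by (simp_all add: kap_plus kap_minus kap_uminus kap_mult algebra_simps)

lemma sd_lin:
 assumes E: "slie_alg E" and "om : AF E" "et : AF E"
 shows "sd E (%l m. om l m + et l m) l m = sd E om l m + sd E et l m"
  "sd E (%l m. om l m - et l m) l m = sd E om l m - sd E et l m"
  "sd E (%l m. c * om l m) l m = c * sd E om l m"
proof -
 note AF = AF_rng[OF assms(2)] AF_rng[OF assms(3)]
 have *: "set l <= car E ==> ssum l (%a r. sanc E a m (%p. om r p + et r p)) = ssum l (%a r. sanc E a m (om r)) + ssum l (%a r. sanc E a m (et r))"
  "set l <= car E ==> ssum l (%a r. sanc E a m (%p. om r p - et r p)) = ssum l (%a r. sanc E a m (om r)) - ssum l (%a r. sanc E a m (et r))"
  "set l <= car E ==> ssum l (%a r. sanc E a m (%p. c * om r p)) = ssum l (%a r. c * sanc E a m (om r))"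
  unfolding ssum_plus[symmetric] ssum_minus[symmetric]
  by (rule ssum_cong, assumption, simp add: slie_anc(2,3)[OF E _ AF(1)] slie_anc_minus[OF E _ AF] AF)+
 show "sd E (%l m. om l m + et l m) l m = sd E om l m + sd E et l m"
  "sd E (%l m. om l m - et l m) l m = sd E om l m - sd E et l m"
  "sd E (%l m. c * om l m) l m = c * sd E om l m"
  unfolding sd_def by (auto simp: * psum_plus psum_minus psum_cmult ssum_cmult distrib_left)
qed

lemma sd_uminus: "slie_alg E ==> om : AF E ==> sd E (%l m. - om l m) l m = - sd E om l m"
 using sd_lin(3)[of E om om "-1"] by simp

lemma AF_lder:
 assumes E: "slie_alg E" and x: "x : car E" and om: "om : AF E"
 shows "lder E x om : AF E"
proof (rule AF_family[of E _ "AF E" "lder E x"])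
 note E' = slie_smodule[OF E] slie_br_closed[OF E]
 note C = lder_Cons[OF E'(2) _ x]
 fix om assume om: "om : AF E"
 show "lder E x om [] : rng E" by (simp add: lder_def[abs_def] slie_anc(1)[OF E x AF_rng[OF om]])
 { fix l assume l: "~ set l <= car E" then show "lder E x om l = (%m. 0)"
   by (simp add: lder_def kap_off AF_off[OF om] slie_anc_0[OF E x]) }
 { fix y assume y: "y : car E"
  have "EX k:AF E. EX s t. ALL l m. set l <= car E --> lder E x om (y # l) m =
   - 1 * ic (sbr E x y) om l m + s * lder E x (ic y om) l m + t * lder E x k l m"
   by (rule bexI[OF _ om], rule exI[of _ 1], rule exI[of _ 0]) (simp add: C[OF om y], simp add: ic_def)
  then show "EX et:AF E. EX j:AF E. EX k:AF E. EX s t. ALL l m. set l <= car E --> lder E x om (y # l) m =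
   et l m + s * lder E x j l m + t * lder E x k l m"
   by (rule bexI[where x = "%l m. - 1 * ic (sbr E x y) om l m", OF bexI[where x = "ic y om"], OF _ AF_ic[OF om y]
    AF_mult[OF E'(1) AF_ic[OF om slie_br[OF E x y]] func_ring_const[OF smodule_rng[OF E'(1)]]]]) }
 fix l a m assume l: "set l <= car E" "a : car E"
 note xa = slie_br[OF E x l(2)]
 { fix b assume b: "b : car E"
  have "lder E x (ic (sadd E a b) om) l m = lder E x (%l m. ic a om l m + ic b om l m) l m"
   by (rule lder_cong[OF E'(2) x _ l(1)]) (simp add: ic_def AF_add1[OF om _ l(2) b])
  then show "lder E x om (sadd E a b # l) m = lder E x om (a # l) m + lder E x om (b # l) m"
   by (simp add: C[OF om] smodule_add[OF E'(1)] l b lder_lin[OF E x AF_ic[OF om] AF_ic[OF om]]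
     slie_bracket(2)[OF E l(2) b x] AF_add1[OF om l(1) xa slie_br[OF E x b]]) }
 { fix g assume g: "g : rng E"
  have "lder E x (ic (sscl E g a) om) l m = lder E x (%l m. g m * ic a om l m) l m"
   by (rule lder_cong[OF E'(2) x _ l(1)]) (simp add: ic_def AF_scl1[OF om _ g l(2)])
  also have "... = g m * lder E x (ic a om) l m + sanc E x m g * om (a # l) m"
   unfolding lder_lin(4)[OF E x AF_ic[OF om l(2)] AF_ic[OF om l(2)] g] by (simp add: ic_def)
  finally show "lder E x om (sscl E g a # l) m = g m * lder E x om (a # l) m"
   by (simp add: C[OF om] smodule_scl[OF E'(1)] l g
     slie_bracket(4)[OF E x l(2) g] AF_add1[OF om l(1)] AF_scl1[OF om l(1)] xa slie_anc(1)[OF E x g] algebra_simps) }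
 have "lder E x (ic a (ic a om)) l m = lder E x (%l m. 0) l m"
  by (rule lder_cong[OF E'(2) x _ l(1)]) (simp add: ic_def AF_alt1[OF om _ l(2)])
 then show "lder E x om (a # a # l) m = 0"
  using AF_swap1[OF E'(1) om l(1) l(2) xa]
  by (simp add: C[OF om] C[OF AF_ic[OF om]] l) (simp add: lder_def kap_def ic_def slie_anc_0[OF E x])
qed (rule slie_smodule[OF E], rule om)

text \<open>The extra term is the wedge product of dg with the insertion of \<open>x\<close>,
  written as a substitution. The same term occurs in \<open>sd_mult_ic\<close>, and the two cancel
  in \<open>AF_sd\<close>.\<close>

lemma lder_scl:
 assumes E: "slie_alg E" and x: "x : car E" and om: "om : AF E" and g: "g : rng E" and l: "set l <= car E"
 shows "lder E (sscl E g x) om l m = g m * lder E x om l m + kap (car E) (%y. y) (%y. sscl E (%m. sanc E y m g) x) om l m"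
proof -
 note R = smodule_rng[OF slie_smodule[OF E]]
 have "ssum l (%b r. om (sbr E (sscl E g x) b # r) m) =
  ssum l (%b r. g m * om (sbr E x b # r) m + (-1) * om (sscl E (%m. sanc E b m g) x # r) m)"
  by (rule ssum_cong[OF l]) (simp add: slie_bracket(3)[OF E x _ g] AF_add1[OF om] AF_scl1[OF om] x g
    slie_br[OF E] smodule_scl[OF slie_smodule[OF E]] slie_anc(1)[OF E _ g] func_ring_uminus[OF R])
 then show ?thesis using l
  by (simp add: lder_def kap_def slie_anc(5)[OF E x AF_rng[OF om] g] ssum_lin ssum_plus ssum_cmult ssum_minus ssum_uminus algebra_simps)
qed

text \<open>The Leibniz rule for a function times a form. It is stated for forms of the shape
  \<open>ic x om\<close>, because then dg wedge the form is a \<open>kap\<close>; this is the shape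
  that Cartan's formula produces for a rescaled argument.\<close>

lemma sd_mult_ic:
 assumes E: "slie_alg E" and x: "x : car E" and g: "g : rng E"
 shows "om : AF E ==> set l <= car E ==> sd E (%l m. g m * ic x om l m) l m =
  g m * sd E (ic x om) l m + kap (car E) (%y. y) (%y. sscl E (%m. sanc E y m g) x) om l m"
proof (induction l arbitrary: om)
 case (Cons y l)
 note E' = slie_smodule[OF E] slie_br_closed[OF E]
 have y: "y : car E" "set l <= car E" using Cons.prems by auto
 note om = Cons.prems(1) and omx = AF_ic[OF Cons.prems(1) x] and omy = AF_ic[OF Cons.prems(1) y(1)]
 note gx = AF_mult[OF E'(1) omx g]
 have A: "(%l m. g m * ic x (ic y om) l m) : AF E" by (rule AF_mult[OF E'(1) AF_ic[OF omy x] g])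
 have sw: "ic y (ic x om) l m = - ic x (ic y om) l m" if "set l <= car E" for l m
  using AF_swap1[OF E'(1) om that x y(1)] by (simp add: ic_def)
 have 1: "sd E (ic y (%l m. g m * ic x om l m)) l m = - sd E (%l m. g m * ic x (ic y om) l m) l m"
  unfolding sd_uminus[OF E A, symmetric]
  by (rule sd_cong[OF E'(2)]) (use sw in "simp add: ic_def")
 have 2: "sd E (ic y (ic x om)) l m = - sd E (ic x (ic y om)) l m"
  unfolding sd_uminus[OF E AF_ic[OF omy x], symmetric] by (rule sd_cong[OF E'(2)]) (rule sw)
 have im: "(%y. sscl E (%m. sanc E y m g) x) ` car E <= car E"
  using smodule_scl[OF E'(1) slie_anc(1)[OF E _ g] x] by auto
 show ?case
  by (simp add: sd_Cons[OF E'(2) gx y] 1 Cons.IH[OF omy y(2)] sd_Cons[OF E'(2) omx y] 2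
    kap_Cons[OF E'(1) om _ im y] lder_lin(4)[OF E y(1) omx omx g])
   (simp add: ic_def AF_scl1[OF om y(2) slie_anc(1)[OF E y(1) g] x] algebra_simps)
qed simp

lemma AF_sd:
 assumes E: "slie_alg E" and om: "om : AF E"
 shows "sd E om : AF E"
proof (rule AF_family[of E _ "AF E" "sd E"])
 note E' = slie_smodule[OF E] slie_br_closed[OF E]
 note C = sd_Cons[OF E'(2)]
 fix om assume om: "om : AF E"
 show "sd E om [] : rng E" using func_ring_const[OF smodule_rng[OF E'(1)]] by (simp add: sd_def)
 { fix l assume l: "~ set l <= car E" then show "sd E om l = (%m. 0)" by (rule sd_off) }
 { fix y assume y: "y : car E"
  have "EX k:AF E. EX s t. ALL l m. set l <= car E --> sd E om (y # l) m =
   lder E y om l m + s * sd E (ic y om) l m + t * sd E k l m"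
   by (rule bexI[OF _ om], rule exI[of _ "-1"], rule exI[of _ 0]) (simp add: C[OF om y])
  then show "EX et:AF E. EX j:AF E. EX k:AF E. EX s t. ALL l m. set l <= car E --> sd E om (y # l) m =
   et l m + s * sd E j l m + t * sd E k l m"
   using AF_lder[OF E y om] AF_ic[OF om y] by blast }
 fix l a m assume l: "set l <= car E" "a : car E"
 { fix b assume b: "b : car E"
  have "sd E (ic (sadd E a b) om) l m = sd E (%l m. ic a om l m + ic b om l m) l m"
   by (rule sd_cong[OF E'(2)]) (simp add: ic_def AF_add1[OF om _ l(2) b])
  moreover have "lder E (sadd E a b) om l m = lder E a om l m + lder E b om l m"
  proof -
   have "ssum l (%c r. om (sbr E (sadd E a b) c # r) m) = ssum l (%c r. om (sbr E a c # r) m + om (sbr E b c # r) m)"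
    by (rule ssum_cong[OF l(1)]) (simp add: slie_bracket(1)[OF E l(2) b] AF_add1[OF om] slie_br[OF E] l b)
   then show ?thesis by (simp add: lder_def kap_def slie_anc(6)[OF E l(2) AF_rng[OF om] b] ssum_plus)
  qed
  ultimately show "sd E om (sadd E a b # l) m = sd E om (a # l) m + sd E om (b # l) m"
   by (simp add: C[OF om] smodule_add[OF E'(1)] l b sd_lin[OF E AF_ic[OF om] AF_ic[OF om]]) }
 { fix g assume g: "g : rng E"
  have "sd E (ic (sscl E g a) om) l m = sd E (%l m. g m * ic a om l m) l m"
   by (rule sd_cong[OF E'(2)]) (simp add: ic_def AF_scl1[OF om _ g l(2)])
  then show "sd E om (sscl E g a # l) m = g m * sd E om (a # l) m"
   by (simp add: C[OF om] smodule_scl[OF E'(1)] l g sd_mult_ic[OF E l(2) g om l(1)] lder_scl[OF E l(2) om g l(1)] algebra_simps) }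
 have "sd E (ic a (ic a om)) l m = sd E (%l m. 0 * om l m) l m"
  by (rule sd_cong[OF E'(2)]) (simp add: ic_def AF_alt1[OF om _ l(2)])
 also have "... = 0" unfolding sd_lin(3)[OF E om om] by simp
 finally show "sd E om (a # a # l) m = 0"
  using AF_snull1[OF E'(1) om slie_bracket(5)[OF E l(2) l(2)] l(1)]
  by (simp add: C[OF om] C[OF AF_ic[OF om]] lder_Cons[OF E'(2) om] l)
qed (rule slie_smodule[OF E], rule om)

lemma galt_lder: "slie_alg E ==> x : car E ==> om : AF E ==> galt (lder E x om) = lder E x (galt om)"
 unfolding lder_def galt_kap[symmetric]
 by (auto simp: galt_def fun_eq_iff slie_anc(2)[OF _ _ AF_rng] right_diff_distrib)

lemma galt_sd:
 assumes E: "slie_alg E" and om: "om : AF E"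
 shows "galt (sd E om) = (%l m. - sd E (galt om) l m)"
proof (intro ext)
 fix l m show "galt (sd E om) l m = - sd E (galt om) l m"
 proof (cases "set l <= car E")
  case True
  have "ssum l (%a r. sanc E a m (%p. (-1) ^ length r * om r p)) = ssum l (%a r. - ((-1) ^ length l * sanc E a m (om r)))"
   by (rule ssum_cong[OF True]) (simp add: slie_anc(2)[OF E _ AF_rng[OF om]])
  moreover have "psum l (%a b r. (-1) ^ Suc (length r) * om (sbr E a b # r) m) = psum l (%a b r. - ((-1) ^ length l * om (sbr E a b # r) m))"
   by (rule psum_cong[OF True]) simp
  ultimately show ?thesis using True
   by (simp add: galt_def sd_def ssum_uminus psum_uminus ssum_cmult psum_cmult algebra_simps)
 qed (simp add: galt_def sd_off)
qed

lemma lder_wedge: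
 fixes E :: "('m, 'm => 's, 'z) slie_scheme"
 assumes E: "slie_alg E" and x: "x : car E"
 shows "om : AF E ==> et : AF E ==> set l <= car E ==>
  lder E x (wedge om et) l m = wedge (lder E x om) et l m + wedge om (lder E x et) l m"
proof (induction l arbitrary: om et)
 case Nil
 then show ?case using slie_anc(4)[OF E x AF_rng[OF Nil(1)] AF_rng[OF Nil(2)], of m "[]" "[]"]
  by (simp add: lder_def wedge_Nil[abs_def] wedge_Nil)
next
 case (Cons y l)
 note E' = slie_smodule[OF E] slie_br_closed[OF E]
 have y: "y : car E" "set l <= car E" "sbr E x y : car E" using Cons.prems slie_br[OF E x] by auto
 note AF = AF_ic[OF _ y(1)] AF_ic[OF _ y(3)] AF_galt[OF E'(1)] Cons.prems(1,2) AF_wedge[OF E'(1)] AF_lder[OF E x]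
 have wl: "wedge (ic y (lder E x om)) ze l m = wedge (lder E x (ic y om)) ze l m - wedge (ic (sbr E x y) om) ze l m"
  "wedge ze (ic y (lder E x om)) l m = wedge ze (lder E x (ic y om)) l m - wedge ze (ic (sbr E x y) om) l m"
  if "om : AF E" for om ze
  unfolding wedge_diff1[symmetric] wedge_diff2[symmetric]
  by (rule wedge_cong[OF y(2) _ refl] wedge_cong[OF y(2) refl], simp add: ic_def[of y "lder E x om"] lder_Cons[OF E'(2) that x y(1)], simp add: ic_def)+
 have "lder E x (wedge om et) (y # l) m = lder E x (ic y (wedge om et)) l m - wedge om et (sbr E x y # l) m"
  by (rule lder_Cons[OF E'(2) AF_wedge[OF E'(1) Cons.prems(1,2)] x y(1,2)])
 also have "ic y (wedge om et) = (%l m. wedge (ic y om) et l m + wedge (galt om) (ic y et) l m)"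
  by (intro ext) (simp add: ic_def[of _ "wedge _ _"] wedge_Cons)
 finally show ?case
  by (simp add: lder_lin(1)[OF E x] AF Cons.IH y(2) wedge_Cons wl galt_lder[OF E x])
qed

lemma sd_wedge:
 fixes E :: "('m, 'm => 's, 'z) slie_scheme"
 assumes E: "slie_alg E"
 shows "om : AF E ==> et : AF E ==> set l <= car E ==>
  sd E (wedge om et) l m = wedge (sd E om) et l m + wedge (galt om) (sd E et) l m"
proof (induction l arbitrary: om et)
 case (Cons y l)
 note E' = slie_smodule[OF E] slie_br_closed[OF E]
 have y: "y : car E" "set l <= car E" using Cons.prems by auto
 note AF = AF_ic[OF _ y(1)] AF_galt[OF E'(1)] Cons.prems(1,2) AF_wedge[OF E'(1)] AF_sd[OF E]
 have wl: "wedge (ic y (sd E om)) ze l m = wedge (lder E y om) ze l m - wedge (sd E (ic y om)) ze l m"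
  "wedge ze (ic y (sd E om)) l m = wedge ze (lder E y om) l m - wedge ze (sd E (ic y om)) l m"
  if "om : AF E" for om ze
  unfolding wedge_diff1[symmetric] wedge_diff2[symmetric]
  by (rule wedge_cong[OF y(2) _ refl] wedge_cong[OF y(2) refl], simp add: ic_def[of y "sd E om"] sd_Cons[OF E'(2) that y(1)])+
 have "sd E (wedge om et) (y # l) m = lder E y (wedge om et) l m - sd E (ic y (wedge om et)) l m"
  by (rule sd_Cons[OF E'(2) AF_wedge[OF E'(1) Cons.prems(1,2)] y])
 also have "ic y (wedge om et) = (%l m. wedge (ic y om) et l m + wedge (galt om) (ic y et) l m)"
  by (intro ext) (simp add: ic_def[of _ "wedge _ _"] wedge_Cons)
 finally show ?case
  by (simp add: sd_lin(1)[OF E] AF Cons.IH lder_wedge[OF E y(1)] y(2) wedge_Cons wl galt_sd[OF E] ic_galt wedge_uminus1)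
qed (simp add: wedge_Nil)

text \<open>With the Jacobi identity and an anchor that preserves brackets, \<^const>\<open>sd\<close> squares to zero.\<close>

definition slie_jacobi :: "('m, 's, 'z) slie_scheme => bool" where
 "slie_jacobi E \<longleftrightarrow> slie_alg E & (ALL x:car E. ALL y:car E.
  (ALL z:car E. sbr E (sbr E x y) z = sadd E (sbr E x (sbr E y z)) (sscl E (%_. -1) (sbr E y (sbr E x z)))) &
  (ALL f:rng E. ALL m. sanc E (sbr E x y) m f = sanc E x m (%p. sanc E y p f) - sanc E y m (%p. sanc E x p f)))"

lemma lder_bracket:
 assumes J: "slie_jacobi E" and x: "x : car E" "y : car E"
 shows "om : AF E ==> set l <= car E ==> lder E (sbr E x y) om l m = lder E x (lder E y om) l m - lder E y (lder E x om) l m"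
proof (induction l arbitrary: om)
 case Nil
 then show ?case using J x AF_rng[OF Nil(1)] by (simp add: lder_def slie_jacobi_def)
next
 case (Cons z l)
 have E: "slie_alg E" using J by (simp add: slie_jacobi_def)
 note E' = slie_smodule[OF E] slie_br_closed[OF E]
 have z: "z : car E" "set l <= car E" using Cons.prems by auto
 note br = slie_br[OF E] x z
 have L: "lder E x (ic z (lder E y om)) l m = lder E x (lder E y (ic z om)) l m - lder E x (ic (sbr E y z) om) l m"
  if "x : car E" "y : car E" "om : AF E" for x y om
  unfolding lder_lin(2)[OF E that(1) AF_lder[OF E that(2) AF_ic[OF that(3) z(1)]] AF_ic[OF that(3) slie_br[OF E that(2) z(1)]], symmetric]
  by (rule lder_cong[OF E'(2) that(1) _ z(2)]) (simp add: ic_def[of z "lder E y om"] lder_Cons[OF E'(2) that(3,2) z(1)], simp add: ic_def)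
 have J': "sbr E (sbr E x y) z = sadd E (sbr E x (sbr E y z)) (sscl E (%_. -1) (sbr E y (sbr E x z)))"
  using J x z by (simp add: slie_jacobi_def)
 have "om (sbr E (sbr E x y) z # l) m = om (sbr E x (sbr E y z) # l) m - om (sbr E y (sbr E x z) # l) m"
  unfolding J' by (simp add: AF_add1[OF Cons.prems(1)] AF_scl1[OF Cons.prems(1)] br smodule_scl[OF E'(1)] func_ring_const[OF smodule_rng[OF E'(1)]])
 then show ?case
  by (simp add: lder_Cons[OF E'(2)] Cons.prems br AF_lder[OF E] L Cons.IH AF_ic)
qed

lemma lder_sd:
 assumes J: "slie_jacobi E" and x: "x : car E"
 shows "om : AF E ==> set l <= car E ==> lder E x (sd E om) l m = sd E (lder E x om) l m"
proof (induction l arbitrary: om)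
 case Nil
 have E: "slie_alg E" using J by (simp add: slie_jacobi_def)
 show ?case using slie_anc_0[OF E x] by (simp add: lder_def sd_def)
next
 case (Cons y l)
 have E: "slie_alg E" using J by (simp add: slie_jacobi_def)
 note E' = slie_smodule[OF E] slie_br_closed[OF E]
 have y: "y : car E" "set l <= car E" using Cons.prems by auto
 note om = Cons.prems(1) and xy = slie_br[OF E x y(1)]
 have 1: "lder E x (ic y (sd E om)) l m = lder E x (lder E y om) l m - lder E x (sd E (ic y om)) l m"
  unfolding lder_lin(2)[OF E x AF_lder[OF E y(1) om] AF_sd[OF E AF_ic[OF om y(1)]], symmetric]
  by (rule lder_cong[OF E'(2) x _ y(2)]) (simp add: ic_def[of y "sd E om"] sd_Cons[OF E'(2) om y(1)])
 have 2: "sd E (ic y (lder E x om)) l m = sd E (lder E x (ic y om)) l m - sd E (ic (sbr E x y) om) l m"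
  unfolding sd_lin(2)[OF E AF_lder[OF E x AF_ic[OF om y(1)]] AF_ic[OF om xy], symmetric]
  by (rule sd_cong[OF E'(2)]) (simp add: ic_def[of y "lder E x om"] lder_Cons[OF E'(2) om x y(1)], simp add: ic_def)
 show ?case
  by (simp add: lder_Cons[OF E'(2) AF_sd[OF E om] x y] sd_Cons[OF E'(2) AF_lder[OF E x om] y] 1 2
   sd_Cons[OF E'(2) om xy y(2)] Cons.IH[OF AF_ic[OF om y(1)] y(2)] lder_bracket[OF J x y(1) om y(2)])
qed

lemma sd_sd:
 assumes J: "slie_jacobi E"
 shows "om : AF E ==> sd E (sd E om) l m = 0"
proof (induction l arbitrary: om)
 case (Cons x l)
 have E: "slie_alg E" using J by (simp add: slie_jacobi_def)
 note E' = slie_smodule[OF E] slie_br_closed[OF E]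
 note om = Cons.prems(1)
 show ?case
 proof (cases "set (x # l) <= car E")
  case True
  then have x: "x : car E" "set l <= car E" by auto
  have "sd E (ic x (sd E om)) l m = sd E (lder E x om) l m - sd E (sd E (ic x om)) l m"
   unfolding sd_lin(2)[OF E AF_lder[OF E x(1) om] AF_sd[OF E AF_ic[OF om x(1)]], symmetric]
   by (rule sd_cong[OF E'(2)]) (simp add: ic_def[of x "sd E om"] sd_Cons[OF E'(2) om x(1)])
  then show ?thesis
   by (simp add: sd_Cons[OF E'(2) AF_sd[OF E om] x] lder_sd[OF J x(1) om x(2)] Cons.IH[OF AF_ic[OF om x(1)]])
 qed (simp add: sd_off)
qed simp

text \<open>A map that preserves anchors but not brackets has a curvature \<open>si\<close>, and its
  contraction is the failure of the pullback to commute with the differentials. The bracket equation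
  is asked under forms, so that zero curvature can be represented by any null section.\<close>

lemma pbk_sd:
 assumes E: "br_closed E" and V: "br_closed V" and ph: "ph ` car E <= car V" and si: "ALL x:car E. ALL y:car E. si x y : car V"
  and P: "!!om. om : AF V ==> pbk (car E) ph om : AF E"
  and anc: "!!x f m. x : car E ==> f : rng V ==> sanc V (ph x) m f = sanc E x m f"
  and br: "!!x y om l m. x : car E ==> y : car E ==> om : AF V ==> set l <= car V ==>
   om (sbr V (ph x) (ph y) # l) m = om (ph (sbr E x y) # l) m + om (si x y # l) m"
 shows "om : AF V ==> set l <= car E ==> pbk (car E) ph (sd V om) l m = sd E (pbk (car E) ph om) l m - con (car E) ph si om l m"
proof (induction l arbitrary: om)
 case Nil show ?case by (simp add: pbk_def)
next
 case (Cons x l)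
 have x: "x : car E" "set l <= car E" "ph x : car V" "set (map ph l) <= car V" using Cons.prems ph by auto
 note om = Cons.prems(1)
 note V' = br_closed_smodule[OF V]
 have "ssum l (%b r. om (sbr V (ph x) (ph b) # map ph r) m) =
   ssum l (%b r. om (ph (sbr E x b) # map ph r) m + om (si x b # map ph r) m)"
  by (rule ssum_cong[OF x(2)], rule br[OF x(1) _ om]) (use ph in auto)
 moreover have "ssum l (%b r. pbk (car E) ph om (sbr E x b # r) m) = ssum l (%b r. om (ph (sbr E x b) # map ph r) m)"
  by (rule ssum_cong[OF x(2)]) (simp add: pbk_def br_closed_br[OF E x(1)])
 moreover have "pbk (car E) ph (lder V (ph x) om) l m = sanc E x m (om (map ph l)) - ssum l (%b r. om (sbr V (ph x) (ph b) # map ph r) m)"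
  using x(2,4) by (simp add: pbk_def lder_def kap_def ssum_map anc[OF x(1) AF_rng[OF om]])
 moreover have "lder E x (pbk (car E) ph om) l m = sanc E x m (pbk (car E) ph om l) - ssum l (%b r. pbk (car E) ph om (sbr E x b # r) m)"
  using x(2) by (simp add: lder_def kap_def)
 moreover have "pbk (car E) ph om l = om (map ph l)" "kap (car E) ph (si x) om l m = ssum l (%b r. om (si x b # map ph r) m)"
  using x(2) by (auto simp: pbk_def kap_def)
 ultimately have 1: "pbk (car E) ph (lder V (ph x) om) l m = lder E x (pbk (car E) ph om) l m - kap (car E) ph (si x) om l m"
  by (simp add: ssum_plus)
 have 2: "sd E (ic x (pbk (car E) ph om)) l m = sd E (pbk (car E) ph (ic (ph x) om)) l m"
  by (rule sd_cong[OF E]) (simp add: ic_def pbk_def x(1))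
 have "pbk (car E) ph (sd V om) (x # l) m = pbk (car E) ph (lder V (ph x) om) l m - pbk (car E) ph (sd V (ic (ph x) om)) l m"
  using x by (simp add: pbk_def sd_Cons[OF V om x(3)])
 then show ?case
  by (simp add: 1 2 sd_Cons[OF E P[OF om] x(1,2)] con_Cons[OF V' om ph si x(1,2)] Cons.IH[OF AF_ic[OF om x(3)] x(2)])
qed

section \<open>Substitutions and contractions as operators on the forms of one module\<close>

context
 fixes S :: "('m, 's, 'z) smod_scheme"
 assumes S: "smodule S"
begin

private abbreviation "ka == kap (car S) (%x. x)"
private abbreviation "co == con (car S) (%x. x)"

lemma ka_Cons:
 assumes "om : AF S" "shom S S th" "x : car S" "set l <= car S"
 shows "ka th om (x # l) m = om (th x # l) m + ka th (ic x om) l m"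
 using kap_Cons[OF S assms(1) _ _ assms(3,4), of "%x. x" th m] shom_car[OF assms(2)] by auto

lemma co_Cons:
 assumes "om : AF S" "alt2 S S ta" "x : car S" "set l <= car S"
 shows "co ta om (x # l) m = ka (ta x) om l m - co ta (ic x om) l m"
 using con_Cons[OF S assms(1) _ _ assms(3,4), of "%x. x" ta m] alt2_car[OF assms(2)] by auto

lemma ka_cong: "shom S S th ==> (!!l. set l <= car S ==> om l m = et l m) ==> ka th om l m = ka th et l m"
 by (rule kap_cong[of _ _ "car S"]) (auto dest: shom_car)

lemma co_cong: "alt2 S S ta ==> (!!l. set l <= car S ==> om l m = et l m) ==> co ta om l m = co ta et l m"
 by (rule con_cong[of _ _ "car S"]) (auto dest: alt2_car)

lemma AF_ka: "shom S S th ==> om : AF S ==> ka th om : AF S"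
 by (rule AF_kap[OF S S refl shom_id])

lemma AF_co: "alt2 S S ta ==> om : AF S ==> co ta om : AF S"
 by (rule AF_con[OF S S refl shom_id])

lemma ka_ic_ka:
 assumes "shom S S th" "shom S S ps" "om : AF S" "y : car S"
 shows "ka th (ic y (ka ps om)) l m = ka th (ic (ps y) om) l m + ka th (ka ps (ic y om)) l m"
 unfolding kap_plus[symmetric]
 by (rule ka_cong[OF assms(1)]) (simp add: ic_def[of y "ka ps om"] ka_Cons[OF assms(3,2,4)], simp add: ic_def)

lemma ka_ic_co:
 assumes "shom S S th" "alt2 S S ta" "om : AF S" "y : car S"
 shows "ka th (ic y (co ta om)) l m = ka th (ka (ta y) om) l m - ka th (co ta (ic y om)) l m"
 unfolding kap_minus[symmetric]
 by (rule ka_cong[OF assms(1)]) (simp add: ic_def[of y "co ta om"] co_Cons[OF assms(3,2,4)])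

lemma co_ic_ka:
 assumes "alt2 S S ta" "shom S S ps" "om : AF S" "y : car S"
 shows "co ta (ic y (ka ps om)) l m = co ta (ic (ps y) om) l m + co ta (ka ps (ic y om)) l m"
 unfolding con_plus[symmetric]
 by (rule co_cong[OF assms(1)]) (simp add: ic_def[of y "ka ps om"] ka_Cons[OF assms(3,2,4)], simp add: ic_def)

lemma co_ic_co:
 assumes "alt2 S S ta" "alt2 S S rh" "om : AF S" "y : car S"
 shows "co ta (ic y (co rh om)) l m = co ta (ka (rh y) om) l m - co ta (co rh (ic y om)) l m"
 unfolding con_minus[symmetric]
 by (rule co_cong[OF assms(1)]) (simp add: ic_def[of y "co rh om"] co_Cons[OF assms(3,2,4)])

text \<open>The commutator of two substitutions is the substitution by the commutator of the two
  maps. Here both composites take null values.\<close>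

lemma ka_commute:
 assumes "shom S S th" "shom S S ps" and n: "!!y. y : car S ==> snull S (th (ps y))" "!!y. y : car S ==> snull S (ps (th y))"
 shows "om : AF S ==> set l <= car S ==> ka th (ka ps om) l m = ka ps (ka th om) l m"
proof (induction l arbitrary: om)
 case (Cons y l)
 then have y: "y : car S" "set l <= car S" by auto
 note om = Cons.prems(1)
 note c = shom_car[OF assms(1) y(1)] shom_car[OF assms(2) y(1)]
 show ?case
  by (simp add: ka_Cons AF_ka assms(1,2) om y ka_ic_ka c Cons.IH[OF AF_ic[OF om y(1)] y(2)]
    AF_snull1[OF S om n(1)[OF y(1)] y(2)] AF_snull1[OF S om n(2)[OF y(1)] y(2)])
qed simp

lemma ka_co_commute:
 assumes th: "shom S S th" and ta: "alt2 S S ta"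
  and n: "!!y z. y : car S ==> z : car S ==> snull S (th (ta y z))" "!!y z. y : car S ==> z : car S ==> snull S (ta (th y) z)"
   "!!y z. y : car S ==> z : car S ==> snull S (ta z (th y))"
 shows "om : AF S ==> set l <= car S ==> ka th (co ta om) l m = co ta (ka th om) l m"
proof (induction l arbitrary: om)
 case (Cons y l)
 then have y: "y : car S" "set l <= car S" by auto
 note om = Cons.prems(1)
 note c = shom_car[OF th y(1)]
 have 0: "ka (ta (th y)) om l m = 0"
 proof -
  have "ssum l (%b r. om (ta (th y) b # r) m) = ssum l (%b r. 0)"
   by (rule ssum_cong[OF y(2)]) (rule AF_snull1[OF S om n(2)[OF y(1)]])
  then show ?thesis by (simp add: kap_def)
 qed
 have 1: "ka th (ka (ta y) om) l m = ka (ta y) (ka th om) l m"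
  by (rule ka_commute[OF th alt2_shom[OF ta y(1)] n(1)[OF y(1)] n(3)[OF _ y(1)] om y(2)])
 show ?case
  by (simp add: ka_Cons[OF AF_co[OF ta om] th y] co_Cons[OF AF_ka[OF th om] ta y] ka_ic_co[OF th ta om y(1)] co_ic_ka[OF ta th om y(1)]
    co_Cons[OF om ta c y(2)] 0 1 Cons.IH[OF AF_ic[OF om y(1)] y(2)])
qed simp

text \<open>Two contractions fail to anticommute only by terms in which a value of one is fed into
  the other, and these are null by hypothesis. The vertical maps \<open>hat r\<close> on pairs have
  this property.\<close>

lemma co_anticommute:
 assumes ta: "alt2 S S ta" and rh: "alt2 S S rh"
  and n: "!!ta' rh' x y z. ta' : {ta, rh} ==> rh' : {ta, rh} ==> x : car S ==> y : car S ==> z : car S ==>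
   snull S (ta' (rh' x y) z) & snull S (ta' z (rh' x y))"
 shows "om : AF S ==> set l <= car S ==> co ta (co rh om) l m = - co rh (co ta om) l m"
proof (induction l arbitrary: om)
 case (Cons y l)
 then have y: "y : car S" "set l <= car S" by auto
 note om = Cons.prems(1)
 have 1: "ka (ta y) (co rh om) l m = co rh (ka (ta y) om) l m"
  by (rule ka_co_commute[OF alt2_shom[OF ta y(1)] rh _ _ _ om y(2)]) (use n y(1) alt2_car[OF rh] in blast)+
 have 2: "ka (rh y) (co ta om) l m = co ta (ka (rh y) om) l m"
  by (rule ka_co_commute[OF alt2_shom[OF rh y(1)] ta _ _ _ om y(2)]) (use n y(1) alt2_car[OF ta] in blast)+
 show ?case
  by (simp add: co_Cons[OF AF_co[OF rh om] ta y] co_Cons[OF AF_co[OF ta om] rh y] co_ic_co[OF ta rh om y(1)] co_ic_co[OF rh ta om y(1)]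
    1 2 Cons.IH[OF AF_ic[OF om y(1)] y(2)])
qed simp

end

text \<open>The graded commutator of \<^const>\<open>sd\<close> and the contraction with \<open>ta\<close> is the contraction with the
 3-form of the hypothesis. Its commutators with one, two and three contractions \<open>ic\<close> are
 \<open>J x\<close>, \<open>G x y\<close> and the value of the 3-form.\<close>

context
 fixes S :: "('m, 's, 'z) slie_scheme" and ta :: "'s => 's => 's"
 assumes S: "slie_alg S" and ta: "alt2 S S ta"
begin

private abbreviation "kk == kap (car S) (%x. x)"
private abbreviation "cc == con (car S) (%x. x)"
private abbreviation "L == lder S"
private abbreviation "d == sd S"

definition gcomm :: "('m, 's) sform => ('m, 's) sform" where
 "gcomm om = (%l m. d (cc ta om) l m + cc ta (d om) l m)"

private definition J where
 "J x om = (%l m. L x (cc ta om) l m - cc ta (L x om) l m + kk (ta x) (d om) l m - d (kk (ta x) om) l m)"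

private definition G where
 "G x y om = (%l m. L x (kk (ta y) om) l m - kk (ta y) (L x om) l m - kk (ta (sbr S x y)) om l m + L (ta x y) om l m
  + kk (ta x) (L y om) l m - L y (kk (ta x) om) l m)"

private lemmas S' = slie_smodule[OF S] slie_br_closed[OF S]
private lemmas AFs = AF_ic AF_lder[OF S] AF_sd[OF S] AF_co[OF slie_smodule[OF S] ta] AF_ka[OF slie_smodule[OF S] alt2_shom[OF ta]]
private lemmas cars = slie_br[OF S] alt2_car[OF ta]
private lemmas kCons = ka_Cons[OF slie_smodule[OF S] _ alt2_shom[OF ta]]
private lemmas cCons = co_Cons[OF slie_smodule[OF S] _ ta]
private lemmas lCons = lder_Cons[OF slie_br_closed[OF S]]
private lemmas dCons = sd_Cons[OF slie_br_closed[OF S]]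

private lemma ops:
 assumes "om : AF S" "x : car S" "y : car S" "z : car S"
 shows "set l <= car S ==> L x (ic y (cc ta om)) l m = L x (kk (ta y) om) l m - L x (cc ta (ic y om)) l m"
  "d (ic y (cc ta om)) l m = d (kk (ta y) om) l m - d (cc ta (ic y om)) l m"
  "set l <= car S ==> L x (ic y (kk (ta z) om)) l m = L x (ic (ta z y) om) l m + L x (kk (ta z) (ic y om)) l m"
  "d (ic y (kk (ta z) om)) l m = d (ic (ta z y) om) l m + d (kk (ta z) (ic y om)) l m"
  "cc ta (ic y (d om)) l m = cc ta (L y om) l m - cc ta (d (ic y om)) l m"
  "cc ta (ic y (L x om)) l m = cc ta (L x (ic y om)) l m - cc ta (ic (sbr S x y) om) l m"
  "kk (ta z) (ic y (d om)) l m = kk (ta z) (L y om) l m - kk (ta z) (d (ic y om)) l m"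
  "kk (ta z) (ic y (L x om)) l m = kk (ta z) (L x (ic y om)) l m - kk (ta z) (ic (sbr S x y) om) l m"
proof -
 have lc: "L x ze l m = L x xi l m" if "!!l m. set l <= car S ==> ze l m = xi l m" "set l <= car S" for ze xi l m
  using lder_cong[OF S'(2) assms(2) that] .
 have dc: "d ze l m = d xi l m" if "!!l m. set l <= car S ==> ze l m = xi l m" for ze xi l m
  using sd_cong[OF S'(2) that] .
 note z = alt2_shom[OF ta assms(4)]
 show "set l <= car S ==> L x (ic y (cc ta om)) l m = L x (kk (ta y) om) l m - L x (cc ta (ic y om)) l m"
  "d (ic y (cc ta om)) l m = d (kk (ta y) om) l m - d (cc ta (ic y om)) l m"
  unfolding lder_lin(2)[OF S assms(2) AFs(5)[OF assms(3,1)] AFs(4)[OF AF_ic[OF assms(1,3)]], symmetric]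
   sd_lin(2)[OF S AFs(5)[OF assms(3,1)] AFs(4)[OF AF_ic[OF assms(1,3)]], symmetric]
  by (rule lc dc; simp add: ic_def[of y "cc ta om"] cCons assms)+
 show "set l <= car S ==> L x (ic y (kk (ta z) om)) l m = L x (ic (ta z y) om) l m + L x (kk (ta z) (ic y om)) l m"
  "d (ic y (kk (ta z) om)) l m = d (ic (ta z y) om) l m + d (kk (ta z) (ic y om)) l m"
  unfolding lder_lin(1)[OF S assms(2) AF_ic[OF assms(1) cars(2)[OF assms(4,3)]] AFs(5)[OF assms(4) AF_ic[OF assms(1,3)]], symmetric]
   sd_lin(1)[OF S AF_ic[OF assms(1) cars(2)[OF assms(4,3)]] AFs(5)[OF assms(4) AF_ic[OF assms(1,3)]], symmetric]
  by (rule lc dc; simp add: ic_def[of y "kk (ta z) om"] kCons assms; simp add: ic_def)+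
 show "cc ta (ic y (d om)) l m = cc ta (L y om) l m - cc ta (d (ic y om)) l m"
  "cc ta (ic y (L x om)) l m = cc ta (L x (ic y om)) l m - cc ta (ic (sbr S x y) om) l m"
  unfolding con_minus[symmetric]
  by (rule co_cong[OF S'(1) ta], simp add: ic_def[of y "d om"] ic_def[of y "L x om"] dCons lCons assms, simp add: ic_def)+
 show "kk (ta z) (ic y (d om)) l m = kk (ta z) (L y om) l m - kk (ta z) (d (ic y om)) l m"
  "kk (ta z) (ic y (L x om)) l m = kk (ta z) (L x (ic y om)) l m - kk (ta z) (ic (sbr S x y) om) l m"
  unfolding kap_minus[symmetric]
  by (rule ka_cong[OF S'(1) z], simp add: ic_def[of y "d om"] ic_def[of y "L x om"] dCons lCons assms, simp add: ic_def)+
qed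

private lemma gcomm_Cons:
 assumes "om : AF S" "x : car S" "set l <= car S"
 shows "gcomm om (x # l) m = gcomm (ic x om) l m + J x om l m"
 using assms by (simp add: gcomm_def J_def dCons cCons AFs ops)

private lemma J_Cons:
 assumes "om : AF S" "x : car S" "y : car S" "set l <= car S"
 shows "J x om (y # l) m = - J x (ic y om) l m + G x y om l m"
 using assms by (simp add: G_def J_def dCons cCons kCons lCons AFs ops cars)

private lemma G_Cons:
 assumes "om : AF S" "x : car S" "y : car S" "z : car S" "set l <= car S"
 shows "G x y om (z # l) m = G x y (ic z om) l m +
  (om (sbr S x (ta y z) # l) m - om (ta y (sbr S x z) # l) m - om (ta (sbr S x y) z # l) m
  - om (sbr S (ta x y) z # l) m - om (sbr S y (ta x z) # l) m + om (ta x (sbr S y z) # l) m)"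
 using assms by (simp add: G_def kCons lCons AFs ops cars)

text \<open>Three nested inductions peel the arguments off the front. The arguments peeled off, and
  the sections \<open>x\<close>, \<open>y\<close> they leave as parameters, all lie in the image of
  \<open>ph\<close>, so the six-term hypothesis is met only there; the anchor hypothesis settles the
  empty list in \<open>G0\<close>.\<close>

lemma gcomm_zero:
 fixes ph :: "'t => 's"
 assumes ph: "ph ` A <= car S" and anc: "!!x y m f. x : car S ==> y : car S ==> f : rng S ==> sanc S (ta x y) m f = 0"
  and \<Omega>: "!!om x y z l m. om : AF S ==> x : ph ` A ==> y : ph ` A ==> z : ph ` A ==> set l <= car S ==>
   om (sbr S x (ta y z) # l) m - om (ta y (sbr S x z) # l) m - om (ta (sbr S x y) z # l) m
  - om (sbr S (ta x y) z # l) m - om (sbr S y (ta x z) # l) m + om (ta x (sbr S y z) # l) m = 0"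
  and om: "om : AF S" and l: "set l <= ph ` A"
 shows "gcomm om l m = 0"
proof -
 have G0: "G x y om l m = 0" if "om : AF S" "x : ph ` A" "y : ph ` A" "set l <= ph ` A" for x y om l
  using that
 proof (induction l arbitrary: om)
  case Nil
  have "x : car S" "y : car S" using Nil ph by auto
  then show ?case
   using anc[OF _ _ AF_rng[OF Nil(1)]] slie_anc_0[OF S] by (simp add: G_def lder_def kap_def)
 next
  case (Cons z l)
  then have c: "x : car S" "y : car S" "z : car S" "set l <= car S" using ph by auto
  then show ?case using Cons.IH[OF AF_ic[OF Cons.prems(1) c(3)]] \<Omega>[OF Cons.prems(1), of x y z l m] Cons.prems
   by (simp add: G_Cons)
 qed
 have J0: "J x om l m = 0" if "om : AF S" "x : ph ` A" "set l <= ph ` A" for x om l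
  using that
 proof (induction l arbitrary: om)
  case Nil
  have "x : car S" using Nil ph by auto
  then show ?case using slie_anc_0[OF S] by (simp add: J_def lder_def kap_def con_def)
 next
  case (Cons z l)
  then have c: "x : car S" "z : car S" "set l <= car S" using ph by auto
  then show ?case using Cons.IH[OF AF_ic[OF Cons.prems(1) c(2)]] G0[OF Cons.prems(1), of x z l] Cons.prems
   by (simp add: J_Cons)
 qed
 show ?thesis using om l
 proof (induction l arbitrary: om)
  case (Cons z l)
  then have c: "z : car S" "set l <= car S" using ph by auto
  then show ?case using Cons.IH[OF AF_ic[OF Cons.prems(1) c(1)]] J0[OF Cons.prems(1), of z l] Cons.prems
   by (simp add: gcomm_Cons)
 qed (simp add: gcomm_def)
qed

end

lemma con_pbk:
 assumes "shom S V g"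
 shows "set l <= A ==> ph ` A <= car S ==> ALL x:A. ALL y:A. ta x y : car S ==>
  con A ph ta (pbk (car S) g om) l m = con A (%x. g (ph x)) (%x y. g (ta x y)) om l m"
 unfolding con_def by (auto simp: pbk_def o_def image_subset_iff subset_iff intro!: psum_cong[of l A])

lemma pbk_con:
 assumes "ps ` B <= A" "set l <= B"
 shows "pbk B ps (con A ph ta om) l m = con B (%x. ph (ps x)) (%x y. ta (ps x) (ps y)) om l m"
 using assms by (auto simp: pbk_def con_def psum_map o_def image_subset_iff subset_iff)

section \<open>Smooth functions on open sets\<close>

lemma Ck_on_cong:
 assumes "open W" "!!x. x : W ==> f x = g x"
 shows "Ck_on k W f \<longleftrightarrow> Ck_on k W g"
 using assms(2)
proof (induction k arbitrary: f g)
 case 0 then show ?case by (simp cong: continuous_on_cong)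
next
 case (Suc k)
 have "(f differentiable at x) = (g differentiable at x)" if "x : W" for x
  unfolding differentiable_def using Suc.prems that
  by (metis has_derivative_transform_within_open[OF _ assms(1)])
 moreover have "frd f (at x) = frd g (at x)" if "x : W" "f differentiable at x" for x
  using frechet_derivative_transform_within_open[OF that(2) assms(1) that(1) Suc.prems] by blast
 ultimately show ?case
  using Suc.IH by (metis (no_types, lifting) Ck_on.simps(2))
qed

lemma Ck_on_subset: "Ck_on k W f ==> V <= W ==> Ck_on k V f"
 by (induction k arbitrary: f) (auto intro: continuous_on_subset)

lemma Ck_on_local:
 assumes "!!x. x : W ==> EX V. open V & x : V & Ck_on k V f"
 shows "Ck_on k W f"
 using assms
proof (induction k arbitrary: f)
 case 0
 have "isCont f x" if "x : W" for x
 proof -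
  obtain V where "open V" "x : V" "continuous_on V f" using 0[OF \<open>x : W\<close>] by auto
  then show ?thesis by (simp add: continuous_on_eq_continuous_at)
 qed
 then show ?case by (simp add: continuous_at_imp_continuous_on)
next
 case (Suc k)
 have "f differentiable at x" if "x : W" for x using Suc.prems[OF that] by auto
 moreover have "Ck_on k W (%x. frd f (at x) v)" for v
  by (rule Suc.IH) (use Suc.prems in "simp, blast")
 ultimately show ?case by simp
qed

lemma Ck_on_SucI:
 assumes "open W" "!!x. x : W ==> (f has_derivative D x) (at x)" "!!v. Ck_on k W (%x. D x v)"
 shows "Ck_on (Suc k) W f"
proof -
 have "D x = frd f (at x)" if "x : W" for x
  by (rule frechet_derivative_at[OF assms(2)[OF that]])
 then have "Ck_on k W (%x. frd f (at x) v)" for v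
  using assms(3)[of v] by (simp cong: Ck_on_cong[OF assms(1)])
 moreover have "ALL x:W. f differentiable at x"
  using assms(2) unfolding differentiable_def by blast
 ultimately show ?thesis by simp
qed

lemma Ck_on_has_derivative: "Ck_on (Suc k) W f ==> x : W ==> (f has_derivative frd f (at x)) (at x)"
 by (simp add: frechet_derivative_works)

lemma Ck_on_SucD: "Ck_on (Suc k) W f ==> Ck_on k W f"
proof (induction k arbitrary: f)
 case 0 then show ?case
  by (auto simp: continuous_on_eq_continuous_within dest: differentiable_imp_continuous_within intro: continuous_at_imp_continuous_at_within)
next
 case (Suc k) then show ?case by (metis Ck_on.simps(2))
qed

lemma Ck_on_continuous: "Ck_on k W f ==> continuous_on W f"
 by (induction k) (auto dest: Ck_on_SucD simp del: Ck_on.simps(2))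

lemma Ck_on_const: "open W ==> Ck_on k W (%x. c)"
proof (induction k arbitrary: c)
 case (Suc k)
 show ?case by (rule Ck_on_SucI[where D = "%_ _. 0", OF Suc.prems]) (use Suc in auto)
qed simp

lemma Ck_on_linear:
 assumes "open W" "bounded_linear h" shows "Ck_on k W h"
proof (cases k)
 case 0 then show ?thesis using assms linear_continuous_on by auto
next
 case (Suc j)
 show ?thesis unfolding Suc
  by (rule Ck_on_SucI[where D = "%_. h", OF assms(1)])
   (use assms bounded_linear_imp_has_derivative Ck_on_const in auto)
qed

lemma Ck_on_add:
 assumes "open W" shows "Ck_on k W f ==> Ck_on k W g ==> Ck_on k W (%x. f x + g x)"
proof (induction k arbitrary: f g)
 case (Suc k)
 show ?case
  by (rule Ck_on_SucI[OF assms has_derivative_add[OF Ck_on_has_derivative[OF Suc.prems(1)] Ck_on_has_derivative[OF Suc.prems(2)]]])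
   (use Suc in auto)
qed (simp add: continuous_on_add)

lemma Ck_on_mult:
 assumes "open W" shows "Ck_on k W f ==> Ck_on k W g ==> Ck_on k W (%x. f x * g x)"
proof (induction k arbitrary: f g)
 case (Suc k)
 show ?case
 proof (rule Ck_on_SucI[OF assms has_derivative_mult[OF Ck_on_has_derivative[OF Suc.prems(1)] Ck_on_has_derivative[OF Suc.prems(2)]]])
  fix v
  show "Ck_on k W (%x. f x * frd g (at x) v + frd f (at x) v * g x)"
   using Suc.prems by (intro Ck_on_add[OF assms] Suc.IH Ck_on_SucD[OF Suc.prems(1)] Ck_on_SucD[OF Suc.prems(2)]) simp_all
 qed
qed (simp add: continuous_on_mult)

lemma Ck_on_sum:
 assumes "open W" "!!i. i : I ==> Ck_on k W (f i)" shows "Ck_on k W (%x. \<Sum>i\<in>I. f i x)"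
 using assms(2) by (induction I rule: infinite_finite_induct) (auto intro: Ck_on_const Ck_on_add assms(1))

section \<open>Smooth real and vector valued maps on open sets\<close>

definition sm :: "'e::euclidean_space set => ('e => real) => bool" where
 "sm W f \<longleftrightarrow> open W & (ALL k. Ck_on k W f)"

lemma sm_open: "sm W f ==> open W"
 and sm_const: "open W ==> sm W (%x. c)"
 and sm_linear: "open W ==> bounded_linear h ==> sm W h"
 and sm_add: "sm W f ==> sm W g ==> sm W (%x. f x + g x)"
 and sm_mult: "sm W f ==> sm W g ==> sm W (%x. f x * g x)"
 and sm_subset: "sm W f ==> open V ==> V <= W ==> sm V f"
 by (auto simp: sm_def intro: Ck_on_const Ck_on_linear Ck_on_add Ck_on_mult Ck_on_subset)

lemma sm_sum: "open W ==> (!!i. i : I ==> sm W (f i)) ==> sm W (%x. \<Sum>i\<in>I. f i x)"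
 by (auto simp: sm_def intro: Ck_on_sum)

lemma sm_cong: "(!!x. x : W ==> f x = g x) ==> sm W f \<longleftrightarrow> sm W g"
 unfolding sm_def using Ck_on_cong by blast

lemma sm_local: "(!!x. x : W ==> EX V. x : V & sm V f) ==> open W ==> sm W f"
 unfolding sm_def using Ck_on_local by metis

lemma sm_diff: "sm W f ==> sm W g ==> sm W (%x. f x - g x)"
 using sm_add[OF _ sm_mult[OF sm_const], of W f g "-1"] sm_open by auto

lemma sm_continuous: "sm W f ==> continuous_on W f"
 unfolding sm_def by (metis Ck_on.simps(1))

lemma sm_has_derivative: "sm W f ==> x : W ==> (f has_derivative frd f (at x)) (at x)"
 unfolding sm_def using Ck_on_has_derivative by blast

lemma sm_frechet: "sm W f ==> sm W (%x. frd f (at x) v)"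
 unfolding sm_def by (metis Ck_on.simps(2))

definition smv :: "'e::euclidean_space set => ('e => 'f::euclidean_space) => bool" where
 "smv W F \<longleftrightarrow> open W & (ALL b:Basis. sm W (%x. F x \<bullet> b))"

lemma smv_open: "smv W F ==> open W"
 and smv_comp: "smv W F ==> b : Basis ==> sm W (%x. F x \<bullet> b)"
 and smv_subset: "smv W F ==> open V ==> V <= W ==> smv V F"
 by (auto simp: smv_def intro: sm_subset)

lemma smv_real: "smv W (f :: 'e::euclidean_space => real) \<longleftrightarrow> sm W f"
 by (auto simp: smv_def sm_open)

lemma smv_has_derivative:
 assumes "smv W F" "x : W"
 shows "(F has_derivative (%v. SUM b:Basis. frd (%x. F x \<bullet> b) (at x) v *\<^sub>R b)) (at x)"
proof -
 have "((%x. SUM b:Basis. (F x \<bullet> b) *\<^sub>R b) has_derivative (%v. SUM b:Basis. frd (%x. F x \<bullet> b) (at x) v *\<^sub>R b)) (at x)"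
  by (intro has_derivative_sum has_derivative_scaleR_left sm_has_derivative[OF smv_comp[OF assms(1)] assms(2)])
 then show ?thesis by (simp add: euclidean_representation)
qed

lemma smv_continuous: "smv W F ==> continuous_on W F"
 using smv_has_derivative[of W F] by (meson continuous_at_imp_continuous_on has_derivative_continuous)

lemma smv_linear: "open W ==> bounded_linear F ==> smv W F"
 unfolding smv_def by (auto intro!: sm_linear bounded_linear_inner_left_comp)

lemma smv_const: "open W ==> smv W (%x. c)"
 by (simp add: smv_def sm_const)

lemma smv_add: "smv W F ==> smv W G ==> smv W (%x. F x + G x)"
 by (simp add: smv_def inner_add_left sm_add)

lemma smv_diff: "smv W F ==> smv W G ==> smv W (%x. F x - G x)"
 by (simp add: smv_def inner_diff_left sm_diff)

lemma smv_cong: "(!!x. x : W ==> F x = G x) ==> smv W F \<longleftrightarrow> smv W G"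
 unfolding smv_def using sm_cong[of W "%x. F x \<bullet> b" "%x. G x \<bullet> b" for b] by metis

lemma smv_Pair: "smv W F ==> smv W G ==> smv W (%x. (F x, G x))"
 by (auto simp: smv_def Basis_prod_def)

text \<open>By the chain rule the derivative is a sum of products of a derivative of
  \<open>G\<close> with a composite of a derivative of \<open>f\<close>. The induction therefore
  keeps \<open>f\<close> arbitrary while \<open>G\<close> stays fixed.\<close>

lemma Ck_on_compose:
 fixes G :: "'e::euclidean_space => 'f::euclidean_space"
 assumes W: "open W" and V: "open V" and GV: "G ` W <= V"
 shows "Ck_on k V f ==> (!!b. b : Basis ==> Ck_on k W (%x. G x \<bullet> b)) ==> Ck_on k W (%x. f (G x))"
proof (induction k arbitrary: f)
 case 0
 have "continuous_on W G" using 0 by (subst continuous_on_componentwise) auto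
 then show ?case using continuous_on_compose2[of V f W G] 0 GV by auto
next
 case (Suc k)
 let ?D = "%x v. SUM b:Basis. frd (%x. G x \<bullet> b) (at x) v *\<^sub>R b"
 have dG: "(G has_derivative ?D x) (at x)" if "x : W" for x
 proof -
  have "((%x. SUM b:Basis. (G x \<bullet> b) *\<^sub>R b) has_derivative ?D x) (at x)"
   by (intro has_derivative_sum has_derivative_scaleR_left Ck_on_has_derivative[OF Suc.prems(2) that])
  then show ?thesis by (simp add: euclidean_representation)
 qed
 have df: "(f has_derivative frd f (at (G x))) (at (G x))" if "x : W" for x
  using GV that by (intro Ck_on_has_derivative[OF Suc.prems(1)]) auto
 have lin: "frd f (at (G x)) (?D x v) = (SUM b:Basis. frd (%x. G x \<bullet> b) (at x) v * frd f (at (G x)) b)"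
  if "x : W" for x v
  unfolding linear_sum[OF has_derivative_linear[OF df[OF that]]] linear_cmul[OF has_derivative_linear[OF df[OF that]]]
  by simp
 show ?case
 proof (rule Ck_on_SucI[OF W has_derivative_compose[OF dG df]])
  fix v
  have "Ck_on k W (%x. SUM b:Basis. frd (%x. G x \<bullet> b) (at x) v * frd f (at (G x)) b)"
  proof (rule Ck_on_sum[OF W], rule Ck_on_mult[OF W])
   fix b :: 'f assume b: "b : Basis"
   show "Ck_on k W (%x. frd (%x. G x \<bullet> b) (at x) v)" using Suc.prems(2)[OF b] by simp
   show "Ck_on k W (%x. frd f (at (G x)) b)"
    by (rule Suc.IH) (use Suc.prems(1) in simp, rule Ck_on_SucD[OF Suc.prems(2)])
  qed
  then show "Ck_on k W (%x. frd f (at (G x)) (?D x v))"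
   using lin by (simp cong: Ck_on_cong[OF W])
 qed auto
qed

lemma sm_compose: "sm V f ==> smv W G ==> G ` W <= V ==> sm W (%x. f (G x))"
 unfolding sm_def smv_def using Ck_on_compose[of W V G _ f] by blast

lemma smv_compose: "smv V F ==> smv W G ==> G ` W <= V ==> smv W (%x. F (G x))"
 unfolding smv_def[of V] smv_def[of W "%x. F (G x)"] using sm_compose[of V _ W G] smv_open by blast

lemma Ck_on_inverse:
 fixes f :: "'e::euclidean_space => real"
 assumes W: "open W" and nz: "!!x. x : W ==> f x ~= 0"
 shows "Ck_on k W f ==> Ck_on k W (%x. inverse (f x))"
proof (induction k)
 case (Suc k)
 show ?case
 proof (rule Ck_on_SucI[OF W Deriv.has_derivative_inverse[OF nz Ck_on_has_derivative[OF Suc.prems]]])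
  fix v
  have "Ck_on k W (%x. - 1 * (inverse (f x) * (frd f (at x) v * inverse (f x))))"
   using Suc Ck_on_SucD[OF Suc.prems] by (intro Ck_on_mult Ck_on_const W Suc.IH) auto
  then show "Ck_on k W (%x. - (inverse (f x) * frd f (at x) v * inverse (f x)))"
   by (simp add: mult.assoc)
 qed auto
qed (use nz in "auto intro!: continuous_intros")

lemma sm_inverse: "sm W f ==> (!!x. x : W ==> f x ~= 0) ==> sm W (%x. inverse (f x))"
 unfolding sm_def using Ck_on_inverse by blast

subsection \<open>Bump functions\<close>

text \<open>The functions x^(-n) exp(-1/x), continued by 0. With the negative powers included the
  family is closed under differentiation up to linear combinations, so smoothness is a single
  induction for all \<open>n\<close> at once.\<close>

definition flat :: "nat => real => real" where
 "flat n x = (if x <= 0 then 0 else inverse x ^ n * exp (- inverse x))"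

lemma flat_tendsto_0: "(flat n \<longlongrightarrow> 0) (at 0)"
proof -
 have "((%x. inverse x ^ n / exp (inverse x)) \<longlongrightarrow> (0::real)) (at_right 0)"
  by (rule filterlim_compose[OF tendsto_power_div_exp_0 filterlim_inverse_at_top_right])
 then have r: "(flat n \<longlongrightarrow> 0) (at_right 0)"
  by (rule Lim_transform_eventually)
   (auto simp: flat_def eventually_at_filter exp_minus divide_inverse)
 have "(flat n \<longlongrightarrow> 0) (at_left 0)"
  by (rule Lim_transform_eventually[OF tendsto_const]) (auto simp: flat_def eventually_at_filter)
 then show ?thesis using r by (simp add: filterlim_at_split)
qed

lemma flat_has_derivative:
 "(flat n has_real_derivative (flat (n + 2) x - real n * flat (n + 1) x)) (at x)"
proof -
 consider "x < 0" | "x = 0" | "x > 0" by linarith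
 then show ?thesis
 proof cases
  case 1
  have "((%_. 0) has_real_derivative 0) (at x)" by simp
  then have "(flat n has_real_derivative 0) (at x)"
   by (rule has_field_derivative_transform_within_open[of _ _ _ "{..<0}"]) (use 1 in "auto simp: flat_def")
  moreover have "flat (n + 2) x - real n * flat (n + 1) x = 0" using 1 by (simp add: flat_def)
  ultimately show ?thesis by metis
 next
  case 2
  \<comment> \<open>At the origin the difference quotient is again a member of the family, so the
    limit is already known.\<close>
  have "(%h. (flat n (0 + h) - flat n 0) / h) = flat (Suc n)"
   by (simp add: flat_def divide_inverse fun_eq_iff)
  then have "((%h. (flat n (0 + h) - flat n 0) / h) \<longlongrightarrow> 0) (at 0)"
   using flat_tendsto_0[of "Suc n"] by simp
  then show ?thesis using 2 by (simp add: DERIV_def flat_def)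
 next
  case 3
  have "((%x. inverse x ^ n * exp (- inverse x)) has_real_derivative
   (inverse x ^ n * (exp (- inverse x) * inverse x ^ 2) + (real n * (inverse x ^ (n - 1) * (- (inverse x ^ 2)))) * exp (- inverse x))) (at x)"
   using 3 by (auto intro!: derivative_eq_intros simp: power2_eq_square algebra_simps)
  moreover have "real n * (inverse x ^ (n - 1) * (- (inverse x ^ 2))) = - real n * inverse x ^ (n + 1)"
   by (cases n) (auto simp: power2_eq_square algebra_simps)
  ultimately have "((%x. inverse x ^ n * exp (- inverse x)) has_real_derivative
    (inverse x ^ n * (exp (- inverse x) * inverse x ^ 2) + (- real n * inverse x ^ (n + 1)) * exp (- inverse x))) (at x)"
   by metis
  then have "((%x. inverse x ^ n * exp (- inverse x)) has_real_derivative (flat (n + 2) x - real n * flat (n + 1) x)) (at x)"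
   using 3 by (simp add: flat_def power_add power2_eq_square algebra_simps)
  then show ?thesis
   by (rule has_field_derivative_transform_within_open[of _ _ _ "{0<..}"]) (use 3 in "auto simp: flat_def")
 qed
qed

lemma sm_flat: "sm UNIV (flat n)"
proof -
 have "Ck_on k UNIV (flat n)" for k
 proof (induction k arbitrary: n)
  case 0
  show ?case using DERIV_isCont[OF flat_has_derivative] by (auto simp: continuous_on_eq_continuous_at)
 next
  case (Suc k)
  have d: "(flat n has_derivative (%v. (flat (n + 2) x + - real n * flat (n + 1) x) * v)) (at x)" for x
   using flat_has_derivative[of n x] by (simp add: has_field_derivative_def)
  show ?case
   by (rule Ck_on_SucI[OF open_UNIV d]) (intro Ck_on_mult Ck_on_add Ck_on_const open_UNIV Suc)
 qed
 then show ?thesis by (simp add: sm_def)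
qed

lemma bump_exists:
 fixes x0 :: "'e::euclidean_space"
 assumes "r > 0"
 obtains \<beta> where "sm UNIV \<beta>" "!!x. dist x0 x >= r ==> \<beta> x = 0" "!!x. dist x0 x < r / 2 ==> \<beta> x = 1"
proof -
 \<comment> \<open>The bump is a / (a + b): \<open>a\<close> is positive exactly inside the ball of
   radius r and \<open>b\<close> exactly outside the closed ball of radius r / 2, so the denominator
   never vanishes.\<close>
 define a where "a = (%x. flat 0 (r ^ 2 - (x - x0) \<bullet> (x - x0)))"
 define b where "b = (%x. flat 0 ((x - x0) \<bullet> (x - x0) - (r / 2) ^ 2))"
 have q: "sm UNIV (%x. (x - x0) \<bullet> (x - x0))"
 proof -
  have "sm UNIV (%x. SUM b:Basis. (x \<bullet> b - x0 \<bullet> b) * (x \<bullet> b - x0 \<bullet> b))"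
   by (intro sm_sum sm_mult sm_diff sm_const sm_linear[OF _ bounded_linear_inner_left]) auto
  then show ?thesis by (subst euclidean_inner) (simp add: inner_diff_left)
 qed
 have sa: "sm UNIV a" and sb: "sm UNIV b" unfolding a_def b_def
  by (rule sm_compose[OF sm_flat]; simp add: smv_real; intro sm_diff q sm_const; simp)+
 have n: "(x - x0) \<bullet> (x - x0) = dist x0 x ^ 2" for x
  by (metis dist_commute dist_norm power2_norm_eq_inner)
 have fp: "flat 0 t > 0 \<longleftrightarrow> t > 0" "flat 0 t >= 0" for t by (auto simp: flat_def)
 have pos: "a x + b x ~= 0" for x
 proof (cases "dist x0 x < r")
  case True
  then have "a x > 0" using assms by (simp add: a_def n fp(1) power_strict_mono)
  then show ?thesis using fp(2)[of "(x - x0) \<bullet> (x - x0) - (r / 2) ^ 2"] by (simp add: b_def)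
 next
  case False
  then have "(r / 2)\<^sup>2 < (dist x0 x)\<^sup>2" using assms by (intro power_strict_mono) auto
  then have "b x > 0" by (simp add: b_def n fp(1))
  then show ?thesis using fp(2)[of "r ^ 2 - (x - x0) \<bullet> (x - x0)"] by (simp add: a_def)
 qed
 show ?thesis
 proof (rule that[of "%x. a x * inverse (a x + b x)"])
  show "sm UNIV (%x. a x * inverse (a x + b x))" by (intro sm_mult sm_inverse sm_add sa sb pos)
  fix x
  { assume "dist x0 x >= r"
   then have "r\<^sup>2 <= (dist x0 x)\<^sup>2" using assms by (intro power_mono) auto
   then show "a x * inverse (a x + b x) = 0" by (simp add: a_def n flat_def) }
  { assume "dist x0 x < r / 2"
   then have "(dist x0 x)\<^sup>2 <= (r / 2)\<^sup>2" by (intro power_mono) auto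
   then have "b x = 0" by (simp add: b_def n flat_def)
   then show "a x * inverse (a x + b x) = 1" using pos[of x] by simp }
 qed
qed

subsection \<open>Hadamard's lemma\<close>

text \<open>The Leibniz rule turns a derivative in x into the integral of a partial derivative of
  \<open>h\<close>, which is a parameter integral of the same kind; hence \<open>h\<close> is
  arbitrary in the induction. Parameter and point form one variable, so joint regularity is at
  hand.\<close>

lemma Ck_on_integral:
 fixes h :: "real \<times> 'e::euclidean_space => real"
 assumes O': "open W" and U: "open U" "convex U" "{0..1} \<times> U <= W"
 shows "Ck_on k W h ==> Ck_on (Suc k) W h ==> Ck_on k U (%x. integral {0..1} (%t. h (t, x)))"
proof (induction k arbitrary: h)
 case 0
 show ?case
  unfolding Ck_on.simps box_real(2)[symmetric]
  by (rule integral_continuous_on_param, unfold split_beta)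
   (rule continuous_on_compose2[of W h _ "%z. (snd z, fst z)"], use 0 U in "auto intro!: continuous_intros")
next
 case (Suc k)
 let ?D = "%x t. Blinfun (%v. frd h (at (t, x)) (0, v))"
 have dh: "((%x. h (t, x)) has_derivative (%v. frd h (at (t, x)) (0, v))) (at x)" if "x : U" "t : {0..1}" for t x
 proof -
  have "((%x. (t, x)) has_derivative (%v. (0, v))) (at x)" by (auto intro!: derivative_eq_intros)
  moreover have "(h has_derivative frd h (at (t, x))) (at (t, x))"
   by (rule Ck_on_has_derivative[OF Suc.prems(1)]) (use that U in auto)
  ultimately show ?thesis by (rule has_derivative_compose)
 qed
 have bl: "blinfun_apply (?D x t) = (%v. frd h (at (t, x)) (0, v))" if "x : U" "t : {0..1}" for x t
  by (rule bounded_linear_Blinfun_apply[OF has_derivative_bounded_linear[OF dh[OF that]]])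
 have cont: "continuous_on (U \<times> {0..1}) (%(x, t). ?D x t)"
 proof (rule continuous_on_blinfun_componentwise)
  fix i :: 'e assume "i : Basis"
  have "Ck_on 0 W (%z. frd h (at z) (0, i))"
   using Suc.prems(1) Ck_on_continuous[of k W] by simp
  then have "continuous_on W (%z. frd h (at z) (0, i))" by simp
  then have "continuous_on (U \<times> {0..1}) (%(x, t). frd h (at (t, x)) (0, i))"
   unfolding split_beta
   by (rule continuous_on_compose2[of W]) (use U in "auto intro!: continuous_intros")
  then show "continuous_on (U \<times> {0..1}) (%z. blinfun_apply (case z of (x, t) => ?D x t) i)"
   by (rule continuous_on_eq) (auto simp: bl)
 qed
 have int: "(%t. h (t, x)) integrable_on {0..1}" if "x : U" for x
 proof (rule integrable_continuous_interval)
  have "continuous_on W h" using Ck_on_continuous[OF Suc.prems(1)] .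
  then show "continuous_on {0..1} (%t. h (t, x))" using that U
   by (intro continuous_on_compose2[of W h "{0..1}" "%t. (t, x)"] continuous_on_Pair continuous_on_id continuous_on_const) auto
 qed
 have der: "((%x. integral {0..1} (%t. h (t, x))) has_derivative (%v. integral {0..1} (%t. frd h (at (t, x)) (0, v)))) (at x)"
  if x: "x : U" for x
 proof -
  have "((%x. integral (cbox 0 1) (%t. h (t, x))) has_derivative blinfun_apply (integral (cbox 0 1) (?D x))) (at x within U)"
   by (rule leibniz_rule[of U 0 1 "%x t. h (t, x)" ?D])
    (use bl dh int cont x U in "auto intro: has_derivative_at_withinI")
  moreover have "continuous_on {0..1} (?D x)"
   by (rule continuous_on_compose2[OF cont, of _ "%t. (x, t)", simplified]) (use x in "auto intro!: continuous_intros")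
  then have "?D x integrable_on {0..1}" by (rule integrable_continuous_interval)
  then have "blinfun_apply (integral {0..1} (?D x)) v = integral {0..1} (%t. frd h (at (t, x)) (0, v))" for v
  proof -
   assume "?D x integrable_on {0..1}"
   from integral_linear[OF this blinfun.bounded_linear_left[of v]]
   have "blinfun_apply (integral {0..1} (?D x)) v = integral {0..1} (%t. blinfun_apply (?D x t) v)"
    by (simp add: o_def)
   also have "... = integral {0..1} (%t. frd h (at (t, x)) (0, v))"
    by (rule integral_cong) (simp add: bl[OF x])
   finally show ?thesis .
  qed
  then have "blinfun_apply (integral {0..1} (?D x)) = (%v. integral {0..1} (%t. frd h (at (t, x)) (0, v)))"
   by (rule ext)
  ultimately show ?thesis using x U by (simp add: at_within_open[OF x] box_real)
 qed
 show ?case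
 proof (rule Ck_on_SucI[OF U(1) der])
  fix v
  have "Ck_on (Suc k) W (%z. frd h (at z) (0, v))"
   using Suc.prems(2) Ck_on.simps(2)[of "Suc k" W h] by blast
  from Suc.IH[OF Ck_on_SucD[OF this] this]
  show "Ck_on k U (%x. integral {0..1} (%t. frd h (at (t, x)) (0, v)))" .
 qed
qed

lemma hadamard:
 fixes f :: "'e::euclidean_space => real"
 assumes f: "sm (ball x0 r) f"
 obtains g where "!!b. b : Basis ==> sm (ball x0 r) (g b)"
  "!!x. x : ball x0 r ==> f x = f x0 + (SUM b:Basis. ((x - x0) \<bullet> b) * g b x)"
  "!!b. b : Basis ==> x0 : ball x0 r ==> g b x0 = frd f (at x0) b"
proof
 let ?B = "ball x0 r"
 let ?m = "%(t::real, x). x0 + t *\<^sub>R (x - x0)"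
 define W where "W = ?m -` ?B"
 have W: "open W" unfolding W_def split_beta
  by (rule continuous_open_vimage) (auto intro!: continuous_intros)
 have sub: "{0..1} \<times> ?B <= W"
 proof (clarsimp simp: W_def dist_norm norm_minus_commute)
  fix t :: real and x assume "0 <= t" "t <= 1" "norm (x - x0) < r"
  then show "t * norm (x - x0) < r" by (smt (verit) mult_left_le_one_le norm_ge_zero)
 qed
 define h where "h = (%b z. frd f (at (?m z)) b)"
 \<comment> \<open>The mean of the partial derivative of \<open>f\<close> in direction
   \<open>b\<close> over the segment from \<open>x0\<close> to x.\<close>
 define g where "g = (%b x. integral {0..1} (%t. h b (t, x)))"
 have lin: "smv UNIV (%z::real \<times> 'e. ?m z)"
  unfolding smv_def split_beta inner_add_left inner_scaleR_left inner_diff_left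
  by (intro conjI ballI open_UNIV sm_const sm_add sm_diff sm_mult sm_linear[OF _ bounded_linear_fst]
   sm_linear[OF _ bounded_linear_inner_left_comp[OF bounded_linear_snd]])
 have h: "sm W (h b)" for b
  unfolding h_def
  by (rule sm_compose[OF sm_frechet[OF f] smv_subset[OF lin W]]) (auto simp: W_def)
 show "sm ?B (g b)" if "b : Basis" for b
 proof -
  have "Ck_on k W (h b)" for k using h[of b] by (simp only: sm_def)
  then show ?thesis unfolding sm_def g_def by (intro conjI allI Ck_on_integral[OF W _ _ sub]) simp_all
 qed
 show "g b x0 = frd f (at x0) b" for b
  by (simp add: g_def h_def)
 fix x assume x: "x : ?B"
 have xt: "(t, x) : W" if "t : {0..1}" for t using sub x that by auto
 have "((%t. f (?m (t, x))) has_vector_derivative frd f (at (?m (t, x))) (x - x0)) (at t within {0..1})"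
  if t: "t : {0..1}" for t
 proof -
  have "(f has_derivative frd f (at (?m (t, x)))) (at (?m (t, x)))"
   by (rule sm_has_derivative[OF f]) (use xt[OF t] in "simp add: W_def")
  moreover have "((%t. ?m (t, x)) has_derivative (%s. s *\<^sub>R (x - x0))) (at t within {0..1})"
   by (auto intro!: derivative_eq_intros)
  ultimately have "((%t. f (?m (t, x))) has_derivative (%s. frd f (at (?m (t, x))) (s *\<^sub>R (x - x0)))) (at t within {0..1})"
   by (rule has_derivative_compose[rotated])
  then show ?thesis
   using linear_cmul[OF has_derivative_linear[OF \<open>(f has_derivative frd f (at (?m (t, x)))) _\<close>]]
   by (simp add: has_vector_derivative_def)
 qed
 then have "((%t. frd f (at (?m (t, x))) (x - x0)) has_integral f x - f x0) {0..1}"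
  using fundamental_theorem_of_calculus[of 0 1 "%t. f (?m (t, x))"] by simp
 moreover have "frd f (at (?m (t, x))) (x - x0) = (SUM b:Basis. ((x - x0) \<bullet> b) * h b (t, x))" if "t : {0..1}" for t
 proof -
  have l: "linear (frd f (at (?m (t, x))))"
   by (rule has_derivative_linear[OF sm_has_derivative[OF f]]) (use xt[OF that] in "simp add: W_def")
  have "frd f (at (?m (t, x))) (SUM b:Basis. ((x - x0) \<bullet> b) *\<^sub>R b) = (SUM b:Basis. ((x - x0) \<bullet> b) * h b (t, x))"
   unfolding linear_sum[OF l] linear_cmul[OF l] by (simp add: h_def)
  then show ?thesis by (simp add: euclidean_representation)
 qed
 ultimately have 1: "((%t. SUM b:Basis. ((x - x0) \<bullet> b) * h b (t, x)) has_integral f x - f x0) {0..1}"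
  by (rule has_integral_eq[rotated])
 have "continuous_on {0..1} (%t. h b (t, x))" for b
  by (rule continuous_on_compose2[OF sm_continuous[OF h]]) (use xt in "auto intro!: continuous_intros")
 then have "((%t. h b (t, x)) has_integral g b x) {0..1}" for b
  unfolding g_def by (intro integrable_integral integrable_continuous_interval)
 then have "((%t. SUM b:Basis. ((x - x0) \<bullet> b) * h b (t, x)) has_integral (SUM b:Basis. ((x - x0) \<bullet> b) * g b x)) {0..1}"
  by (intro has_integral_sum has_integral_mult_right) auto
 from has_integral_unique[OF 1 this] show "f x = f x0 + (SUM b:Basis. ((x - x0) \<bullet> b) * g b x)"
  by simp
qed

subsection \<open>The inverse function theorem\<close>

text \<open>At a zero of \<open>p\<close> the product rule asks of \<open>q\<close> only continuity.
  This breaks a circle in \<open>sm_matrix_inverse\<close>, where the inverse is known to be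
  continuous, and no more, when its derivative is computed.\<close>

lemma has_derivative_mult_vanishing:
 fixes p q :: "'e::real_normed_vector => real"
 assumes p: "(p has_derivative p') (at x0)" and p0: "p x0 = 0" and q: "isCont q x0"
 shows "((%x. p x * q x) has_derivative (%h. p' h * q x0)) (at x0)"
proof -
 obtain K where K: "!!h. norm (p' h) <= norm h * K" and bl: "bounded_linear p'"
  using has_derivative_bounded_linear[OF p] bounded_linear.bounded by metis
 have "((%x. norm (p x - p x0 - p' (x - x0)) / norm (x - x0)) \<longlongrightarrow> 0) (at x0)"
  using p by (simp add: has_derivative_iff_norm)
 then have ev: "\<forall>\<^sub>F x in at x0. norm (p x - p' (x - x0)) / norm (x - x0) < 1"
  using order_tendstoD(2)[OF _ zero_less_one] p0 by fastforce
 have bnd: "\<forall>\<^sub>F x in at x0. norm (p x * (q x - q x0)) / norm (x - x0) <= (1 + \<bar>K\<bar>) * norm (q x - q x0)"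
  using ev eventually_at_ball[OF zero_less_one, of x0 UNIV]
 proof eventually_elim
  case (elim x)
  then have nz: "x ~= x0 ==> norm (x - x0) > 0" by simp
  have "norm (p x) <= norm (p x - p' (x - x0)) + norm (p' (x - x0))" by (metis norm_triangle_sub add.commute)
  moreover have "norm (p' (x - x0)) <= norm (x - x0) * \<bar>K\<bar>"
   using order_trans[OF K[of "x - x0"] mult_left_mono[of K "\<bar>K\<bar>" "norm (x - x0)"]] by simp
  moreover have "norm (p x - p' (x - x0)) <= norm (x - x0)"
   using elim(1) by (cases "x = x0") (use bl linear_0[OF bounded_linear.linear] p0 in "auto simp: divide_simps split: if_splits")
  ultimately have "norm (p x) <= (1 + \<bar>K\<bar>) * norm (x - x0)" by (simp add: algebra_simps)
  then have "norm (p x) * norm (q x - q x0) <= ((1 + \<bar>K\<bar>) * norm (q x - q x0)) * norm (x - x0)"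
   using mult_right_mono[of "norm (p x)" "(1 + \<bar>K\<bar>) * norm (x - x0)" "norm (q x - q x0)"] by (simp add: mult_ac)
  then show ?case by (cases "x = x0") (auto simp: abs_mult divide_simps)
 qed
 have "((%x. (1 + \<bar>K\<bar>) * norm (q x - q x0)) \<longlongrightarrow> (1 + \<bar>K\<bar>) * norm (q x0 - q x0)) (at x0)"
  by (intro tendsto_intros isContD q)
 then have lim: "((%x. (1 + \<bar>K\<bar>) * norm (q x - q x0)) \<longlongrightarrow> 0) (at x0)" by simp
 have "\<forall>\<^sub>F x in at x0. norm (norm (p x * (q x - q x0)) / norm (x - x0)) <= (1 + \<bar>K\<bar>) * norm (q x - q x0)"
  using bnd by simp
 from Lim_null_comparison[OF this lim]
 have "((%x. p x * (q x - q x0)) has_derivative (%h. 0)) (at x0)"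
  by (simp add: has_derivative_iff_norm p0)
 moreover have "((%x. p x * q x0) has_derivative (%h. p' h * q x0)) (at x0)"
  by (rule has_derivative_mult_left[OF p])
 ultimately have "((%x. p x * (q x - q x0) + p x * q x0) has_derivative (%h. 0 + p' h * q x0)) (at x0)"
  by (rule has_derivative_add)
 then show ?thesis by (simp add: algebra_simps)
qed

text \<open>Everything comes from B(x) - B(x0) = - B(x0) (A(x) - A(x0)) B(x). Near x0 the difference
  of the matrices is small enough to absorb B(x) on the right, which bounds B and gives continuity;
  the same equation then gives the derivative, and the formula for it raises the order by induction.
  No determinants are involved.\<close>

lemma sm_matrix_inverse:
 fixes A :: "'e::euclidean_space => 'f::euclidean_space => 'f"
 assumes U: "open U" and A: "!!e c. sm U (%x. A x e \<bullet> c)" and lin: "!!x. x : U ==> linear (A x)"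
  and B: "!!x v. x : U ==> A x (B x v) = v" "!!x v. x : U ==> B x (A x v) = v"
 shows "sm U (%x. B x v \<bullet> b)"
proof -
 have linB: "linear (B x)" if "x : U" for x
 proof (rule linearI)
  fix u v c
  show "B x (u + v) = B x u + B x v" by (metis B linear_add[OF lin] that)
  show "B x (c *\<^sub>R v) = c *\<^sub>R B x v" by (metis B linear_scale[OF lin] that)
 qed
 have id: "B x v \<bullet> b = B x0 v \<bullet> b - (SUM c:Basis. SUM e:Basis. (B x0 c \<bullet> b) * ((A x e \<bullet> c - A x0 e \<bullet> c) * (B x v \<bullet> e)))"
  if "x : U" "x0 : U" for x x0 v b
 proof -
  let ?w = "B x v"
  have "B x v - B x0 v = B x0 (A x0 ?w - A x ?w)"
   by (simp add: linear_diff[OF linB[OF that(2)]] B that)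
  also have "A x0 ?w - A x ?w = - (SUM e:Basis. (?w \<bullet> e) *\<^sub>R (A x e - A x0 e))"
  proof -
   have "A y ?w = (SUM e:Basis. (?w \<bullet> e) *\<^sub>R A y e)" if "y : U" for y
    by (subst euclidean_representation[of ?w, symmetric])
     (simp add: linear_sum[OF lin[OF that]] linear_cmul[OF lin[OF that]])
   then show ?thesis using that by (simp add: scaleR_diff_right sum_subtractf)
  qed
  also have "B x0 ... = - (SUM e:Basis. (?w \<bullet> e) *\<^sub>R B x0 (A x e - A x0 e))"
   using linB[OF that(2)] by (simp add: linear_neg linear_sum linear_cmul)
  also have "... = - (SUM e:Basis. (?w \<bullet> e) *\<^sub>R (SUM c:Basis. ((A x e - A x0 e) \<bullet> c) *\<^sub>R B x0 c))"
  proof -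
   have "B x0 u = (SUM c:Basis. (u \<bullet> c) *\<^sub>R B x0 c)" for u
    by (subst euclidean_representation[of u, symmetric])
     (simp add: linear_sum[OF linB[OF that(2)]] linear_cmul[OF linB[OF that(2)]])
   then show ?thesis by metis
  qed
  finally have "(B x v - B x0 v) \<bullet> b = - (SUM e:Basis. SUM c:Basis. (B x0 c \<bullet> b) * ((A x e \<bullet> c - A x0 e \<bullet> c) * (B x v \<bullet> e)))"
   by (simp add: inner_sum_left inner_diff_left sum_distrib_left mult_ac)
  then show ?thesis by (subst sum.swap) (simp add: inner_diff_left)
 qed
 have cont: "isCont (%x. B x v \<bullet> b) x0" if x0: "x0 : U" for x0 v b
 proof -
  define D where "D = (%x. SUM b:Basis. SUM c:Basis. SUM e:Basis. \<bar>B x0 c \<bullet> b\<bar> * \<bar>A x e \<bullet> c - A x0 e \<bullet> c\<bar>)"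
  have "isCont (%x. A x e \<bullet> c) x0" for e c
   using sm_continuous[OF A] x0 U by (simp add: continuous_on_eq_continuous_at)
  then have "((%x. D x) \<longlongrightarrow> D x0) (at x0)" unfolding D_def
   by (intro tendsto_intros isContD)
  then have D: "(D \<longlongrightarrow> 0) (at x0)" by (simp add: D_def)
  have N: "norm (B x v - B x0 v) <= D x * norm (B x v)" if "x : U" for x
  proof -
   have "norm (B x v - B x0 v) <= (SUM b:Basis. \<bar>(B x v - B x0 v) \<bullet> b\<bar>)" by (rule norm_le_l1)
   also have "... <= (SUM b:Basis. (SUM c:Basis. SUM e:Basis. \<bar>B x0 c \<bullet> b\<bar> * \<bar>A x e \<bullet> c - A x0 e \<bullet> c\<bar>) * norm (B x v))"
   proof (rule sum_mono)
    fix b :: 'f assume "b : Basis"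
    have "\<bar>(B x v - B x0 v) \<bullet> b\<bar> = \<bar>SUM c:Basis. SUM e:Basis. (B x0 c \<bullet> b) * ((A x e \<bullet> c - A x0 e \<bullet> c) * (B x v \<bullet> e))\<bar>"
     using id[OF that x0, of v b] by (simp add: inner_diff_left)
    also have "... <= (SUM c:Basis. SUM e:Basis. \<bar>(B x0 c \<bullet> b) * ((A x e \<bullet> c - A x0 e \<bullet> c) * (B x v \<bullet> e))\<bar>)"
     by (intro order_trans[OF sum_abs] sum_mono order_trans[OF sum_abs]) simp
    also have "... <= (SUM c:Basis. SUM e:Basis. \<bar>B x0 c \<bullet> b\<bar> * \<bar>A x e \<bullet> c - A x0 e \<bullet> c\<bar> * norm (B x v))"
     by (intro sum_mono) (simp add: abs_mult mult.assoc mult_left_mono Basis_le_norm)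
    finally show "\<bar>(B x v - B x0 v) \<bullet> b\<bar> <= (SUM c:Basis. SUM e:Basis. \<bar>B x0 c \<bullet> b\<bar> * \<bar>A x e \<bullet> c - A x0 e \<bullet> c\<bar>) * norm (B x v)"
     by (simp add: sum_distrib_right)
   qed
   finally show ?thesis by (simp add: D_def sum_distrib_right)
  qed
  have "\<forall>\<^sub>F x in at x0. D x < 1 / 2" by (rule order_tendstoD[OF D]) simp
  moreover have "\<forall>\<^sub>F x in at x0. x : U" using U x0 by (simp add: eventually_at_topological) blast
  ultimately have "\<forall>\<^sub>F x in at x0. norm (B x v - B x0 v) <= D x * (2 * norm (B x0 v))"
  proof eventually_elim
   case (elim x)
   have n: "norm (B x v) <= norm (B x0 v) + norm (B x v - B x0 v)" by (metis norm_triangle_sub add.commute)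
   have D0: "0 <= D x" by (simp add: D_def sum_nonneg)
   have "D x * norm (B x v) <= 1 / 2 * norm (B x v)" by (rule mult_right_mono) (use elim in auto)
   then have "norm (B x v) <= 2 * norm (B x0 v)" using n N[OF elim(2)] by linarith
   then show ?case using N[OF elim(2)] mult_left_mono[OF _ D0] by fastforce
  qed
  moreover have "((%x. D x * (2 * norm (B x0 v))) \<longlongrightarrow> 0) (at x0)"
   using tendsto_mult_right[OF D, of "2 * norm (B x0 v)"] by simp
  ultimately have "((%x. B x v - B x0 v) \<longlongrightarrow> 0) (at x0)"
   by (rule Lim_null_comparison)
  then have "((%x. B x v) \<longlongrightarrow> B x0 v) (at x0)" by (simp add: LIM_zero_iff)
  then show ?thesis unfolding isCont_def by (intro tendsto_intros)
 qed
 have "Ck_on k U (%x. B x v \<bullet> b)" for k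
 proof (induction k arbitrary: v b)
  case 0 show ?case using cont by (simp add: continuous_at_imp_continuous_on)
 next
  case (Suc k)
  let ?a = "%x e c h. frd (%x. A x e \<bullet> c) (at x) h"
  have d: "((%x. B x v \<bullet> b) has_derivative (%h. 0 - (SUM c:Basis. SUM e:Basis. (B x0 c \<bullet> b) * (?a x0 e c h * (B x0 v \<bullet> e))))) (at x0)"
   if x0: "x0 : U" for x0
  proof (rule has_derivative_transform_within_open[OF _ U x0 id[OF _ x0, symmetric]])
   show "((%x. B x0 v \<bullet> b - (SUM c:Basis. SUM e:Basis. (B x0 c \<bullet> b) * ((A x e \<bullet> c - A x0 e \<bullet> c) * (B x v \<bullet> e)))) has_derivative
    (%h. 0 - (SUM c:Basis. SUM e:Basis. (B x0 c \<bullet> b) * (?a x0 e c h * (B x0 v \<bullet> e))))) (at x0)"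
   proof (intro has_derivative_diff has_derivative_const has_derivative_sum has_derivative_mult_right has_derivative_mult_vanishing cont x0)
    fix e c
    show "((%x. A x e \<bullet> c - A x0 e \<bullet> c) has_derivative ?a x0 e c) (at x0)"
     using has_derivative_diff[OF sm_has_derivative[OF A x0, of e c] has_derivative_const[of "A x0 e \<bullet> c"]] by simp
   qed simp
  qed
  have "Ck_on k U (%x. 0 - (SUM c:Basis. SUM e:Basis. (B x c \<bullet> b) * (?a x e c h * (B x v \<bullet> e))))" for h
  proof -
   have "Ck_on k U (%x. ?a x e c h)" for e c using sm_frechet[OF A] by (simp add: sm_def)
   then have "Ck_on k U (%x. 0 + - 1 * (SUM c:Basis. SUM e:Basis. (B x c \<bullet> b) * (?a x e c h * (B x v \<bullet> e))))"
    by (intro Ck_on_add Ck_on_const Ck_on_mult Ck_on_sum U Suc)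
   then show ?thesis by simp
  qed
  from Ck_on_SucI[OF U d this] show ?case .
 qed
 then show ?thesis using U by (simp add: sm_def)
qed

text \<open>The classical theorem gives a differentiable inverse \<open>g\<close> whose derivative
  at y is the inverse of the derivative of \<open>f\<close> at g y. Inversion being smooth,
  \<open>g\<close> of class C^k has a derivative of class C^k. The derivative of \<open>f\<close> at
  \<open>x0\<close> is normalised to the identity, which makes its invertibility immediate.\<close>

theorem smooth_inverse_function:
 fixes f :: "'e::euclidean_space => 'e"
 assumes f: "smv W f" and x0: "x0 : W" and id: "(f has_derivative (%v. v)) (at x0)"
 obtains U V g where "open U" "x0 : U" "U <= W" "open V" "f x0 : V" "homeomorphism U V f g" "smv V g"
proof -
 let ?d = "%x v. SUM b:Basis. frd (%x. f x \<bullet> b) (at x) v *\<^sub>R b"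
 define f' where "f' = (%x. Blinfun (?d x))"
 have d: "(f has_derivative ?d x) (at x)" if "x : W" for x by (rule smv_has_derivative[OF f that])
 have app: "blinfun_apply (f' x) = ?d x" if "x : W" for x
  unfolding f'_def by (rule bounded_linear_Blinfun_apply[OF has_derivative_bounded_linear[OF d[OF that]]])
 have sme: "sm W (%x. ?d x e \<bullet> c)" for e c
  unfolding inner_sum_left inner_scaleR_left
  by (intro sm_sum sm_mult sm_const sm_frechet smv_comp[OF f] smv_open[OF f])
 have cont: "continuous_on W f'"
 proof (rule continuous_on_blinfun_componentwise)
  fix i :: 'e
  have "continuous_on W (%x. ?d x i)"
   by (subst continuous_on_componentwise) (rule ballI, rule sm_continuous[OF sme])
  then show "continuous_on W (%x. blinfun_apply (f' x) i)"
   by (rule continuous_on_eq) (simp add: app)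
 qed
 have "?d x0 = (%v. v)" by (rule has_derivative_unique[OF d[OF x0] id])
 then have inv: "id_blinfun o\<^sub>L f' x0 = id_blinfun"
  by (intro blinfun_eqI) (simp add: app[OF x0])
 obtain U V g g' where *: "open U" "U <= W" "x0 : U" "open V" "f x0 : V" "homeomorphism U V f g"
  "!!y. y : V ==> (g has_derivative (g' y)) (at y)"
  "!!y. y : V ==> g' y = inv_into UNIV (blinfun_apply (f' (g y)))"
  "!!y. y : V ==> bij (blinfun_apply (f' (g y)))"
  by (rule inverse_function_theorem[OF smv_open[OF f] _ cont x0 inv, of f]) (use d app in auto)
 have gU: "g y : U" if "y : V" for y using *(6) that by (auto simp: homeomorphism_def)
 have UV: "f x : V" "g (f x) = x" if "x : U" for x using *(6) that by (auto simp: homeomorphism_def)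
 have bij: "bij (?d x)" if "x : U" for x
  using *(9)[OF UV(1)[OF that]] UV(2)[OF that] app that *(2) by auto
 define B where "B = (%x. inv_into UNIV (?d x))"
 have smB: "sm U (%x. B x v \<bullet> b)" for v b
 proof (rule sm_matrix_inverse[OF *(1), of ?d])
  show "sm U (%x. ?d x e \<bullet> c)" for e c by (rule sm_subset[OF sme *(1,2)])
  show "linear (?d x)" if "x : U" for x using has_derivative_linear[OF d] that *(2) by blast
  show "?d x (B x v) = v" "B x (?d x v) = v" if "x : U" for x v
   using surj_f_inv_f[OF bij_is_surj[OF bij[OF that]]] inv_f_f[OF bij_is_inj[OF bij[OF that]]]
   by (simp_all add: B_def)
 qed
 have dg: "((%y. g y \<bullet> b) has_derivative (%v. B (g y) v \<bullet> b)) (at y)" if "y : V" for y b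
  using has_derivative_inner_left[OF *(7)[OF that], of b] *(8)[OF that] app[of "g y"] gU[OF that] *(2)
  by (auto simp: B_def)
 have "Ck_on k V (%y. g y \<bullet> b)" if "b : Basis" for k b
  using that
 proof (induction k arbitrary: b)
  case 0
  show ?case using has_derivative_continuous[OF dg] by (simp add: continuous_at_imp_continuous_on)
 next
  case (Suc k)
  have "Ck_on k V (%y. B (g y) v \<bullet> b)" for v
   by (rule Ck_on_compose[OF *(4,1)]) (use gU smB[of v b] Suc.IH in "auto simp: sm_def")
  from Ck_on_SucI[OF *(4) dg this] show ?case .
 qed
 then have "smv V g" using *(4) by (simp add: smv_def sm_def)
 with * show ?thesis using that by blast
qed

section \<open>Manifolds\<close>

definition prj :: "'e::euclidean_space set => 'e => 'e" where
 "prj S = (SOME g. linear g & range g <= S & (ALL x:S. g x = x))"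

lemma prj:
 assumes "subspace S"
 shows "linear (prj S)" "prj S x : S" "x : S ==> prj S x = x"
proof -
 have "EX g. range g <= S & linear g & (ALL v:S. g (id v) = v)"
  by (rule linear_exists_left_inverse_on[OF linear_id assms]) simp
 then have "EX g. linear g & range g <= S & (ALL x:S. g x = x)" by auto
 then have "linear (prj S) & range (prj S) <= S & (ALL x:S. prj S x = x)"
  unfolding prj_def by (rule someI_ex)
 then show "linear (prj S)" "prj S x : S" "x : S ==> prj S x = x" by auto
qed

text \<open>A chart \<open>c = (U, ph)\<close> is turned into a parametrisation of \<open>U\<close> by an open subset of the ambient
 Euclidean space: project to the model, then invert \<open>ph\<close>. This removes the model subspace from most
 arguments.\<close>

definition par :: "('a, 'e::euclidean_space) manifold => 'a set \<times> ('a => 'e) => 'e => 'a" where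
 "par M c x = inv_into (fst c) (snd c) (prj (model M) x)"

definition pdom :: "('a, 'e::euclidean_space) manifold => 'a set \<times> ('a => 'e) => 'e set" where
 "pdom M c = {x. prj (model M) x : snd c ` fst c}"

text \<open>The version of \<open>cinf\<close> on an open set. It can be restricted and patched, and
  is read through the parametrisations of all charts.\<close>

definition lsm :: "('a::topological_space, 'e::euclidean_space) manifold => 'a set => ('a => real) => bool" where
 "lsm M A f \<longleftrightarrow> open A & (ALL c:charts M. sm {x\<in>pdom M c. par M c x : A} (%x. f (par M c x)))"

text \<open>The function made constant along the fibres of the projection is itself a smooth
  extension; conversely it is, locally, any given smooth extension composed with a linear
  map.\<close>

lemma smooth_fun_on_iff:
 assumes S: "subspace S" and V: "V <= S" "open (prj S -` V)"
 shows "smooth_fun_on V g \<longleftrightarrow> sm (prj S -` V) (%x. g (prj S x))"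
proof
 note P = prj[OF S]
 assume L: "smooth_fun_on V g"
 show "sm (prj S -` V) (%x. g (prj S x))"
 proof (rule sm_local[OF _ V(2)])
  fix x assume "x : prj S -` V"
  then obtain W h where W: "open W" "prj S x : W" "ALL k. Ck_on k W h" "ALL y:V Int W. h y = g y"
   using L unfolding smooth_fun_on_def by fastforce
  let ?X = "prj S -` V Int prj S -` W"
  have lin: "bounded_linear (prj S)" using P(1) by (simp add: linear_conv_bounded_linear)
  have o: "open ?X" using V(2) W(1) linear_continuous_on[OF lin] by (auto intro: open_vimage)
  have "sm ?X (%x. h (prj S x))"
   by (rule sm_compose[OF _ smv_linear[OF o lin], of W]) (use W in "auto simp: sm_def")
  then have "sm ?X (%x. g (prj S x))"
   by (rule sm_cong[THEN iffD1, rotated]) (use W(4) in auto)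
  then show "EX X. x : X & sm X (%x. g (prj S x))"
   using \<open>x : prj S -` V\<close> W(2) by (intro exI[of _ ?X]) auto
 qed
next
 note P = prj[OF S]
 assume R: "sm (prj S -` V) (%x. g (prj S x))"
 show "smooth_fun_on V g"
  unfolding smooth_fun_on_def
 proof
  fix x assume "x : V"
  then show "EX W h. open W & x : W & (ALL k. Ck_on k W h) & (ALL y:V Int W. h y = g y)"
   using R V P(3) by (intro exI[of _ "prj S -` V"] exI[of _ "%x. g (prj S x)"]) (auto simp: sm_def subset_iff)
 qed
qed

context
 fixes M :: "('a::{t2_space,second_countable_topology}, 'e::euclidean_space) manifold"
 assumes M: "is_manifold M"
begin

lemma model_subspace: "subspace (model M)"
 using M by (simp add: is_manifold_def)

lemmas prjM = prj[OF model_subspace]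

lemma bounded_linear_prjM: "bounded_linear (prj (model M))"
 using prjM(1) by (simp add: linear_conv_bounded_linear)

lemma chart_exists: obtains U ph where "(U, ph) : charts M" "p : U"
proof -
 have "p : (\<Union>(U, ph)\<in>charts M. U)" using M by (simp add: is_manifold_def)
 then show ?thesis using that by auto
qed

lemma chart:
 assumes c: "(U, ph) : charts M"
 shows chart_open: "open U"
  and chart_inj: "inj_on ph U"
  and chart_cont: "continuous_on U ph"
  and chart_model: "p : U ==> ph p : model M"
  and pdom_open: "open (pdom M (U, ph))"
  and par_cont: "continuous_on (pdom M (U, ph)) (par M (U, ph))"
  and par_in: "x : pdom M (U, ph) ==> par M (U, ph) x : U"
  and par_chart: "p : U ==> par M (U, ph) (ph p) = p"
  and chart_pdom: "p : U ==> ph p : pdom M (U, ph)"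
  and chart_par: "x : pdom M (U, ph) ==> ph (par M (U, ph) x) = prj (model M) x"
  and inv_cont: "continuous_on (ph ` U) (inv_into U ph)"
proof -
 obtain ps where 1: "open U" "openin (top_of_set (model M)) (ph ` U)" "homeomorphism U (ph ` U) ph ps"
  using M c unfolding is_manifold_def by fastforce
 show "open U" by fact
 show inj: "inj_on ph U" using 1(3) by (metis homeomorphism_apply1 inj_onI)
 show "continuous_on U ph" using 1(3) by (simp add: homeomorphism_def)
 have m: "p : U ==> ph p : model M" for p using openin_subset[OF 1(2)] by auto
 then show "p : U ==> ph p : model M" .
 obtain T where T: "open T" "ph ` U = model M Int T" using 1(2) by (auto simp: openin_open)
 have "pdom M (U, ph) = prj (model M) -` T"
  unfolding pdom_def using T(2) prjM(2) by auto
 then show "open (pdom M (U, ph))"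
  using T(1) linear_continuous_on[OF bounded_linear_prjM, of UNIV] by (auto intro: open_vimage)
 show "x : pdom M (U, ph) ==> par M (U, ph) x : U" for x
  by (auto simp: pdom_def par_def inv_into_into)
 show "p : U ==> par M (U, ph) (ph p) = p" for p
  using inj m by (simp add: par_def prjM(3))
 show "p : U ==> ph p : pdom M (U, ph)" for p
  using m by (simp add: pdom_def prjM(3))
 show "x : pdom M (U, ph) ==> ph (par M (U, ph) x) = prj (model M) x" for x
  by (auto simp: pdom_def par_def f_inv_into_f)
 have "ps y = inv_into U ph y" if "y : ph ` U" for y
  using that inj 1(3) by (auto simp: homeomorphism_def)
 then show ic: "continuous_on (ph ` U) (inv_into U ph)"
  using 1(3) by (auto simp: homeomorphism_def cong: continuous_on_cong)
 show "continuous_on (pdom M (U, ph)) (par M (U, ph))"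
  unfolding par_def fst_conv snd_conv
  by (rule continuous_on_compose2[OF ic linear_continuous_on[OF bounded_linear_prjM]]) (auto simp: pdom_def)
qed

lemma par_preimage_open:
 assumes "(U, ph) : charts M" "open A" shows "open {x\<in>pdom M (U, ph). par M (U, ph) x : A}"
 using continuous_open_preimage[OF par_cont[OF assms(1)] pdom_open[OF assms(1)] assms(2)]
 by (simp add: vimage_def Int_def)

lemma cinf_iff_lsm: "f : cinf M \<longleftrightarrow> lsm M UNIV f"
proof -
 have "smooth_fun_on (ph ` U) (%x. f (inv_into U ph x)) \<longleftrightarrow> sm (pdom M (U, ph)) (%x. f (par M (U, ph) x))"
  if c: "(U, ph) : charts M" for U ph
 proof -
  have v: "prj (model M) -` (ph ` U) = pdom M (U, ph)" by (auto simp: pdom_def)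
  show ?thesis
   using smooth_fun_on_iff[OF model_subspace, of "ph ` U" "%x. f (inv_into U ph x)"] chart_model[OF c] pdom_open[OF c]
   unfolding v par_def by auto
 qed
 then show ?thesis unfolding cinf_def lsm_def by auto
qed

lemma lsm_open: "lsm M A f ==> open A"
 by (simp add: lsm_def)

lemma lsm_subset: "lsm M A f ==> open B ==> B <= A ==> lsm M B f"
 unfolding lsm_def
proof (intro conjI ballI)
 fix c assume *: "open A & (ALL c:charts M. sm {x : pdom M c. par M c x : A} (%x. f (par M c x)))" "open B" "B <= A" "c : charts M"
 obtain U ph where c: "c = (U, ph)" by fastforce
 have "sm {x : pdom M c. par M c x : A} (%x. f (par M c x))" using * by blast
 then show "sm {x : pdom M c. par M c x : B} (%x. f (par M c x))"
  by (rule sm_subset) (use *(2-4) c par_preimage_open in auto)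
qed

lemma lsm_cong: "(!!p. p : A ==> f p = g p) ==> lsm M A f \<longleftrightarrow> lsm M A g"
 unfolding lsm_def by (intro conj_cong ball_cong refl sm_cong) auto

lemma lsm_local:
 assumes "open A" "!!p. p : A ==> EX B. p : B & lsm M B f"
 shows "lsm M A f"
 unfolding lsm_def
proof (intro conjI ballI assms(1))
 fix c assume c: "c : charts M"
 obtain U ph where c': "c = (U, ph)" by fastforce
 show "sm {x : pdom M c. par M c x : A} (%x. f (par M c x))"
 proof (rule sm_local)
  fix x assume x: "x : {x : pdom M c. par M c x : A}"
  then obtain B where "par M c x : B" "lsm M B f" using assms(2) by auto
  then show "EX V. x : V & sm V (%x. f (par M c x))"
   using c x by (intro exI[of _ "{x : pdom M c. par M c x : B}"]) (auto simp: lsm_def)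
 qed (use par_preimage_open assms(1) c c' in auto)
qed

lemma cinf_lsm: "f : cinf M ==> open A ==> lsm M A f"
 using cinf_iff_lsm lsm_subset by blast

lemma cinfI: "(!!p. EX B. p : B & lsm M B f) ==> f : cinf M"
 using cinf_iff_lsm lsm_local[of UNIV f] by auto

lemma lsm_const: "open A ==> lsm M A (%p. c)"
 and lsm_add: "lsm M A f ==> lsm M A g ==> lsm M A (%p. f p + g p)"
 and lsm_mult: "lsm M A f ==> lsm M A g ==> lsm M A (%p. f p * g p)"
 unfolding lsm_def by (auto intro: sm_const sm_add sm_mult par_preimage_open)

lemma func_ring_cinf: "(%_. c) : cinf M" "f : cinf M ==> g : cinf M ==> (%p. f p + g p) : cinf M"
 "f : cinf M ==> g : cinf M ==> (%p. f p * g p) : cinf M"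
 by (simp_all add: cinf_iff_lsm lsm_const lsm_add lsm_mult)

lemma lsm_chart_coord:
 assumes c: "(V, ps) : charts M" and b: "b : Basis"
 shows "lsm M V (%p. ps p \<bullet> b)"
 unfolding lsm_def
proof (intro conjI ballI chart_open[OF c])
 fix d assume d: "d : charts M"
 obtain U ph where d': "d = (U, ph)" by fastforce
 note D = d[unfolded d']
 have "smooth_fun_on (ph ` (U Int V)) (%x. ps (inv_into U ph x) \<bullet> b)"
  using M c D b unfolding is_manifold_def by fastforce
 moreover have v: "prj (model M) -` (ph ` (U Int V)) = {x : pdom M d. par M d x : V}"
  unfolding d' pdom_def par_def using chart_inj[OF D] by (auto simp: inv_into_into)
 ultimately show "sm {x : pdom M d. par M d x : V} (%x. ps (par M d x) \<bullet> b)"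
  using smooth_fun_on_iff[OF model_subspace, of "ph ` (U Int V)" "%x. ps (inv_into U ph x) \<bullet> b"]
   chart_model[OF D] par_preimage_open[OF D chart_open[OF c]]
  unfolding v unfolding d' par_def by auto
qed

lemma lsm_comp_par:
 assumes f: "lsm M A f" and c: "(U, ph) : charts M" and g: "smv W (%x. ph (\<gamma> x))" "\<gamma> ` W <= A Int U"
 shows "sm W (%x. f (\<gamma> x))"
proof -
 have "sm {x\<in>pdom M (U, ph). par M (U, ph) x : A} (%x. f (par M (U, ph) x))"
  using f c by (auto simp: lsm_def)
 from sm_compose[OF this g(1)] have "sm W (%x. f (par M (U, ph) (ph (\<gamma> x))))"
  using g(2) chart_pdom[OF c] par_chart[OF c] by fastforce
 then show ?thesis
  by (rule sm_cong[THEN iffD1, rotated]) (use g(2) par_chart[OF c] in auto)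
qed

lemma lsm_chartI:
 assumes c: "(U, ph) : charts M" and A: "open A" "A <= U"
  and f: "sm {x\<in>pdom M (U, ph). par M (U, ph) x : A} (%x. f (par M (U, ph) x))"
 shows "lsm M A f"
 unfolding lsm_def
proof (intro conjI ballI A(1))
 fix d assume d: "d : charts M"
 obtain V ps where d': "d = (V, ps)" by fastforce
 let ?W = "{x : pdom M d. par M d x : A}"
 have o: "open ?W" using par_preimage_open d A(1) unfolding d' by blast
 have "smv ?W (%x. ph (par M d x))"
  unfolding smv_def
 proof (intro conjI ballI o)
  fix b :: 'e assume "b : Basis"
  from lsm_subset[OF lsm_chart_coord[OF c this] A] d
  show "sm ?W (%x. ph (par M d x) \<bullet> b)" by (auto simp: lsm_def)
 qed
 from sm_compose[OF f this] have "sm ?W (%x. f (par M (U, ph) (ph (par M d x))))"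
  using A(2) chart_pdom[OF c] par_chart[OF c] by fastforce
 then show "sm ?W (%x. f (par M d x))"
  by (rule sm_cong[THEN iffD1, rotated]) (use A(2) par_chart[OF c] in auto)
qed

lemma lsm_chart_comp:
 assumes c: "(U, ph) : charts M" and g: "sm W g" and A: "open A" "A <= U" "ph ` A <= W"
 shows "lsm M A (%p. g (ph p))"
proof (rule lsm_chartI[OF c A(1,2)])
 let ?X = "{x : pdom M (U, ph). par M (U, ph) x : A}"
 have o: "open ?X" by (rule par_preimage_open[OF c A(1)])
 have "prj (model M) ` ?X <= W" using chart_par[OF c] A(3) by auto
 from sm_compose[OF g smv_linear[OF o bounded_linear_prjM] this]
 show "sm ?X (%x. g (ph (par M (U, ph) x)))"
  by (rule sm_cong[THEN iffD1, rotated]) (simp add: chart_par[OF c])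
qed

lemma lsm_continuous: "lsm M A f ==> continuous_on A f"
proof -
 assume f: "lsm M A f"
 have "isCont f p" if "p : A" for p
 proof -
  obtain U ph where c: "(U, ph) : charts M" "p : U" by (rule chart_exists)
  let ?X = "{x : pdom M (U, ph). par M (U, ph) x : A}"
  have "sm ?X (%x. f (par M (U, ph) x))" using f c by (auto simp: lsm_def)
  then have "continuous_on (A Int U) (%p. f (par M (U, ph) (ph p)))"
   by (rule continuous_on_compose2[OF sm_continuous continuous_on_subset[OF chart_cont[OF c(1)]]])
    (auto simp: chart_pdom[OF c(1)] par_chart[OF c(1)])
  then have "continuous_on (A Int U) f"
   by (rule continuous_on_eq) (simp add: par_chart[OF c(1)])
  then show ?thesis using c(2) that
    continuous_on_eq_continuous_at[OF open_Int[OF lsm_open[OF f] chart_open[OF c(1)]], of f] by blast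
 qed
 then show ?thesis by (simp add: continuous_at_imp_continuous_on)
qed

lemma bump:
 assumes A: "open A" "p : A"
 obtains ze B K where "ze : cinf M" "open B" "p : B" "B <= A" "!!q. q : B ==> ze q = 1"
  "closed K" "K <= A" "!!q. q ~: K ==> ze q = 0"
proof -
 obtain U ph where c: "(U, ph) : charts M" "p : U" by (rule chart_exists)
 let ?X = "{x : pdom M (U, ph). par M (U, ph) x : A}"
 have "open ?X" "ph p : ?X" using par_preimage_open[OF c(1) A(1)] A(2) c par_chart[OF c] chart_pdom[OF c] by auto
 then obtain r where r: "r > 0" "cball (ph p) r <= ?X" by (meson open_contains_cball)
 obtain \<beta> where \<beta>: "sm UNIV \<beta>" "!!x. dist (ph p) x >= r ==> \<beta> x = 0" "!!x. dist (ph p) x < r / 2 ==> \<beta> x = 1"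
  using bump_exists[OF r(1)] by metis
 \<comment> \<open>A compact set, hence closed in the whole Hausdorff space and not only in the
   chart. This makes the extension of the bump by 0 smooth across the boundary of
   \<open>U\<close>.\<close>
 define K where "K = par M (U, ph) ` (cball (ph p) r)"
 define B where "B = {q\<in>U. ph q : ball (ph p) (r / 2)}"
 define ze where "ze = (%q. if q : U then \<beta> (ph q) else 0)"
 have "compact K" unfolding K_def
  by (rule compact_continuous_image[OF continuous_on_subset[OF par_cont[OF c(1)]]]) (use r(2) in auto)
 then have K: "closed K" by (rule compact_imp_closed)
 have KA: "K <= A" using r(2) by (auto simp: K_def)
 have z: "ze q = 0" if "q ~: K" for q
 proof (cases "q : U")
  case True
  then have "ph q ~: cball (ph p) r" using that par_chart[OF c(1) True] unfolding K_def by (metis image_eqI)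
  then show ?thesis using \<beta>(2) by (simp add: ze_def)
 qed (simp add: ze_def)
 have B: "open B" unfolding B_def
  using continuous_open_preimage[OF chart_cont[OF c(1)] chart_open[OF c(1)] open_ball[of "ph p" "r / 2"]]
  by (simp add: vimage_def Int_def)
 have BK: "B <= K"
 proof
  fix q assume q: "q : B"
  then have "q = par M (U, ph) (ph q)" "ph q : cball (ph p) r" using par_chart[OF c(1)] r(1) by (auto simp: B_def)
  then show "q : K" unfolding K_def by (rule image_eqI)
 qed
 show ?thesis
 proof (rule that[OF _ B _ _ _ K KA z])
  show "p : B" using c r by (simp add: B_def)
  show "B <= A" using BK KA by auto
  show "!!q. q : B ==> ze q = 1" using \<beta>(3) by (auto simp: B_def ze_def)
  show "ze : cinf M"
  proof (rule cinfI)
   fix q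
   have 1: "lsm M U ze"
    by (rule lsm_cong[THEN iffD1, OF _ lsm_chart_comp[OF c(1) \<beta>(1) chart_open[OF c(1)]]]) (auto simp: ze_def)
   have 2: "lsm M (- K) ze"
    by (rule lsm_cong[THEN iffD1, OF _ lsm_const[of _ 0]]) (use z K in auto)
   have "K <= U" unfolding K_def using r(2) par_in[OF c(1)] by auto
   then show "EX B. q : B & lsm M B ze" using 1 2 by blast
  qed
 qed
qed

text \<open>Derivations act on global functions. Local functions such as coordinates are therefore
  cut off by a bump function, without change near the point of interest.\<close>

lemma globalize:
 assumes f: "lsm M A f" and p: "p : A"
 obtains F B where "F : cinf M" "open B" "p : B" "B <= A" "!!q. q : B ==> F q = f q"
proof -
 obtain ze B K where ze: "ze : cinf M" "open B" "p : B" "B <= A" "!!q. q : B ==> ze q = 1"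
  "closed K" "K <= A" "!!q. q ~: K ==> ze q = 0"
  using bump[OF lsm_open[OF f] p] by metis
 let ?F = "%q. if q : A then ze q * f q else 0"
 show ?thesis
 proof (rule that[OF _ ze(2-4)])
  show "!!q. q : B ==> ?F q = f q" using ze by auto
  show "?F : cinf M"
  proof (rule cinfI)
   fix q
   have 1: "lsm M A ?F"
    by (rule lsm_cong[THEN iffD1, OF _ lsm_mult[OF cinf_lsm[OF ze(1) lsm_open[OF f]] f]]) auto
   have 2: "lsm M (- K) ?F"
    by (rule lsm_cong[THEN iffD1, OF _ lsm_const[of _ 0]]) (use ze in auto)
   show "EX B. q : B & lsm M B ?F" using 1 2 ze(7) by blast
  qed
 qed
qed

section \<open>Tangent vectors are local and are directional derivatives\<close>

lemma tangent_add: "v : TS M p ==> f : cinf M ==> g : cinf M ==> v (%x. f x + g x) = v f + v g"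
 and tangent_cmult: "v : TS M p ==> f : cinf M ==> v (%x. c * f x) = c * v f"
 and tangent_mult: "v : TS M p ==> f : cinf M ==> g : cinf M ==> v (%x. f x * g x) = v f * g p + f p * v g"
 and tangent_off: "v : TS M p ==> f ~: cinf M ==> v f = 0"
 by (simp_all add: tangent_space_def)

lemma tangent_const: assumes "v : TS M p" shows "v (%x. c) = 0"
proof -
 have "v (%x. 1 * 1) = v (%x. 1) * 1 + 1 * v (%x. 1)"
  by (rule tangent_mult[OF assms func_ring_cinf(1) func_ring_cinf(1)])
 then have "v (%x. 1) = 0" by simp
 then show ?thesis using tangent_cmult[OF assms func_ring_cinf(1)[of 1], of c] by simp
qed

text \<open>A bump function supported where \<open>f\<close> and \<open>g\<close> agree annihilates
  their difference, and the product rule at \<open>p\<close>, where the bump is 1, forces the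
  derivation to vanish on it.\<close>

lemma tangent_local:
 assumes v: "v : TS M p" and f: "f : cinf M" "g : cinf M" and A: "open A" "p : A" "!!q. q : A ==> f q = g q"
 shows "v f = v g"
proof -
 obtain ze B K where ze: "ze : cinf M" "open B" "p : B" "B <= A" "!!q. q : B ==> ze q = 1"
  "closed K" "K <= A" "!!q. q ~: K ==> ze q = 0"
  using bump[OF A(1,2)] by metis
 let ?h = "%q. f q + -1 * g q"
 have h: "?h : cinf M" by (intro func_ring_cinf f)
 have "(%q. ze q * ?h q) = (%q. 0)" using ze(7,8) A(3) by (auto simp: fun_eq_iff)
 then have "0 = v ze * ?h p + ze p * v ?h"
  using tangent_mult[OF v ze(1) h] tangent_const[OF v, of 0] by simp
 then have "v ?h = 0" using ze(3,5) A(2,3) by simp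
 moreover have "v ?h = v f + -1 * v g"
  by (subst tangent_add[OF v f(1)]) (simp_all only: tangent_cmult[OF v f(2)] func_ring_cinf f)
 ultimately show ?thesis by simp
qed

lemma tangent_sum:
 assumes v: "v : TS M p" and "finite I" "!!i. i : I ==> f i : cinf M"
 shows "(%x. \<Sum>i\<in>I. f i x) : cinf M" "v (%x. \<Sum>i\<in>I. f i x) = (\<Sum>i\<in>I. v (f i))"
 using assms(2,3)
 by (induction I) (simp_all add: func_ring_cinf tangent_const[OF v] tangent_add[OF v])

definition dirv :: "'a set \<times> ('a => 'e) => 'a => 'e => 'a tvec" where
 "dirv c p w = (%f. if f : cinf M then frd (%x. f (par M c x)) (at (snd c p)) w else 0)"

lemma cinf_par:
 assumes c: "(U, ph) : charts M" and f: "f : cinf M"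
 shows "sm (pdom M (U, ph)) (%x. f (par M (U, ph) x))"
 using f c by (auto simp: cinf_iff_lsm lsm_def)

lemma dirv_tangent:
 assumes c: "(U, ph) : charts M" "p : U"
 shows "dirv (U, ph) p w : TS M p"
proof -
 let ?D = "%f. frd (%x. f (par M (U, ph) x)) (at (ph p))"
 have d: "((%x. f (par M (U, ph) x)) has_derivative ?D f) (at (ph p))" if "f : cinf M" for f
  by (rule sm_has_derivative[OF cinf_par[OF c(1) that] chart_pdom[OF c]])
 have "?D (%x. f x + g x) = (%w. ?D f w + ?D g w)" if "f : cinf M" "g : cinf M" for f g
  using frechet_derivative_at[OF has_derivative_add[OF d[OF that(1)] d[OF that(2)]]] by simp
 moreover have "?D (%x. k * f x) = (%w. k * ?D f w)" if "f : cinf M" for f k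
  using frechet_derivative_at[OF has_derivative_mult_right[OF d[OF that(1)]]] by simp
 moreover have "?D (%x. f x * g x) = (%w. f p * ?D g w + ?D f w * g p)" if "f : cinf M" "g : cinf M" for f g
  using frechet_derivative_at[OF has_derivative_mult[OF d[OF that(1)] d[OF that(2)]]] par_chart[OF c] by simp
 ultimately show ?thesis by (simp add: tangent_space_def dirv_def func_ring_cinf)
qed

text \<open>By Hadamard's lemma every derivation is a directional derivative.\<close>

lemma tangent_dirv:
 assumes v: "v : TS M p" and c: "(U, ph) : charts M" "p : U"
 obtains w where "w : model M" "v = dirv (U, ph) p w"
proof -
 let ?c = "(U, ph)"
 have co: "lsm M U (%q. ph q \<bullet> b - ph p \<bullet> b)" if "b : Basis" for b
  using lsm_add[OF lsm_chart_coord[OF c(1) that] lsm_const[OF chart_open[OF c(1)], of "- (ph p \<bullet> b)"]] by simp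
 have "EX F B. F : cinf M & open B & p : B & B <= U & (ALL q:B. F q = ph q \<bullet> b - ph p \<bullet> b)" if "b : Basis" for b
  using globalize[OF co[OF that] c(2)] by metis
 then obtain F B where F: "!!b. b : Basis ==> F b : cinf M" "!!b. b : Basis ==> open (B b)" "!!b. b : Basis ==> p : B b"
  "!!b q. b : Basis ==> q : B b ==> F b q = ph q \<bullet> b - ph p \<bullet> b"
  by metis
 obtain r where r: "r > 0" "ball (ph p) r <= pdom M ?c"
  using pdom_open[OF c(1)] chart_pdom[OF c] open_contains_ball by blast
 define w0 where "w0 = (SUM b:Basis. v (F b) *\<^sub>R b)"
 have vf: "v f = frd (%x. f (par M ?c x)) (at (ph p)) w0" if f: "f : cinf M" for f
 proof -
  let ?f = "%x. f (par M ?c x)"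
  have sf: "sm (ball (ph p) r) ?f" by (rule sm_subset[OF cinf_par[OF c(1) f] open_ball r(2)])
  obtain g where g: "!!b. b : Basis ==> sm (ball (ph p) r) (g b)"
   "!!x. x : ball (ph p) r ==> ?f x = ?f (ph p) + (SUM b:Basis. ((x - ph p) \<bullet> b) * g b x)"
   "!!b. b : Basis ==> ph p : ball (ph p) r ==> g b (ph p) = frd ?f (at (ph p)) b"
   using that by (rule hadamard[OF sf])
  let ?A = "{q\<in>U. ph q : ball (ph p) r}"
  have A: "open ?A" "p : ?A"
   using continuous_open_preimage[OF chart_cont[OF c(1)] chart_open[OF c(1)] open_ball[of "ph p" r]] c(2) r(1)
   by (simp_all add: vimage_def Int_def)
  have "EX G D. G : cinf M & open D & p : D & (ALL q:D. G q = g b (ph q))" if "b : Basis" for b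
  proof -
   have ls: "lsm M ?A (%q. g b (ph q))" by (rule lsm_chart_comp[OF c(1) g(1)[OF that] A(1)]) auto
   obtain G D where "G : cinf M" "open D" "p : D" "D <= ?A" "!!q. q : D ==> G q = g b (ph q)"
    using that by (rule globalize[OF ls A(2)])
   then show ?thesis by (intro exI[of _ G] exI[of _ D]) simp
  qed
  then obtain G D where G: "!!b. b : Basis ==> G b : cinf M" "!!b. b : Basis ==> open (D b)" "!!b. b : Basis ==> p : D b"
   "!!b q. b : Basis ==> q : D b ==> G b q = g b (ph q)"
   by metis
  \<comment> \<open>Hadamard's expansion with coordinates and coefficients replaced by global
    functions. It agrees with \<open>f\<close> near \<open>p\<close>, so locality allows the product
    rule to be applied to it.\<close>
  let ?h = "%q. f p + (SUM b:Basis. F b q * G b q)"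
  let ?N = "?A Int (\<Inter>b\<in>Basis. B b Int D b)"
  have FG: "(%q. F b q * G b q) : cinf M" if "b : Basis" for b by (intro func_ring_cinf F(1) G(1) that)
  have S: "(%q. SUM b:Basis. F b q * G b q) : cinf M" "v (%q. SUM b:Basis. F b q * G b q) = (SUM b:Basis. v (%q. F b q * G b q))"
   by (rule tangent_sum[OF v finite_Basis FG], assumption)+
  have "open ?N" using A F(2) G(2) by (intro open_Int open_INT) auto
  moreover have "p : ?N" using A F(3) G(3) by auto
  moreover have "f q = ?h q" if "q : ?N" for q
  proof -
   have q: "q : U" "ph q : ball (ph p) r" using that by auto
   have "f q = f p + (SUM b:Basis. ((ph q - ph p) \<bullet> b) * g b (ph q))"
    using g(2)[OF q(2)] by (simp add: par_chart[OF c(1)] q c(2))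
   also have "(SUM b:Basis. ((ph q - ph p) \<bullet> b) * g b (ph q)) = (SUM b:Basis. F b q * G b q)"
    by (rule sum.cong[OF refl]) (use that F(4) G(4) in "auto simp: inner_diff_left")
   finally show ?thesis .
  qed
  ultimately have "v f = v ?h" by (rule tangent_local[OF v f func_ring_cinf(2)[OF func_ring_cinf(1) S(1)]])
  also have "... = v (%_. f p) + v (%q. SUM b:Basis. F b q * G b q)"
   by (rule tangent_add[OF v func_ring_cinf(1) S(1)])
  also have "... = (SUM b:Basis. v (%q. F b q * G b q))"
   by (simp only: tangent_const[OF v] S(2) add_0)
  also have "... = (SUM b:Basis. v (F b) * frd ?f (at (ph p)) b)"
  proof (rule sum.cong[OF refl])
   fix b :: 'e assume b: "b : Basis"
   have "F b p = 0" "G b p = frd ?f (at (ph p)) b"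
    using F(3,4)[OF b] G(3,4)[OF b] g(3)[OF b] r(1) by auto
   then show "v (%q. F b q * G b q) = v (F b) * frd ?f (at (ph p)) b"
    by (simp add: tangent_mult[OF v F(1)[OF b] G(1)[OF b]])
  qed
  also have "... = frd ?f (at (ph p)) w0"
  proof -
   have l: "linear (frd ?f (at (ph p)))"
    by (rule has_derivative_linear[OF sm_has_derivative[OF sf]]) (use r(1) in simp)
   show ?thesis unfolding w0_def linear_sum[OF l] linear_cmul[OF l] by simp
  qed
  finally show ?thesis .
 qed
 \<comment> \<open>The parametrisation factors through the projection to the model, so the part of
   \<open>w0\<close> in the kernel of the projection has no effect and may be dropped.\<close>
 have pd: "frd (%x. f (par M ?c x)) (at (ph p)) w0 = frd (%x. f (par M ?c x)) (at (ph p)) (prj (model M) w0)"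
  if f: "f : cinf M" for f
 proof -
  let ?f = "%x. f (par M ?c x)"
  have "?f x = ?f (prj (model M) x)" for x by (simp add: par_def prjM)
  moreover have "(?f has_derivative frd ?f (at (ph p))) (at (prj (model M) (ph p)))"
   using sm_has_derivative[OF cinf_par[OF c(1) f] chart_pdom[OF c]] chart_model[OF c] by (simp add: prjM(3))
  from has_derivative_compose[OF bounded_linear_imp_has_derivative[OF bounded_linear_prjM] this]
  have "((%x. ?f (prj (model M) x)) has_derivative (%w. frd ?f (at (ph p)) (prj (model M) w))) (at (ph p))" .
  ultimately have "(?f has_derivative (%w. frd ?f (at (ph p)) (prj (model M) w))) (at (ph p))" by simp
  from frechet_derivative_at[OF this] show ?thesis by metis
 qed
 show ?thesis
 proof (rule that[of "prj (model M) w0"])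
  show "prj (model M) w0 : model M" by (rule prjM(2))
  show "v = dirv ?c p (prj (model M) w0)"
   using vf pd tangent_off[OF v] by (auto simp: dirv_def fun_eq_iff)
 qed
qed

end

subsection \<open>Smooth maps\<close>

text \<open>Smooth maps are defined by pulling back functions, so continuity has to be recovered:
  the set where a pulled back bump function is nonzero is open and lies in the preimage.\<close>

lemma smooth_preimage_open:
 assumes M: "is_manifold M" and N: "is_manifold N" and f: "smooth_map M N f" and A: "open A"
 shows "open (f -` A)"
proof (subst open_subopen, rule ballI)
 fix p assume "p : f -` A"
 then have p: "f p : A" by simp
 obtain ze B K where ze: "ze : cinf N" "open B" "f p : B" "B <= A" "!!q. q : B ==> ze q = 1"
  "closed K" "K <= A" "!!q. q ~: K ==> ze q = 0"
  using that by (rule bump[OF N A p])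
 have "ze \<circ> f : cinf M" using f ze(1) by (simp add: smooth_map_def)
 then have "continuous_on UNIV (ze \<circ> f)"
  by (intro lsm_continuous[OF M] cinf_lsm[OF M] open_UNIV)
 then have "open ((ze \<circ> f) -` (- {0}))" by (rule open_vimage[rotated]) auto
 moreover have "p : (ze \<circ> f) -` (- {0})" using ze(3,5) by simp
 moreover have "(ze \<circ> f) -` (- {0}) <= f -` A"
 proof
  fix x assume "x : (ze \<circ> f) -` (- {0})"
  then have "f x : K" using ze(8)[of "f x"] by fastforce
  then show "x : f -` A" using ze(7) by auto
 qed
 ultimately show "EX T. open T & p : T & T <= f -` A" by blast
qed

lemma lsm_compose_map:
 assumes M: "is_manifold M" and N: "is_manifold N" and f: "smooth_map M N f" and g: "lsm N B g"
 shows "lsm M (f -` B) (%x. g (f x))"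
proof (rule lsm_local[OF M smooth_preimage_open[OF M N f lsm_open[OF N g]]])
 fix p assume "p : f -` B"
 then have p: "f p : B" by simp
 obtain F B' where F: "F : cinf N" "open B'" "f p : B'" "B' <= B" "!!q. q : B' ==> F q = g q"
  using that by (rule globalize[OF N g p])
 have o: "open (f -` B')" by (rule smooth_preimage_open[OF M N f F(2)])
 have "F \<circ> f : cinf M" using f F(1) by (simp add: smooth_map_def)
 from cinf_lsm[OF M this o] have "lsm M (f -` B') (%x. g (f x))"
  by (rule lsm_cong[OF M, THEN iffD1, rotated]) (simp add: F(5))
 then show "EX B. p : B & lsm M B (%x. g (f x))" using F(3) by blast
qed

lemma smooth_map_compose: "smooth_map L M g ==> smooth_map M N f ==> smooth_map L N (%x. f (g x))"
 unfolding smooth_map_def o_def by (intro ballI) (drule(1) bspec, drule(1) bspec, assumption)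

lemma smooth_map_id: "smooth_map M M (%x. x)"
 by (simp add: smooth_map_def o_def)

lemma smooth_map_const: "is_manifold M ==> smooth_map M N (%x. c)"
 by (simp add: smooth_map_def o_def func_ring_cinf)

lemma smooth_mapD: "smooth_map M N f ==> g : cinf N ==> (%x. g (f x)) : cinf M"
 by (simp add: smooth_map_def o_def)

lemma smooth_map_charts:
 fixes M :: "('a::{t2_space,second_countable_topology}, 'e::euclidean_space) manifold"
  and N :: "('b::{t2_space,second_countable_topology}, 'f::euclidean_space) manifold"
 assumes M: "is_manifold M" and N: "is_manifold N" and f: "smooth_map M N f"
  and c: "(U, ph) : charts M" and d: "(V, ps) : charts N"
 shows "smv {x : pdom M (U, ph). f (par M (U, ph) x) : V} (%x. ps (f (par M (U, ph) x)))"
 unfolding smv_def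
proof (intro conjI ballI)
 show "open {x : pdom M (U, ph). f (par M (U, ph) x) : V}"
  using par_preimage_open[OF M c smooth_preimage_open[OF M N f chart_open[OF N d]]] by simp
 fix b :: 'f assume "b : Basis"
 from lsm_compose_map[OF M N f lsm_chart_coord[OF N d this]] c
 show "sm {x : pdom M (U, ph). f (par M (U, ph) x) : V} (%x. ps (f (par M (U, ph) x)) \<bullet> b)"
  by (auto simp: lsm_def)
qed

subsection \<open>Products\<close>

lemma inv_into_map_prod:
 assumes "inj_on f A" "inj_on g B" "x : f ` A" "y : g ` B"
 shows "inv_into (A \<times> B) (map_prod f g) (x, y) = (inv_into A f x, inv_into B g y)"
proof (rule inv_into_f_eq)
 show "inj_on (map_prod f g) (A \<times> B)" using assms(1,2) by (auto simp: inj_on_def)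
 show "(inv_into A f x, inv_into B g y) : A \<times> B" using assms(3,4) by (simp add: inv_into_into)
 show "map_prod f g (inv_into A f x, inv_into B g y) = (x, y)" using assms(3,4) by (simp add: f_inv_into_f)
qed

lemma smooth_fun_on_fst:
 assumes "smooth_fun_on V u" "fst ` W <= V" "!!z. z : W ==> f z = u (fst z)"
 shows "smooth_fun_on (W :: ('e::euclidean_space \<times> 'f::euclidean_space) set) f"
 unfolding smooth_fun_on_def
proof
 fix z assume z: "z : W"
 then have "fst z : V" using assms(2) by auto
 from assms(1)[unfolded smooth_fun_on_def, rule_format, OF this]
 obtain X h where X: "open X" "fst z : X" "ALL k. Ck_on k X h" "ALL y:V Int X. h y = u y"
  by blast
 have o: "open (X \<times> (UNIV :: 'f set))" using X(1) by (intro open_Times) auto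
 have "sm (X \<times> (UNIV :: 'f set)) (%z. h (fst z))"
  by (rule sm_compose[of X h "X \<times> (UNIV :: 'f set)" fst, OF _ smv_linear[OF o bounded_linear_fst]]) (use X in "auto simp: sm_def")
 then show "EX X h. open X & z : X & (ALL k. Ck_on k X h) & (ALL y:W Int X. h y = f y)"
 proof (intro exI conjI ballI)
  show "open (X \<times> (UNIV :: 'f set))" by (rule o)
  show "z : X \<times> (UNIV :: 'f set)" using X(2) by (simp add: mem_Times_iff)
  show "ALL k. Ck_on k (X \<times> (UNIV :: 'f set)) (%z. h (fst z))" using \<open>sm _ _\<close> by (simp add: sm_def)
  fix y assume "y : W Int (X \<times> (UNIV :: 'f set))"
  then show "h (fst y) = f y" using X(4) assms(2,3) by (auto simp: mem_Times_iff)
 qed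
qed

lemma smooth_fun_on_snd:
 assumes "smooth_fun_on V u" "snd ` W <= V" "!!z. z : W ==> f z = u (snd z)"
 shows "smooth_fun_on (W :: ('e::euclidean_space \<times> 'f::euclidean_space) set) f"
 unfolding smooth_fun_on_def
proof
 fix z assume z: "z : W"
 then have "snd z : V" using assms(2) by auto
 from assms(1)[unfolded smooth_fun_on_def, rule_format, OF this]
 obtain X h where X: "open X" "snd z : X" "ALL k. Ck_on k X h" "ALL y:V Int X. h y = u y"
  by blast
 have o: "open ((UNIV :: 'e set) \<times> X)" using X(1) by (intro open_Times) auto
 have "sm ((UNIV :: 'e set) \<times> X) (%z. h (snd z))"
  by (rule sm_compose[of X h "(UNIV :: 'e set) \<times> X" snd, OF _ smv_linear[OF o bounded_linear_snd]]) (use X in "auto simp: sm_def")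
 then show "EX X h. open X & z : X & (ALL k. Ck_on k X h) & (ALL y:W Int X. h y = f y)"
 proof (intro exI conjI ballI)
  show "open ((UNIV :: 'e set) \<times> X)" by (rule o)
  show "z : (UNIV :: 'e set) \<times> X" using X(2) by (simp add: mem_Times_iff)
  show "ALL k. Ck_on k ((UNIV :: 'e set) \<times> X) (%z. h (snd z))" using \<open>sm _ _\<close> by (simp add: sm_def)
  fix y assume "y : W Int ((UNIV :: 'e set) \<times> X)"
  then show "h (snd y) = f y" using X(4) assms(2,3) by (auto simp: mem_Times_iff)
 qed
qed

lemma charts_prod: "(UV, th) : charts (PM M N) \<longleftrightarrow>
  (EX U ph V ps. UV = U \<times> V & th = map_prod ph ps & (U, ph) : charts M & (V, ps) : charts N)"
 by (auto simp: prod_manifold_def)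

lemma is_manifold_prod:
 assumes M: "is_manifold M" and N: "is_manifold N"
 shows "is_manifold (PM M N)"
proof -
 let ?P = "PM M N"
 have 1: "subspace (model (PM M N))"
  using model_subspace[OF M] model_subspace[OF N] by (simp add: prod_manifold_def subspace_Times)
 have 2: "(\<Union>(U, ph)\<in>charts (PM M N). U) = UNIV"
 proof -
  have "EX UV th. (UV, th) : charts (PM M N) & z : UV" for z
  proof -
   obtain U ph where "(U, ph) : charts M" "fst z : U" by (rule chart_exists[OF M])
   moreover obtain V ps where "(V, ps) : charts N" "snd z : V" by (rule chart_exists[OF N])
   ultimately have "(U \<times> V, map_prod ph ps) : charts (PM M N)" "z : U \<times> V"
    by (auto simp: charts_prod mem_Times_iff)
   then show ?thesis by blast
  qed
  then show ?thesis by fastforce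
 qed
 have 3: "open UV & openin (top_of_set (model ?P)) (th ` UV) & (EX ps. homeomorphism UV (th ` UV) th ps)"
  if UV: "(UV, th) : charts ?P" for UV th
 proof (intro conjI)
 from UV obtain U ph V ps where *: "UV = U \<times> V" "th = map_prod ph ps" and c: "(U, ph) : charts M" and d: "(V, ps) : charts N"
  by (auto simp: charts_prod)
 have im: "th ` UV = ph ` U \<times> ps ` V" by (auto simp: *)
 have oi: "openin (top_of_set (model M)) (ph ` U)" "openin (top_of_set (model N)) (ps ` V)"
  and hm: "EX ps. homeomorphism U (ph ` U) ph ps" "EX ps'. homeomorphism V (ps ` V) ps ps'"
  using M N c d unfolding is_manifold_def by fastforce+
 show "open UV" by (simp add: * open_Times chart_open[OF M c] chart_open[OF N d])
 show "openin (top_of_set (model (PM M N))) (th ` UV)"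
  unfolding im using openin_Times[OF oi] by (simp add: prod_manifold_def)
 obtain a b where "homeomorphism U (ph ` U) ph a" "homeomorphism V (ps ` V) ps b" using hm by blast
 then have "homeomorphism UV (th ` UV) th (map_prod a b)"
  unfolding im unfolding * homeomorphism_def map_prod_def split_beta
  by (auto simp: fst_image_times snd_image_times image_iff intro!: continuous_intros continuous_on_compose2[of U ph] continuous_on_compose2[of V ps]
    continuous_on_compose2[of "ph ` U" a] continuous_on_compose2[of "ps ` V" b] bexI)
 then show "EX ps. homeomorphism UV (th ` UV) th ps" by blast
 qed
 have 4: "smooth_fun_on (th ` (UV Int UV')) (%x. th' (inv_into UV th x) \<bullet> b)"
  if UV: "(UV, th) : charts ?P" "(UV', th') : charts ?P" and b: "b : Basis" for UV th UV' th' b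
 proof -
 from UV obtain U ph V ps U' ph' V' ps' where *: "UV = U \<times> V" "th = map_prod ph ps" and c: "(U, ph) : charts M" and d: "(V, ps) : charts N"
  and eq: "UV' = U' \<times> V'" "th' = map_prod ph' ps'" and c': "(U', ph') : charts M" and d': "(V', ps') : charts N"
  by (auto simp: charts_prod)
 have inv: "inv_into UV th z = (inv_into U ph (fst z), inv_into V ps (snd z))" if "z : th ` (UV Int UV')" for z
  using that inv_into_map_prod[OF chart_inj[OF M c] chart_inj[OF N d]] by (auto simp: *)
 have im: "fst ` th ` (UV Int UV') <= ph ` (U Int U')" "snd ` th ` (UV Int UV') <= ps ` (V Int V')" by (auto simp: * eq)
 show "smooth_fun_on (th ` (UV Int UV')) (%x. th' (inv_into UV th x) \<bullet> b)"
 proof (cases "EX i:Basis. b = (i, 0)")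
  case True
  then obtain i where i: "i : Basis" "b = (i, 0)" by blast
  have "smooth_fun_on (ph ` (U Int U')) (%x. ph' (inv_into U ph x) \<bullet> i)"
   using M c c' i(1) unfolding is_manifold_def by fastforce
  from smooth_fun_on_fst[OF this im(1)] show ?thesis by (simp add: inv eq i)
 next
  case False
  then obtain i where i: "i : Basis" "b = (0, i)" using b by (auto simp: Basis_prod_def)
  have "smooth_fun_on (ps ` (V Int V')) (%x. ps' (inv_into V ps x) \<bullet> i)"
   using N d d' i(1) unfolding is_manifold_def by fastforce
  from smooth_fun_on_snd[OF this im(2)] show ?thesis by (simp add: inv eq i)
 qed
 qed
 show ?thesis
  unfolding is_manifold_def using 1 2 3 4 by (intro conjI) (auto 0 0)
qed

context
 fixes M :: "('a::{t2_space,second_countable_topology}, 'e::euclidean_space) manifold"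
  and N :: "('b::{t2_space,second_countable_topology}, 'f::euclidean_space) manifold"
 assumes M: "is_manifold M" and N: "is_manifold N"
begin

lemma smooth_map_fst: "smooth_map (PM M N) M fst"
 unfolding smooth_map_def
proof
 note MN = is_manifold_prod[OF M N]
 fix f assume f: "f : cinf M"
 show "f \<circ> fst : cinf (PM M N)"
 proof (rule cinfI[OF MN])
  fix z :: "'a \<times> 'b"
  obtain U ph where c: "(U, ph) : charts M" "fst z : U" by (rule chart_exists[OF M])
  obtain V ps where d: "(V, ps) : charts N" "snd z : V" by (rule chart_exists[OF N])
  let ?c = "(U \<times> V, map_prod ph ps)" and ?P = "PM M N"
  have c': "?c : charts ?P" using c d by (auto simp: charts_prod)
  let ?X = "{x : pdom ?P ?c. par ?P ?c x : U \<times> V}"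
  have o: "open ?X" by (rule par_preimage_open[OF MN c' chart_open[OF MN c']])
  have "smv ?X (%x. fst (prj (model ?P) x))"
   by (rule smv_linear[OF o bounded_linear_compose[OF bounded_linear_fst bounded_linear_prjM[OF MN]]])
  then have "smv ?X (%x. ph (fst (par ?P ?c x)))"
  proof (rule smv_cong[THEN iffD1, rotated])
   fix x assume x: "x : ?X"
   have "map_prod ph ps (par ?P ?c x) = prj (model ?P) x" using chart_par[OF MN c'] x by simp
   then show "fst (prj (model ?P) x) = ph (fst (par ?P ?c x))" by (metis fst_map_prod)
  qed
  moreover have "(%x. fst (par ?P ?c x)) ` ?X <= UNIV Int U" by (auto simp: mem_Times_iff)
  ultimately have "sm ?X (%x. f (fst (par ?P ?c x)))"
   by (rule lsm_comp_par[OF M cinf_lsm[OF M f open_UNIV] c(1)])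
  then have "sm ?X (%x. (f \<circ> fst) (par ?P ?c x))" by simp
  then have "lsm ?P (U \<times> V) (f \<circ> fst)"
   by (rule lsm_chartI[OF MN c' chart_open[OF MN c'] subset_refl])
  then show "EX B. z : B & lsm ?P B (f \<circ> fst)"
   using c(2) d(2) by (intro exI[of _ "U \<times> V"] conjI) (simp_all only: mem_Times_iff)
 qed
qed

lemma smooth_map_snd: "smooth_map (PM M N) N snd"
 unfolding smooth_map_def
proof
 note MN = is_manifold_prod[OF M N]
 fix f assume f: "f : cinf N"
 show "f \<circ> snd : cinf (PM M N)"
 proof (rule cinfI[OF MN])
  fix z :: "'a \<times> 'b"
  obtain U ph where c: "(U, ph) : charts M" "fst z : U" by (rule chart_exists[OF M])
  obtain V ps where d: "(V, ps) : charts N" "snd z : V" by (rule chart_exists[OF N])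
  let ?c = "(U \<times> V, map_prod ph ps)" and ?P = "PM M N"
  have c': "?c : charts ?P" using c d by (auto simp: charts_prod)
  let ?X = "{x : pdom ?P ?c. par ?P ?c x : U \<times> V}"
  have o: "open ?X" by (rule par_preimage_open[OF MN c' chart_open[OF MN c']])
  have "smv ?X (%x. snd (prj (model ?P) x))"
   by (rule smv_linear[OF o bounded_linear_compose[OF bounded_linear_snd bounded_linear_prjM[OF MN]]])
  then have "smv ?X (%x. ps (snd (par ?P ?c x)))"
  proof (rule smv_cong[THEN iffD1, rotated])
   fix x assume x: "x : ?X"
   have "map_prod ph ps (par ?P ?c x) = prj (model ?P) x" using chart_par[OF MN c'] x by simp
   then show "snd (prj (model ?P) x) = ps (snd (par ?P ?c x))" by (metis snd_map_prod)
  qed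
  moreover have "(%x. snd (par ?P ?c x)) ` ?X <= UNIV Int V" by (auto simp: mem_Times_iff)
  ultimately have "sm ?X (%x. f (snd (par ?P ?c x)))"
   by (rule lsm_comp_par[OF N cinf_lsm[OF N f open_UNIV] d(1)])
  then have "sm ?X (%x. (f \<circ> snd) (par ?P ?c x))" by simp
  then have "lsm ?P (U \<times> V) (f \<circ> snd)"
   by (rule lsm_chartI[OF MN c' chart_open[OF MN c'] subset_refl])
  then show "EX B. z : B & lsm ?P B (f \<circ> snd)"
   using c(2) d(2) by (intro exI[of _ "U \<times> V"] conjI) (simp_all only: mem_Times_iff)
 qed
qed

lemma smooth_map_Pair:
 assumes L: "is_manifold L" and f: "smooth_map L M f" and g: "smooth_map L N g"
 shows "smooth_map L (PM M N) (%x. (f x, g x))"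
 unfolding smooth_map_def
proof
 note MN = is_manifold_prod[OF M N]
 fix F assume F: "F : cinf (PM M N)"
 show "F \<circ> (%x. (f x, g x)) : cinf L"
 proof (rule cinfI[OF L])
  fix p
  obtain U ph where c: "(U, ph) : charts M" "f p : U" by (rule chart_exists[OF M])
  obtain V ps where d: "(V, ps) : charts N" "g p : V" by (rule chart_exists[OF N])
  obtain T th where t: "(T, th) : charts L" "p : T" by (rule chart_exists[OF L])
  let ?c = "(U \<times> V, map_prod ph ps)" and ?P = "PM M N"
  have c': "?c : charts ?P" using c d by (auto simp: charts_prod)
  let ?A = "T Int f -` U Int g -` V"
  have A: "open ?A"
   by (intro open_Int chart_open[OF L t(1)] smooth_preimage_open[OF L M f chart_open[OF M c(1)]]
    smooth_preimage_open[OF L N g chart_open[OF N d(1)]])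
  let ?X = "{x : pdom L (T, th). par L (T, th) x : ?A}"
  have o: "open ?X" by (rule par_preimage_open[OF L t(1) A])
  have "smv ?X (%x. map_prod ph ps (f (par L (T, th) x), g (par L (T, th) x)))"
   unfolding map_prod_simp
   by (intro smv_Pair smv_subset[OF smooth_map_charts[OF L M f t(1) c(1)] o] smv_subset[OF smooth_map_charts[OF L N g t(1) d(1)] o]) auto
  moreover have "(%x. (f (par L (T, th) x), g (par L (T, th) x))) ` ?X <= UNIV Int U \<times> V" by auto
  ultimately have "sm ?X (%x. F (f (par L (T, th) x), g (par L (T, th) x)))"
   by (rule lsm_comp_par[OF MN cinf_lsm[OF MN F open_UNIV] c'])
  moreover have "?A <= T" by auto
  ultimately have "lsm L ?A (F \<circ> (%x. (f x, g x)))"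
   unfolding o_def by (intro lsm_chartI[OF L t(1) A])
  then show "EX B. p : B & lsm L B (F \<circ> (%x. (f x, g x)))" using c(2) d(2) t(2) by (intro exI[of _ ?A]) simp
 qed
qed

text \<open>The parametrisation is the product of the two given ones. It may differ from
  \<open>par\<close> of the product chart, because the projection onto the product of the models is
  chosen independently of the two projections.\<close>

lemma sm_prod_par:
 assumes F: "F : cinf (PM M N)" and c: "(U, ph) : charts M" and d: "(V, ps) : charts N"
 shows "sm (pdom M (U, ph) \<times> pdom N (V, ps)) (%z. F (par M (U, ph) (fst z), par N (V, ps) (snd z)))"
proof -
 note MN = is_manifold_prod[OF M N]
 let ?c = "(U \<times> V, map_prod ph ps)" and ?P = "PM M N" and ?X = "pdom M (U, ph) \<times> pdom N (V, ps)"
 have c': "?c : charts ?P" using c d by (auto simp: charts_prod)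
 have o: "open ?X" by (intro open_Times pdom_open[OF M c] pdom_open[OF N d])
 have "smv ?X (%z. (prj (model M) (fst z), prj (model N) (snd z)))"
  by (intro smv_Pair smv_linear[OF o] bounded_linear_compose[OF bounded_linear_prjM[OF M] bounded_linear_fst]
   bounded_linear_compose[OF bounded_linear_prjM[OF N] bounded_linear_snd])
 then have "smv ?X (%z. map_prod ph ps (par M (U, ph) (fst z), par N (V, ps) (snd z)))"
  by (rule smv_cong[THEN iffD1, rotated]) (auto simp: chart_par[OF M c] chart_par[OF N d])
 moreover have "(%z. (par M (U, ph) (fst z), par N (V, ps) (snd z))) ` ?X <= UNIV Int U \<times> V"
  using par_in[OF M c] par_in[OF N d] by auto
 ultimately show ?thesis by (rule lsm_comp_par[OF MN cinf_lsm[OF MN F open_UNIV] c'])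
qed

lemma cinf_slice1: "F : cinf (PM M N) ==> (%x. F (x, y)) : cinf M"
 and cinf_slice2: "F : cinf (PM M N) ==> (%y. F (x, y)) : cinf N"
 using smooth_mapD[OF smooth_map_Pair[OF M smooth_map_id smooth_map_const[OF M]]]
  smooth_mapD[OF smooth_map_Pair[OF N smooth_map_const[OF N] smooth_map_id]] by auto

end

text \<open>The splitting (w, w) = (w, 0) + (0, w) of a diagonal direction, at the level of
  derivations. Partial derivatives enter the later arguments in this form.\<close>

lemma tangent_Pair:
 assumes L: "is_manifold L" and M: "is_manifold M" and N: "is_manifold N"
  and f: "smooth_map L M f" and g: "smooth_map L N g" and F: "F : cinf (PM M N)"
  and v: "v : TS L p"
 shows "v (%x. F (f x, g x)) = v (%x. F (f x, g p)) + v (%x. F (f p, g x))"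
proof -
 note LL = is_manifold_prod[OF L L]
 define G where "G = (%z. F (f (fst z), g (snd z)))"
 have "smooth_map (PM L L) (PM M N) (%z. (f (fst z), g (snd z)))"
  by (rule smooth_map_Pair[OF M N LL smooth_map_compose[OF smooth_map_fst[OF L L] f] smooth_map_compose[OF smooth_map_snd[OF L L] g]])
 from smooth_mapD[OF this F] have G: "G : cinf (PM L L)" by (simp add: G_def)
 obtain U ph where c: "(U, ph) : charts L" "p : U" by (rule chart_exists[OF L])
 obtain w where w: "v = dirv L (U, ph) p w" using tangent_dirv[OF L v c] .
 let ?r = "par L (U, ph)" and ?x = "ph p"
 let ?H = "%z. G (?r (fst z), ?r (snd z))"
 let ?D = "frd ?H (at (?x, ?x))"
 have d: "(?H has_derivative ?D) (at (?x, ?x))"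
  by (rule sm_has_derivative[OF sm_prod_par[OF L L G c(1) c(1)]]) (simp add: chart_pdom[OF L c])
 have "((%x. ?H (x, x)) has_derivative (%w. ?D (w, w))) (at ?x)"
  by (rule has_derivative_compose[of "%x. (x, x)" "%w. (w, w)" ?x UNIV ?H ?D, OF _ d]) (auto intro!: derivative_eq_intros)
 then have 1: "frd (%x. ?H (x, x)) (at ?x) w = ?D (w, w)" by (drule_tac frechet_derivative_at) (drule_tac x = w in fun_cong, simp)
 have "((%x. ?H (x, ?x)) has_derivative (%w. ?D (w, 0))) (at ?x)"
  by (rule has_derivative_compose[of "%x. (x, ?x)" "%w. (w, 0)" ?x UNIV ?H ?D, OF _ d]) (auto intro!: derivative_eq_intros)
 then have 2: "frd (%x. ?H (x, ?x)) (at ?x) w = ?D (w, 0)" by (drule_tac frechet_derivative_at) (drule_tac x = w in fun_cong, simp)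
 have "((%x. ?H (?x, x)) has_derivative (%w. ?D (0, w))) (at ?x)"
  by (rule has_derivative_compose[of "%x. (?x, x)" "%w. (0, w)" ?x UNIV ?H ?D, OF _ d]) (auto intro!: derivative_eq_intros)
 then have 3: "frd (%x. ?H (?x, x)) (at ?x) w = ?D (0, w)" by (drule_tac frechet_derivative_at) (drule_tac x = w in fun_cong, simp)
 have "?D (w, w) = ?D (w, 0) + ?D (0, w)"
  using linear_add[OF has_derivative_linear[OF d], of "(w, 0)" "(0, w)"] by simp
 moreover have m: "(%x. F (f x, g x)) : cinf L" "(%x. F (f x, g p)) : cinf L" "(%x. F (f p, g x)) : cinf L"
  using smooth_mapD[OF smooth_map_Pair[OF M N L f g] F] smooth_mapD[OF smooth_map_Pair[OF M N L f smooth_map_const[OF L]] F]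
   smooth_mapD[OF smooth_map_Pair[OF M N L smooth_map_const[OF L] g] F] by auto
 have e: "v k = frd (%x. k (?r x)) (at ?x) w" if "k : cinf L" for k
  using that by (simp add: w dirv_def[OF L])
 have "v (%x. F (f x, g x)) = ?D (w, w)" using e[OF m(1)] 1 by (simp add: G_def)
 moreover have "v (%x. F (f x, g p)) = ?D (w, 0)" using e[OF m(2)] 2 by (simp add: G_def par_chart[OF L c])
 moreover have "v (%x. F (f p, g x)) = ?D (0, w)" using e[OF m(3)] 3 by (simp add: G_def par_chart[OF L c])
 ultimately show ?thesis by simp
qed

subsection \<open>Coordinates of tangent vectors\<close>

context
 fixes M :: "('a::{t2_space,second_countable_topology}, 'e::euclidean_space) manifold"
 assumes M: "is_manifold M"
begin

text \<open>Coordinates cut off to global functions \<open>F b\<close>: near \<open>p0\<close>, the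
  values of a tangent vector on them are its components in the chart. They turn pointwise
  derivations into vectors that vary smoothly with the point.\<close>

lemma chart_functions:
 assumes c: "(U, ph) : charts M" "p0 : U"
 obtains F B where "open B" "p0 : B" "B <= U" "!!b. b : Basis ==> F b : cinf M"
  "!!b q. b : Basis ==> q : B ==> F b q = ph q \<bullet> b"
  "!!b q w. b : Basis ==> q : B ==> dirv M (U, ph) q w (F b) = prj (model M) w \<bullet> b"
  "!!q v f. q : B ==> v : TS M q ==> f : cinf M ==>
   v f = frd (%x. f (par M (U, ph) x)) (at (ph q)) (SUM b:Basis. v (F b) *\<^sub>R b)"
  "!!q v. q : B ==> v : TS M q ==> (SUM b:Basis. v (F b) *\<^sub>R b) : model M"
proof -
 have "EX F B. F : cinf M & open B & p0 : B & B <= U & (ALL q:B. F q = ph q \<bullet> b)" if b: "b : Basis" for b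
 proof -
  obtain F B where "F : cinf M" "open B" "p0 : B" "B <= U" "!!q. q : B ==> F q = ph q \<bullet> b"
   using that by (rule globalize[OF M lsm_chart_coord[OF M c(1) b] c(2)])
  then show ?thesis by blast
 qed
 then have "ALL b:Basis. EX FB. fst FB : cinf M & open (snd FB) & p0 : snd FB & snd FB <= U & (ALL q:snd FB. fst FB q = ph q \<bullet> b)"
  by simp
 from bchoice[OF this] obtain FB where FB: "!!b. b : Basis ==> fst (FB b) : cinf M & open (snd (FB b)) & p0 : snd (FB b) &
  snd (FB b) <= U & (ALL q:snd (FB b). fst (FB b) q = ph q \<bullet> b)" by blast
 define F where "F = (%b. fst (FB b))"
 define B where "B = U Int (\<Inter>b\<in>Basis. snd (FB b))"
 have F: "F b : cinf M" if "b : Basis" for b using FB[OF that] by (simp add: F_def)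
 have B: "open B" "p0 : B" "B <= U" using FB chart_open[OF M c(1)] c(2) unfolding B_def by (auto intro!: open_Int open_INT)
 have Fq: "F b q = ph q \<bullet> b" if "b : Basis" "q : B" for b q using FB[OF that(1)] that(1,2) unfolding B_def F_def by blast
 have dF: "dirv M (U, ph) q w (F b) = prj (model M) w \<bullet> b" if "b : Basis" "q : B" for b q w
 proof -
  have q: "q : U" using that(2) B(3) by auto
  have "((%x. prj (model M) x \<bullet> b) has_derivative (%w. prj (model M) w \<bullet> b)) (at (ph q))"
   by (intro bounded_linear_imp_has_derivative bounded_linear_inner_left_comp bounded_linear_prjM[OF M])
  then have "((%x. F b (par M (U, ph) x)) has_derivative (%w. prj (model M) w \<bullet> b)) (at (ph q))"
   by (rule has_derivative_transform_within_open[of _ _ _ _ "{x : pdom M (U, ph). par M (U, ph) x : B}"])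
    (use par_preimage_open[OF M c(1) B(1)] chart_pdom[OF M c(1) q] par_chart[OF M c(1) q] that Fq chart_par[OF M c(1)] in auto)
  from fun_cong[OF frechet_derivative_at[OF this], of w] show ?thesis using F[OF that(1)] by (simp add: dirv_def[OF M])
 qed
 have w: "v = dirv M (U, ph) q (SUM b:Basis. v (F b) *\<^sub>R b)" "(SUM b:Basis. v (F b) *\<^sub>R b) : model M"
  if qB: "q : B" and vT: "v : TS M q" for q v
 proof -
  have q: "q : U" using qB B(3) by auto
  obtain w where w: "w : model M" "v = dirv M (U, ph) q w" using tangent_dirv[OF M vT c(1) q] .
  have "v (F b) = w \<bullet> b" if "b : Basis" for b using dF[OF that qB] w by (simp add: prjM(3)[OF M])
  then have "(SUM b:Basis. v (F b) *\<^sub>R b) = w" by (simp add: euclidean_representation)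
  then show "v = dirv M (U, ph) q (SUM b:Basis. v (F b) *\<^sub>R b)" "(SUM b:Basis. v (F b) *\<^sub>R b) : model M" using w by simp_all
 qed
 show ?thesis
 proof (rule that[OF B F Fq dF])
  fix q v f assume "q : B" "v : TS M q" "f : cinf M"
  then show "v f = frd (%x. f (par M (U, ph) x)) (at (ph q)) (SUM b:Basis. v (F b) *\<^sub>R b)"
   using fun_cong[OF w(1), of q v f] by (simp add: dirv_def[OF M])
 qed (auto intro: w(2))
qed

lemma dirv_inj:
 assumes c: "(U, ph) : charts M" "p : U" and w: "w : model M" "w' : model M" and e: "dirv M (U, ph) p w = dirv M (U, ph) p w'"
 shows "w = w'"
proof -
 obtain F B where FB: "p : B" "!!b q w. b : Basis ==> q : B ==> dirv M (U, ph) q w (F b) = prj (model M) w \<bullet> b"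
  using that by (rule chart_functions[OF c])
 show ?thesis
  by (rule euclidean_eqI) (use FB(2)[OF _ FB(1), of _ w] FB(2)[OF _ FB(1), of _ w'] e w in "simp add: prjM(3)[OF M]")
qed

lemma lsm_sum: "open A ==> (!!i. i : I ==> lsm M A (f i)) ==> lsm M A (%x. \<Sum>i\<in>I. f i x)"
 by (induction I rule: infinite_finite_induct) (simp_all add: lsm_const[OF M] lsm_add[OF M])

lemma cinf_separates:
 assumes "!!u. u : cinf M ==> u p = u q" shows "p = q"
proof (rule ccontr)
 assume "p ~= q"
 then have "open (- {q})" "p : - {q}" by auto
 obtain ze B K where ze: "ze : cinf M" "open B" "p : B" "B <= - {q}" "!!q. q : B ==> ze q = 1"
  "closed K" "K <= - {q}" "!!q. q ~: K ==> ze q = 0"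
  using that by (rule bump[OF M \<open>open (- {q})\<close> \<open>p : - {q}\<close>])
 then have "ze q = 0" "ze p = 1" by auto
 then show False using assms[OF ze(1)] by simp
qed

end

context
 fixes M :: "('a::{t2_space,second_countable_topology}, 'e::euclidean_space) manifold"
  and N :: "('b::{t2_space,second_countable_topology}, 'f::euclidean_space) manifold"
 assumes M: "is_manifold M" and N: "is_manifold N"
begin

lemma tmap_tangent:
 assumes f: "smooth_map M N f" and v: "v : TS M p"
 shows "tmap N f v : TS N (f p)"
 using tangent_add[OF M v smooth_mapD[OF f] smooth_mapD[OF f]] tangent_cmult[OF M v smooth_mapD[OF f]]
  tangent_mult[OF M v smooth_mapD[OF f] smooth_mapD[OF f]]
 by (simp add: tangent_space_def tmap_def o_def func_ring_cinf[OF N])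

lemma tangent_eqI:
 assumes "v : TS M p" "w : TS M q" "!!f. f : cinf M ==> v f = w f"
 shows "v = w"
 using assms tangent_off[OF M assms(1)] tangent_off[OF M assms(2)] by (metis ext)

definition tpair :: "'a tvec => 'a => 'b tvec => 'b => ('a \<times> 'b) tvec" where
 "tpair v p w q = (%F. if F : cinf (PM M N) then v (%x. F (x, q)) + w (%y. F (p, y)) else 0)"

lemma tangent_tpair:
 assumes v: "v : TS (PM M N) (p, q)"
 shows "v = tpair (tmap M fst v) p (tmap N snd v) q"
proof
 fix F
 note MN = is_manifold_prod[OF M N]
 show "v F = tpair (tmap M fst v) p (tmap N snd v) q F"
 proof (cases "F : cinf (PM M N)")
  case True
  have "v (%z. F (fst z, snd z)) = v (%z. F (fst z, q)) + v (%z. F (p, snd z))"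
   using tangent_Pair[OF MN M N smooth_map_fst[OF M N] smooth_map_snd[OF M N] True v] by simp
  then show ?thesis using True by (simp add: tpair_def tmap_def o_def cinf_slice1[OF M N] cinf_slice2[OF M N])
 qed (simp add: tpair_def tangent_off[OF MN v])
qed

text \<open>In product charts the derivative in the second variable is that of \<open>F\<close> in a
  fixed direction (0, \<open>w0\<close>), hence smooth in the first variable.\<close>

lemma tangent_param:
 assumes w: "w : TS N q" and F: "F : cinf (PM M N)"
 shows "(%x. w (%y. F (x, y))) : cinf M"
proof (rule cinfI[OF M])
 fix p
 obtain U ph where c: "(U, ph) : charts M" "p : U" by (rule chart_exists[OF M])
 obtain V ps where d: "(V, ps) : charts N" "q : V" by (rule chart_exists[OF N])
 obtain w0 where w0: "w = dirv N (V, ps) q w0" using tangent_dirv[OF N w d] .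
 let ?r = "par M (U, ph)" and ?s = "par N (V, ps)"
 let ?F = "%z. F (?r (fst z), ?s (snd z))"
 note sF = sm_prod_par[OF M N F c(1) d(1)]
 note pd = pdom_open[OF M c(1)]
 have "sm (pdom M (U, ph)) (%x. frd ?F (at (x, ps q)) (0, w0))"
  by (rule sm_compose[OF sm_frechet[OF sF] smv_Pair[OF smv_linear[OF pd bounded_linear_ident] smv_const[OF pd]]])
   (use chart_pdom[OF N d] in auto)
 from lsm_chart_comp[OF M c(1) this chart_open[OF M c(1)] subset_refl]
 have "lsm M U (%x. frd ?F (at (ph x, ps q)) (0, w0))" using chart_pdom[OF M c(1)] by auto
 then have "lsm M U (%x. w (%y. F (x, y)))"
 proof (rule lsm_cong[OF M, THEN iffD1, rotated])
  fix x assume x: "x : U"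
  have "(?F has_derivative frd ?F (at (ph x, ps q))) (at (ph x, ps q))"
   by (rule sm_has_derivative[OF sF]) (use chart_pdom[OF M c(1) x] chart_pdom[OF N d] in auto)
  moreover have "((%y. (ph x, y)) has_derivative (%w. (0, w))) (at (ps q))"
   by (auto intro!: derivative_eq_intros)
  ultimately have "((%y. ?F (ph x, y)) has_derivative (%w. frd ?F (at (ph x, ps q)) (0, w))) (at (ps q))"
   by (rule has_derivative_compose[rotated])
  from fun_cong[OF frechet_derivative_at[OF this], of w0]
  show "frd ?F (at (ph x, ps q)) (0, w0) = w (%y. F (x, y))"
   by (simp add: w0 dirv_def[OF N] cinf_slice2[OF M N F] par_chart[OF M c(1) x])
 qed
 then show "EX B. p : B & lsm M B (%x. w (%y. F (x, y)))" using c(2) by blast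
qed

text \<open>Unlike in \<open>tangent_param\<close>, the point at which the derivative is taken moves
  with the argument, so the components of \<open>Y\<close> enter, as its values on the functions of
  \<open>chart_functions\<close>.\<close>

lemma vector_field_param:
 assumes Y: "Y : VF M" and F: "F : cinf (PM M N)"
 shows "(%z. Y (fst z) (%x. F (x, snd z))) : cinf (PM M N)"
proof (rule cinfI[OF is_manifold_prod[OF M N]])
 let ?P = "PM M N"
 note MN = is_manifold_prod[OF M N]
 fix z0 :: "'a \<times> 'b"
 obtain U ph where c: "(U, ph) : charts M" "fst z0 : U" by (rule chart_exists[OF M])
 obtain V ps where d: "(V, ps) : charts N" "snd z0 : V" by (rule chart_exists[OF N])
 have cd: "(U \<times> V, map_prod ph ps) : charts ?P" using c d by (auto simp: charts_prod)
 obtain G B where B: "open B" "fst z0 : B" "B <= U" and G: "!!b. b : Basis ==> G b : cinf M"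
  and "!!b q. b : Basis ==> q : B ==> G b q = ph q \<bullet> b"
  "!!b q w. b : Basis ==> q : B ==> dirv M (U, ph) q w (G b) = prj (model M) w \<bullet> b"
  and vG: "!!q v f. q : B ==> v : TS M q ==> f : cinf M ==>
   v f = frd (%x. f (par M (U, ph) x)) (at (ph q)) (SUM b:Basis. v (G b) *\<^sub>R b)"
  and "!!q v. q : B ==> v : TS M q ==> (SUM b:Basis. v (G b) *\<^sub>R b) : model M"
  using that by (rule chart_functions[OF M c])
 let ?r = "par M (U, ph)" and ?s = "par N (V, ps)"
 let ?F = "%z. F (?r (fst z), ?s (snd z))"
 note sF = sm_prod_par[OF M N F c(1) d(1)]
 let ?A = "B \<times> V"
 have A: "open ?A" "?A <= U \<times> V" "map_prod ph ps ` ?A <= pdom M (U, ph) \<times> pdom N (V, ps)"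
  using B chart_open[OF N d(1)] chart_pdom[OF M c(1)] chart_pdom[OF N d(1)] by (auto intro: open_Times)
 have 1: "lsm ?P ?A (%z. frd ?F (at (map_prod ph ps z)) (b, 0))" for b
  by (rule lsm_chart_comp[OF MN cd sm_frechet[OF sF] A])
 have 2: "lsm ?P ?A (%z. Y (fst z) (G b))" if "b : Basis" for b
  by (rule cinf_lsm[OF MN smooth_mapD[OF smooth_map_fst[OF M N]] A(1)]) (use Y G[OF that] in "simp add: vector_fields_def")
 have "lsm ?P ?A (%z. SUM b:Basis. Y (fst z) (G b) * frd ?F (at (map_prod ph ps z)) (b, 0))"
 proof -
  have "lsm ?P ?A (%z. Y (fst z) (G b) * frd ?F (at (map_prod ph ps z)) (b, 0))" if "b : Basis" for b
   by (rule lsm_mult[OF MN 2[OF that] 1])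
  then show ?thesis by (rule lsm_sum[OF MN A(1)])
 qed
 then have "lsm ?P ?A (%z. Y (fst z) (%x. F (x, snd z)))"
 proof (rule lsm_cong[OF MN, THEN iffD1, rotated])
  fix z assume z: "z : ?A"
  obtain q h where qh: "z = (q, h)" by fastforce
  then have q: "q : B" "q : U" "h : V" using z B(3) by auto
  let ?D = "frd ?F (at (ph q, ps h))"
  have D: "(?F has_derivative ?D) (at (ph q, ps h))"
   by (rule sm_has_derivative[OF sF]) (use chart_pdom[OF M c(1) q(2)] chart_pdom[OF N d(1) q(3)] in auto)
  moreover have "((%x. (x, ps h)) has_derivative (%w. (w, 0))) (at (ph q))"
   by (auto intro!: derivative_eq_intros)
  ultimately have "((%x. ?F (x, ps h)) has_derivative (%w. ?D (w, 0))) (at (ph q))"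
   by (rule has_derivative_compose[rotated])
  note e = fun_cong[OF frechet_derivative_at[OF this]]
  have "Y q (%x. F (x, h)) = frd (%x. F (?r x, h)) (at (ph q)) (SUM b:Basis. Y q (G b) *\<^sub>R b)"
   by (rule vG[OF q(1) _ cinf_slice1[OF M N F]]) (use Y in "simp add: vector_fields_def")
  also have "... = ?D ((SUM b:Basis. Y q (G b) *\<^sub>R b), 0)"
   using e[of "SUM b:Basis. Y q (G b) *\<^sub>R b"] by (simp add: par_chart[OF N d(1) q(3)])
  also have "((SUM b:Basis. Y q (G b) *\<^sub>R b), 0 :: 'f) = (SUM b:Basis. Y q (G b) *\<^sub>R (b, 0))"
   by (simp add: prod_eq_iff fst_sum snd_sum)
  also have "?D ... = (SUM b:Basis. Y q (G b) * ?D (b, 0))"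
   unfolding linear_sum[OF has_derivative_linear[OF D]] linear_cmul[OF has_derivative_linear[OF D]] by simp
  finally show "(SUM b:Basis. Y (fst z) (G b) * frd ?F (at (map_prod ph ps z)) (b, 0)) = Y (fst z) (%x. F (x, snd z))"
   by (simp add: qh)
 qed
 then show "EX B. z0 : B & lsm ?P B (%z. Y (fst z) (%x. F (x, snd z)))"
  using B(2) d(2) by (intro exI[of _ ?A]) (simp add: mem_Times_iff)
qed

text \<open>The coordinate expression takes values in the model, so projecting to the model does not
  change it, nor its derivative: this is why \<open>A\<close> maps into
  \<open>model N\<close>.\<close>

lemma smooth_map_derivative:
 assumes f: "smooth_map M N f" and c: "(U, ph) : charts M" "p : U" and d: "(V, ps) : charts N" "f p : V"
 obtains A where "((%x. ps (f (par M (U, ph) x))) has_derivative A) (at (ph p))" "range A <= model N"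
  "!!w. tmap N f (dirv M (U, ph) p w) = dirv N (V, ps) (f p) (A w)"
proof -
 let ?r = "par M (U, ph)" and ?s = "par N (V, ps)"
 let ?f = "%x. ps (f (?r x))" and ?X = "{x : pdom M (U, ph). f (?r x) : V}"
 note sf = smooth_map_charts[OF M N f c(1) d(1)]
 have x: "ph p : ?X" using chart_pdom[OF M c] par_chart[OF M c] d(2) by simp
 obtain A where A: "(?f has_derivative A) (at (ph p))" using smv_has_derivative[OF sf x] by blast
 have "((%x. prj (model N) (?f x)) has_derivative (%w. prj (model N) (A w))) (at (ph p))"
  by (rule has_derivative_compose[OF A bounded_linear_imp_has_derivative[OF bounded_linear_prjM[OF N]]])
 then have "(?f has_derivative (%w. prj (model N) (A w))) (at (ph p))"
  by (rule has_derivative_transform_within_open[OF _ smv_open[OF sf] x])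
   (simp add: prjM(3)[OF N] chart_model[OF N d(1)])
 from has_derivative_unique[OF A this] have "range A <= model N" using prjM(2)[OF N] by (metis image_subset_iff)
 moreover have "tmap N f (dirv M (U, ph) p w) = dirv N (V, ps) (f p) (A w)" for w
 proof
  fix g show "tmap N f (dirv M (U, ph) p w) g = dirv N (V, ps) (f p) (A w) g"
  proof (cases "g : cinf N")
   case True
   have "((%x. g (?s x)) has_derivative frd (%x. g (?s x)) (at (ps (f p)))) (at (?f (ph p)))"
    using sm_has_derivative[OF cinf_par[OF N d(1) True] chart_pdom[OF N d]] by (simp add: par_chart[OF M c])
   from has_derivative_compose[OF A this]
   have "((%x. g (?s (?f x))) has_derivative (%w. frd (%x. g (?s x)) (at (ps (f p))) (A w))) (at (ph p))" .
   then have "((%x. g (f (?r x))) has_derivative (%w. frd (%x. g (?s x)) (at (ps (f p))) (A w))) (at (ph p))"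
    by (rule has_derivative_transform_within_open[OF _ smv_open[OF sf] x]) (simp add: par_chart[OF N d(1)])
   from fun_cong[OF frechet_derivative_at[OF this], of w]
   show ?thesis using True smooth_mapD[OF f True] by (simp add: tmap_def dirv_def[OF M] dirv_def[OF N] o_def)
  qed (simp add: tmap_def dirv_def[OF N])
 qed
 ultimately show ?thesis using that A by blast
qed

end

subsection \<open>Local sections of submersions\<close>

context
 fixes M :: "('a::{t2_space,second_countable_topology}, 'e::euclidean_space) manifold"
  and N :: "('b::{t2_space,second_countable_topology}, 'f::euclidean_space) manifold"
 assumes M: "is_manifold M" and N: "is_manifold N"
begin

text \<open>A linear right inverse \<open>L\<close> of the differential spans a slice
  \<open>h\<close> through \<open>a\<close>. Restricted to it, \<open>f\<close> is locally
  invertible, and the section is the slice composed with the inverse.\<close>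

lemma local_section:
 assumes f: "smooth_map M N f" and onto: "TS N (f a) <= tmap N f ` TS M a"
 obtains B s where "open B" "f a : B" "s (f a) = a" "!!y. y : B ==> f (s y) = y"
  "!!g. g : cinf M ==> lsm N B (%y. g (s y))"
proof -
 obtain U ph where c: "(U, ph) : charts M" "a : U" by (rule chart_exists[OF M])
 obtain V ps where d: "(V, ps) : charts N" "f a : V" by (rule chart_exists[OF N])
 let ?r = "par M (U, ph)" and ?S = "model N" and ?p = "prj (model N)"
 let ?f = "%x. ps (f (?r x))" and ?X = "{x : pdom M (U, ph). f (?r x) : V}"
 note sf = smooth_map_charts[OF M N f c(1) d(1)]
 obtain A where A: "(?f has_derivative A) (at (ph a))" "range A <= ?S"
  "!!w. tmap N f (dirv M (U, ph) a w) = dirv N (V, ps) (f a) (A w)"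
  using that by (rule smooth_map_derivative[OF M N f c d])
 have lA: "linear A" by (rule has_derivative_linear[OF A(1)])
 have "EX u. A u = w" if "w : ?S" for w
 proof -
  have "dirv N (V, ps) (f a) w : tmap N f ` TS M a" using onto dirv_tangent[OF N d] by auto
  then obtain v where v: "v : TS M a" "dirv N (V, ps) (f a) w = tmap N f v" by auto
  obtain u where u: "v = dirv M (U, ph) a u" using tangent_dirv[OF M v(1) c] .
  have "w = A u" by (rule dirv_inj[OF N d that]) (use A(2,3) u v in auto)
  then show ?thesis by blast
 qed
 then have AS: "?S <= A ` UNIV" by blast
 obtain L where L: "linear L" "!!w. w : ?S ==> A (L w) = w"
  using linear_exists_right_inverse_on[OF lA subspace_UNIV] AS by blast
 let ?z = "ps (f a)"
 have z: "?z : ?S" "?p ?z = ?z" using chart_model[OF N d] prjM(3)[OF N] by auto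
 define h where "h = (%y. ph a + L (?p (y - ?z)))"
 have bL: "bounded_linear (%y. L (?p y))"
  by (rule bounded_linear_compose[OF L(1)[unfolded linear_conv_bounded_linear] bounded_linear_prjM[OF N]])
 have smh: "smv W h" if "open W" for W
 proof -
  have "smv W (%y. ph a + (L (?p y) - L (?p ?z)))"
   by (intro smv_add smv_diff smv_const smv_linear[OF _ bL] that)
  then show ?thesis by (simp add: h_def linear_diff[OF prjM(1)[OF N]] linear_diff[OF L(1)])
 qed
 let ?W = "h -` ?X"
 have W: "open ?W" using smv_continuous[OF smh[OF open_UNIV]] smv_open[OF sf] by (rule open_vimage[rotated])
 have hz: "h ?z = ph a" by (simp add: h_def linear_0[OF prjM(1)[OF N]] linear_0[OF L(1)])
 have zW: "?z : ?W" using hz chart_pdom[OF M c] par_chart[OF M c] d(2) by simp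
 \<comment> \<open>The summand y - p y makes \<open>G\<close> the identity across the model, so its
   derivative at the base point is the identity of the whole ambient space and the inverse function
   theorem applies. Projecting to the model removes the summand again.\<close>
 define G where "G = (%y. ?f (h y) + (y - ?p y))"
 have smG: "smv ?W G" unfolding G_def
  by (intro smv_add smv_diff smv_compose[OF sf smh[OF W]] smv_linear[OF W] bounded_linear_ident bounded_linear_prjM[OF N]) auto
 have dh: "(h has_derivative (%v. L (?p v))) (at ?z)"
 proof -
  have "((%y. ph a + (L (?p y) - L (?p ?z))) has_derivative (%v. 0 + (L (?p v) - 0))) (at ?z)"
   by (intro has_derivative_add has_derivative_diff has_derivative_const bounded_linear_imp_has_derivative[OF bL])
  then show ?thesis by (simp add: h_def linear_diff[OF prjM(1)[OF N]] linear_diff[OF L(1)])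
 qed
 have "(G has_derivative (%v. A (L (?p v)) + (v - ?p v))) (at ?z)" unfolding G_def
  by (intro has_derivative_add has_derivative_diff has_derivative_ident bounded_linear_imp_has_derivative[OF bounded_linear_prjM[OF N]]
   has_derivative_compose[OF dh, of ?f A]) (use A(1) hz in simp)
 then have dG: "(G has_derivative (%v. v)) (at ?z)" by (simp add: L(2) prjM(2)[OF N])
 obtain U' V' g where g: "open U'" "?z : U'" "U' <= ?W" "open V'" "G ?z : V'" "homeomorphism U' V' G g" "smv V' g"
  using that by (rule smooth_inverse_function[OF smG zW dG])
 have Gz: "G ?z = ?z" using hz par_chart[OF M c] z by (simp add: G_def)
 have gU: "g y : U'" "G (g y) = y" if "y : V'" for y using g(6) that by (auto simp: homeomorphism_def)
 have gz: "g ?z = ?z" using g(6,2) Gz by (metis homeomorphism_apply1)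
 define B where "B = {y\<in>V. ps y : V'}"
 define s where "s = (%y. ?r (h (g (ps y))))"
 have B: "open B" unfolding B_def
  using continuous_open_preimage[OF chart_cont[OF N d(1)] chart_open[OF N d(1)] g(4)] by (simp add: vimage_def Int_def)
 have hX: "h (g y) : ?X" if "y : V'" for y using gU(1)[OF that] g(3) by auto
 show ?thesis
 proof (rule that[OF B])
  show "f a : B" using d(2) g(5) Gz by (simp add: B_def)
  show "s (f a) = a" by (simp add: s_def gz hz par_chart[OF M c])
 next
  fix y assume y: "y : B"
  then have yV: "y : V" "ps y : V'" by (auto simp: B_def)
  have fX: "f (s y) : V" using hX[OF yV(2)] by (simp add: s_def)
  have "?f (h (g (ps y))) + (g (ps y) - ?p (g (ps y))) = ps y" using gU(2)[OF yV(2)] by (simp add: G_def)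
  then have "?p (ps (f (s y)) + (g (ps y) - ?p (g (ps y)))) = ?p (ps y)" by (simp add: s_def)
  then have "ps (f (s y)) = ps y"
   by (simp add: linear_add[OF prjM(1)[OF N]] linear_diff[OF prjM(1)[OF N]] prjM(2,3)[OF N] chart_model[OF N d(1)] fX yV)
  then show "f (s y) = y" using inj_onD[OF chart_inj[OF N d(1)]] fX yV by blast
 next
  fix k assume k: "k : cinf M"
  have "smv V' (%y. h (g y))" by (rule smv_compose[OF smh[OF open_UNIV] g(7)]) simp
  from sm_compose[OF cinf_par[OF M c(1) k] this] have "sm V' (%y. k (?r (h (g y))))" using hX by auto
  from lsm_chart_comp[OF N d(1) this B] show "lsm N B (%y. k (s y))" by (auto simp: B_def s_def)
 qed
qed

text \<open>A smooth injective map has no vector field \<open>V \<noteq> 0\<close> in its kernel: it is constant along the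
 limits of the Euler polygons of \<open>V\<close>, which are not loops. The existence of integral curves is not
 needed.\<close>

lemma vector_field_kernel:
 assumes f: "smooth_map M N f" and inj: "inj f" and V: "V : VF M"
  and ker: "!!p u. u : cinf N ==> V p (%x. u (f x)) = 0"
 shows "V e = (%g. 0)"
proof (rule ccontr)
 assume nz: "V e ~= (%g. 0)"
 have VT: "V p : TS M p" for p using V by (simp add: vector_fields_def)
 obtain U ph where c: "(U, ph) : charts M" "e : U" by (rule chart_exists[OF M])
 obtain F B where B: "open B" "e : B" "B <= U" and F: "!!b. b : Basis ==> F b : cinf M"
  and "!!b q. b : Basis ==> q : B ==> F b q = ph q \<bullet> b"
  "!!b q w. b : Basis ==> q : B ==> dirv M (U, ph) q w (F b) = prj (model M) w \<bullet> b"
  and vF: "!!q v f. q : B ==> v : TS M q ==> f : cinf M ==>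
   v f = frd (%x. f (par M (U, ph) x)) (at (ph q)) (SUM b:Basis. v (F b) *\<^sub>R b)"
  and vm: "!!q v. q : B ==> v : TS M q ==> (SUM b:Basis. v (F b) *\<^sub>R b) : model M"
  using that by (rule chart_functions[OF M c])
 let ?r = "par M (U, ph)" and ?D = "pdom M (U, ph)" and ?x0 = "ph e"
 define om where "om = (%x. SUM b:Basis. V (?r x) (F b) *\<^sub>R b)"
 have smV: "sm ?D (%x. V (?r x) (F b))" if "b : Basis" for b
  using cinf_par[OF M c(1), of "%q. V q (F b)"] V F[OF that] by (simp add: vector_fields_def)
 have co: "continuous_on ?D om" unfolding om_def
  by (intro continuous_on_sum continuous_on_scaleR sm_continuous[OF smV] continuous_on_const)
 define w0 where "w0 = om ?x0"
 have par0: "?r ?x0 = e" by (rule par_chart[OF M c])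
 have w0: "w0 ~= 0"
 proof
  assume z: "w0 = 0"
  have "V e g = 0" for g
  proof (cases "g : cinf M")
   case True
   have "linear (frd (%x. g (?r x)) (at (ph e)))"
    by (rule has_derivative_linear[OF sm_has_derivative[OF cinf_par[OF M c(1) True] chart_pdom[OF M c]]])
   then show ?thesis using vF[OF B(2) VT True] z linear_0 by (simp add: w0_def om_def par0)
  qed (rule tangent_off[OF M VT])
  then show False using nz by auto
 qed
 let ?a = "norm w0"
 let ?X = "{x\<in>?D. ?r x : B}"
 have X: "open ?X" by (rule par_preimage_open[OF M c(1) B(1)])
 have x0X: "?x0 : ?X" using chart_pdom[OF M c] par0 B(2) by simp
 have coX: "continuous_on ?X om" by (rule continuous_on_subset[OF co]) auto
 \<comment> \<open>Here the field has component more than |w0|^2 / 2 along \<open>w0\<close>, which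
   forces the polygons to advance, and length below 2 |w0|, which keeps them near
   \<open>x0\<close>.\<close>
 let ?Y = "?X Int om -` {w. w \<bullet> w0 > ?a\<^sup>2 / 2 & norm w < 2 * ?a}"
 have "open {w. w \<bullet> w0 > ?a\<^sup>2 / 2 & norm w < 2 * ?a}"
  by (intro open_Collect_conj open_Collect_less continuous_intros)
 then have Y: "open ?Y" by (rule continuous_open_preimage[OF coX X])
 have "?x0 : ?Y" using x0X w0 by (simp add: w0_def[symmetric] power2_norm_eq_inner[symmetric])
 then obtain r where r: "r > 0" "cball ?x0 r <= ?Y" using Y open_contains_cball by blast
 let ?K = "cball ?x0 r"
 have KX: "x : ?X" and KD: "x : ?D" and K1: "om x \<bullet> w0 > ?a\<^sup>2 / 2" and K2: "norm (om x) < 2 * ?a" if "x : ?K" for x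
  using r(2) that by auto
 \<comment> \<open>A time span in which a path of speed below 2 |w0| cannot leave the ball of radius
   r.\<close>
 define ep where "ep = r / (2 * ?a)"
 have ep: "ep > 0" "ep * (2 * ?a) = r" using r(1) w0 by (auto simp: ep_def)
 \<comment> \<open>The k-th vertex of the Euler polygon of step size \<open>ep / n\<close> starting
   at \<open>x0\<close>.\<close>
 define X where "X = (%n k. ((%x. x + (ep / real n) *\<^sub>R om x) ^^ k) ?x0)"
 have XS: "X n (Suc k) = X n k + (ep / real n) *\<^sub>R om (X n k)" for n k by (simp add: X_def)
 have inv: "X n k : model M & dist ?x0 (X n k) <= real k * (ep / real n * (2 * ?a)) &
  (X n k - ?x0) \<bullet> w0 >= real k * (ep / real n * (?a\<^sup>2 / 2))" if "n > 0" "k <= n" for n k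
  using that(2)
 proof (induction k)
  case 0 then show ?case by (simp add: X_def chart_model[OF M c])
 next
  case (Suc k)
  let ?s = "ep / real n" and ?y = "X n k"
  have s: "?s > 0" using ep that by simp
  have Sk: "real (Suc k) * z = real k * z + z" for z by (simp add: algebra_simps)
  have IH: "?y : model M" "dist ?x0 ?y <= real k * (?s * (2 * ?a))" "(?y - ?x0) \<bullet> w0 >= real k * (?s * (?a\<^sup>2 / 2))"
   using Suc.IH[OF Suc_leD[OF Suc.prems]] by blast+
  have "real k * (?s * (2 * ?a)) <= real n * (?s * (2 * ?a))"
   by (rule mult_right_mono) (use Suc.prems s ep(1) in auto)
  also have "... = r" using ep(2) that(1) by simp
  finally have xK: "?y : ?K" using IH(2) by simp
  have "om ?y : model M" unfolding om_def by (rule vm[OF _ VT]) (use KX[OF xK] in simp)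
  then have 1: "X n (Suc k) : model M"
   unfolding XS by (intro subspace_add[OF model_subspace[OF M]] subspace_scale[OF model_subspace[OF M]] IH(1))
  have "dist ?x0 (X n (Suc k)) <= dist ?x0 ?y + dist ?y (X n (Suc k))" by (rule dist_triangle)
  also have "dist ?y (X n (Suc k)) = ?s * norm (om ?y)" using s ep(1) by (simp add: XS dist_norm)
  also have "?s * norm (om ?y) <= ?s * (2 * ?a)" by (rule mult_left_mono) (use K2[OF xK] s in auto)
  finally have 2: "dist ?x0 (X n (Suc k)) <= real (Suc k) * (?s * (2 * ?a))" using IH(2) unfolding Sk by linarith
  have "?s * (?a\<^sup>2 / 2) <= ?s * (om ?y \<bullet> w0)" by (rule mult_left_mono) (use K1[OF xK] s in auto)
  then have 3: "(X n (Suc k) - ?x0) \<bullet> w0 >= real (Suc k) * (?s * (?a\<^sup>2 / 2))"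
   using IH(3) unfolding XS Sk by (simp add: inner_add_left inner_diff_left)
  show ?case using 1 2 3 by blast
 qed
 have XK: "X n k : ?K" if "n > 0" "k <= n" for n k
 proof -
  have "real k * (ep / real n * (2 * ?a)) <= real n * (ep / real n * (2 * ?a))"
   by (rule mult_right_mono) (use that ep in auto)
  also have "... = r" using ep(2) that(1) by simp
  finally show ?thesis using inv[OF that] by simp
 qed
 define y where "y = (%n. X (Suc n) (Suc n))"
 have yK: "y n : ?K Int model M" for n using XK[of "Suc n" "Suc n"] inv[of "Suc n" "Suc n"] by (simp add: y_def)
 have yw: "(y n - ?x0) \<bullet> w0 >= ep * (?a\<^sup>2 / 2)" for n
 proof -
  have "real (Suc n) * (ep / real (Suc n) * z) = ep * z" for z by simp
  then show ?thesis using inv[of "Suc n" "Suc n"] unfolding y_def by (metis order_refl zero_less_Suc)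
 qed
 have "compact (?K Int model M)" by (intro compact_Int_closed compact_cball closed_subspace model_subspace[OF M])
 then obtain x1 rh where x1: "x1 : ?K Int model M" "strict_mono rh" "(y \<circ> rh) \<longlonglongrightarrow> x1"
  using yK unfolding compact_def by blast
 have sep: "u (f (?r x1)) = u (f e)" if u: "u : cinf N" for u
 proof -
  let ?u = "%x. u (f (?r x))"
  have su: "sm ?D ?u" by (rule cinf_par[OF M c(1) smooth_mapD[OF f u]])
  have du: "(?u has_derivative frd ?u (at x)) (at x)" if "x : ?D" for x
   by (rule sm_has_derivative[OF su that])
  \<comment> \<open>The derivative of \<open>u\<close> at one point in the direction of the field at
    another. On the diagonal of the model it is zero by hypothesis, and uniform continuity makes it
    small along each segment of a fine polygon.\<close>
  define h where "h = (%z. frd ?u (at (fst z)) (om (snd z)))"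
  have hsum: "h z = (SUM b:Basis. V (?r (snd z)) (F b) * frd ?u (at (fst z)) b)" if "fst z : ?D" for z
   unfolding h_def om_def linear_sum[OF has_derivative_linear[OF du[OF that]]] linear_cmul[OF has_derivative_linear[OF du[OF that]]]
   by simp
  have "continuous_on (?K \<times> ?K) (%z. SUM b:Basis. V (?r (snd z)) (F b) * frd ?u (at (fst z)) b)"
   by (intro continuous_on_sum continuous_on_mult continuous_on_compose2[OF sm_continuous[OF smV] continuous_on_snd[OF continuous_on_id]]
    continuous_on_compose2[OF sm_continuous[OF sm_frechet[OF su]] continuous_on_fst[OF continuous_on_id]]) (use KD in auto)
  then have "continuous_on (?K \<times> ?K) h" by (rule continuous_on_eq) (use hsum KD in auto)
  then have uc: "uniformly_continuous_on (?K \<times> ?K) h"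
   by (rule compact_uniformly_continuous) (intro compact_Times compact_cball)
  have h0: "h (x, x) = 0" if "x : ?K" "x : model M" for x
  proof -
   have q: "?r x : B" "ph (?r x) = x" using KX[OF that(1)] chart_par[OF M c(1)] that(2) prjM(3)[OF M] by auto
   have "V (?r x) (%x. u (f x)) = h (x, x)"
    using vF[OF q(1) VT smooth_mapD[OF f u]] by (simp add: h_def om_def q(2))
   then show ?thesis using ker[OF u] by simp
  qed
  have lim: "(%n. ?u (y n)) \<longlonglongrightarrow> ?u ?x0"
  proof (rule LIMSEQ_I)
   fix de' :: real assume "de' > 0"
   define de where "de = de' / (2 * ep)"
   have de: "de > 0" "ep * de < de'" using \<open>de' > 0\<close> ep(1) by (auto simp: de_def)
   obtain et where et: "et > 0" "!!z z'. z : ?K \<times> ?K ==> z' : ?K \<times> ?K ==> dist z' z < et ==> dist (h z') (h z) < de"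
    using uc de(1) unfolding uniformly_continuous_on_def by metis
   obtain n0 where n0: "real n0 > r / et" using reals_Archimedean2 by blast
   have "norm (?u (y n) - ?u ?x0) < de'" if "n >= n0" for n
   proof -
    let ?n = "Suc n"
    let ?s = "ep / real ?n"
    have s: "?s > 0" using ep by simp
    have "r / et < real ?n" using n0 that by simp
    then have sm: "?s * (2 * ?a) < et" using ep(2) et(1) by (simp add: divide_simps mult.commute)
    have step: "\<bar>?u (X ?n (Suc k)) - ?u (X ?n k)\<bar> <= ?s * de" if k: "Suc k <= ?n" for k
    proof -
     let ?x = "X ?n k"
     have xK: "?x : ?K" "X ?n (Suc k) : ?K" and xm: "?x : model M"
      using XK[of ?n k] XK[of ?n "Suc k"] inv[of ?n k] k by auto
     have seg: "?x + t *\<^sub>R om ?x : ?K" if "0 <= t" "t <= ?s" for t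
     proof -
      define th where "th = t / ?s"
      have th: "0 <= th" "th <= 1" "t = th * ?s"
       using divide_nonneg_pos[OF that(1) s] that(2) pos_divide_le_eq[OF s, of t 1] nonzero_eq_divide_eq[of ?s "t / ?s" t] s unfolding th_def
       by (simp_all only: mult_1_left order_less_imp_not_eq2 times_divide_eq_left nonzero_mult_div_cancel_right nonzero_divide_eq_eq simp_thms not_False_eq_True)
      have "x + (th * s') *\<^sub>R w = (1 - th) *\<^sub>R x + th *\<^sub>R (x + s' *\<^sub>R w)" for x w :: 'e and s'
       by (simp add: algebra_simps)
      then show ?thesis using convexD_alt[OF convex_cball xK th(1,2)] unfolding XS th(3) by metis
     qed
     have der: "((%t. ?u (?x + t *\<^sub>R om ?x)) has_real_derivative h (?x + t *\<^sub>R om ?x, ?x)) (at t)" if "0 <= t" "t <= ?s" for t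
     proof -
      have "((%t. ?x + t *\<^sub>R om ?x) has_derivative (%d. d *\<^sub>R om ?x)) (at t)" by (auto intro!: derivative_eq_intros)
      from has_derivative_compose[OF this du[OF KD[OF seg[OF that]]]]
      have "((%t. ?u (?x + t *\<^sub>R om ?x)) has_derivative (%d. d * h (?x + t *\<^sub>R om ?x, ?x))) (at t)"
       using linear_cmul[OF has_derivative_linear[OF du[OF KD[OF seg[OF that]]]]] by (simp add: h_def)
      then show ?thesis by (simp add: has_field_derivative_def mult_commute_abs)
     qed
     obtain t where t: "0 < t" "t < ?s" "?u (?x + ?s *\<^sub>R om ?x) - ?u (?x + 0 *\<^sub>R om ?x) = (?s - 0) * h (?x + t *\<^sub>R om ?x, ?x)"
      using MVT2[OF s, of "%t. ?u (?x + t *\<^sub>R om ?x)" "%t. h (?x + t *\<^sub>R om ?x, ?x)"] der by blast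
     have "dist (?x + t *\<^sub>R om ?x, ?x) (?x, ?x) = t * norm (om ?x)" using t(1) by (simp add: dist_Pair_Pair dist_norm)
     also have "... <= ?s * (2 * ?a)" by (rule mult_mono) (use t s K2[OF xK(1)] in auto)
     finally have "dist (?x + t *\<^sub>R om ?x, ?x) (?x, ?x) < et" using sm by simp
     then have "dist (h (?x + t *\<^sub>R om ?x, ?x)) (h (?x, ?x)) < de"
      by (intro et(2)) (use xK(1) seg[of t] t in auto)
     then have "\<bar>h (?x + t *\<^sub>R om ?x, ?x)\<bar> <= de" by (simp add: h0[OF xK(1) xm])
     then have "?s * \<bar>h (?x + t *\<^sub>R om ?x, ?x)\<bar> <= ?s * de" by (rule mult_left_mono) (use s in simp)
     then show ?thesis using t(3) abs_of_pos[OF s] unfolding XS by (simp only: abs_mult scaleR_zero_left add_0_right diff_0_right)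
    qed
    have "\<bar>?u (X ?n k) - ?u ?x0\<bar> <= real k * (?s * de)" if "k <= ?n" for k
     using that
    proof (induction k)
     case 0 then show ?case by (simp add: X_def)
    next
     case (Suc k)
     then have "\<bar>?u (X ?n k) - ?u ?x0\<bar> <= real k * (?s * de)" "\<bar>?u (X ?n (Suc k)) - ?u (X ?n k)\<bar> <= ?s * de"
      using step by auto
     moreover have "real (Suc k) * z = real k * z + z" for z by (simp add: algebra_simps)
     ultimately show ?case by (smt (verit))
    qed
    from this[of ?n] have "\<bar>?u (y n) - ?u ?x0\<bar> <= ep * de" by (simp add: y_def)
    then show ?thesis using de(2) by simp
   qed
   then show "EX n0. ALL n>=n0. norm (?u (y n) - ?u ?x0) < de'" by blast
  qed
  have "isCont ?u x1" using sm_continuous[OF su] KD x1(1) sm_open[OF su] by (simp add: continuous_on_eq_continuous_at)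
  from isCont_tendsto_compose[OF this x1(3)] have "(%n. ?u (y (rh n))) \<longlonglongrightarrow> ?u x1" by (simp add: o_def)
  moreover have "(%n. ?u (y (rh n))) \<longlonglongrightarrow> ?u ?x0" using LIMSEQ_subseq_LIMSEQ[OF lim x1(2)] by (simp add: o_def)
  ultimately have "?u x1 = ?u ?x0" by (rule LIMSEQ_unique)
  then show ?thesis by (simp add: par0)
 qed
 \<comment> \<open>The end points of the polygons accumulate at \<open>x1\<close>, which smooth
   functions of \<open>f\<close> cannot tell from \<open>e\<close>. Injectivity identifies the two,
   against the advance along \<open>w0\<close>.\<close>
 have "f (?r x1) = f e" by (rule cinf_separates[OF N]) (rule sep)
 then have "?r x1 = e" using inj by (simp add: inj_eq)
 moreover have "ph (?r x1) = x1" using chart_par[OF M c(1)] KD x1(1) prjM(3)[OF M] by auto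
 ultimately have "x1 = ?x0" by simp
 moreover have "(x1 - ?x0) \<bullet> w0 >= ep * (?a\<^sup>2 / 2)"
 proof (rule LIMSEQ_le_const)
  show "(%n. ((y \<circ> rh) n - ?x0) \<bullet> w0) \<longlonglongrightarrow> (x1 - ?x0) \<bullet> w0" by (intro tendsto_intros x1(3))
 qed (use yw in auto)
 moreover have "ep * (?a\<^sup>2 / 2) > 0" using ep(1) w0 by simp
 ultimately show False by simp
qed

end

subsection \<open>Dimension\<close>

context
 fixes M :: "('a::{t2_space,second_countable_topology}, 'e::euclidean_space) manifold"
  and N :: "('b::{t2_space,second_countable_topology}, 'f::euclidean_space) manifold"
 assumes M: "is_manifold M" and N: "is_manifold N"
begin

text \<open>A differentiable image of a lower dimensional subspace has measure zero. To use this in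
  the ambient space of \<open>N\<close>, the kernel \<open>Z\<close> of the projection to its model
  is added on both sides; the images of finitely or countably many charts would then cover an open
  set.\<close>

lemma surj_smooth_dim:
 assumes f: "smooth_map M N f" and sf: "surj f"
 shows "dim (model N) <= dim (model M)"
proof (rule ccontr)
 assume "~ dim (model N) <= dim (model M)"
 then have less: "dim (model M) < dim (model N)" by simp
 let ?p = "prj (model N)"
 define Z where "Z = {x. ?p x = 0}"
 have lp: "linear ?p" by (rule prjM(1)[OF N])
 have Z: "subspace Z" unfolding Z_def by (rule linear_subspace_kernel[OF lp])
 have sN: "subspace (model N)" by (rule model_subspace[OF N])
 have sM: "subspace (model M)" by (rule model_subspace[OF M])
 have "{x + y |x y. x : model N & y : Z} = UNIV"
 proof -
  have "x = ?p x + (x - ?p x) & ?p x : model N & x - ?p x : Z" for x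
   using prjM(2)[OF N] prjM(3)[OF N] by (auto simp: Z_def linear_diff[OF lp])
  then show ?thesis by blast
 qed
 moreover have "model N Int Z = {0}"
  using prjM(3)[OF N] subspace_0[OF sN] linear_0[OF lp] by (auto simp: Z_def)
 ultimately have dN: "dim (model N) + dim Z = DIM('f)"
  using dim_sums_Int[OF sN Z] by simp
 have sMZ: "subspace (model M \<times> Z)" by (rule subspace_Times[OF sM Z])
 have dMZ: "dim (model M \<times> Z) = dim (model M) + dim Z" by (rule dim_Times[OF sM Z])
 then have "dim (model M \<times> Z) <= dim (UNIV :: 'f set)" using dN less by simp
 then obtain D :: "'f set" where D: "subspace D" "dim D = dim (model M \<times> Z)"
  by (rule choose_subspace_of_subspace) auto
 have nD: "negligible D" by (rule negligible_lowdim) (use D(2) dMZ dN less in simp)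
 \<comment> \<open>The subspace \<open>D\<close> lies in the ambient space of \<open>N\<close> and
   has less than full dimension; it serves as a common domain for all charts of \<open>M\<close>
   times \<open>Z\<close>.\<close>
 obtain T :: "'f => 'e \<times> 'f" where T: "linear T" "T ` D = model M \<times> Z"
  by (rule isometry_subspaces[OF D(1) sMZ D(2)])
 obtain b0 :: 'b where True by simp
 obtain V ps where d: "(V, ps) : charts N" "b0 : V" by (rule chart_exists[OF N])
 \<comment> \<open>Second countability reduces the atlas to countably many domains, as required for
   a union of null sets.\<close>
 obtain \<F> where F: "\<F> <= fst ` charts M" "countable \<F>" "\<Union>\<F> = \<Union>(fst ` charts M)"
  by (rule Lindelof[of "fst ` charts M"]) (use chart_open[OF M] in auto)
 define S where "S = (%c. {x : D. fst (T x) : pdom M c & f (par M c (fst (T x))) : V})"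
 define G where "G = (%c x. ps (f (par M c (fst (T x)))) + snd (T x))"
 define ch where "ch = (%U. SOME c. c : charts M & fst c = U)"
 have ch: "ch U : charts M & fst (ch U) = U" if "U : \<F>" for U
  unfolding ch_def by (rule someI_ex) (use F(1) that in force)
 have neg: "negligible (G c ` S c)" if c: "c : charts M" for c
 proof (rule negligible_differentiable_image_negligible)
  show "negligible (S c)" by (rule negligible_subset[OF nD]) (auto simp: S_def)
  obtain U ph where c': "c = (U, ph)" by fastforce
  show "G c differentiable_on S c" unfolding differentiable_on_def
  proof
   fix x assume x: "x : S c"
   let ?X = "{x : pdom M c. f (par M c x) : V}"
   have "smv ?X (%x. ps (f (par M c x)))" using smooth_map_charts[OF M N f c[unfolded c'] d(1)] c' by simp
   from smv_has_derivative[OF this] x obtain A where A: "((%x. ps (f (par M c x))) has_derivative A) (at (fst (T x)))"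
    by (auto simp: S_def)
   have dT: "(T has_derivative T) (at x)"
    by (rule bounded_linear_imp_has_derivative[OF T(1)[unfolded linear_conv_bounded_linear]])
   have "(G c has_derivative (%h. A (fst (T h)) + snd (T h))) (at x)" unfolding G_def
    by (intro has_derivative_add has_derivative_compose[OF has_derivative_fst[OF dT] A] has_derivative_snd[OF dT])
   then show "G c differentiable at x within S c"
    using differentiableI differentiable_at_withinI by blast
  qed
 qed simp
 have "pdom N (V, ps) <= (\<Union>U\<in>\<F>. G (ch U) ` S (ch U))"
 proof
  fix y assume y: "y : pdom N (V, ps)"
  let ?b = "par N (V, ps) y"
  have b: "?b : V" "ps ?b = ?p y" using par_in[OF N d(1) y] chart_par[OF N d(1) y] by auto
  obtain a where a: "f a = ?b" using sf by (metis surjD)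
  have "a : \<Union>\<F>" using F(3) chart_exists[OF M, of a] by (metis UnionI fst_conv image_eqI)
  then obtain U where U: "U : \<F>" "a : U" by blast
  obtain ph where c: "ch U = (U, ph)" "(U, ph) : charts M" using ch[OF U(1)] by (metis prod.collapse)
  have "(ph a, y - ?p y) : model M \<times> Z"
   using chart_model[OF M c(2) U(2)] prjM(2)[OF N] prjM(3)[OF N] by (auto simp: Z_def linear_diff[OF lp])
  then obtain x where x: "x : D" "T x = (ph a, y - ?p y)" using T(2) by (metis imageE)
  have "x : S (ch U)" using x chart_pdom[OF M c(2) U(2)] par_chart[OF M c(2) U(2)] a b(1) by (simp add: S_def c(1))
  moreover have "G (ch U) x = y" using x par_chart[OF M c(2) U(2)] a b(2) by (simp add: G_def c(1))
  ultimately show "y : (\<Union>U\<in>\<F>. G (ch U) ` S (ch U))" using U(1) by blast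
 qed
 moreover have "negligible (\<Union>U\<in>\<F>. G (ch U) ` S (ch U))"
  by (rule negligible_countable_Union) (use F(2) neg ch in "simp, blast")
 ultimately have "negligible (pdom N (V, ps))" using negligible_subset by blast
 moreover have "ps b0 : pdom N (V, ps)" by (rule chart_pdom[OF N d])
 ultimately show False using open_not_negligible[OF pdom_open[OF N d(1)]] by blast
qed

text \<open>An injective differential has an image of the dimension of \<open>M\<close>, and global
  surjectivity bounds the dimension of \<open>N\<close> by that number; so the image fills the
  tangent space.\<close>

lemma surj_immersion_onto:
 assumes f: "smooth_map M N f" and sf: "surj f" and inj: "inj_on (tmap N f) (TS M a)"
 shows "TS N (f a) <= tmap N f ` TS M a"
proof
 fix v assume v: "v : TS N (f a)"
 obtain U ph where c: "(U, ph) : charts M" "a : U" by (rule chart_exists[OF M])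
 obtain V ps where d: "(V, ps) : charts N" "f a : V" by (rule chart_exists[OF N])
 obtain A where A: "((%x. ps (f (par M (U, ph) x))) has_derivative A) (at (ph a))" "range A <= model N"
  "!!w. tmap N f (dirv M (U, ph) a w) = dirv N (V, ps) (f a) (A w)"
  using that by (rule smooth_map_derivative[OF M N f c d])
 have lA: "linear A" by (rule has_derivative_linear[OF A(1)])
 have sN: "subspace (model N)" by (rule model_subspace[OF N])
 have sM: "subspace (model M)" by (rule model_subspace[OF M])
 have "inj_on A (model M)"
 proof
  fix w w' assume w: "w : model M" "w' : model M" "A w = A w'"
  then have "tmap N f (dirv M (U, ph) a w) = tmap N f (dirv M (U, ph) a w')" by (simp add: A(3))
  from inj_onD[OF inj this dirv_tangent[OF M c] dirv_tangent[OF M c]] show "w = w'"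
   by (rule dirv_inj[OF M c w(1,2)])
 qed
 then have "dim (A ` model M) = dim (model M)"
  by (intro dim_image_eq[OF lA]) (simp add: span_eq_iff[THEN iffD2, OF sM])
 moreover have "A ` model M <= model N" using A(2) by blast
 ultimately have "A ` model M = model N"
  by (intro subspace_dim_equal[OF linear_subspace_image[OF lA sM] sN]) (use surj_smooth_dim[OF f sf] in auto)
 moreover obtain w where w: "w : model N" "v = dirv N (V, ps) (f a) w" using that by (rule tangent_dirv[OF N v d])
 ultimately obtain u where "w = A u" by blast
 then have "v = tmap N f (dirv M (U, ph) a u)" using w(2) A(3) by simp
 then show "v : tmap N f ` TS M a" using dirv_tangent[OF M c] by blast
qed

end

section \<open>Atiyah algebroids\<close>

definition slie_of :: "('m, 'e::euclidean_space, 'v) lie_algebroid => ('m, 'm => 'v) slie" where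
 "slie_of E = \<lparr>rng = cinf (vbase E), car = secs E, sadd = secadd E, sscl = secscale E,
  sanc = (%x m. anchor E m (x m)), sbr = bracket E\<rparr>"

lemma slie_of_sel [simp]: "rng (slie_of E) = cinf (vbase E)" "car (slie_of E) = secs E" "sadd (slie_of E) = secadd E"
 "sscl (slie_of E) = secscale E" "sanc (slie_of E) x m = anchor E m (x m)" "sbr (slie_of E) = bracket E"
 by (simp_all add: slie_of_def)

lemma tangent_algebroid_sel [simp]:
 "vbase (tangent_algebroid M) = M" "fibre (tangent_algebroid M) = TS M"
 "secs (tangent_algebroid M) = VF M" "anchor (tangent_algebroid M) m v = v"
 "bracket (tangent_algebroid M) = vf_bracket" "vadd (tangent_algebroid M) v w = (%f. v f + w f)"
 "vscale (tangent_algebroid M) c v = (%f. c * v f)" "vzero (tangent_algebroid M) m = (%f. 0)"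
 by (simp_all add: tangent_algebroid_def)

lemma tmap_comp: "smooth_map N K g ==> tmap K g (tmap N f v) = tmap K (%x. g (f x)) v"
 by (auto simp: tmap_def smooth_map_def o_def)

lemma tmap_apply: "f : cinf N ==> tmap N ph v f = v (%x. f (ph x))"
 and tmap_off: "f ~: cinf N ==> tmap N ph v f = 0"
 and tmap_plus: "tmap N ph (%f. v f + w f) = (%f. tmap N ph v f + tmap N ph w f)"
 and tmap_times: "tmap N ph (%f. c * v f) = (%f. c * tmap N ph v f)"
 by (auto simp: tmap_def o_def)

context
 fixes M :: "('a::{t2_space,second_countable_topology}, 'e::euclidean_space) manifold"
 assumes M: "is_manifold M"
begin

lemma tangent_closed: "v : TS M p ==> w : TS M p ==> (%f. v f + w f) : TS M p"
 "v : TS M p ==> (%f. c * v f) : TS M p" "(%f. 0) : TS M p"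
 unfolding tangent_space_def by (auto simp: algebra_simps)

lemma vf_tangent: "X : VF M ==> X p : TS M p"
 and vf_smooth: "X : VF M ==> f : cinf M ==> (%p. X p f) : cinf M"
 by (auto simp: vector_fields_def)

lemma cinf_diff: "f : cinf M ==> g : cinf M ==> (%p. f p - g p) : cinf M"
 using func_ring_cinf(2)[OF M _ func_ring_cinf(3)[OF M func_ring_cinf(1)[OF M, of "-1"]]] by (simp add: algebra_simps)

lemma vf_diff: "X : VF M ==> f : cinf M ==> g : cinf M ==> X p (%p. f p - g p) = X p f - X p g"
 using tangent_add[OF M vf_tangent, of X f "%x. -1 * g x" p] tangent_cmult[OF M vf_tangent, of X g p "-1"]
  func_ring_cinf(3)[OF M func_ring_cinf(1)[OF M, of "-1"], of g] by simp

lemma vector_fields_closed: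
 assumes X: "X : VF M" and Y: "Y : VF M"
 shows "(%p f. X p f + Y p f) : VF M" "g : cinf M ==> (%p f. g p * X p f) : VF M"
  "vf_bracket X Y : VF M"
proof -
 show "(%p f. X p f + Y p f) : VF M" unfolding vector_fields_def
  using tangent_closed(1)[OF vf_tangent[OF X] vf_tangent[OF Y]] func_ring_cinf(2)[OF M vf_smooth[OF X] vf_smooth[OF Y]] by simp
 show "(%p f. g p * X p f) : VF M" if g: "g : cinf M" unfolding vector_fields_def
  using tangent_closed(2)[OF vf_tangent[OF X]] func_ring_cinf(3)[OF M g vf_smooth[OF X]] by simp
 have off: "(%q. X q f) = (%q. 0)" "(%q. Y q f) = (%q. 0)" if "f ~: cinf M" for f
  using tangent_off[OF M vf_tangent[OF X] that] tangent_off[OF M vf_tangent[OF Y] that] by auto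
 have "vf_bracket X Y p : TS M p" for p
  unfolding tangent_space_def vf_bracket_def
 proof (intro CollectI conjI ballI allI impI)
  note * = vf_tangent[OF X] vf_tangent[OF Y] vf_smooth[OF X] vf_smooth[OF Y] func_ring_cinf[OF M]
  fix f g assume f: "f : cinf M" and g: "g : cinf M"
  show "X p (%q. Y q (%x. f x + g x)) - Y p (%q. X q (%x. f x + g x)) =
    X p (%q. Y q f) - Y p (%q. X q f) + (X p (%q. Y q g) - Y p (%q. X q g))"
   using f g by (simp add: tangent_add[OF M vf_tangent[OF X]] tangent_add[OF M vf_tangent[OF Y]] *)
  show "X p (%q. Y q (%x. f x * g x)) - Y p (%q. X q (%x. f x * g x)) =
    (X p (%q. Y q f) - Y p (%q. X q f)) * g p + f p * (X p (%q. Y q g) - Y p (%q. X q g))"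
   using f g by (simp add: tangent_mult[OF M vf_tangent[OF X]] tangent_mult[OF M vf_tangent[OF Y]]
    tangent_add[OF M vf_tangent[OF X]] tangent_add[OF M vf_tangent[OF Y]] * algebra_simps)
 next
  fix c f assume f: "f : cinf M"
  show "X p (%q. Y q (%x. c * f x)) - Y p (%q. X q (%x. c * f x)) = c * (X p (%q. Y q f) - Y p (%q. X q f))"
   using f by (simp add: tangent_cmult[OF M vf_tangent[OF X]] tangent_cmult[OF M vf_tangent[OF Y]]
    vf_smooth[OF X] vf_smooth[OF Y] algebra_simps)
 next
  fix f assume f: "f ~: cinf M"
  show "X p (%q. Y q f) - Y p (%q. X q f) = 0"
   unfolding off[OF f] using tangent_const[OF M vf_tangent[OF X]] tangent_const[OF M vf_tangent[OF Y]] by simp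
 qed
 moreover have "(%p. vf_bracket X Y p f) : cinf M" if "f : cinf M" for f
  unfolding vf_bracket_def using that by (intro cinf_diff vf_smooth[OF X] vf_smooth[OF Y])
 ultimately show "vf_bracket X Y : VF M" by (simp add: vector_fields_def)
qed

lemma vector_field_eqI:
 assumes "X : VF M" "Y : VF M" "!!p f. f : cinf M ==> X p f = Y p f"
 shows "X = Y"
 using assms tangent_off[OF M vf_tangent] by (metis (no_types) ext)

lemma slie_jacobi_tangent: "slie_jacobi (slie_of (tangent_algebroid M))"
proof -
 note T = vf_tangent and cl = vector_fields_closed and fr = func_ring_cinf[OF M]
 have uc: "(%p. - f p) : cinf M" if "f : cinf M" for f using fr(3)[OF fr(1)[of "-1"] that] by simp
 note D = vf_smooth cinf_diff fr uc and D' = tangent_add[OF M T] tangent_mult[OF M T] tangent_cmult[OF M T] vf_diff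
 let ?T = "slie_of (tangent_algebroid M)"
 have ca: "sadd ?T x y : VF M" and cb: "sbr ?T x y : VF M"
  if "x : VF M" "y : VF M" for x y
  using cl[OF that] by (simp_all add: secadd_def)
 have cs: "sscl ?T g x : VF M" if "g : cinf M" "x : VF M" for x g
  using cl(2)[OF that(2,2,1)] by (simp add: secscale_def)
 have 1: "br_closed ?T"
  using cl fr by (auto simp: br_closed_def smodule_def func_ring_def secadd_def secscale_def)
 have 2: "slie_alg ?T" unfolding slie_alg_def
 proof (intro conjI ballI allI 1)
  fix x assume x: "x : car ?T"
  show "snull ?T (sbr ?T x x)" using cl(3)[of x x] x by (simp add: snull_def secscale_def vf_bracket_def)
  from x have x: "x : VF M" by simp
  fix y assume "y : car ?T"
  then have y: "y : VF M" by simp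
  note Dxy = D D'[OF x] D'[OF y] x y
  { fix m f assume "f : rng ?T" show "sanc ?T (sadd ?T x y) m f = sanc ?T x m f + sanc ?T y m f" by (simp add: secadd_def) }
  { fix z assume "z : car ?T"
   then have z: "z : VF M" by simp
   show "sbr ?T (sadd ?T x y) z = sadd ?T (sbr ?T x z) (sbr ?T y z)"
    by (rule vector_field_eqI[OF cb[OF ca[OF x y] z] ca[OF cb[OF x z] cb[OF y z]]]) (simp add: secadd_def vf_bracket_def Dxy D'[OF z] z)
   show "sbr ?T z (sadd ?T x y) = sadd ?T (sbr ?T z x) (sbr ?T z y)"
    by (rule vector_field_eqI[OF cb[OF z ca[OF x y]] ca[OF cb[OF z x] cb[OF z y]]]) (simp add: secadd_def vf_bracket_def Dxy D'[OF z] z) }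
  fix g assume "g : rng ?T"
  then have g: "g : cinf M" by simp
  have g': "(%m. - sanc ?T y m g) : cinf M" "(%m. sanc ?T x m g) : cinf M" using g x y by (simp_all add: D)
  show "sbr ?T (sscl ?T g x) y = sadd ?T (sscl ?T g (sbr ?T x y)) (sscl ?T (%m. - sanc ?T y m g) x)"
   by (rule vector_field_eqI[OF cb[OF cs[OF g x] y] ca[OF cs[OF g cb[OF x y]] cs[OF g'(1) x]]])
    (simp add: g secadd_def secscale_def vf_bracket_def Dxy algebra_simps)
  show "sbr ?T x (sscl ?T g y) = sadd ?T (sscl ?T g (sbr ?T x y)) (sscl ?T (%m. sanc ?T x m g) y)"
   by (rule vector_field_eqI[OF cb[OF x cs[OF g y]] ca[OF cs[OF g cb[OF x y]] cs[OF g'(2) y]]])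
    (simp add: g secadd_def secscale_def vf_bracket_def Dxy algebra_simps)
 next
  fix x f m assume "x : car ?T" "f : rng ?T"
  then have x: "x : VF M" "f : cinf M" by simp_all
  show "(%m. sanc ?T x m f) : rng ?T" using x by (simp add: D D'[OF x(1)])
  show "sanc ?T x m (%p. c * f p) = c * sanc ?T x m f" for c
   using x by (simp add: tangent_cmult[OF M T[OF x(1)]])
  fix g assume "g : rng ?T"
  then have g: "g : cinf M" by simp
  show "sanc ?T x m (%p. f p + g p) = sanc ?T x m f + sanc ?T x m g"
   "sanc ?T x m (%p. f p * g p) = sanc ?T x m f * g m + f m * sanc ?T x m g"
   "sanc ?T (sscl ?T g x) m f = g m * sanc ?T x m f" using x g by (simp_all add: D D'[OF x(1)] secscale_def)
 qed
 show ?thesis unfolding slie_jacobi_def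
 proof (intro conjI ballI allI 2)
  fix x y z assume "x : car ?T" "y : car ?T" "z : car ?T"
  then have xyz: "x : VF M" "y : VF M" "z : VF M" by simp_all
  show "sbr ?T (sbr ?T x y) z = sadd ?T (sbr ?T x (sbr ?T y z)) (sscl ?T (%_. - 1) (sbr ?T y (sbr ?T x z)))"
   by (rule vector_field_eqI[OF cb[OF cb[OF xyz(1,2)] xyz(3)] ca[OF cb[OF xyz(1) cb[OF xyz(2,3)]] cs[OF fr(1) cb[OF xyz(2) cb[OF xyz(1,3)]]]]])
    (simp add: secadd_def secscale_def vf_bracket_def D D'[OF xyz(1)] D'[OF xyz(2)] D'[OF xyz(3)] xyz)
 next
  fix x y f m assume "f : rng ?T"
  show "sanc ?T (sbr ?T x y) m f = sanc ?T x m (%p. sanc ?T y p f) - sanc ?T y m (%p. sanc ?T x p f)"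
   by (simp add: vf_bracket_def)
 qed
qed

end

section \<open>Related vector fields and descent of smooth functions\<close>

lemma related_bracket:
 fixes P :: "('a::{t2_space,second_countable_topology}, 'e::euclidean_space) manifold"
  and N :: "('b::{t2_space,second_countable_topology}, 'f::euclidean_space) manifold"
 assumes N: "is_manifold N"
  and V: "V' : VF N" "!!p. V' (ph p) = tmap N ph (V p)"
  and W: "W' : VF N" "!!p. W' (ph p) = tmap N ph (W p)"
 shows "vf_bracket V' W' (ph p) = tmap N ph (vf_bracket V W p)"
proof
 fix f
 show "vf_bracket V' W' (ph p) f = tmap N ph (vf_bracket V W p) f"
 proof (cases "f : cinf N")
  case True
  then show ?thesis using vf_smooth[OF N V(1) True] vf_smooth[OF N W(1) True]
   by (simp add: vf_bracket_def V(2) W(2) tmap_apply)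
 next
  case False
  then show ?thesis
   using tangent_off[OF N vf_tangent[OF N vector_fields_closed(3)[OF N V(1) W(1)]]] by (simp add: tmap_off)
 qed
qed

text \<open>Near each point \<open>g\<close> is its pullback composed with a local section, which is
  smooth although \<open>g\<close> itself is not known to be continuous.\<close>

lemma cinf_descend:
 assumes N: "is_manifold N" and P: "is_manifold P" and ph: "smooth_map N P ph"
  and onto: "!!x. TS P (ph x) <= tmap P ph ` TS N x"
  and surj: "surj ph" and g: "(%x. g (ph x)) : cinf N"
 shows "g : cinf P"
proof (rule cinfI[OF P])
 fix m
 obtain p where p: "ph p = m" using surj by (metis surjD)
 obtain B s where "open B" "ph p : B" "s (ph p) = p" and s: "!!y. y : B ==> ph (s y) = y"
  "!!g. g : cinf N ==> lsm P B (%y. g (s y))"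
  using that by (rule local_section[OF N P ph onto, of p])
 have "lsm P B (%y. g (ph (s y)))" by (rule s(2)[OF g])
 then have "lsm P B g" using lsm_cong[OF P, of B "%y. g (ph (s y))" g] s(1) by simp
 then show "EX B. m : B & lsm P B g" using p \<open>ph p : B\<close> by auto
qed

text \<open>Separated from the 2-bundle because it is used twice: for \<open>P\<close> with the
  semidirect product and for \<open>Q\<close> with \<open>K\<close>.\<close>

locale principal_action =
 fixes P :: "('p::{t2_space,second_countable_topology}, 'pe::euclidean_space) manifold"
  and M :: "('m::{t2_space,second_countable_topology}, 'me::euclidean_space) manifold"
  and G :: "'g monoid" and a :: "'p => 'g => 'p" and pq :: "'p => 'm"
 assumes P: "is_manifold P" and M: "is_manifold M" and grp: "group G" "carrier G = UNIV"
  and smooth_act: "!!g. smooth_map P P (%p. a p g)" and act_one: "!!p. a p \<one>\<^bsub>G\<^esub> = p"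
  and act_mult: "!!p g h. a p (g \<otimes>\<^bsub>G\<^esub> h) = a (a p g) h"
  and free: "!!p g. a p g = p ==> g = \<one>\<^bsub>G\<^esub>"
  and quot: "is_quotient P a M pq"
begin

abbreviation "\<A> == atiyah_algebroid P a M pq"
definition "R g = tmap P (%p. a p g)"
text \<open>Over one point of the base, an orbit of tangent vectors is the graph of an equivariant
  field along the fibre of \<open>pq\<close>. In this notation the operations on orbits become
  pointwise operations on fields.\<close>

definition "graph m V = {(p, V p) | p. pq p = m}"
definition "equivariant m V \<longleftrightarrow> (ALL p. pq p = m --> V p : TS P p & (ALL g. V (a p g) = R g (V p)))"
definition "inv_fields = {V : VF P. ALL p g. V (a p g) = R g (V p)}"

lemma pq: "smooth_map P M pq" "!!g p. pq (a p g) = pq p" "!!p p'. pq p = pq p' ==> EX g. p' = a p g"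
  "!!m. EX p. pq p = m" "!!p. tmap M pq ` TS P p = TS M (pq p)"
 using quot unfolding is_quotient_def submersion_def by (auto simp: surj_def) metis+

lemma pq_onto: "TS M (pq p) <= tmap M pq ` TS P p"
 by (simp add: pq(5))

lemma act_inj: "a p g = a p h ==> g = h"
proof -
 assume "a p g = a p h"
 then have "a (a p h) (inv\<^bsub>G\<^esub> h \<otimes>\<^bsub>G\<^esub> g) = a p h"
  using grp by (simp add: act_mult[symmetric] group.inv_solve_left group.r_inv monoid.m_assoc[symmetric] group.is_monoid)
 then have "inv\<^bsub>G\<^esub> h \<otimes>\<^bsub>G\<^esub> g = \<one>\<^bsub>G\<^esub>" by (rule free)
 then show "g = h" using grp by (metis UNIV_I group.inv_closed group.inv_equality group.inv_inv)
qed

lemma R_tangent: "v : TS P p ==> R g v : TS P (a p g)"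
 unfolding R_def by (rule tmap_tangent[OF P P smooth_act])

lemma R_mult: "R h (R g v) = R (g \<otimes>\<^bsub>G\<^esub> h) v"
 by (simp add: R_def tmap_comp[OF smooth_act] act_mult)

lemma R_one: "v : TS P p ==> R \<one>\<^bsub>G\<^esub> v = v"
 using tangent_off[OF P, of v] by (auto simp: R_def tmap_def act_one o_def)

lemma tmap_pq_R: "tmap M pq (R g v) = tmap M pq v"
 by (simp add: R_def tmap_comp[OF pq(1)] pq(2))

lemma mem_graph [simp]: "(p, v) : graph m V \<longleftrightarrow> pq p = m & v = V p"
 by (auto simp: graph_def)

lemma graph_eq: "graph m V = graph m W \<longleftrightarrow> (ALL p. pq p = m --> V p = W p)"
 by (auto simp: graph_def)

lemma graph_cong: "(!!p. pq p = m ==> V p = W p) ==> graph m V = graph m W"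
 by (simp add: graph_eq)

lemma equivariantD: "equivariant m V ==> pq p = m ==> V p : TS P p"
 "equivariant m V ==> pq p = m ==> V (a p g) = R g (V p)"
 by (auto simp: equivariant_def)

lemma torbit_graph: "equivariant m V ==> pq p = m ==> torbit P a (p, V p) = graph m V"
proof -
 assume V: "equivariant m V" and p: "pq p = m"
 have "tmap P (%p. a p g) (V p) = V (a p g)" for g using equivariantD(2)[OF V p] by (simp add: R_def)
 then have 1: "torbit P a (p, V p) = {(a p g, V (a p g)) | g. True}" by (simp add: torbit_def)
 have "EX g. p' = a p g" if "pq p' = m" for p' using pq(3)[of p p'] p that by simp
 then show ?thesis unfolding 1 by (auto simp: graph_def pq(2) p)
qed

lemma fibre_iff: "x : fibre \<A> m \<longleftrightarrow> (EX V. equivariant m V & x = graph m V)"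
proof
 assume "x : fibre \<A> m"
 then obtain p v where x: "x = torbit P a (p, v)" "pq p = m" "v : TS P p"
  by (auto simp: atiyah_algebroid_def atiyah_fibre_def)
 \<comment> \<open>The division map of the free action. Translating \<open>v\<close> by the element
   that carries \<open>p\<close> to \<open>p'\<close> spreads it to an equivariant field.\<close>
 define de where "de = (%p'. SOME g. p' = a p g)"
 have de: "de (a p g) = g" for g unfolding de_def by (rule some_equality) (auto dest: act_inj)
 have V: "equivariant m (%p'. R (de p') v)" unfolding equivariant_def
 proof (intro allI impI conjI)
  fix p' assume "pq p' = m"
  then obtain g where g: "p' = a p g" using pq(3) x(2) by metis
  show "R (de p') v : TS P p'" using R_tangent[OF x(3)] by (simp add: g de)
  show "R (de (a p' h)) v = R h (R (de p') v)" for h by (simp add: g de R_mult act_mult[symmetric])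
 qed
 have "R (de p) v = v" using R_one[OF x(3)] de[of "\<one>\<^bsub>G\<^esub>"] by (simp add: act_one)
 then show "EX V. equivariant m V & x = graph m V" using torbit_graph[OF V x(2)] V x(1) by auto
next
 assume "EX V. equivariant m V & x = graph m V"
 then obtain V where V: "equivariant m V" "x = graph m V" by blast
 obtain p where p: "pq p = m" using pq(4) by blast
 show "x : fibre \<A> m" using torbit_graph[OF V(1) p] equivariantD(1)[OF V(1) p] V(2) p
  by (auto simp: atiyah_algebroid_def atiyah_fibre_def)
qed

lemma lift_graph: "lift pq (%m. graph m (V m)) p = V (pq p) p"
 by (simp add: lift_def)

lemma inv_fieldsD: "V : inv_fields ==> V : VF P" "V : inv_fields ==> V (a p g) = R g (V p)"
 "V : inv_fields ==> equivariant m V"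
 by (auto simp: inv_fields_def equivariant_def vf_tangent[OF P])

lemma sections_iff: "al : secs \<A> \<longleftrightarrow> lift pq al : inv_fields & al = (%m. graph m (lift pq al))"
proof
 assume "al : secs \<A>"
 then have al: "!!m. al m : fibre \<A> m" "lift pq al : VF P" by (auto simp: atiyah_algebroid_def)
 then obtain V where V: "!!m. equivariant m (V m)" "!!m. al m = graph m (V m)" unfolding fibre_iff by metis
 have l: "lift pq al p = V (pq p) p" for p using lift_graph[of V] V(2) by (simp add: lift_def)
 show "lift pq al : inv_fields & al = (%m. graph m (lift pq al))"
  using al(2) equivariantD(2)[OF V(1)] by (auto simp: inv_fields_def l pq(2) V(2) graph_eq)
next
 assume "lift pq al : inv_fields & al = (%m. graph m (lift pq al))"
 moreover from this have "al m : fibre \<A> m" for m unfolding fibre_iff using inv_fieldsD(3) by metis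
 ultimately show "al : secs \<A>" by (auto simp: inv_fields_def atiyah_algebroid_def)
qed

lemma lift_sec [simp]: "lift pq (%m. graph m V) = V"
 by (rule ext) (simp add: lift_graph)

lemma sec_sections: "V : inv_fields ==> (%m. graph m V) : secs \<A>"
 by (simp add: sections_iff)

lemma sections_cases:
 assumes "al : secs \<A>" obtains V where "V : inv_fields" "al = (%m. graph m V)"
 using assms that unfolding sections_iff by blast

lemma algebroid_sel [simp]: "vbase \<A> = M"
 "vzero \<A> m = graph m (%p f. 0)"
 "vadd \<A> (graph m V) (graph m W) = graph m (%p f. V p f + W p f)"
 "vscale \<A> c (graph m V) = graph m (%p f. c * V p f)"
 "bracket \<A> (%m. graph m V) (%m. graph m W) = (%m. graph m (vf_bracket V W))"
 by (auto simp: atiyah_algebroid_def graph_def[symmetric])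

lemma anchor_graph: "equivariant m V ==> pq p = m ==> anchor \<A> m (graph m V) = tmap M pq (V p)"
proof -
 assume V: "equivariant m V" and p: "pq p = m"
 have eq: "tmap M pq (V p') = tmap M pq (V p)" if m: "pq p' = m" for p'
 proof -
  obtain g where "p' = a p g" using pq(3)[of p p'] m p by metis
  then show ?thesis using equivariantD(2)[OF V p, of g] tmap_pq_R by simp
 qed
 have "anchor \<A> m (graph m V) = (THE w. EX (p, v):graph m V. w = tmap M pq v)" by (simp add: atiyah_algebroid_def)
 also have "... = tmap M pq (V p)"
 proof (rule the_equality)
  show "EX (p', v):graph m V. tmap M pq (V p) = tmap M pq v" using p by (intro bexI[of _ "(p, V p)"]) auto
  fix w assume "EX (p, v):graph m V. w = tmap M pq v"
  then obtain p' where "pq p' = m" "w = tmap M pq (V p')" by (auto simp: graph_def)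
  then show "w = tmap M pq (V p)" using eq by simp
 qed
 finally show ?thesis .
qed

lemma equivariant_closed: "equivariant m V ==> equivariant m W ==> equivariant m (%p f. V p f + W p f)"
 "equivariant m V ==> equivariant m (%p f. c * V p f)" "equivariant m (%p f. 0)"
 using tangent_closed[OF P] by (auto simp: equivariant_def R_def tmap_plus tmap_times) (auto simp: tmap_def)

lemma cinf_pq: "g : cinf M \<longleftrightarrow> (%p. g (pq p)) : cinf P"
 using smooth_mapD[OF pq(1)] cinf_descend[OF P M pq(1) pq_onto] pq(4) by (metis surjI surj_def)

lemma inv_fields_closed:
 assumes V: "V : inv_fields" and W: "W : inv_fields"
 shows "(%p f. V p f + W p f) : inv_fields" "g : cinf M ==> (%p f. g (pq p) * V p f) : inv_fields"
  "vf_bracket V W : inv_fields"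
proof -
 note cl = vector_fields_closed[OF P inv_fieldsD(1)[OF V] inv_fieldsD(1)[OF W]]
 show "(%p f. V p f + W p f) : inv_fields" "g : cinf M ==> (%p f. g (pq p) * V p f) : inv_fields"
  using cl inv_fieldsD(2)[OF V] inv_fieldsD(2)[OF W] cinf_pq
  by (auto simp: inv_fields_def R_def tmap_plus tmap_times pq(2))
 have "vf_bracket V W (a p g) = R g (vf_bracket V W p)" for p g
  unfolding R_def using inv_fieldsD(2)[OF V] inv_fieldsD(2)[OF W]
  by (intro related_bracket[OF P inv_fieldsD(1)[OF V] _ inv_fieldsD(1)[OF W]]) (simp_all add: R_def)
 then show "vf_bracket V W : inv_fields" using cl by (simp add: inv_fields_def)
qed

lemma anchor_sec: "V : inv_fields ==> f : cinf M ==> anchor \<A> (pq p) (graph (pq p) V) f = V p (%q. f (pq q))"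
 using anchor_graph[OF inv_fieldsD(3) refl, of V p] by (simp add: tmap_apply)

lemma sec_ops: "secadd \<A> (%m. graph m V) (%m. graph m W) = (%m. graph m (%p f. V p f + W p f))"
 "secscale \<A> g (%m. graph m V) = (%m. graph m (%p f. g (pq p) * V p f))"
 by (auto simp: secadd_def secscale_def intro!: graph_cong)

text \<open>Every identity is one between vector fields on \<open>P\<close>, transported through the
  graphs of invariant fields. Functions on the base are pulled back along \<open>pq\<close>, and
  anchors are evaluated at an arbitrary point of the fibre.\<close>

lemma slie_jacobi_atiyah: "slie_jacobi (slie_of \<A>)"
proof -
 let ?T = "slie_of (tangent_algebroid P)" and ?A = "slie_of \<A>"
 have J: "slie_jacobi ?T" by (rule slie_jacobi_tangent[OF P])
 then have S: "slie_alg ?T" by (simp add: slie_jacobi_def)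
 note cl = inv_fields_closed and fr = func_ring_cinf[OF M]
 have tT: "sadd ?T V W = (%p f. V p f + W p f)" "sscl ?T g V = (%p f. g p * V p f)" "sbr ?T V W = vf_bracket V W"
  "sanc ?T V p f = V p f" for V W g p f
  by (simp_all add: secadd_def secscale_def)
 have tA: "sadd ?A (%m. graph m V) (%m. graph m W) = (%m. graph m (sadd ?T V W))"
  "sscl ?A g (%m. graph m V) = (%m. graph m (sscl ?T (%p. g (pq p)) V))"
  "sbr ?A (%m. graph m V) (%m. graph m W) = (%m. graph m (sbr ?T V W))" for V W g
  by (simp_all add: sec_ops secadd_def[of "tangent_algebroid P"] secscale_def[of "tangent_algebroid P"])
 have anc: "sanc ?A (%m. graph m V) m f = sanc ?T V p (%q. f (pq q))" if "V : inv_fields" "f : cinf M" "pq p = m" for V f m p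
  using anchor_sec[OF that(1,2)] that(3) by auto
 have ancf: "(%m. sanc ?A (%m. graph m V) m f) : cinf M" if "V : inv_fields" "f : cinf M" for V f
  using vf_smooth[OF P inv_fieldsD(1)[OF that(1)]] that(2) cinf_pq anc[OF that refl] by simp
 have cT: "V : car ?T" if "V : inv_fields" for V using inv_fieldsD(1)[OF that] by simp
 have rT: "(%p. g (pq p)) : rng ?T" if "g : cinf M" for g using that cinf_pq by simp
 have cA: "(%m. graph m V) : car ?A" if "V : inv_fields" for V using sec_sections[OF that] by simp
 have iT: "sadd ?T V W : inv_fields" "g : cinf M ==> sscl ?T (%p. g (pq p)) V : inv_fields" "sbr ?T V W : inv_fields"
  if "V : inv_fields" "W : inv_fields" for V W g using cl[OF that] unfolding tT by simp_all
 have car: "x : car ?A ==> EX V:inv_fields. x = (%m. graph m V)" for x using sections_cases[of x] by auto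
 have r: "rng ?A = cinf M" by simp
 have 1: "br_closed ?A" unfolding br_closed_def smodule_def func_ring_def
  using fr cA iT unfolding r by (auto dest!: car simp: tA simp del: slie_of_sel)
 have 2: "slie_alg ?A" unfolding slie_alg_def r
 proof (intro conjI ballI allI 1)
  fix x assume "x : car ?A"
  then obtain V where V: "V : inv_fields" "x = (%m. graph m V)" using car by blast
  show "snull ?A (sbr ?A x x)" using slie_bracket(5)[OF S cT cT, of V V] V iT(3)[of V V] cA
   unfolding snull_def V(2) tA by simp
  fix y assume "y : car ?A"
  then obtain W where W: "W : inv_fields" "y = (%m. graph m W)" using car by blast
  { fix m f assume f: "f : cinf M"
   obtain p where p: "pq p = m" using pq(4) by blast
   show "sanc ?A (sadd ?A x y) m f = sanc ?A x m f + sanc ?A y m f"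
    unfolding V(2) W(2) tA anc[OF iT(1)[OF V(1) W(1)] f p] anc[OF V(1) f p] anc[OF W(1) f p]
    by (rule slie_anc(6)[OF S cT[OF V(1)] rT[OF f] cT[OF W(1)]]) }
  { fix z assume "z : car ?A"
   then obtain Z where Z: "Z : inv_fields" "z = (%m. graph m Z)" using car by blast
   show "sbr ?A (sadd ?A x y) z = sadd ?A (sbr ?A x z) (sbr ?A y z)" "sbr ?A z (sadd ?A x y) = sadd ?A (sbr ?A z x) (sbr ?A z y)"
    unfolding V(2) W(2) Z(2) tA slie_bracket(1,2)[OF S cT[OF V(1)] cT[OF W(1)] cT[OF Z(1)]] by (rule refl)+ }
  fix g assume g: "g : cinf M"
  have neg: "(%m. - sanc ?A (%m. graph m W) m g) : cinf M"
   using fr(3)[OF fr(1)[of "-1"] ancf[OF W(1) g]] by (simp del: slie_of_sel)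
  show "sbr ?A (sscl ?A g x) y = sadd ?A (sscl ?A g (sbr ?A x y)) (sscl ?A (%m. - sanc ?A y m g) x)"
   unfolding V(2) W(2) tA slie_bracket(3)[OF S cT[OF V(1)] cT[OF W(1)] rT[OF g]] anc[OF W(1) g refl] by (rule refl)
  show "sbr ?A x (sscl ?A g y) = sadd ?A (sscl ?A g (sbr ?A x y)) (sscl ?A (%m. sanc ?A x m g) y)"
   unfolding V(2) W(2) tA slie_bracket(4)[OF S cT[OF V(1)] cT[OF W(1)] rT[OF g]] anc[OF V(1) g refl] by (rule refl)
 next
  fix x f m assume "x : car ?A" and f: "f : cinf M"
  then obtain V where V: "V : inv_fields" "x = (%m. graph m V)" using car by blast
  obtain p where p: "pq p = m" using pq(4) by blast
  show "(%m. sanc ?A x m f) : cinf M" using ancf V f by blast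
  show "sanc ?A x m (%p. c * f p) = c * sanc ?A x m f" for c
   unfolding V(2) anc[OF V(1) f p] anc[OF V(1) fr(3)[OF fr(1) f] p] by (rule slie_anc(2)[OF S cT[OF V(1)] rT[OF f]])
  fix g assume g: "g : cinf M"
  note s = slie_anc[OF S cT[OF V(1)] rT[OF f]]
  show "sanc ?A x m (%p. f p + g p) = sanc ?A x m f + sanc ?A x m g"
   unfolding V(2) anc[OF V(1) f p] anc[OF V(1) g p] anc[OF V(1) fr(2)[OF f g] p] by (rule s(3)[OF rT[OF g]])
  show "sanc ?A x m (%p. f p * g p) = sanc ?A x m f * g m + f m * sanc ?A x m g"
   unfolding V(2) anc[OF V(1) f p] anc[OF V(1) g p] anc[OF V(1) fr(3)[OF f g] p] s(4)[OF rT[OF g]] p by (rule refl)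
  show "sanc ?A (sscl ?A g x) m f = g m * sanc ?A x m f"
   unfolding V(2) tA anc[OF V(1) f p] anc[OF iT(2)[OF V(1) V(1) g] f p] s(5)[OF rT[OF g]] p by (rule refl)
 qed
 show ?thesis unfolding slie_jacobi_def r
 proof (intro conjI ballI allI 2)
  fix x y assume "x : car ?A" "y : car ?A"
  then obtain V W where V: "V : inv_fields" "x = (%m. graph m V)" and W: "W : inv_fields" "y = (%m. graph m W)" using car by blast
  note Jc = J[unfolded slie_jacobi_def, THEN conjunct2, rule_format, OF cT[OF V(1)] cT[OF W(1)]]
  { fix z assume "z : car ?A"
   then obtain Z where Z: "Z : inv_fields" "z = (%m. graph m Z)" using car by blast
   show "sbr ?A (sbr ?A x y) z = sadd ?A (sbr ?A x (sbr ?A y z)) (sscl ?A (%_. - 1) (sbr ?A y (sbr ?A x z)))"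
    unfolding V(2) W(2) Z(2) tA Jc[THEN conjunct1, rule_format, OF cT[OF Z(1)]] by (rule refl) }
  fix f m assume f: "f : cinf M"
  obtain p where p: "pq p = m" using pq(4) by blast
  show "sanc ?A (sbr ?A x y) m f = sanc ?A x m (%p. sanc ?A y p f) - sanc ?A y m (%p. sanc ?A x p f)"
   unfolding V(2) W(2) tA anc[OF iT(3)[OF V(1) W(1)] f p] anc[OF V(1) ancf[OF W(1) f] p] anc[OF W(1) ancf[OF V(1) f] p]
    anc[OF V(1) f refl] anc[OF W(1) f refl]
   using Jc[THEN conjunct2, rule_format, OF rT[OF f]] .
 qed
qed

text \<open>Sections are separated by the 1-forms \<open>al \<mapsto> ze (al(s) f)\<close>, \<open>ze\<close> a bump function supported in the domain
 of a local section \<open>s\<close> of \<open>pq\<close>.\<close>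

lemma sections_separate:
 assumes al: "al : secs \<A>" and eq: "!!xi. (ALL b:secs \<A>. xi b : cinf M) ==>
   (ALL b:secs \<A>. ALL c:secs \<A>. xi (secadd \<A> b c) = (%m. xi b m + xi c m)) ==>
   (ALL g:cinf M. ALL b:secs \<A>. xi (secscale \<A> g b) = (%m. g m * xi b m)) ==> xi al = (%m. 0)"
 shows "al = vzero \<A>"
proof -
 obtain V where V: "V : inv_fields" "al = (%m. graph m V)" using al by (rule sections_cases)
 have "V p f = 0" if f: "f : cinf P" for p f
 proof -
  obtain B s where s: "open B" "pq p : B" "s (pq p) = p" "!!y. y : B ==> pq (s y) = y"
   "!!g. g : cinf P ==> lsm M B (%y. g (s y))"
   using that by (rule local_section[OF P M pq(1) pq_onto, of p])
  obtain ze C K where ze: "ze : cinf M" "open C" "pq p : C" "C <= B" "!!q. q : C ==> ze q = 1"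
   "closed K" "K <= B" "!!q. q ~: K ==> ze q = 0"
   using that by (rule bump[OF M s(1,2)])
  define xi where "xi = (%\<beta> m. if m : B then ze m * lift pq \<beta> (s m) f else 0)"
  have "xi al = (%m. 0)"
  proof (rule eq; intro ballI)
   fix b assume "b : secs \<A>"
   then obtain X where X: "X : inv_fields" "b = (%m. graph m X)" by (rule sections_cases)
   show "xi b : cinf M"
   proof (rule cinfI[OF M])
    fix m
    have "lsm M B (%m. ze m * X (s m) f)"
     by (intro lsm_mult[OF M] cinf_lsm[OF M ze(1) s(1)] s(5) vf_smooth[OF P inv_fieldsD(1)[OF X(1)] f])
    then have 1: "lsm M B (xi b)" using lsm_cong[OF M, of B "%m. ze m * X (s m) f" "xi b"] by (simp add: xi_def X(2))
    have "lsm M (- K) (%m. 0)" using lsm_const[OF M open_Compl[OF ze(6)]] by simp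
    then have 2: "lsm M (- K) (xi b)" using lsm_cong[OF M, of "-K" "%m. 0" "xi b"] ze(8) by (simp add: xi_def)
    show "EX B. m : B & lsm M B (xi b)" using 1 2 ze(7) by blast
   qed
   { fix c assume "c : secs \<A>"
    then obtain Y where Y: "Y : inv_fields" "c = (%m. graph m Y)" by (rule sections_cases)
    show "xi (secadd \<A> b c) = (%m. xi b m + xi c m)" by (auto simp: xi_def X(2) Y(2) sec_ops algebra_simps) }
   fix g assume "g : cinf M"
   show "xi (secscale \<A> g b) = (%m. g m * xi b m)" using s(4) by (auto simp: xi_def X(2) sec_ops)
  qed
  then have "xi al (pq p) = 0" by simp
  then show ?thesis using s(2,3) ze(3,5) by (simp add: xi_def V(2))
 qed
 then have "V = (%p f. 0)" using tangent_off[OF P vf_tangent[OF P inv_fieldsD(1)[OF V(1)]]] by (metis ext)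
 then show ?thesis by (auto simp: V(2))
qed

end

section \<open>The Atiyah LA-groupoid\<close>

text \<open>An equivariant map of principal bundles over the identity of the base. Its instances are
  the source, the target and the unit of the groupoid.\<close>

locale principal_morphism = D: principal_action P M G a pq + C: principal_action P' M G' a' pq'
 for P :: "('p::{t2_space,second_countable_topology}, 'pe::euclidean_space) manifold"
  and M :: "('m::{t2_space,second_countable_topology}, 'me::euclidean_space) manifold"
  and G :: "'g monoid" and a pq
  and P' :: "('q::{t2_space,second_countable_topology}, 'qe::euclidean_space) manifold"
  and G' :: "'h monoid" and a' pq' +
 fixes ph th
 assumes ph: "smooth_map P P' ph" and ph_act: "!!p g. ph (a p g) = a' (ph p) (th g)" and ph_proj: "!!p. pq' (ph p) = pq p"
begin

text \<open>\<open>push V\<close> is the equivariant vector field \<open>ph\<close>-related to \<open>V\<close>.\<close>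

definition "push V p' = (let pg = SOME pg. a' (ph (fst pg)) (snd pg) = p' in C.R (snd pg) (tmap P' ph (V (fst pg))))"

lemma reach: "EX p g. a' (ph p) g = p' & pq p = pq' p'"
proof -
 obtain p where p: "pq p = pq' p'" using D.pq(4) by blast
 then show ?thesis using C.pq(3)[of "ph p" p'] ph_proj by metis
qed

text \<open>Independence of the choice made in \<open>push\<close>. Two representations of a point
  differ by an element of the first structure group; \<open>th\<close> carries it to the second
  group, where freeness turns it into the change of \<open>g\<close>.\<close>

lemma push_act:
 assumes V: "D.equivariant m V" and p: "pq p = m"
 shows "push V (a' (ph p) g) = C.R g (tmap P' ph (V p))"
proof -
 define pg where "pg = (SOME pg. a' (ph (fst pg)) (snd pg) = a' (ph p) g)"
 have "a' (ph (fst pg)) (snd pg) = a' (ph p) g" unfolding pg_def by (rule someI[of _ "(p, g)"]) simp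
 then obtain p1 g1 where 1: "pg = (p1, g1)" "a' (ph p1) g1 = a' (ph p) g" by (cases pg) auto
 then have "pq p1 = m" using C.pq(2) ph_proj p by metis
 then obtain k where k: "p = a p1 k" using D.pq(3) p by metis
 then have "a' (ph p1) g1 = a' (ph p1) (th k \<otimes>\<^bsub>G'\<^esub> g)" using 1(2) by (simp add: ph_act C.act_mult)
 then have g1: "g1 = th k \<otimes>\<^bsub>G'\<^esub> g" by (rule C.act_inj)
 have "V p = D.R k (V p1)" using D.equivariantD(2)[OF V \<open>pq p1 = m\<close>] k by simp
 then have "tmap P' ph (V p) = C.R (th k) (tmap P' ph (V p1))"
  by (simp add: D.R_def C.R_def tmap_comp[OF ph] tmap_comp[OF C.smooth_act] ph_act)
 then show ?thesis by (simp add: push_def pg_def[symmetric] 1(1) g1 C.R_mult)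
qed

lemma push_related:
 assumes V: "D.equivariant m V" and p: "pq p = m"
 shows "push V (ph p) = tmap P' ph (V p)"
 using push_act[OF assms, of "\<one>\<^bsub>G'\<^esub>"] C.R_one[OF tmap_tangent[OF D.P C.P ph D.equivariantD(1)[OF assms]]]
 by (simp add: C.act_one)

lemma push_equivariant: "D.equivariant m V ==> C.equivariant m (push V)"
 unfolding C.equivariant_def
proof (intro allI impI)
 fix p' assume V: "D.equivariant m V" and p': "pq' p' = m"
 obtain p g where p: "a' (ph p) g = p'" "pq p = m" using reach p' by blast
 have "push V p' : TS P' p'"
  using C.R_tangent[OF tmap_tangent[OF D.P C.P ph D.equivariantD(1)[OF V p(2)]], of g] push_act[OF V p(2), of g] p(1) by simp
 moreover have "push V (a' p' h) = C.R h (push V p')" for h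
  using push_act[OF V p(2)] p(1) by (simp add: C.R_mult C.act_mult[symmetric] flip: p(1))
 ultimately show "push V p' : TS P' p' & (ALL h. push V (a' p' h) = C.R h (push V p'))" by blast
qed

text \<open>The image of \<open>ph\<close> meets every orbit, so an equivariant field is determined
  along it. Identities between pushed fields are checked in this way.\<close>

lemma equivariant_unique:
 assumes "C.equivariant m X" "C.equivariant m Y" "!!p. pq p = m ==> X (ph p) = Y (ph p)" "pq' p' = m"
 shows "X p' = Y p'"
proof -
 obtain p g where p: "a' (ph p) g = p'" "pq p = m" using reach assms(4) by blast
 then show ?thesis using C.equivariantD(2)[OF assms(1), of "ph p" g] C.equivariantD(2)[OF assms(2), of "ph p" g] assms(3) ph_proj by simp
qed

lemma graph_push_image:
 assumes V: "D.equivariant m V" and "!!p'. EX p. ph p = p'"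
 shows "{(ph p, tmap P' ph v) | p v. (p, v) : D.graph m V} = C.graph m (push V)"
proof -
 have "(EX p. p' = ph p & v' = tmap P' ph (V p) & pq p = m) \<longleftrightarrow> pq' p' = m & v' = push V p'" for p' v'
  using push_related[OF V] ph_proj assms(2)[of p'] by metis
 then show ?thesis by (auto simp: C.graph_def)
qed

lemma graph_push_orbits:
 assumes V: "D.equivariant m V"
 shows "(\<Union>(p, v)\<in>D.graph m V. torbit P' a' (ph p, tmap P' ph v)) = C.graph m (push V)"
proof -
 have "torbit P' a' (ph p, tmap P' ph (V p)) = C.graph m (push V)" if "pq p = m" for p
  using C.torbit_graph[OF push_equivariant[OF V], of "ph p"] push_related[OF V that] ph_proj that by simp
 moreover obtain p where "pq p = m" using D.pq(4) by blast
 ultimately show ?thesis by (auto simp: D.graph_def)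
qed

text \<open>A smooth right inverse of \<open>ph\<close> expresses the pushed field by values of
  \<open>V\<close> along it. Source and target have the unit as right inverse; the unit in general
  has none, and \<open>unit_smooth\<close> takes another way.\<close>

lemma push_smooth:
 assumes V: "V : D.inv_fields" and si: "smooth_map P' P si" "!!q. ph (si q) = q"
 shows "push V : VF P'"
proof -
 have 1: "push V q f = V (si q) (%p. f (ph p))" if "f : cinf P'" for q f
  using push_related[OF D.inv_fieldsD(3)[OF V] refl, of "si q"] that si(2) by (simp add: tmap_apply)
 have "(%q. push V q f) : cinf P'" if "f : cinf P'" for f
  unfolding 1[OF that] by (rule smooth_mapD[OF si(1) vf_smooth[OF D.P D.inv_fieldsD(1)[OF V] smooth_mapD[OF ph that]]])
 moreover have "push V q : TS P' q" for q
  using C.equivariantD(1)[OF push_equivariant[OF D.inv_fieldsD(3)[OF V]] refl] .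
 ultimately show ?thesis by (simp add: vector_fields_def)
qed

section \<open>Pushing forward as a morphism of Lie algebroids\<close>

context
 fixes \<Phi>
 assumes \<Phi>: "!!m V. D.equivariant m V ==> \<Phi> m (D.graph m V) = C.graph m (push V)"
  and sm: "!!V. V : D.inv_fields ==> push V : VF P'"
begin

lemma push_inv: "V : D.inv_fields ==> push V : C.inv_fields"
 using sm C.equivariantD(2)[OF push_equivariant[OF D.inv_fieldsD(3)]] by (auto simp: C.inv_fields_def)

lemma push_sec: "V : D.inv_fields ==> secmap \<Phi> (%m. D.graph m V) = (%m. C.graph m (push V))"
 by (simp add: secmap_def \<Phi> D.inv_fieldsD(3))

lemma push_bundle_map: "bundle_map D.\<A> C.\<A> \<Phi>"
 unfolding bundle_map_def
proof (intro conjI ballI allI)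
 fix m x assume "x : fibre D.\<A> m"
 then obtain V where V: "D.equivariant m V" "x = D.graph m V" using D.fibre_iff by blast
 show "\<Phi> m x : fibre C.\<A> m" using push_equivariant[OF V(1)] by (auto simp: V(2) \<Phi>[OF V(1)] C.fibre_iff)
 { fix c
  note e = D.equivariant_closed(2)[OF V(1), of c]
  have "push (%p f. c * V p f) p' = (%f. c * push V p' f)" if "pq' p' = m" for p'
   by (rule equivariant_unique[OF push_equivariant[OF e] C.equivariant_closed(2)[OF push_equivariant[OF V(1)]] _ that])
    (simp add: push_related[OF e] push_related[OF V(1)] tmap_times)
  then show "\<Phi> m (vscale D.\<A> c x) = vscale C.\<A> c (\<Phi> m x)" by (simp add: V(2) \<Phi>[OF V(1)] \<Phi>[OF e] C.graph_eq) }
 fix y assume "y : fibre D.\<A> m"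
 then obtain W where W: "D.equivariant m W" "y = D.graph m W" using D.fibre_iff by blast
 note e = D.equivariant_closed(1)[OF V(1) W(1)]
 have "push (%p f. V p f + W p f) p' = (%f. push V p' f + push W p' f)" if "pq' p' = m" for p'
  by (rule equivariant_unique[OF push_equivariant[OF e] C.equivariant_closed(1)[OF push_equivariant[OF V(1)] push_equivariant[OF W(1)]] _ that])
   (simp add: push_related[OF e] push_related[OF V(1)] push_related[OF W(1)] tmap_plus)
 then show "\<Phi> m (vadd D.\<A> x y) = vadd C.\<A> (\<Phi> m x) (\<Phi> m y)"
  by (simp add: V(2) W(2) \<Phi>[OF V(1)] \<Phi>[OF W(1)] \<Phi>[OF e] C.graph_eq)
next
 fix al assume "al : secs D.\<A>"
 then obtain V where V: "V : D.inv_fields" "al = (%m. D.graph m V)" by (rule D.sections_cases)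
 then show "secmap \<Phi> al : secs C.\<A>" using push_sec C.sec_sections[OF push_inv] by simp
qed

lemma push_bracket:
 assumes x: "al : secs D.\<A>" "\<beta> : secs D.\<A>"
 shows "secmap \<Phi> (bracket D.\<A> al \<beta>) = bracket C.\<A> (secmap \<Phi> al) (secmap \<Phi> \<beta>)"
proof -
 obtain V where V: "V : D.inv_fields" "al = (%m. D.graph m V)" using x(1) by (rule D.sections_cases)
 obtain W where W: "W : D.inv_fields" "\<beta> = (%m. D.graph m W)" using x(2) by (rule D.sections_cases)
 note b = D.inv_fields_closed(3)[OF V(1) W(1)]
 have eq: "push (vf_bracket V W) p = vf_bracket (push V) (push W) p" for p
 proof (rule equivariant_unique[OF push_equivariant[OF D.inv_fieldsD(3)[OF b]]
   C.inv_fieldsD(3)[OF C.inv_fields_closed(3)[OF push_inv[OF V(1)] push_inv[OF W(1)]]] _ refl])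
  fix p
  show "push (vf_bracket V W) (ph p) = vf_bracket (push V) (push W) (ph p)"
   unfolding push_related[OF D.inv_fieldsD(3)[OF b] refl]
   by (rule related_bracket[OF C.P sm[OF V(1)] _ sm[OF W(1)], symmetric])
    (simp_all add: push_related[OF D.inv_fieldsD(3)[OF V(1)] refl] push_related[OF D.inv_fieldsD(3)[OF W(1)] refl])
 qed
 show ?thesis by (simp add: V(2) W(2) push_sec[OF V(1)] push_sec[OF W(1)] push_sec[OF b], intro ext C.graph_cong eq)
qed

lemma push_anchor: "x : fibre D.\<A> m ==> anchor C.\<A> m (\<Phi> m x) = anchor D.\<A> m x"
proof -
 assume "x : fibre D.\<A> m"
 then obtain V where V: "D.equivariant m V" "x = D.graph m V" using D.fibre_iff by blast
 obtain p where p: "pq p = m" using D.pq(4) by blast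
 show ?thesis using C.anchor_graph[OF push_equivariant[OF V(1)], of "ph p"] D.anchor_graph[OF V(1) p] p
  by (simp add: V(2) \<Phi>[OF V(1)] ph_proj push_related[OF V(1) p] tmap_comp[OF C.pq(1)])
qed

end

end

section \<open>The 2-group, its action, and the parametrisation of the arrows\<close>

locale principal_two_bundle =
 fixes B :: "('p::{t2_space,second_countable_topology}, 'pe::euclidean_space,
   'q::{t2_space,second_countable_topology}, 'qe::euclidean_space,
   'm::{t2_space,second_countable_topology}, 'me::euclidean_space,
   'h::{t2_space,second_countable_topology}, 'he::euclidean_space,
   'k::{t2_space,second_countable_topology}, 'ke::euclidean_space) two_bundle"
 assumes B: "principal_2_bundle B"
begin

abbreviation "P == Pman B"
abbreviation "Q == Qman B"
abbreviation "H == hgrp (xmod B)"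
abbreviation "K == kgrp (xmod B)"
abbreviation "HK == semidirect (xmod B)"
abbreviation mulH (infixl "*H" 70) where "x *H y == mult H x y"
abbreviation mulK (infixl "*K" 70) where "x *K y == mult K x y"
abbreviation mulS (infixl "*S" 70) where "x *S y == mult HK x y"
abbreviation "bnd == bd (xmod B)"
abbreviation "ac == act (xmod B)"
abbreviation "\<s> == src (grpd B)"
abbreviation "\<t> == tgt (grpd B)"
abbreviation "\<u> == unt (grpd B)"

lemma manifolds: "is_manifold P" "is_manifold Q" "is_manifold (Mman B)" "is_manifold (Hman B)" "is_manifold (Kman B)"
 "is_manifold (PM (Hman B) (Kman B))"
 using B by (auto simp: principal_2_bundle_def is_lie_groupoid_def is_lie_crossed_module_def is_lie_group_def intro: is_manifold_prod)

lemma groups: "group H" "group K" "carrier H = UNIV" "carrier K = UNIV" "bnd : hom H K"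
 "!!k x y. ac k (x *H y) = ac k x *H ac k y" "!!h. ac \<one>\<^bsub>K\<^esub> h = h" "!!k l h. ac (k *K l) h = ac k (ac l h)"
 "!!x y. ac (bnd x) y = x *H y *H inv\<^bsub>H\<^esub> x"
 using B by (auto simp: principal_2_bundle_def is_lie_crossed_module_def is_lie_group_def)

lemma smooths: "smooth_map (PM (Hman B) (Hman B)) (Hman B) (%(a, b). a *H b)"
 "smooth_map (Kman B) (Kman B) (%a. inv\<^bsub>K\<^esub> a)" "smooth_map (Hman B) (Kman B) bnd"
 "smooth_map (PM P (PM (Hman B) (Kman B))) P (%(p, g). actP B p g)"
 "smooth_map (PM Q (Kman B)) Q (%(p, g). actQ B p g)"
 "smooth_map P Q \<s>" "smooth_map P Q \<t>" "smooth_map Q P \<u>"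
 "smooth_map_on (PM P P) {(x, y). \<s> x = \<t> y} P (%(x, y). comp (grpd B) x y)"
 using B by (auto simp: principal_2_bundle_def is_lie_crossed_module_def is_lie_group_def smooth_right_action_def
   is_lie_groupoid_def submersion_def)

lemma acts: "!!p. actP B p \<one>\<^bsub>HK\<^esub> = p" "!!p g h. actP B p (g *S h) = actP B (actP B p g) h"
 "!!p. actQ B p \<one>\<^bsub>K\<^esub> = p" "!!p g h. actQ B p (g *K h) = actQ B (actQ B p g) h"
 "!!p g. actP B p g = p ==> g = \<one>\<^bsub>HK\<^esub>" "!!p g. actQ B p g = p ==> g = \<one>\<^bsub>K\<^esub>"
 "is_quotient P (actP B) (Mman B) (projP B)" "is_quotient Q (actQ B) (Mman B) (projQ B)"
 "!!p g. \<s> (actP B p g) = actQ B (\<s> p) (src (two_group (xmod B)) g)"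
 "!!p g. \<t> (actP B p g) = actQ B (\<t> p) (tgt (two_group (xmod B)) g)"
 "!!q k. \<u> (actQ B q k) = actP B (\<u> q) (unt (two_group (xmod B)) k)"
 "!!p. projQ B (\<t> p) = projQ B (\<s> p)"
 "!!p p' g g'. \<s> p = \<t> p' ==> src (two_group (xmod B)) g = tgt (two_group (xmod B)) g' ==>
  comp (grpd B) (actP B p g) (actP B p' g') = actP B (comp (grpd B) p p') (comp (two_group (xmod B)) g g')"
 using B by (auto simp: principal_2_bundle_def smooth_right_action_def free_action_def)

lemma grpd: "!!q. \<s> (\<u> q) = q" "!!q. \<t> (\<u> q) = q" "!!x. comp (grpd B) x (\<u> (\<s> x)) = x"
 "!!x y. \<s> x = \<t> y ==> \<s> (comp (grpd B) x y) = \<s> y"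
 using B by (auto simp: principal_2_bundle_def is_lie_groupoid_def is_groupoid_def)

lemma two_group_sel [simp]: "src (two_group (xmod B)) = snd" "tgt (two_group (xmod B)) (h, k) = bnd h *K k"
 "unt (two_group (xmod B)) k = (\<one>\<^bsub>H\<^esub>, k)" "comp (two_group (xmod B)) (h', k') (h, k) = (h' *H h, k)"
 "\<one>\<^bsub>HK\<^esub> = (\<one>\<^bsub>H\<^esub>, \<one>\<^bsub>K\<^esub>)" "(h, k) *S (h', k') = (h *H ac k h', k *K k')"
 by (simp_all add: two_group_def semidirect_def)

lemma mon [simp]: "\<one>\<^bsub>H\<^esub> *H x = x" "x *H \<one>\<^bsub>H\<^esub> = x" "\<one>\<^bsub>K\<^esub> *K k = k" "k *K \<one>\<^bsub>K\<^esub> = k"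
 "x *H y *H z = x *H (y *H z)" "k *K l *K n = k *K (l *K n)"
 "inv\<^bsub>H\<^esub> x *H x = \<one>\<^bsub>H\<^esub>" "x *H inv\<^bsub>H\<^esub> x = \<one>\<^bsub>H\<^esub>" "inv\<^bsub>K\<^esub> k *K k = \<one>\<^bsub>K\<^esub>" "k *K inv\<^bsub>K\<^esub> k = \<one>\<^bsub>K\<^esub>"
 "inv\<^bsub>H\<^esub> x *H (x *H y) = y" "x *H (inv\<^bsub>H\<^esub> x *H y) = y" "inv\<^bsub>H\<^esub> (inv\<^bsub>H\<^esub> x) = x"
proof -
 interpret H: group H by (rule groups(1))
 interpret K: group K by (rule groups(2))
 show "\<one>\<^bsub>H\<^esub> *H x = x" "x *H \<one>\<^bsub>H\<^esub> = x" "\<one>\<^bsub>K\<^esub> *K k = k" "k *K \<one>\<^bsub>K\<^esub> = k"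
  "x *H y *H z = x *H (y *H z)" "k *K l *K n = k *K (l *K n)"
  "inv\<^bsub>H\<^esub> x *H x = \<one>\<^bsub>H\<^esub>" "x *H inv\<^bsub>H\<^esub> x = \<one>\<^bsub>H\<^esub>" "inv\<^bsub>K\<^esub> k *K k = \<one>\<^bsub>K\<^esub>" "k *K inv\<^bsub>K\<^esub> k = \<one>\<^bsub>K\<^esub>"
  "inv\<^bsub>H\<^esub> (inv\<^bsub>H\<^esub> x) = x"
  by (simp_all add: groups(3,4) H.m_assoc K.m_assoc)
 show "inv\<^bsub>H\<^esub> x *H (x *H y) = y" "x *H (inv\<^bsub>H\<^esub> x *H y) = y"
  by (simp_all add: groups(3) H.m_assoc[symmetric])
qed

lemma bnd_mult: "bnd (x *H y) = bnd x *K bnd y"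
 using groups(5,3) by (simp add: hom_def)

lemma bnd_inv: "inv\<^bsub>K\<^esub> (bnd x) = bnd (inv\<^bsub>H\<^esub> x)"
 using group_hom.hom_inv[of H K bnd x] groups by (simp add: group_hom_def group_hom_axioms_def)

lemma inv_unique: "x *H y = x ==> y = \<one>\<^bsub>H\<^esub>"
 by (metis mon(11) mon(7))

lemma ac_one: "ac k \<one>\<^bsub>H\<^esub> = \<one>\<^bsub>H\<^esub>"
 by (rule inv_unique[of "ac k \<one>\<^bsub>H\<^esub>"]) (simp flip: groups(6))

lemma group_HK: "group HK" "carrier HK = UNIV"
proof -
 show c: "carrier HK = UNIV" by (simp add: semidirect_def)
 show "group HK"
 proof (rule groupI)
  fix x assume "x : carrier HK"
  obtain h k where x: "x = (h, k)" by fastforce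
  show "\<one>\<^bsub>HK\<^esub> *S x = x" by (simp add: x groups(7))
  have "(ac (inv\<^bsub>K\<^esub> k) (inv\<^bsub>H\<^esub> h), inv\<^bsub>K\<^esub> k) *S x = \<one>\<^bsub>HK\<^esub>" by (simp add: x ac_one flip: groups(6))
  then show "EX y:carrier HK. y *S x = \<one>\<^bsub>HK\<^esub>" using c by blast
 next
  fix x y z show "x *S y *S z = x *S (y *S z)"
   by (cases x; cases y; cases z) (simp add: groups(6,8))
 qed (simp_all add: c)
qed

lemma projP: "projP B p = projQ B (\<s> p)"
 by (simp add: projP_def)

sublocale PA: principal_action P "Mman B" HK "actP B" "projP B"
proof (rule principal_action.intro)
 fix g show "smooth_map P P (%p. actP B p g)"
  using smooth_map_compose[OF smooth_map_Pair[OF manifolds(1,6,1) smooth_map_id smooth_map_const[OF manifolds(1)]] smooths(4)] by simp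
qed (rule manifolds group_HK acts(1,2,7) | (rule acts(5), assumption))+

sublocale QA: principal_action Q "Mman B" K "actQ B" "projQ B"
proof (rule principal_action.intro)
 fix g show "smooth_map Q Q (%p. actQ B p g)"
  using smooth_map_compose[OF smooth_map_Pair[OF manifolds(2,5,2) smooth_map_id smooth_map_const[OF manifolds(2)]] smooths(5)] by simp
qed (rule manifolds groups acts(3,4,8) | (rule acts(6), assumption))+

sublocale S: principal_morphism P "Mman B" HK "actP B" "projP B" Q K "actQ B" "projQ B" \<s> "src (two_group (xmod B))"
 by unfold_locales (use smooths acts in "auto simp: projP")

sublocale T: principal_morphism P "Mman B" HK "actP B" "projP B" Q K "actQ B" "projQ B" \<t> "tgt (two_group (xmod B))"
 by unfold_locales (use smooths acts in "auto simp: projP")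

sublocale U: principal_morphism Q "Mman B" K "actQ B" "projQ B" P HK "actP B" "projP B" \<u> "unt (two_group (xmod B))"
 by unfold_locales (use smooths acts grpd in "auto simp: projP")

text \<open>Runs through the kernel of the target homomorphism of the 2-group, reversing the order
  of multiplication.\<close>

definition "j h = (h, inv\<^bsub>K\<^esub> (bnd h))"
text \<open>An arrow is described by its target and by the element of the kernel of the target that
  moves the unit there to it. This parametrisation stands in for a trivialisation of
  \<open>P\<close> over \<open>Q\<close>.\<close>

definition "Ps z = actP B (\<u> (fst z)) (j (snd z))"

lemma j_tgt: "tgt (two_group (xmod B)) (j h) = \<one>\<^bsub>K\<^esub>"
 by (simp add: j_def)

lemma j_mult: "j h *S j h' = j (h' *H h)"
 by (simp add: j_def bnd_inv groups(9) bnd_mult flip: bnd_mult)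
  (metis bnd_inv bnd_mult group.inv_mult_group groups(1,3) UNIV_I)

lemma tgt_one: "tgt (two_group (xmod B)) g = \<one>\<^bsub>K\<^esub> ==> g = j (fst g)"
 by (cases g) (simp add: j_def, metis UNIV_I group.inv_comm group.inv_equality groups(2,4))

text \<open>The kernels of source and target of a strict 2-group commute; this is the Peiffer
  identity of the crossed module.\<close>

lemma j_commute: "(h', \<one>\<^bsub>K\<^esub>) *S j h = j h *S (h', \<one>\<^bsub>K\<^esub>)"
 by (simp add: j_def bnd_inv groups(7,9))

lemma Ps_smooth: "smooth_map (PM Q (Hman B)) P Ps"
proof -
 note QH = is_manifold_prod[OF manifolds(2,4)]
 have "smooth_map (Hman B) (PM (Hman B) (Kman B)) j" unfolding j_def
  by (rule smooth_map_Pair[OF manifolds(4,5,4) smooth_map_id smooth_map_compose[OF smooths(3,2)]])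
 from smooth_map_compose[OF smooth_map_Pair[OF manifolds(1,6) QH
   smooth_map_compose[OF smooth_map_fst[OF manifolds(2,4)] smooths(8)]
   smooth_map_compose[OF smooth_map_snd[OF manifolds(2,4)] this]] smooths(4)]
 show ?thesis by (simp add: Ps_def[abs_def])
qed

lemma Ps_slices: "smooth_map Q P (%q. Ps (q, h))" "smooth_map (Hman B) P (%h. Ps (q, h))"
 using smooth_map_compose[OF smooth_map_Pair[OF manifolds(2,4,2) smooth_map_id smooth_map_const[OF manifolds(2)]] Ps_smooth]
  smooth_map_compose[OF smooth_map_Pair[OF manifolds(2,4,4) smooth_map_const[OF manifolds(4)] smooth_map_id] Ps_smooth] by auto

lemma Ps_tgt: "\<t> (Ps z) = fst z"
 by (simp add: Ps_def acts j_tgt grpd)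

text \<open>An arrow and the unit at its target lie over the same point of the base. The group
  element between them fixes the target, so by freeness on \<open>Q\<close> it lies in the kernel of
  the target.\<close>

lemma Ps_surj: "EX h. p = Ps (\<t> p, h)"
proof -
 have "projP B (\<u> (\<t> p)) = projP B p" by (simp add: projP grpd acts)
 then obtain g where g: "p = actP B (\<u> (\<t> p)) g" using PA.pq(3) by blast
 then have "actQ B (\<t> p) (tgt (two_group (xmod B)) g) = \<t> p" by (metis acts(10) grpd(2))
 from tgt_one[OF acts(6)[OF this]] g show ?thesis unfolding Ps_def fst_conv snd_conv by metis
qed

lemma Ps_inj: "Ps (q, h) = Ps (q, h') ==> h = h'"
 using PA.act_inj[of "\<u> q" "j h" "j h'"] by (simp add: Ps_def j_def)

lemma Ps_mult: "Ps (q, h' *H h) = actP B (Ps (q, h)) (j h')"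
 by (simp add: Ps_def j_mult flip: acts(2))

text \<open>A tangent vector of \<open>H\<close> that the orbit map kills extends, by left
  translation, to an invariant field that is killed everywhere, since \<open>Ps_mult\<close> turns
  translations into the action. The orbit map is injective, so \<open>vector_field_kernel\<close>
  applies.\<close>

lemma Ps_immersion:
 assumes et: "et : TS (Hman B) h0" and z: "tmap P (%h. Ps (q, h)) et = (%f. 0)"
 shows "et = (%f. 0)"
proof -
 note Hm = manifolds(4)
 define L where "L = (%h y. h *H inv\<^bsub>H\<^esub> h0 *H y)"
 have mul: "smooth_map N (Hman B) (%x. f x *H g x)" if "is_manifold N" "smooth_map N (Hman B) f" "smooth_map N (Hman B) g"
  for N :: "('x::{t2_space,second_countable_topology}, 'y::euclidean_space) manifold" and f g
  using smooth_map_compose[OF smooth_map_Pair[OF Hm Hm that] smooths(1)] by simp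
 note HH = is_manifold_prod[OF Hm Hm]
 have L: "smooth_map (PM (Hman B) (Hman B)) (Hman B) (%z. L (fst z) (snd z))" unfolding L_def
  by (intro mul HH smooth_map_fst smooth_map_snd Hm smooth_map_const)
 have Lh: "smooth_map (Hman B) (Hman B) (L h)" for h unfolding L_def
  by (intro mul Hm smooth_map_const smooth_map_id)
 define V where "V = (%h. tmap (Hman B) (L h) et)"
 have Lh0: "L h h0 = h" for h by (simp add: L_def)
 have V: "V : VF (Hman B)" unfolding vector_fields_def
 proof (intro CollectI conjI allI ballI)
  show "V h : TS (Hman B) h" for h using tmap_tangent[OF Hm Hm Lh et, of h] by (simp add: V_def Lh0)
  show "(%h. V h f) : cinf (Hman B)" if f: "f : cinf (Hman B)" for f
   using tangent_param[OF Hm Hm et smooth_mapD[OF L f]] by (simp add: V_def tmap_apply[OF f])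
 qed
 have ker: "V h (%x. u (Ps (q, x))) = 0" if u: "u : cinf P" for u h
 proof -
  have "Ps (q, L h y) = actP B (Ps (q, y)) (j (h *H inv\<^bsub>H\<^esub> h0))" for y unfolding L_def by (rule Ps_mult)
  then have "V h (%x. u (Ps (q, x))) = et (%y. u (actP B (Ps (q, y)) (j (h *H inv\<^bsub>H\<^esub> h0))))"
   by (simp add: V_def tmap_apply[OF smooth_mapD[OF Ps_slices(2) u]])
  also have "... = tmap P (%h. Ps (q, h)) et (%p. u (actP B p (j (h *H inv\<^bsub>H\<^esub> h0))))"
   by (simp add: tmap_apply[OF smooth_mapD[OF PA.smooth_act u]])
  finally show ?thesis by (simp add: z)
 qed
 have "V h0 = (%g. 0)"
  by (rule vector_field_kernel[OF Hm manifolds(1) Ps_slices(2) _ V ker]) (auto intro: injI dest: Ps_inj)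
 moreover have "V h0 = et"
 proof
  fix f show "V h0 f = et f"
   using tangent_off[OF Hm et] by (auto simp: V_def tmap_def o_def L_def simp del: mon(5))
 qed
 ultimately show ?thesis by simp
qed

lemma Ps_onto: "TS P (Ps z) <= tmap P Ps ` TS (PM Q (Hman B)) z"
proof (rule surj_immersion_onto[OF is_manifold_prod[OF manifolds(2,4)] manifolds(1) Ps_smooth])
 show "surj Ps" using Ps_surj by (metis surjI surj_def)
 note QH = is_manifold_prod[OF manifolds(2,4)]
 obtain q h where qh: "z = (q, h)" by fastforce
 \<comment> \<open>A vector in the kernel has no component along \<open>Q\<close>, because the
   target recovers the first coordinate. What remains is tangent to \<open>H\<close>.\<close>
 have 0: "w = (%f. 0)" if w: "w : TS (PM Q (Hman B)) z" and k: "tmap P Ps w = (%f. 0)" for w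
 proof -
  have "tmap Q fst w = tmap Q \<t> (tmap P Ps w)" by (simp add: tmap_comp[OF smooths(7)] Ps_tgt[abs_def])
  then have 1: "tmap Q fst w = (%f. 0)" by (simp add: k) (simp add: tmap_def)
  have "w (%x. f (Ps x)) = tmap (Hman B) snd w (%h. f (Ps (q, h)))" if f: "f : cinf P" for f
  proof -
   note F = smooth_mapD[OF Ps_smooth f]
   have "w (%x. f (Ps (fst x, snd x))) = w (%x. f (Ps (fst x, h))) + w (%x. f (Ps (q, snd x)))"
    using tangent_Pair[OF QH manifolds(2,4) smooth_map_fst[OF manifolds(2,4)] smooth_map_snd[OF manifolds(2,4)] F w] by (simp add: qh)
   moreover have "w (%x. f (Ps (fst x, h))) = tmap Q fst w (%q. f (Ps (q, h)))"
    by (simp add: tmap_apply[OF smooth_mapD[OF Ps_slices(1) f]])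
   ultimately show ?thesis by (simp add: 1 tmap_apply[OF smooth_mapD[OF Ps_slices(2) f]])
  qed
  then have "tmap P (%h. Ps (q, h)) (tmap (Hman B) snd w) = tmap P Ps w"
   using smooth_mapD[OF Ps_slices(2)] by (auto simp: tmap_def o_def)
  then have 2: "tmap (Hman B) snd w = (%f. 0)"
   using k tmap_tangent[OF QH manifolds(4) smooth_map_snd[OF manifolds(2,4)] w]
   by (intro Ps_immersion[of _ h q]) (simp_all add: qh)
  show ?thesis using tangent_tpair[OF manifolds(2,4) w[unfolded qh]] unfolding 1 2
   using tangent_tpair[OF manifolds(2,4) tangent_closed(3)[OF QH]] by (simp add: tmap_def)
 qed
 show "inj_on (tmap P Ps) (TS (PM Q (Hman B)) z)"
 proof
  fix v w assume vw: "v : TS (PM Q (Hman B)) z" "w : TS (PM Q (Hman B)) z"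
   "tmap P Ps v = tmap P Ps w"
  have "(%f. v f + -1 * w f) = (%f. 0)"
   by (rule 0[OF tangent_closed(1)[OF QH vw(1) tangent_closed(2)[OF QH vw(2)]]])
    (use vw(3) in "simp only: tmap_plus tmap_times, simp")
  then show "v = w" by (metis (no_types, lifting) add.commute ext minus_add_cancel mult_minus1 right_minus_eq uminus_add_conv_diff)
 qed
qed

text \<open>The first summand moves the target with \<open>h\<close> frozen, the second moves
  \<open>h\<close> alone. Surjectivity of the differential of \<open>Ps\<close> suffices for this,
  in place of a product structure on \<open>P\<close>.\<close>

lemma Ps_split:
 assumes v: "v : TS P (Ps (q, h))"
 obtains et where "et : TS (Hman B) h"
  "!!f. f : cinf P ==> v f = v (%p. f (Ps (\<t> p, h))) + et (%h. f (Ps (q, h)))"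
proof -
 note QH = is_manifold_prod[OF manifolds(2,4)]
 obtain w where w: "w : TS (PM Q (Hman B)) (q, h)" "v = tmap P Ps w" using Ps_onto v by blast
 show ?thesis
 proof (rule that)
  show "tmap (Hman B) snd w : TS (Hman B) h"
   using tmap_tangent[OF QH manifolds(4) smooth_map_snd[OF manifolds(2,4)] w(1)] by simp
  fix f assume f: "f : cinf P"
  have "w (%x. f (Ps (fst x, snd x))) = w (%x. f (Ps (fst x, h))) + w (%x. f (Ps (q, snd x)))"
   using tangent_Pair[OF QH manifolds(2,4) smooth_map_fst[OF manifolds(2,4)] smooth_map_snd[OF manifolds(2,4)]
    smooth_mapD[OF Ps_smooth f] w(1)] by simp
  then show "v f = v (%p. f (Ps (\<t> p, h))) + tmap (Hman B) snd w (%h. f (Ps (q, h)))"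
   by (simp add: w(2) tmap_apply[OF f] tmap_apply[OF smooth_mapD[OF Ps_slices(2) f]] Ps_tgt
    tmap_apply[OF smooth_mapD[OF smooth_map_compose[OF smooths(7) Ps_slices(1)] f]])
 qed
qed

text \<open>In the parametrisation the pushed field is \<open>W\<close> acting on the first
  coordinate, which is smooth in all variables. Smoothness descends because \<open>Ps\<close> is a
  surjective submersion.\<close>

lemma unit_smooth:
 assumes W: "W : QA.inv_fields"
 shows "U.push W : VF P"
proof -
 note QH = is_manifold_prod[OF manifolds(2,4)]
 have 1: "U.push W (Ps z) f = W (fst z) (%x. f (Ps (x, snd z)))" if f: "f : cinf P" for z f
  using U.push_act[OF QA.inv_fieldsD(3)[OF W] refl, of "fst z" "j (snd z)"] smooth_mapD[OF PA.smooth_act f] f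
  by (simp add: Ps_def PA.R_def tmap_apply)
 have "(%p. U.push W p f) : cinf P" if f: "f : cinf P" for f
 proof (rule cinf_descend[OF QH manifolds(1) Ps_smooth Ps_onto])
  show "surj Ps" using Ps_surj by (metis surjI surj_def)
  show "(%z. U.push W (Ps z) f) : cinf (PM Q (Hman B))"
   unfolding 1[OF f] using vector_field_param[OF manifolds(2,4) QA.inv_fieldsD(1)[OF W] smooth_mapD[OF Ps_smooth f]] .
 qed
 moreover have "U.push W p : TS P p" for p
  using PA.equivariantD(1)[OF U.push_equivariant[OF QA.inv_fieldsD(3)[OF W]] refl] .
 ultimately show ?thesis by (simp add: vector_fields_def)
qed

section \<open>Structure maps and composition of the Atiyah LA-groupoid\<close>

abbreviation "\<L> == atiyah_LA_groupoid B"
abbreviation "\<A> == arr \<L>"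
abbreviation "\<E> == obj \<L>"

lemma LA_sel: "\<A> = PA.\<A>" "\<E> = QA.\<A>"
 by (simp_all add: atiyah_LA_groupoid_def Let_def)

lemma maps_graph:
 "PA.equivariant m V ==> vsrc \<L> m (PA.graph m V) = QA.graph m (S.push V)"
 "PA.equivariant m V ==> vtgt \<L> m (PA.graph m V) = QA.graph m (T.push V)"
 "QA.equivariant m W ==> vunt \<L> m (QA.graph m W) = PA.graph m (U.push W)"
 using S.graph_push_image[of m V] T.graph_push_image[of m V] U.graph_push_orbits[of m W] grpd(1,2)
 unfolding atiyah_LA_groupoid_def Let_def by simp_all metis+

lemma maps_smooth: "V : PA.inv_fields ==> S.push V : VF Q" "V : PA.inv_fields ==> T.push V : VF Q"
 using S.push_smooth[OF _ smooths(8) grpd(1)] T.push_smooth[OF _ smooths(8) grpd(2)] by auto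

lemma LA_maps: "bundle_map \<A> \<E> (vsrc \<L>)" "bundle_map \<A> \<E> (vtgt \<L>)" "bundle_map \<E> \<A> (vunt \<L>)"
 unfolding LA_sel by (rule S.push_bundle_map T.push_bundle_map U.push_bundle_map; (rule maps_graph maps_smooth unit_smooth; assumption))+

lemma LA_brackets:
 "x : secs \<A> ==> y : secs \<A> ==> secmap (vsrc \<L>) (bracket \<A> x y) = bracket \<E> (secmap (vsrc \<L>) x) (secmap (vsrc \<L>) y)"
 "x : secs \<A> ==> y : secs \<A> ==> secmap (vtgt \<L>) (bracket \<A> x y) = bracket \<E> (secmap (vtgt \<L>) x) (secmap (vtgt \<L>) y)"
 "a : secs \<E> ==> b : secs \<E> ==> secmap (vunt \<L>) (bracket \<E> a b) = bracket \<A> (secmap (vunt \<L>) a) (secmap (vunt \<L>) b)"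
 unfolding LA_sel by (rule S.push_bracket T.push_bracket U.push_bracket; (assumption | (rule maps_graph maps_smooth unit_smooth; assumption)))+

lemma LA_anchors:
 "x : fibre \<A> m ==> anchor \<E> m (vsrc \<L> m x) = anchor \<A> m x"
 "x : fibre \<A> m ==> anchor \<E> m (vtgt \<L> m x) = anchor \<A> m x"
 "a : fibre \<E> m ==> anchor \<A> m (vunt \<L> m a) = anchor \<E> m a"
 unfolding LA_sel by (rule S.push_anchor T.push_anchor U.push_anchor; (assumption | (rule maps_graph maps_smooth unit_smooth; assumption)))+

lemma LA_units: "a : fibre \<E> m ==> vsrc \<L> m (vunt \<L> m a) = a" "a : fibre \<E> m ==> vtgt \<L> m (vunt \<L> m a) = a"
proof -
 assume "a : fibre \<E> m"
 then obtain W where W: "QA.equivariant m W" "a = QA.graph m W" unfolding LA_sel QA.fibre_iff by blast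
 note u = U.push_equivariant[OF W(1)]
 have id: "tmap Q (%x. x) (W q) = W q" if "projQ B q = m" for q
  using tangent_off[OF manifolds(2) QA.equivariantD(1)[OF W(1) that]] by (auto simp: tmap_def o_def)
 have "S.push (U.push W) q = W q" "T.push (U.push W) q = W q" if "projQ B q = m" for q
  using S.push_related[OF u, of "\<u> q"] T.push_related[OF u, of "\<u> q"] U.push_related[OF W(1) that] that id[OF that]
  by (simp_all add: grpd projP tmap_comp[OF smooths(6)] tmap_comp[OF smooths(7)])
 then show "vsrc \<L> m (vunt \<L> m a) = a" "vtgt \<L> m (vunt \<L> m a) = a"
  by (simp_all add: W(2) maps_graph(3)[OF W(1)] maps_graph(1,2)[OF u] QA.graph_eq)
qed

text \<open>Composing with a unit translated by the kernel of the target is the same as acting by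
  that element, by multiplicativity of the action. It reduces the multiplication of \<open>P\<close>
  to the group action.\<close>

lemma comp_Ps: "\<s> x = q ==> comp (grpd B) x (Ps (q, h)) = actP B x (j h)"
 using acts(13)[of x "\<u> (\<s> x)" "\<one>\<^bsub>HK\<^esub>" "j h"] acts(1)[of x] j_tgt[of h] grpd(3)[of x] by (simp add: Ps_def grpd) (simp add: j_def)

text \<open>The differential of the multiplication. \<open>Y\<close> is split into a part carried by
  its image under the target, which equals the source of \<open>X\<close>, and a part
  \<open>et\<close> tangent to \<open>H\<close>. The first part and \<open>X\<close> together move
  through the pairs (x, Ps (s x, h)), where \<open>comp_Ps\<close> applies; along the second the
  left factor stays fixed.\<close>

lemma comp_value:
 assumes X: "PA.equivariant m X" and Y: "PA.equivariant m Y" and st: "ALL q. projQ B q = m --> S.push X q = T.push Y q"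
  and p: "projP B p = m" "\<s> p = \<t> p'" and f: "f : cinf P" and E: "E : cinf (PM P P)"
  and W: "open W" "(p, p') : W" "!!x y. (x, y) : W ==> \<s> x = \<t> y ==> E (x, y) = f (comp (grpd B) x y)"
 shows "X p (%x. E (x, p')) + Y p' (%y. E (p, y)) =
  X (comp (grpd B) p p') f + Y (comp (grpd B) p p') f - U.push (S.push X) (comp (grpd B) p p') f"
proof -
 note Pm = manifolds(1) and PP = is_manifold_prod[OF manifolds(1,1)]
 define q where "q = \<s> p"
 have qm: "projQ B q = m" using p(1) by (simp add: q_def projP)
 obtain h where h: "p' = Ps (q, h)" using Ps_surj p(2) q_def by metis
 have p'm: "projP B p' = m" using acts(12)[of p'] p(2) qm by (simp add: projP q_def)
 have tX: "X p : TS P p" by (rule PA.equivariantD(1)[OF X p(1)])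
 have tY: "Y p' : TS P p'" by (rule PA.equivariantD(1)[OF Y p'm])
 obtain et where et: "et : TS (Hman B) h"
  "!!g. g : cinf P ==> Y p' g = Y p' (%p. g (Ps (\<t> p, h))) + et (%h. g (Ps (q, h)))"
  using that by (rule Ps_split[OF tY[unfolded h], folded h])
 have Yt: "Y p' (%y. k (\<t> y)) = S.push X q k" if "k : cinf Q" for k
  using T.push_related[OF Y p'm] st[rule_format, OF qm] p(2) that by (simp add: q_def tmap_apply)
 have Xs: "S.push X q k = X p (%x. k (\<s> x))" if "k : cinf Q" for k
  using S.push_related[OF X p(1)] that by (simp add: q_def tmap_apply)
 have smg: "smooth_map P P (%x. Ps (\<s> x, h))" by (rule smooth_map_compose[OF smooths(6) Ps_slices(1)])
 have c: "comp (grpd B) p p' = actP B p (j h)" using comp_Ps[OF q_def[symmetric]] h by simp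
 have 1: "X p (%x. E (x, p')) + X p (%x. E (p, Ps (\<s> x, h))) = X p (%x. E (x, Ps (\<s> x, h)))"
  using tangent_Pair[OF Pm Pm Pm smooth_map_id smg E tX] by (simp add: h q_def)
 have smd: "smooth_map P (PM P P) (%x. (x, Ps (\<s> x, h)))" by (rule smooth_map_Pair[OF Pm Pm Pm smooth_map_id smg])
 have 2: "X p (%x. E (x, Ps (\<s> x, h))) = X p (%x. f (actP B x (j h)))"
 proof (rule tangent_local[OF Pm tX smooth_mapD[OF smd E] smooth_mapD[OF PA.smooth_act f] smooth_preimage_open[OF Pm PP smd W(1)]])
  show "p : (%x. (x, Ps (\<s> x, h))) -` W" using W(2) by (simp add: h q_def)
  fix x assume "x : (%x. (x, Ps (\<s> x, h))) -` W"
  then show "E (x, Ps (\<s> x, h)) = f (actP B x (j h))" using W(3)[of x "Ps (\<s> x, h)"] by (simp add: Ps_tgt comp_Ps)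
 qed
 have 3: "X p (%x. f (actP B x (j h))) = X (actP B p (j h)) f"
  using PA.equivariantD(2)[OF X p(1), of "j h"] by (simp add: PA.R_def tmap_apply[OF f])
 have smh: "smooth_map (Hman B) (PM P P) (%h. (p, Ps (q, h)))"
  by (rule smooth_map_Pair[OF Pm Pm manifolds(4) smooth_map_const[OF manifolds(4)] Ps_slices(2)])
 have "(%h. f (comp (grpd B) p (Ps (q, h)))) = (%h. f (actP B p (j h)))" by (simp add: comp_Ps q_def)
 \<comment> \<open>\<open>p\<close> differs from the unit at its source by an element of the kernel
   of the source. By \<open>j_commute\<close> acting on \<open>p\<close> with \<open>j h\<close> is
   then acting on \<open>Ps (q, h)\<close> with a fixed element.\<close>
 obtain h' where h': "p = actP B (\<u> q) (h', \<one>\<^bsub>K\<^esub>)"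
 proof -
  have "projP B (\<u> q) = projP B p" by (simp add: projP grpd q_def)
  then obtain g where g: "p = actP B (\<u> q) g" using PA.pq(3) by blast
  then have "actQ B q (snd g) = q" using acts(9)[of "\<u> q" g] grpd(1) q_def by simp
  then have "snd g = \<one>\<^bsub>K\<^esub>" by (rule acts(6))
  then have "g = (fst g, \<one>\<^bsub>K\<^esub>)" by (metis prod.collapse)
  then have "p = actP B (\<u> q) (fst g, \<one>\<^bsub>K\<^esub>)" using g by (rule subst[where P="%x. p = actP B (\<u> q) x"])
  then show ?thesis by (rule that)
 qed
 let ?g = "(h', \<one>\<^bsub>K\<^esub>)"
 have pj: "actP B p (j h) = actP B (Ps (q, h)) ?g" for h
 proof -
  have "actP B p (j h) = actP B (\<u> q) (?g *S j h)" unfolding acts(2) h'[symmetric] by (rule refl)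
  also have "... = actP B (\<u> q) (j h *S ?g)" unfolding j_commute by (rule refl)
  finally show ?thesis unfolding acts(2) by (simp add: Ps_def)
 qed
 have fg: "(%y. f (actP B y ?g)) : cinf P" by (rule smooth_mapD[OF PA.smooth_act f])
 have smp: "(%h. f (actP B p (j h))) : cinf (Hman B)" unfolding pj by (rule smooth_mapD[OF Ps_slices(2) fg])
 have 4: "et (%h. E (p, Ps (q, h))) = et (%h. f (actP B p (j h)))"
 proof (rule tangent_local[OF manifolds(4) et(1) smooth_mapD[OF smh E] smp smooth_preimage_open[OF manifolds(4) PP smh W(1)]])
  show "h : (%h. (p, Ps (q, h))) -` W" using W(2) by (simp add: h)
  fix y assume "y : (%h. (p, Ps (q, h))) -` W"
  then show "E (p, Ps (q, y)) = f (actP B p (j y))" using W(3)[of p "Ps (q, y)"] comp_Ps[of p q y] by (simp add: Ps_tgt q_def[symmetric])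
 qed
 have "X p (%x. E (x, p')) + Y p' (%y. E (p, y)) =
   X p (%x. E (x, p')) + (Y p' (%y. E (p, Ps (\<t> y, h))) + et (%h. E (p, Ps (q, h))))"
  by (subst et(2)[OF cinf_slice2[OF Pm Pm E]]) (rule refl)
 also have "Y p' (%y. E (p, Ps (\<t> y, h))) = X p (%x. E (p, Ps (\<s> x, h)))"
  using Yt[OF smooth_mapD[OF Ps_slices(1) cinf_slice2[OF Pm Pm E]]] Xs[OF smooth_mapD[OF Ps_slices(1) cinf_slice2[OF Pm Pm E]]] by simp
 finally have L: "X p (%x. E (x, p')) + Y p' (%y. E (p, y)) = X (actP B p (j h)) f + et (%h. f (actP B p (j h)))"
  using 1 2 3 4 by simp
 have "Y (actP B p (j h)) f = Y p' (%y. f (actP B y ?g))"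
  using PA.equivariantD(2)[OF Y p'm, of ?g] by (simp add: pj h PA.R_def tmap_apply[OF f])
 also have "... = Y p' (%y. f (actP B (Ps (\<t> y, h)) ?g)) + et (%h. f (actP B (Ps (q, h)) ?g))" by (rule et(2)[OF fg])
 also have "Y p' (%y. f (actP B (Ps (\<t> y, h)) ?g)) = S.push X q (%x. f (actP B (Ps (x, h)) ?g))"
  by (rule Yt[OF smooth_mapD[OF Ps_slices(1) fg]])
 also have "... = U.push (S.push X) (actP B p (j h)) f"
 proof -
  have "actP B p (j h) = actP B (\<u> q) (j h *S ?g)" unfolding acts(2) by (simp add: pj Ps_def)
  then have "U.push (S.push X) (actP B p (j h)) = PA.R (j h *S ?g) (tmap P \<u> (S.push X q))"
   using U.push_act[OF S.push_equivariant[OF X] qm] by simp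
  then have "U.push (S.push X) (actP B p (j h)) f = S.push X q (%x. f (actP B (\<u> x) (j h *S ?g)))"
   by (simp only: PA.R_def tmap_apply[OF f] tmap_apply[OF smooth_mapD[OF PA.smooth_act f]])
  then show ?thesis by (simp only: acts(2) Ps_def fst_conv snd_conv)
 qed
 finally have "Y (actP B p (j h)) f = U.push (S.push X) (actP B p (j h)) f + et (%h. f (actP B p (j h)))" by (simp add: pj)
 then show ?thesis using L by (simp add: c)
qed

text \<open>\<open>tcomp\<close> quantifies over all local extensions of the product. That one
  extension exists makes its element unique; that the value in \<open>comp_value\<close> is the same
  for every extension makes \<open>Z\<close> an element. Each point of the graph is reached by
  composing with a unit.\<close>

lemma LA_comp:
 assumes x: "x : fibre \<A> m" and y: "y : fibre \<A> m" and st: "vsrc \<L> m x = vtgt \<L> m y"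
 shows "vcomp \<L> m x y = vadd \<A> (vadd \<A> x y) (vscale \<A> (-1) (vunt \<L> m (vsrc \<L> m x)))"
proof -
 note Pm = manifolds(1)
 obtain X where X: "PA.equivariant m X" "x = PA.graph m X" using x unfolding LA_sel PA.fibre_iff by blast
 obtain Y where Y: "PA.equivariant m Y" "y = PA.graph m Y" using y unfolding LA_sel PA.fibre_iff by blast
 have XY: "ALL q. projQ B q = m --> S.push X q = T.push Y q"
  using st unfolding X(2) Y(2) maps_graph(1)[OF X(1)] maps_graph(2)[OF Y(1)] QA.graph_eq .
 note u = U.push_equivariant[OF S.push_equivariant[OF X(1)]]
 define Z where "Z = (%p f. X p f + Y p f + - 1 * U.push (S.push X) p f)"
 have eZ: "PA.equivariant m Z" unfolding Z_def
  by (intro PA.equivariant_closed(1)[OF PA.equivariant_closed(1)[OF X(1) Y(1)] PA.equivariant_closed(2)[OF u]])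
 have rhs: "vadd \<A> (vadd \<A> x y) (vscale \<A> (-1) (vunt \<L> m (vsrc \<L> m x))) = PA.graph m Z"
  unfolding Z_def X(2) Y(2) maps_graph(1)[OF X(1)] maps_graph(3)[OF S.push_equivariant[OF X(1)]] LA_sel by simp
 have proj: "projP B (comp (grpd B) p p') = m" if "projP B p = m" "\<s> p = \<t> p'" for p p'
  using grpd(4)[OF that(2)] acts(12)[of p'] that by (simp add: projP)
 have tc: "w : tcomp P (grpd B) p (X p) p' (Y p') \<longleftrightarrow> w = Z (comp (grpd B) p p')" if p: "projP B p = m" "\<s> p = \<t> p'" for p p' w
 proof
  note val = comp_value[OF X(1) Y(1) XY p]
  note zt = PA.equivariantD(1)[OF eZ proj[OF p]]
  { assume w: "w = Z (comp (grpd B) p p')"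
   show "w : tcomp P (grpd B) p (X p) p' (Y p')" unfolding tcomp_def
   proof (intro CollectI conjI ballI allI impI)
    show "w : TS P (comp (grpd B) p p')" using zt w by simp
    fix g W E assume *: "g : cinf P" "E : cinf (PM P P)"
     "open W & (p, p') : W & (ALL (x, y):W. \<s> x = \<t> y --> E (x, y) = g (comp (grpd B) x y))"
    then have "E (x, y) = g (comp (grpd B) x y)" if "(x, y) : W" "\<s> x = \<t> y" for x y using that by blast
    note E' = this
    have "X p (%x. E (x, p')) + Y p' (%y. E (p, y)) = Z (comp (grpd B) p p') g"
     unfolding Z_def by (subst val[OF *(1,2), of W]) (use *(3) E' in simp_all)
    then show "w g = X p (%x. E (x, p')) + Y p' (%y. E (p, y))" by (simp add: w)
   qed }
  assume w: "w : tcomp P (grpd B) p (X p) p' (Y p')"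
  show "w = Z (comp (grpd B) p p')"
  proof (rule tangent_eqI[OF Pm Pm _ zt])
   show "w : TS P (comp (grpd B) p p')" using w by (simp add: tcomp_def)
   fix f assume f: "f : cinf P"
   then have "f \<circ> (%(x, y). comp (grpd B) x y) : cinf_on (PM P P) {(x, y). \<s> x = \<t> y}"
    using smooths(9) by (simp add: smooth_map_on_def)
   then obtain W E where E: "E : cinf (PM P P)" "open W" "(p, p') : W"
    "ALL y:{(x, y). \<s> x = \<t> y} Int W. (f \<circ> (%(x, y). comp (grpd B) x y)) y = E y"
    using p(2) unfolding cinf_on_def by fastforce
   have E': "E (x, y) = f (comp (grpd B) x y)" if "(x, y) : W" "\<s> x = \<t> y" for x y using bspec[OF E(4), of "(x, y)"] that by simp
   have "w f = X p (%x. E (x, p')) + Y p' (%y. E (p, y))"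
    using w f E(1-3) E' unfolding tcomp_def by blast
   then show "w f = Z (comp (grpd B) p p') f" using val[OF f E(1-3) E'] by (simp add: Z_def)
  qed
 qed
 have "vcomp \<L> m x y = {(comp (grpd B) p p', w) | p v p' v' w.
   (p, v) : x & (p', v') : y & \<s> p = \<t> p' & tmap Q \<s> v = tmap Q \<t> v' & w : tcomp P (grpd B) p v p' v'}"
  by (simp add: atiyah_LA_groupoid_def Let_def)
 also have "... = PA.graph m Z"
 proof (rule subset_antisym; rule subsetI)
  fix z assume "z : {(comp (grpd B) p p', w) | p v p' v' w.
   (p, v) : x & (p', v') : y & \<s> p = \<t> p' & tmap Q \<s> v = tmap Q \<t> v' & w : tcomp P (grpd B) p v p' v'}"
  then show "z : PA.graph m Z" using tc proj unfolding X(2) Y(2) by auto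
 next
  fix z assume "z : PA.graph m Z"
  then obtain p where p: "z = (p, Z p)" "projP B p = m" by (auto simp: PA.graph_def)
  let ?p' = "\<u> (\<s> p)"
  have p': "projP B ?p' = m" "\<s> p = \<t> ?p'" "comp (grpd B) p ?p' = p" using p(2) by (simp_all add: projP grpd)
  have "tmap Q \<s> (X p) = tmap Q \<t> (Y ?p')"
   using S.push_related[OF X(1) p(2)] T.push_related[OF Y(1) p'(1)] XY[rule_format, of "\<s> p"] p(2) by (simp add: projP grpd)
  moreover have "Z p : tcomp P (grpd B) p (X p) ?p' (Y ?p')" using tc[OF p(2) p'(2)] p'(3) by simp
  ultimately show "z : {(comp (grpd B) p p', w) | p v p' v' w.
   (p, v) : x & (p', v') : y & \<s> p = \<t> p' & tmap Q \<s> v = tmap Q \<t> v' & w : tcomp P (grpd B) p v p' v'}"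
   using p p' unfolding X(2) Y(2) by (simp only: mem_Collect_eq PA.mem_graph) (metis p'(3))
 qed
 finally show ?thesis using rhs by simp
qed

end

section \<open>The coherence law in terms of forms\<close>

lemma AF_ext: "om : AF E ==> et : AF E ==> (!!l m. set l <= car E ==> om l m = et l m) ==> om = et"
 by (rule ext, case_tac "set x <= car E") (auto simp: AF_off)

lemma con_fun_cong:
 assumes "!!x. x : A ==> ph x = ph' x" "!!x y. x : A ==> y : A ==> ta x y = ta' x y"
 shows "con A ph ta om = con A ph' ta' om"
proof (intro ext)
 fix l m
 have "psum l (%a b r. om (ta a b # map ph r) m) = psum l (%a b r. om (ta' a b # map ph' r) m)" if "set l <= A"
 proof (rule psum_cong[OF that])
  fix a b r assume *: "a : A" "b : A" "set r <= A"
  have "map ph r = map ph' r" by (rule map_cong) (use * assms(1) in auto)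
  then show "om (ta a b # map ph r) m = om (ta' a b # map ph' r) m" by (simp only: assms(2)[OF *(1,2)])
 qed
 then show "con A ph ta om l m = con A ph' ta' om l m" by (simp add: con_def)
qed

lemma con_null:
 assumes "smodule V" "om : AF V" "ph ` A <= car V" "!!x y. x : A ==> y : A ==> snull V (ta x y)"
 shows "con A ph ta om l m = 0"
proof (cases "set l <= A")
 case True
 have "psum l (%a b r. om (ta a b # map ph r) m) = psum l (%a b r. 0)"
 proof (rule psum_cong[OF True])
  fix a b r assume "a : A" "b : A" "set r <= A"
  then show "om (ta a b # map ph r) m = 0" using assms(3) by (intro AF_snull1[OF assms(1,2) assms(4)]) auto
 qed
 then show ?thesis by (simp add: con_def)
qed (simp add: con_off)

lemma con_intertwine:
 assumes h: "shom S1 S2 h" and r: "!!x y. x : car S1 ==> y : car S1 ==> r1 x y : car S1 & h (r1 x y) = r2 (h x) (h y)"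
  and l: "set l <= car S1"
 shows "con (car S1) (%x. x) r1 (pbk (car S1) h om) l m = pbk (car S1) h (con (car S2) (%x. x) r2 om) l m"
proof -
 have "con (car S1) (%x. x) r1 (pbk (car S1) h om) l m = con (car S1) h (%x y. h (r1 x y)) om l m"
  by (rule con_pbk[OF h l]) (use r in auto)
 also have "... = con (car S1) h (%x y. r2 (h x) (h y)) om l m" using con_fun_cong[of "car S1" h h "%x y. h (r1 x y)"] r by metis
 also have "... = pbk (car S1) h (con (car S2) (%x. x) r2 om) l m" by (rule pbk_con[symmetric, OF _ l]) (use shom_car[OF h] in auto)
 finally show ?thesis .
qed

section \<open>Pairs of sections\<close>

definition "fstm w = (%m. fst (w m))"
definition "sndm w = (%m. snd (w m))"
definition "pairm x y = (%m. (x m, y m))"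

lemma pairm [simp]: "fstm (pairm x y) = x" "sndm (pairm x y) = y" "pairm (fstm w) (sndm w) = w"
 "pairm x y = pairm x' y' \<longleftrightarrow> x = x' & y = y'"
 by (auto simp: fstm_def sndm_def pairm_def fun_eq_iff)

text \<open>All pairs; this is where contractions are formed. Brackets live on the smaller
  \<open>slprod\<close>, whose pairs act on functions by the same derivation.\<close>

definition sprod :: "('m, 'm => 't, 'z) smod_scheme => ('m, 'm => 'v, 'y) smod_scheme => ('m, 'm => 't \<times> 'v) smod" where
 "sprod T V = \<lparr>rng = rng T, car = {w. fstm w : car T & sndm w : car V},
  sadd = (%w w'. pairm (sadd T (fstm w) (fstm w')) (sadd V (sndm w) (sndm w'))),
  sscl = (%g w. pairm (sscl T g (fstm w)) (sscl V g (sndm w)))\<rparr>"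

definition slprod :: "('m, 'm => 't, 'z) slie_scheme => ('m, 'm => 'v, 'y) slie_scheme => ('m, 'm => 't \<times> 'v) slie" where
 "slprod T V = \<lparr>rng = rng T,
  car = {w. fstm w : car T & sndm w : car V & (ALL f:rng T. ALL m. sanc T (fstm w) m f = sanc V (sndm w) m f)},
  sadd = (%w w'. pairm (sadd T (fstm w) (fstm w')) (sadd V (sndm w) (sndm w'))),
  sscl = (%g w. pairm (sscl T g (fstm w)) (sscl V g (sndm w))),
  sanc = (%w. sanc T (fstm w)),
  sbr = (%w w'. pairm (sbr T (fstm w) (fstm w')) (sbr V (sndm w) (sndm w')))\<rparr>"

lemma sprod_sel [simp]: "rng (sprod T V) = rng T" "w : car (sprod T V) \<longleftrightarrow> fstm w : car T & sndm w : car V"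
 "sadd (sprod T V) w w' = pairm (sadd T (fstm w) (fstm w')) (sadd V (sndm w) (sndm w'))"
 "sscl (sprod T V) g w = pairm (sscl T g (fstm w)) (sscl V g (sndm w))"
 by (simp_all add: sprod_def)

lemma slprod_sel [simp]: "rng (slprod T V) = rng T"
 "w : car (slprod T V) \<longleftrightarrow> fstm w : car T & sndm w : car V & (ALL f:rng T. ALL m. sanc T (fstm w) m f = sanc V (sndm w) m f)"
 "sadd (slprod T V) w w' = pairm (sadd T (fstm w) (fstm w')) (sadd V (sndm w) (sndm w'))"
 "sscl (slprod T V) g w = pairm (sscl T g (fstm w)) (sscl V g (sndm w))"
 "sanc (slprod T V) w = sanc T (fstm w)"
 "sbr (slprod T V) w w' = pairm (sbr T (fstm w) (fstm w')) (sbr V (sndm w) (sndm w'))"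
 by (simp_all add: slprod_def)

lemma smodule_closed: "smodule E ==> a : car E ==> b : car E ==> sadd E a b : car E"
 "smodule E ==> g : rng E ==> a : car E ==> sscl E g a : car E" "smodule E ==> func_ring (rng E)"
 by (auto simp: smodule_def)

lemma slie_alg_slprod:
 assumes T: "slie_jacobi T" and V: "slie_jacobi V" and R: "rng V = rng T"
 shows "slie_alg (slprod T V)"
proof -
 have T': "slie_alg T" "smodule T" and V': "slie_alg V" "smodule V" using T V by (auto simp: slie_jacobi_def slie_smodule)
 note aT = slie_anc[OF T'(1)] and aV = slie_anc[OF V'(1), unfolded R] and bT = slie_bracket[OF T'(1)] and bV = slie_bracket[OF V'(1), unfolded R]
 note jT = T[unfolded slie_jacobi_def, THEN conjunct2, rule_format] and jV = V[unfolded slie_jacobi_def, THEN conjunct2, rule_format, unfolded R]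
 let ?S = "slprod T V"
 have anc: "(%p. sanc V (sndm w) p f) = (%p. sanc T (fstm w) p f)" if "w : car ?S" "f : rng T" for w f using that by auto
 note cl = smodule_closed[OF T'(2)] smodule_closed[OF V'(2), unfolded R] slie_br[OF T'(1)] slie_br[OF V'(1)]
 \<comment> \<open>Closure of the fibre product under the bracket is where both anchors have to
   preserve brackets.\<close>
 have br: "sbr ?S w w' : car ?S" if w: "w : car ?S" "w' : car ?S" for w w'
 proof -
  have "sanc T (sbr T (fstm w) (fstm w')) m f = sanc V (sbr V (sndm w) (sndm w')) m f" if f: "f : rng T" for m f
  proof -
   have w': "fstm w : car T" "fstm w' : car T" "sndm w : car V" "sndm w' : car V" using w by auto
   have e: "sanc V (sndm u) m g = sanc T (fstm u) m g" if "u : {w, w'}" "g : rng T" for u g using w that by auto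
   show ?thesis unfolding jT[OF w'(1,2), THEN conjunct2, rule_format, OF f] jV[OF w'(3,4), THEN conjunct2, rule_format, OF f]
    anc[OF w(1) f] anc[OF w(2) f] e[OF _ aT(1)[OF w'(1) f], of w', simplified] e[OF _ aT(1)[OF w'(2) f], of w, simplified] by (rule refl)
  qed
  then show ?thesis using w cl by simp
 qed
 have 1: "br_closed ?S" unfolding br_closed_def smodule_def
  using br cl aT(5,6) aV(5,6) by (auto simp del: slprod_sel(6))
 show ?thesis unfolding slie_alg_def
 proof (intro conjI ballI allI 1)
  fix x assume x: "x : car ?S"
  show "snull ?S (sbr ?S x x)" using br[OF x x] bT(5)[of "fstm x" "fstm x"] bV(5)[of "sndm x" "sndm x"] x by (simp add: snull_def)
  fix y assume y: "y : car ?S"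
  { fix m f assume "f : rng ?S"
   then show "sanc ?S (sadd ?S x y) m f = sanc ?S x m f + sanc ?S y m f" using x y aT(6) by simp }
  { fix z assume z: "z : car ?S"
   show "sbr ?S (sadd ?S x y) z = sadd ?S (sbr ?S x z) (sbr ?S y z)" "sbr ?S z (sadd ?S x y) = sadd ?S (sbr ?S z x) (sbr ?S z y)"
    using x y z bT(1,2) bV(1,2) by simp_all }
  fix g assume g: "g : rng ?S"
  then have g': "g : rng T" by simp
  have xy: "fstm x : car T" "fstm y : car T" "sndm x : car V" "sndm y : car V" using x y by auto
  have e: "sanc V (sndm x) m g = sanc T (fstm x) m g" "sanc V (sndm y) m g = sanc T (fstm y) m g" for m using x y g' by auto
  show "sbr ?S (sscl ?S g x) y = sadd ?S (sscl ?S g (sbr ?S x y)) (sscl ?S (%m. - sanc ?S y m g) x)"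
   by (simp only: slprod_sel pairm bT(3)[OF xy(1,2) g'] bV(3)[OF xy(3,4) g'] e)
  show "sbr ?S x (sscl ?S g y) = sadd ?S (sscl ?S g (sbr ?S x y)) (sscl ?S (%m. sanc ?S x m g) y)"
   by (simp only: slprod_sel pairm bT(4)[OF xy(1,2) g'] bV(4)[OF xy(3,4) g'] e)
 next
  fix x f m assume "x : car ?S" "f : rng ?S"
  then have x: "fstm x : car T" "f : rng T" by auto
  show "(%m. sanc ?S x m f) : rng ?S" "sanc ?S x m (%p. c * f p) = c * sanc ?S x m f" for c using aT(1,2)[OF x] by simp_all
  fix g assume "g : rng ?S"
  then show "sanc ?S x m (%p. f p + g p) = sanc ?S x m f + sanc ?S x m g"
   "sanc ?S x m (%p. f p * g p) = sanc ?S x m f * g m + f m * sanc ?S x m g"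
   "sanc ?S (sscl ?S g x) m f = g m * sanc ?S x m f" using aT(3-5)[OF x] by simp_all
 qed
qed

text \<open>Antisymmetry in the form available without subtraction of sections: it holds under every
  additive \<open>N\<close> that vanishes on null sections.\<close>

lemma bracket_swap:
 assumes S: "slie_alg S" and N: "!!a b. a : car S ==> b : car S ==> N (sadd S a b) = N a + N b" "!!n. snull S n ==> N n = (0::real)"
  and x: "x : car S" "y : car S"
 shows "N (sbr S x y) = - N (sbr S y x)"
proof -
 note b = slie_bracket[OF S] and c = slie_br[OF S] smodule_closed(1)[OF slie_smodule[OF S]]
 have "N (sbr S (sadd S x y) (sadd S x y)) = N (sbr S x x) + N (sbr S x y) + (N (sbr S y x) + N (sbr S y y))"
  using x by (simp add: b(1,2) c N(1))
 then show ?thesis using N(2)[OF b(5)] x c by simp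
qed

lemma alt2_swap:
 assumes E: "smodule E" and V: "smodule V" and r: "alt2 E V r" and N: "!!a b. a : car V ==> b : car V ==> N (sadd V a b) = N a + N b" "!!n. snull V n ==> N n = (0::real)"
  and x: "x : car E" "y : car E"
 shows "N (r x y) = - N (r y x)"
proof -
 have n: "snull V (r x x)" if "x : car E" for x using r that by (simp add: alt2_def)
 note c = smodule_closed(1)[OF E] alt2_car[OF r] smodule_closed(1)[OF V]
 have "r (sadd E x y) (sadd E x y) = sadd V (sadd V (r x x) (r y x)) (sadd V (r x y) (r y y))"
  using x c by (simp add: alt2_add[OF r] shom_add[OF alt2_shom[OF r]])
 then have "N (r (sadd E x y) (sadd E x y)) = N (r x x) + N (r y x) + (N (r x y) + N (r y y))"
  using x by (simp add: c N(1))
 then show ?thesis using N(2)[OF n] x c by simp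
qed

text \<open>The six terms add up to the cyclic sum that defines the curvature.\<close>

lemma gcomm_terms:
 assumes S: "slie_alg S" and ta: "alt2 S S ta" and om: "om : AF S" and l: "set l <= car S" and x: "x : car S" "y : car S" "z : car S"
 defines "t == %x y z. sadd S (sbr S x (ta y z)) (sscl S (%_. - 1) (ta (sbr S x y) z))"
 shows "om (sbr S x (ta y z) # l) m - om (ta y (sbr S x z) # l) m - om (ta (sbr S x y) z # l) m
  - om (sbr S (ta x y) z # l) m - om (sbr S y (ta x z) # l) m + om (ta x (sbr S y z) # l) m =
  om (sadd S (t x y z) (sadd S (t y z x) (t z x y)) # l) m"
proof -
 note SM = slie_smodule[OF S]
 note c = slie_br[OF S] alt2_car[OF ta] smodule_closed[OF SM]
 have mi: "(%_. - 1) : rng S" using smodule_closed(3)[OF SM] by (rule func_ring_const)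
 let ?N = "%a. om (a # l) m"
 have N: "?N (sadd S a b) = ?N a + ?N b" if "a : car S" "b : car S" for a b using AF_add1[OF om] that l by simp
 have N0: "?N n = 0" if "snull S n" for n by (rule AF_snull1[OF SM om that l])
 have Ns: "?N (sscl S (%_. - 1) a) = - ?N a" if "a : car S" for a using AF_scl1[OF om] that l mi by simp
 \<comment> \<open>Bracketing with a null section gives nothing under \<open>om\<close>: rescaling
   it by 0 costs a term with the derivative of the constant 0, which vanishes.\<close>
 have ad0: "?N (sbr S u n) = 0" if "snull S n" "u : car S" for n u
 proof -
  have z0: "(%_. 0) : rng S" using smodule_closed(3)[OF SM] by (rule func_ring_const)
  have n: "n : car S" "sscl S (%_. 0) n = n" using that by (auto simp: snull_def)
  have "sbr S u n = sadd S (sscl S (%_. 0) (sbr S u n)) (sscl S (%m. sanc S u m (%_. 0)) n)"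
   using slie_bracket(4)[OF S that(2) n(1) z0] n(2) by simp
  also have "(%m. sanc S u m (%_. 0)) = (%_. 0)" using slie_anc_0[OF S that(2)] by simp
  finally have "?N (sbr S u n) = ?N (sadd S (sscl S (%_. 0) (sbr S u n)) (sscl S (%_. 0) n))" by simp
  also have "... = 0" using n that(2) c z0 AF_scl1[OF om] l N0[OF that(1)] by (simp add: N)
  finally show ?thesis .
 qed
 have t0: "?N (ta u n) = 0" if "snull S n" "u : car S" for n u
 proof -
  have n: "n : car S" "sscl S (%_. 0) n = n" using that by (auto simp: snull_def)
  have z0: "(%_. 0) : rng S" using smodule_closed(3)[OF SM] by (rule func_ring_const)
  have "ta u n = sscl S (%_. 0) (ta u n)" using shom_scl[OF alt2_shom[OF ta that(2)] z0 n(1)] n(2) by simp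
  then have "snull S (ta u n)" using alt2_car[OF ta that(2) n(1)] by (simp add: snull_def)
  then show ?thesis by (rule N0)
 qed
 have 1: "?N (sbr S (ta x y) z) = - ?N (sbr S z (ta x y))" by (rule bracket_swap[OF S N N0]) (use x c in auto)
 have 2: "?N (sbr S y (ta x z)) = - ?N (sbr S y (ta z x))"
  by (rule alt2_swap[OF SM SM ta, where N="%a. ?N (sbr S y a)"]) (use x c ad0 in "auto simp: slie_bracket(2)[OF S] N")
 have 3: "?N (ta x (sbr S y z)) = - ?N (ta (sbr S y z) x)" by (rule alt2_swap[OF SM SM ta N N0]) (use x c in auto)
 have 4: "?N (ta y (sbr S x z)) = - ?N (ta (sbr S x z) y)" by (rule alt2_swap[OF SM SM ta N N0]) (use x c in auto)
 have 5: "?N (ta y (sbr S x z)) = - ?N (ta y (sbr S z x))"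
  by (rule bracket_swap[OF S, where N="%a. ?N (ta y a)"]) (use x c t0 in "auto simp: shom_add[OF alt2_shom[OF ta]] N")
 have 6: "?N (ta y (sbr S z x)) = - ?N (ta (sbr S z x) y)" by (rule alt2_swap[OF SM SM ta N N0]) (use x c in auto)
 have tc: "t u v w : car S" "?N (t u v w) = ?N (sbr S u (ta v w)) - ?N (ta (sbr S u v) w)" if "u : car S" "v : car S" "w : car S" for u v w
  using that c mi unfolding t_def by (auto simp: N Ns)
 show ?thesis using 1 2 3 5 6 x tc c by (simp add: N)
qed

text \<open>The role of \<open>T\<close> is played by vector fields on the base, and
  \<open>z\<close> is the zero field. It is a parameter because the record of a module names no
  zero, and it fills the first component of vertical pairs.\<close>

locale coherence =
 fixes T :: "('m, 'm => 't) slie" and z :: "'m => 't"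
 assumes T: "slie_jacobi T" and z: "z : car T" "!!x. x : car T ==> sadd T x z = x" "!!g. g : rng T ==> sscl T g z = z"
  "!!x. x : car T ==> sbr T x z = z" "!!x. x : car T ==> sbr T z x = z"
begin

text \<open>The vertical extension to pairs: it reads first components and answers in the second.
  Feeding a value of one such map into another therefore gives a null pair, and their contractions
  anticommute.\<close>

definition "hat r = (%x y. pairm z (r (fstm x) (fstm y)))"
definition "gr g = (%X. pairm X (g X))"
definition "iot V r = con (car (sprod T V)) (%x. x) (hat r)"
text \<open>The double contraction of \<open>om\<close> with two 2-forms valued in \<open>V\<close>.
  A single \<open>con\<close> turns forms on \<open>V\<close> into forms on \<open>T\<close> and
  cannot be repeated; on pairs both contractions are operators on one algebra, and the graph of
  \<open>g\<close> brings the result back to \<open>T\<close>.\<close>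

definition "BB V g r s om = pbk (car T) (gr g) (iot V r (iot V s (pbk (car (sprod T V)) sndm om)))"

text \<open>A degree 1 derivation along the pullback by \<open>g\<close>: the exact one, corrected
  by a contraction. All first-order components below have this shape.\<close>

definition "W1 g r om = (%l m. sd T (pbk (car T) g om) l m - con (car T) g r om l m)"
text \<open>The second-order component above the first-order ones given by \<open>s\<close> and
  \<open>r\<close>. Formally it is (d - i_r)(d - i_s) plus the graded commutator of d and i_r, so
  that the term i_r d, for which \<open>V\<close> would need a differential, cancels.\<close>

definition "W12 V g r s om = (%l m. sd T (%l m. con (car T) g r om l m - con (car T) g s om l m) l m + BB V g r s om l m)"

definition "curv A ph ta X Y Z =
 (let t = %X Y Z. sadd A (sbr A (ph X) (ta Y Z)) (sscl A (%_. - 1) (ta (sbr T X Y) Z))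
 in sadd A (t X Y Z) (sadd A (t Y Z X) (t Z X Y)))"

lemma T': "slie_alg T" "smodule T" "br_closed T" "func_ring (rng T)"
 using T by (auto simp: slie_jacobi_def slie_smodule slie_br_closed smodule_closed)

lemma zero_rng: "(%_. 0) : rng T" using T'(4) by (rule func_ring_const)

lemma shom_gr: "shom T V g ==> shom T (sprod T V) (gr g)"
 by (auto simp: shom_def gr_def)

lemma shom_snd: "shom (sprod T V) V sndm"
 by (auto simp: shom_def)

lemma smodule_sprod: "smodule V ==> rng V = rng T ==> smodule (sprod T V)"
 using T'(2) by (auto simp: smodule_def)

lemma alt2_hat: "alt2 T V r ==> alt2 (sprod T V) (sprod T V) (hat r)"
 using z zero_rng by (auto simp: alt2_def shom_def snull_def hat_def)

lemma alt2_zero: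
 assumes "alt2 T V r" "x : car T" shows "snull V (r z x)" "snull V (r x z)"
 using assms z(1) z(3)[OF zero_rng] zero_rng unfolding alt2_def shom_def snull_def by metis+

context
 fixes V :: "('m, 'm => 'v, 'y) smod_scheme"
 assumes V: "smodule V" and R: "rng V = rng T"
begin

lemma AF_iot: "alt2 T V r ==> om : AF (sprod T V) ==> iot V r om : AF (sprod T V)"
 unfolding iot_def by (rule AF_con[OF smodule_sprod[OF V R] smodule_sprod[OF V R] refl shom_id alt2_hat])

lemma AF_snd: "om : AF V ==> pbk (car (sprod T V)) sndm om : AF (sprod T V)"
 by (rule AF_pbk[OF shom_snd _ smodule_sprod[OF V R]]) (simp_all add: R)

lemma AF_gr: "shom T V g ==> om : AF (sprod T V) ==> pbk (car T) (gr g) om : AF T"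
 by (rule AF_pbk[OF shom_gr _ T'(2)]) simp_all

lemma AF_BB: "shom T V g ==> alt2 T V r ==> alt2 T V s ==> om : AF V ==> BB V g r s om : AF T"
 unfolding BB_def by (intro AF_gr AF_iot AF_snd)

lemma AF_conT: "shom T V g ==> alt2 T V r ==> om : AF V ==> con (car T) g r om : AF T"
 by (rule AF_con[OF T'(2) V]) (simp_all add: R)

lemma AF_pbkT: "shom T V g ==> om : AF V ==> pbk (car T) g om : AF T"
 by (rule AF_pbk[OF _ _ T'(2)]) (simp_all add: R)

lemma gr_snd: "shom T V g ==> pbk (car T) (gr g) (pbk (car (sprod T V)) sndm om) = pbk (car T) g om"
 by (rule ext) (auto simp: pbk_def gr_def o_def shom_def)

lemma gr_iot:
 assumes g: "shom T V g" and r: "alt2 T V r" and om: "om : AF V"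
 shows "pbk (car T) (gr g) (iot V r (pbk (car (sprod T V)) sndm om)) = con (car T) g r om"
proof (rule AF_ext[OF AF_gr[OF g AF_iot[OF r AF_snd[OF om]]] AF_conT[OF g r om]])
 fix l m assume l: "set l <= car T"
 have gT: "gr g ` car T <= car (sprod T V)" using shom_car[OF shom_gr[OF g]] by blast
 have c: "ALL x:car T. ALL y:car T. pairm z (r x y) : car (sprod T V)" using z(1) alt2_car[OF r] by simp
 have "pbk (car T) (gr g) (iot V r (pbk (car (sprod T V)) sndm om)) l m =
   con (car T) (gr g) (%x y. pairm z (r x y)) (pbk (car (sprod T V)) sndm om) l m"
  unfolding iot_def using pbk_con[OF gT l, of "%x. x" "hat r" "pbk (car (sprod T V)) sndm om" m] by (simp add: hat_def gr_def)
 also have "... = con (car T) g r om l m"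
  using con_pbk[OF shom_snd l gT c, of om m] by (simp add: gr_def)
 finally show "pbk (car T) (gr g) (iot V r (pbk (car (sprod T V)) sndm om)) l m = con (car T) g r om l m" .
qed

text \<open>Two antiderivations in succession. The cross terms, where each acts on a different
  factor, come in both orders and with opposite signs.\<close>

lemma BB_wedge:
 assumes g: "shom T V g" and r: "alt2 T V r" and s: "alt2 T V s" and a: "a : AF V" and b: "b : AF V"
 shows "BB V g r s (wedge a b) l m = wedge (BB V g r s a) (pbk (car T) g b) l m + wedge (pbk (car T) g a) (BB V g r s b) l m
  + wedge (con (car T) g r (galt a)) (con (car T) g s b) l m - wedge (con (car T) g s (galt a)) (con (car T) g r b) l m"
proof (cases "set l <= car T")
 case True
 let ?S = "sprod T V" and ?p = "pbk (car (sprod T V)) sndm" and ?G = "pbk (car T) (gr g)"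
 note S = smodule_sprod[OF V R]
 have iw: "iot V r' (wedge c d) l m = wedge (iot V r' c) d l m + wedge (galt c) (iot V r' d) l m"
  if r': "alt2 T V r'" and c: "c : AF ?S" "d : AF ?S" and l: "set l <= car ?S" for r' c d l m
 proof -
  have i: "pbk (car ?S) (%x. x) e = e" if "e : AF ?S" for e :: "('m, 'm => 't \<times> 'v) sform"
   by (rule ext) (auto simp: pbk_def AF_off[OF that])
  show ?thesis unfolding iot_def using con_wedge[OF S _ _ c l, of "%x. x" "hat r'" m] alt2_car[OF alt2_hat[OF r']]
   by (simp add: i c)
 qed
 note A = AF_snd[OF a] AF_snd[OF b]
 note AS = AF_wedge[OF S] AF_iot AF_galt[OF S]
 have gl: "galt (iot V r' c) = (%l m. - iot V r' (galt c) l m)" for r' c unfolding iot_def by (rule galt_con)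
 have "iot V r (iot V s (?p (wedge a b))) l m = wedge (iot V r (iot V s (?p a))) (?p b) l m + wedge (?p a) (iot V r (iot V s (?p b))) l m
  + wedge (iot V r (galt (?p a))) (iot V s (?p b)) l m - wedge (iot V s (galt (?p a))) (iot V r (?p b)) l m"
  if l: "set l <= car ?S" for l m
 proof -
  have "iot V r (iot V s (?p (wedge a b))) l m =
    iot V r (%l m. wedge (iot V s (?p a)) (?p b) l m + wedge (galt (?p a)) (iot V s (?p b)) l m) l m"
   unfolding iot_def[of V r]
  proof (rule con_cong[where B="car ?S"])
   show "iot V s (?p (wedge a b)) l m = wedge (iot V s (?p a)) (?p b) l m + wedge (galt (?p a)) (iot V s (?p b)) l m"
    if "set l <= car ?S" for l by (simp only: pbk_wedge iw[OF s A that])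
  qed (use alt2_car[OF alt2_hat[OF r]] in auto)
  also have "... = iot V r (wedge (iot V s (?p a)) (?p b)) l m + iot V r (wedge (galt (?p a)) (iot V s (?p b))) l m"
   unfolding iot_def[of V r] by (rule con_plus)
  also have "iot V r (wedge (iot V s (?p a)) (?p b)) l m = wedge (iot V r (iot V s (?p a))) (?p b) l m - wedge (iot V s (galt (?p a))) (iot V r (?p b)) l m"
   by (simp add: iw[OF r AS(2)[OF s A(1)] A(2) l] gl wedge_uminus1)
  also have "iot V r (wedge (galt (?p a)) (iot V s (?p b))) l m = wedge (iot V r (galt (?p a))) (iot V s (?p b)) l m + wedge (?p a) (iot V r (iot V s (?p b))) l m"
   by (simp add: iw[OF r AS(3)[OF A(1)] AS(2)[OF s A(2)] l])
  finally show ?thesis by simp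
 qed
 from this[of "map (gr g) l"] have "BB V g r s (wedge a b) l m = ?G (wedge (iot V r (iot V s (?p a))) (?p b)) l m + ?G (wedge (?p a) (iot V r (iot V s (?p b)))) l m
  + ?G (wedge (iot V r (?p (galt a))) (iot V s (?p b))) l m - ?G (wedge (iot V s (?p (galt a))) (iot V r (?p b))) l m"
  using shom_map[OF shom_gr[OF g] True] True unfolding BB_def galt_pbk by (simp add: pbk_def[of "car T"])
 then show ?thesis unfolding pbk_wedge BB_def[symmetric] gr_snd[OF g] gr_iot[OF g r AF_galt[OF V a]] gr_iot[OF g s AF_galt[OF V a]]
  gr_iot[OF g r b] gr_iot[OF g s b] .
next
 case False
 note AW = AF_wedge[OF T'(2)]
 show ?thesis using False AF_off[OF AF_BB[OF g r s AF_wedge[OF V a b]] False] AF_off[OF AW[OF AF_BB[OF g r s a] AF_pbkT[OF g b]] False]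
  AF_off[OF AW[OF AF_pbkT[OF g a] AF_BB[OF g r s b]] False] AF_off[OF AW[OF AF_conT[OF g r AF_galt[OF V a]] AF_conT[OF g s b]] False]
  AF_off[OF AW[OF AF_conT[OF g s AF_galt[OF V a]] AF_conT[OF g r b]] False] by simp
qed

lemma iot_swap:
 assumes r: "alt2 T V r" and s: "alt2 T V s" and om: "om : AF (sprod T V)" and l: "set l <= car (sprod T V)"
 shows "iot V r (iot V s om) l m = - iot V s (iot V r om) l m"
 unfolding iot_def
proof (rule co_anticommute[OF smodule_sprod[OF V R] alt2_hat[OF r] alt2_hat[OF s] _ om l])
 fix r' s' :: "('m => 't \<times> 'v) => ('m => 't \<times> 'v) => 'm => 't \<times> 'v" and x y w assume *: "r' : {hat r, hat s}" "s' : {hat r, hat s}" "x : car (sprod T V)" "y : car (sprod T V)" "w : car (sprod T V)"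
 show "snull (sprod T V) (r' (s' x y) w) & snull (sprod T V) (r' w (s' x y))"
  using * z(1) z(3)[OF zero_rng] alt2_zero[OF r] alt2_zero[OF s] by (auto simp: hat_def snull_def)
qed

lemma BB_swap:
 assumes "shom T V g" "alt2 T V r" "alt2 T V s" "om : AF V"
 shows "BB V g r s om l m = - BB V g s r om l m"
 using iot_swap[OF assms(2,3) AF_snd[OF assms(4)]] shom_map[OF shom_gr[OF assms(1)]] by (simp add: BB_def pbk_def)

lemma BB_null:
 assumes g: "shom T V g" and r: "alt2 T V r" and s: "alt2 T V s" and om: "om : AF V"
  and n: "!!x y. x : car T ==> y : car T ==> snull V (r x y)"
 shows "BB V g r s om l m = 0"
proof -
 have "iot V r (iot V s (pbk (car (sprod T V)) sndm om)) l m = 0" for l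
  unfolding iot_def[of V r] using n z(1) z(3)[OF zero_rng]
  by (intro con_null[OF smodule_sprod[OF V R] AF_iot[OF s AF_snd[OF om]]]) (auto simp: snull_def hat_def)
 then show ?thesis by (simp add: BB_def pbk_def)
qed

lemma BB_natural:
 assumes A: "smodule A" "rng A = rng T" and q: "shom V A q" and g: "shom T V g" and r: "alt2 T V r" and s: "alt2 T V s" and om: "om : AF A"
 shows "BB V g r s (pbk (car V) q om) = BB A (%x. q (g x)) (%x y. q (r x y)) (%x y. q (s x y)) om"
proof (intro ext)
 fix l m
 let ?h = "%w. pairm (fstm w) (q (sndm w))" and ?S = "sprod T V" and ?SA = "sprod T A"
 have h: "shom ?S ?SA ?h" using q by (auto simp: shom_def R)
 have i: "iot V r' (pbk (car ?S) ?h et) l m = pbk (car ?S) ?h (iot A (%x y. q (r' x y)) et) l m"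
  if r': "alt2 T V r'" and l: "set l <= car ?S" for r' et l m
  unfolding iot_def by (rule con_intertwine[OF h _ l]) (use alt2_car[OF alt2_hat[OF r']] in "auto simp: hat_def")
 have p: "pbk (car ?S) sndm (pbk (car V) q om) l = pbk (car ?S) ?h (pbk (car ?SA) sndm om) l" if l: "set l <= car ?S" for l
  using shom_map[OF h l] shom_map[OF shom_snd l] by (simp add: pbk_def o_def)
 have "iot V r (iot V s (pbk (car ?S) sndm (pbk (car V) q om))) l m =
   pbk (car ?S) ?h (iot A (%x y. q (r x y)) (iot A (%x y. q (s x y)) (pbk (car ?SA) sndm om))) l m" if l: "set l <= car ?S" for l
 proof -
  have c: "ALL x:car ?S. ALL y:car ?S. hat r x y : car ?S" "ALL x:car ?S. ALL y:car ?S. hat s x y : car ?S"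
   using alt2_car[OF alt2_hat[OF r]] alt2_car[OF alt2_hat[OF s]] by auto
  have "iot V s (pbk (car ?S) sndm (pbk (car V) q om)) l m = pbk (car ?S) ?h (iot A (%x y. q (s x y)) (pbk (car ?SA) sndm om)) l m"
   if l: "set l <= car ?S" for l
  proof -
   have "iot V s (pbk (car ?S) sndm (pbk (car V) q om)) l m = iot V s (pbk (car ?S) ?h (pbk (car ?SA) sndm om)) l m"
    unfolding iot_def by (rule con_cong[where B="car ?S"]) (use c(2) p in auto)
   then show ?thesis by (simp only: i[OF s l])
  qed
  then have "iot V r (iot V s (pbk (car ?S) sndm (pbk (car V) q om))) l m =
    iot V r (pbk (car ?S) ?h (iot A (%x y. q (s x y)) (pbk (car ?SA) sndm om))) l m"
   unfolding iot_def[of V r] by (intro con_cong[where B="car ?S"]) (use c(1) in auto)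
  then show ?thesis by (simp only: i[OF r l])
 qed
 from this[of "map (gr g) l"] show "BB V g r s (pbk (car V) q om) l m = BB A (%x. q (g x)) (%x y. q (r x y)) (%x y. q (s x y)) om l m"
  using shom_map[OF shom_gr[OF g]] by (simp add: BB_def pbk_def gr_def o_def)
qed

lemma BB_cong:
 fixes om :: "('m, 'm => 'v) sform"
 assumes "!!x. x : car T ==> g x = g' x" "!!x y. x : car T ==> y : car T ==> r x y = r' x y" "!!x y. x : car T ==> y : car T ==> s x y = s' x y"
 shows "BB V g r s om = BB V g' r' s' om"
proof -
 have "iot V r et = iot V r' et" "iot V s et = iot V s' et" for et :: "('m, 'm => 't \<times> 'v) sform"
  unfolding iot_def using assms(2,3) by (auto intro!: con_fun_cong simp: hat_def)
 moreover have "pbk (car T) (gr g) et = pbk (car T) (gr g') et" for et :: "('m, 'm => 't \<times> 'v) sform"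
 proof
  fix l
  have mp: "map (gr g) l = map (gr g') l" if "set l <= car T" by (rule map_cong) (use that assms(1) in "auto simp: gr_def")
  show "pbk (car T) (gr g) et l = pbk (car T) (gr g') et l" by (cases "set l <= car T") (simp_all only: pbk_def if_True if_False mp)
 qed
 ultimately show ?thesis by (simp add: BB_def)
qed

lemma AF_W1: "shom T V g ==> alt2 T V r ==> om : AF V ==> W1 g r om : AF T"
 unfolding W1_def by (intro AF_minus[OF T'(2)] AF_sd[OF T'(1)] AF_pbkT AF_conT)

lemma AF_W12: "shom T V g ==> alt2 T V r ==> alt2 T V s ==> om : AF V ==> W12 V g r s om : AF T"
 unfolding W12_def by (intro AF_plus[OF T'(2)] AF_sd[OF T'(1)] AF_minus[OF T'(2)] AF_BB AF_conT)

context
 fixes g r s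
 assumes g: "shom T V g" and r: "alt2 T V r" and s: "alt2 T V s"
begin

lemma con_wedgeT:
 assumes "alt2 T V r'" "a : AF V" "b : AF V" "set l <= car T"
 shows "con (car T) g r' (wedge a b) l m = wedge (con (car T) g r' a) (pbk (car T) g b) l m + wedge (pbk (car T) g (galt a)) (con (car T) g r' b) l m"
 using con_wedge[OF V _ _ assms(2-4), of g r' m] shom_car[OF g] alt2_car[OF assms(1)] by (auto simp: galt_pbk)

lemma W1_wedge:
 assumes a: "a : AF V" and b: "b : AF V" and l: "set l <= car T"
 shows "W1 g r (wedge a b) l m = wedge (W1 g r a) (pbk (car T) g b) l m + wedge (pbk (car T) g (galt a)) (W1 g r b) l m"
 unfolding W1_def wedge_diff1 wedge_diff2 con_wedgeT[OF r a b l] pbk_wedge sd_wedge[OF T'(1) AF_pbkT[OF g a] AF_pbkT[OF g b] l] galt_pbk by simp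

text \<open>The product rule of a map into the iterated shifted tangent bundle. Cross terms from the
  differential and from \<open>BB_wedge\<close> combine into the two products of \<open>W1\<close>,
  in whose difference the products of two differentials cancel.\<close>

lemma W12_wedge:
 assumes a: "a : AF V" and b: "b : AF V" and l: "set l <= car T"
 shows "W12 V g r s (wedge a b) l m = wedge (W12 V g r s a) (pbk (car T) g b) l m + wedge (pbk (car T) g a) (W12 V g r s b) l m
  + (wedge (W1 g r (galt a)) (W1 g s b) l m - wedge (W1 g s (galt a)) (W1 g r b) l m)"
proof -
 let ?g = "pbk (car T) g" and ?e = "%a l m. con (car T) g r a l m - con (car T) g s a l m"
 have a': "galt a : AF V" by (rule AF_galt[OF V a])
 have Ae: "?e x : AF T" if "x : AF V" for x using that by (intro AF_minus[OF T'(2)] AF_conT g r s)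
 note Ag = AF_pbkT[OF g]
 have ge: "galt (?e a) = (%l m. - ?e (galt a) l m)"
  using fun_cong[OF fun_cong[OF galt_con[of "car T" g r a]]] fun_cong[OF fun_cong[OF galt_con[of "car T" g s a]]]
  by (simp add: galt_def fun_eq_iff right_diff_distrib)
 have "sd T (?e (wedge a b)) l m = sd T (%l m. wedge (?e a) (?g b) l m + wedge (?g (galt a)) (?e b) l m) l m"
  by (rule sd_cong[OF T'(3)]) (simp add: con_wedgeT[OF r a b] con_wedgeT[OF s a b] wedge_diff1 wedge_diff2)
 also have "... = sd T (wedge (?e a) (?g b)) l m + sd T (wedge (?g (galt a)) (?e b)) l m"
  by (rule sd_lin(1)[OF T'(1) AF_wedge[OF T'(2) Ae[OF a] Ag[OF b]] AF_wedge[OF T'(2) Ag[OF a'] Ae[OF b]]])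
 also have "... = wedge (sd T (?e a)) (?g b) l m - wedge (?e (galt a)) (sd T (?g b)) l m
   + (wedge (sd T (?g (galt a))) (?e b) l m + wedge (?g a) (sd T (?e b)) l m)"
  unfolding sd_wedge[OF T'(1) Ae[OF a] Ag[OF b] l] sd_wedge[OF T'(1) Ag[OF a'] Ae[OF b] l] ge
  by (subst wedge_uminus1) (simp add: galt_pbk)
 finally show ?thesis unfolding W12_def W1_def BB_wedge[OF g r s a b]
  by (simp add: wedge_plus1 wedge_plus2 wedge_diff1 wedge_diff2)
qed

end

end

section \<open>Contraction as a graded commutator along the graph of a splitting\<close>

context
 fixes A :: "('m, 'm => 'v) slie" and ph ta si nA
 assumes A: "slie_jacobi A" and R: "rng A = rng T" and ph: "shom T A ph" and ta: "alt2 T A ta" and si: "alt2 T A si"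
  and anc: "!!x f m. x : car T ==> f : rng T ==> sanc A (ph x) m f = sanc T x m f"
  and ancta: "!!x y f m. x : car T ==> y : car T ==> f : rng T ==> sanc A (ta x y) m f = 0"
  and ancsi: "!!x y f m. x : car T ==> y : car T ==> f : rng T ==> sanc A (si x y) m f = 0"
  and br: "!!x y. x : car T ==> y : car T ==> sbr A (ph x) (ph y) = sadd A (ph (sbr T x y)) (si x y)"
  and nA: "snull A nA"
begin

abbreviation "S == slprod T A"

lemma A': "slie_alg A" "smodule A" "br_closed A"
 using A by (auto simp: slie_jacobi_def slie_smodule slie_br_closed)

lemma S': "slie_alg S" "smodule S" "br_closed S"
 using slie_alg_slprod[OF T A R] by (auto simp: slie_smodule slie_br_closed)

lemma sanc_z: "f : rng T ==> sanc T z m f = 0"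
 using slie_anc(5)[OF T'(1) z(1) _ zero_rng, of f m] z(3)[OF zero_rng] by simp

lemma shom_grS: "shom T S (gr ph)"
 using shom_gr[OF ph] anc by (auto simp: shom_def gr_def)

lemma alt2_hatS:
 assumes r: "alt2 T A r" "!!x y f m. x : car T ==> y : car T ==> f : rng T ==> sanc A (r x y) m f = 0"
 shows "alt2 S S (hat r)"
 using alt2_hat[OF r(1)] sanc_z r(2) by (auto simp: alt2_def shom_def snull_def hat_def)

lemma hat_ta: "alt2 S S (hat ta)"
 by (rule alt2_hatS[OF ta]) (rule ancta)

lemma hat_si: "alt2 S S (hat si)"
 by (rule alt2_hatS[OF si]) (rule ancsi)

lemma AF_sndS: "om : AF A ==> pbk (car S) sndm om : AF S"
 by (rule AF_pbk[OF _ _ S'(2)]) (auto simp: shom_def R)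

lemma pbk_sd_ph:
 assumes "om : AF A"
 shows "pbk (car T) ph (sd A om) = W1 ph si om"
proof (rule AF_ext[OF AF_pbkT[OF A'(2) R ph AF_sd[OF A'(1) assms]] AF_W1[OF A'(2) R ph si assms]])
 fix l m assume l: "set l <= car T"
 show "pbk (car T) ph (sd A om) l m = W1 ph si om l m" unfolding W1_def
 proof (rule pbk_sd[OF T'(3) A'(3) _ _ AF_pbkT[OF A'(2) R ph] _ _ assms l])
  show "ph ` car T <= car A" using shom_car[OF ph] by blast
  show "ALL x:car T. ALL y:car T. si x y : car A" using alt2_car[OF si] by blast
  fix x y om l m assume "x : car T" "y : car T" "om : AF A" "set l <= car A"
  then show "om (sbr A (ph x) (ph y) # l) m = om (ph (sbr T x y) # l) m + om (si x y # l) m"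
   unfolding br[OF \<open>x : car T\<close> \<open>y : car T\<close>]
   by (intro AF_add1) (auto intro: shom_car[OF ph] alt2_car[OF si] slie_br[OF T'(1)])
 qed (simp_all add: anc R)
qed

text \<open>The graph of \<open>ph\<close> preserves brackets up to the vertical pair (0,
  \<open>si\<close>). By \<open>pbk_sd\<close>, restricting a differential to the graph thus costs a
  contraction with \<open>si\<close>; applied to a form already contracted with \<open>ta\<close> it
  is the quadratic term, with its sign fixed by \<open>BB_swap\<close>. The other half of the
  commutator restricts exactly, since the second projection preserves brackets.\<close>

lemma gcomm_eq:
 assumes om: "om : AF A" and l: "set l <= car T"
 shows "con (car T) ph ta (sd A om) l m + sd T (con (car T) ph ta om) l m + BB A ph ta si om l m =
  gcomm S (hat ta) (pbk (car S) sndm om) (map (gr ph) l) m"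
proof -
 let ?S = "sprod T A"
 let ?p = "pbk (car S) sndm" and ?i = "%r. con (car S) (%x. x) (hat r)"
 note g = shom_grS and hta = hat_ta and hsi = hat_si
 have gS: "gr ph ` car T <= car S" using shom_car[OF g] by blast
 have L: "set (map (gr ph) l) <= car S" using gS l by auto
 have p: "?p om : AF S" by (rule AF_sndS[OF om])
 have Ap: "pbk (car T) (gr ph) et : AF T" if "et : AF S" for et by (rule AF_pbk[OF g _ T'(2) that]) simp
 have Ai: "?i r et : AF S" if "alt2 S S (hat r)" "et : AF S" for r et by (rule AF_con[OF S'(2) S'(2) refl shom_id that])
 have inc: "shom S ?S (%x. x)" by (auto simp: shom_def)
 have gi: "pbk (car T) (gr ph) (?i r (?p et)) = con (car T) ph r et" if r: "alt2 T A r" "alt2 S S (hat r)" and et: "et : AF A" for r et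
 proof (rule AF_ext[OF Ap[OF Ai[OF r(2) AF_sndS[OF et]]] AF_conT[OF A'(2) R ph r(1) et]])
  fix l m assume l: "set l <= car T"
  have c: "pairm z (r x y) : car S" if "x : car T" "y : car T" for x y
   using alt2_car[OF r(2) shom_car[OF g that(1)] shom_car[OF g that(2)]] by (simp add: hat_def gr_def)
  have "pbk (car T) (gr ph) (?i r (?p et)) l m = con (car T) (gr ph) (%x y. pairm z (r x y)) (?p et) l m"
   using pbk_con[OF gS l, of "%x. x" "hat r" "?p et" m] by (simp add: hat_def gr_def)
  also have "... = con (car T) ph r et l m"
  proof -
   have sS: "shom S A sndm" by (auto simp: shom_def)
   have c': "ALL x:car T. ALL y:car T. pairm z (r x y) : car S" using c by blast
   show ?thesis using con_pbk[OF sS l gS c', of et m] by (simp add: gr_def del: slprod_sel)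
  qed
  finally show "pbk (car T) (gr ph) (?i r (?p et)) l m = con (car T) ph r et l m" .
 qed
 have 1: "sd S (?i ta (?p om)) (map (gr ph) l) m = sd T (con (car T) ph ta om) l m + BB A ph ta si om l m"
 proof -
  let ?et = "?i ta (?p om)"
  have et: "?et : AF S" by (rule Ai[OF hta p])
  have "pbk (car T) (gr ph) (sd S ?et) l m = sd T (pbk (car T) (gr ph) ?et) l m - con (car T) (gr ph) (%x y. pairm z (si x y)) ?et l m"
  proof (rule pbk_sd[OF T'(3) S'(3) gS _ Ap _ _ et l])
   have c: "pairm z (si x y) : car S" if "x : car T" "y : car T" for x y
    using alt2_car[OF hsi shom_car[OF g that(1)] shom_car[OF g that(2)]] by (simp add: hat_def gr_def)
   then show "ALL x:car T. ALL y:car T. pairm z (si x y) : car S" by blast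
   fix x y om l m assume *: "x : car T" "y : car T" "om : AF S" "set l <= car S"
   have "sbr S (gr ph x) (gr ph y) = sadd S (gr ph (sbr T x y)) (pairm z (si x y))"
    using br[OF *(1,2)] z(2) slie_br[OF T'(1) *(1,2)] by (simp add: gr_def)
   then show "om (sbr S (gr ph x) (gr ph y) # l) m = om (gr ph (sbr T x y) # l) m + om (pairm z (si x y) # l) m"
    using AF_add1[OF *(3,4) shom_car[OF g slie_br[OF T'(1) *(1,2)]] c[OF *(1,2)]] by simp
  qed (simp_all add: gr_def)
  moreover have "con (car T) (gr ph) (%x y. pairm z (si x y)) ?et l m = BB A ph si ta om l m"
  proof -
   have a2: "ALL x:car S. ALL y:car S. hat si x y : car S" using alt2_car[OF hsi] by blast
   have i: "?i r (pbk (car S) (%x. x) et) l m = pbk (car S) (%x. x) (iot A r et) l m" if "alt2 S S (hat r)" "set l <= car S" for r l m and et :: "('m, 'm => 't \<times> 'v) sform"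
    unfolding iot_def by (rule con_intertwine[OF inc _ that(2)]) (use alt2_car[OF that(1)] in blast)
   have p': "?p om = pbk (car S) (%x. x) (pbk (car ?S) sndm om)" by (rule ext) (auto simp: pbk_def)
   have i1: "?et l m = pbk (car S) (%x. x) (iot A ta (pbk (car ?S) sndm om)) l m" if "set l <= car S" for l m
    unfolding p' by (rule i[OF hta that])
   have "con (car T) (gr ph) (%x y. pairm z (si x y)) ?et l m = pbk (car T) (gr ph) (?i si ?et) l m"
    using pbk_con[OF gS l, of "%x. x" "hat si" ?et m] by (simp add: hat_def gr_def)
   also have "... = ?i si ?et (map (gr ph) l) m" using l by (simp add: pbk_def)
   also have "... = ?i si (pbk (car S) (%x. x) (iot A ta (pbk (car ?S) sndm om))) (map (gr ph) l) m"
    by (rule con_cong[where B="car S"]) (use a2 i1 in auto)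
   also have "... = iot A si (iot A ta (pbk (car ?S) sndm om)) (map (gr ph) l) m"
    unfolding i[OF hsi L] using L unfolding pbk_def by (simp only: if_True map_ident)
   finally show ?thesis using l by (simp add: BB_def pbk_def[of "car T"])
  qed
  ultimately show ?thesis using BB_swap[OF A'(2) R ph si ta om, of l m] gi[OF ta hta om] l by (simp add: pbk_def[of "car T" "gr ph"])
 qed
 have 2: "?i ta (sd S (?p om)) (map (gr ph) l) m = con (car T) ph ta (sd A om) l m"
 proof -
  have c: "sd S (?p om) l m = ?p (sd A om) l m" if l: "set l <= car S" for l m
  proof -
   have "?p (sd A om) l m = sd S (?p om) l m - con (car S) sndm (%x y. nA) om l m"
   proof (rule pbk_sd[OF S'(3) A'(3) _ _ AF_sndS _ _ om l])
    show "ALL x:car S. ALL y:car S. nA : car A" using nA by (simp add: snull_def)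
    fix x y om l m assume "om : AF A" "set l <= car A"
    then show "om (sbr A (sndm x) (sndm y) # l) m = om (sndm (sbr S x y) # l) m + om (nA # l) m"
     using AF_snull1[OF A'(2) _ nA] by simp
   qed (auto simp: R)
   moreover have "con (car S) sndm (%x y. nA) om l m = 0" by (rule con_null[OF A'(2) om]) (auto simp: nA)
   ultimately show ?thesis by simp
  qed
  have "?i ta (sd S (?p om)) (map (gr ph) l) m = ?i ta (?p (sd A om)) (map (gr ph) l) m"
   by (rule con_cong[where B="car S"]) (use alt2_car[OF hta] c in auto)
  also have "... = pbk (car T) (gr ph) (?i ta (?p (sd A om))) l m" using l by (simp add: pbk_def[of "car T"])
  finally show ?thesis unfolding gi[OF ta hta AF_sd[OF A'(1) om]] .
 qed
 show ?thesis unfolding gcomm_def[OF S'(1) hta] using 1 2 by simp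
qed

lemma curv_S:
 assumes x: "X : car T" "Y : car T" "Z : car T"
 defines "t == %x y z. sadd S (sbr S x (hat ta y z)) (sscl S (%_. - 1) (hat ta (sbr S x y) z))"
 shows "sadd S (t (gr ph X) (gr ph Y) (gr ph Z)) (sadd S (t (gr ph Y) (gr ph Z) (gr ph X)) (t (gr ph Z) (gr ph X) (gr ph Y))) = pairm z (curv A ph ta X Y Z)"
 unfolding t_def curv_def Let_def using x z func_ring_const[OF T'(4)] by (simp add: hat_def gr_def)

lemma gcomm_terms_curv:
 assumes x: "X : car T" "Y : car T" "Z : car T" and om: "om : AF S" and l: "set l <= car S"
 defines "x == gr ph X" and "y == gr ph Y" and "w == gr ph Z"
 shows "om (sbr S x (hat ta y w) # l) m - om (hat ta y (sbr S x w) # l) m - om (hat ta (sbr S x y) w # l) m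
  - om (sbr S (hat ta x y) w # l) m - om (sbr S y (hat ta x w) # l) m + om (hat ta x (sbr S y w) # l) m = om (pairm z (curv A ph ta X Y Z) # l) m"
 unfolding curv_S[OF x, symmetric] x_def y_def w_def
 by (rule gcomm_terms[OF S'(1) hat_ta om l]) (rule shom_car[OF shom_grS] x)+

text \<open>With null curvature the pair (0, curvature) is null in the fibre product, its anchor
  acting by 0, and the commutator on pairs vanishes along the graph.\<close>

lemma key_identity:
 assumes 0: "!!X Y Z. X : car T ==> Y : car T ==> Z : car T ==> snull A (curv A ph ta X Y Z)"
  and om: "om : AF A" and l: "set l <= car T"
 shows "con (car T) ph ta (sd A om) l m + sd T (con (car T) ph ta om) l m + BB A ph ta si om l m = 0"
 unfolding gcomm_eq[OF om l]
proof (rule gcomm_zero[OF S'(1) hat_ta, of "gr ph" "car T"])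
 show "gr ph ` car T <= car S" using shom_car[OF shom_grS] by blast
 show "sanc S (hat ta x y) m f = 0" if "f : rng S" for x y m f using sanc_z that by (simp add: hat_def)
 show "set (map (gr ph) l) <= gr ph ` car T" using l by auto
 fix om x y w l m assume *: "om : AF S" "x : gr ph ` car T" "y : gr ph ` car T" "w : gr ph ` car T" "set l <= car S"
 then obtain X Y Z where x: "X : car T" "Y : car T" "Z : car T" "x = gr ph X" "y = gr ph Y" "w = gr ph Z" by blast
 have "snull S (pairm z (curv A ph ta X Y Z))"
 proof -
  have n: "snull A (curv A ph ta X Y Z)" by (rule 0[OF x(1-3)])
  have "sanc A (curv A ph ta X Y Z) m f = 0" if "f : rng T" for m f
   using slie_anc(5)[OF A'(1), of "curv A ph ta X Y Z" f "%_. 0" m] n that zero_rng by (simp add: snull_def R)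
  then show ?thesis using n z(1) z(3)[OF zero_rng] sanc_z by (simp add: snull_def)
 qed
 then show "om (sbr S x (hat ta y w) # l) m - om (hat ta y (sbr S x w) # l) m - om (hat ta (sbr S x y) w # l) m
  - om (sbr S (hat ta x y) w # l) m - om (sbr S y (hat ta x w) # l) m + om (hat ta x (sbr S y w) # l) m = 0"
  unfolding x(4-6) gcomm_terms_curv[OF x(1-3) *(1,5)] by (rule AF_snull1[OF S'(2) *(1) _ *(5)])
qed (rule AF_sndS[OF om])

text \<open>On a 1-form the quadratic term drops out: it would insert a vertical value into
  \<open>hat si\<close>, which reads first components. What is left of the commutator is the value
  on the cyclic sum.\<close>

lemma gcomm_one_form:
 assumes xi: "xi : AF A" "!!l. length l ~= 1 ==> xi l = (%m. 0)" and X: "X : car T" "Y : car T" "Z : car T"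
 shows "con (car T) ph ta (sd A xi) [X, Y, Z] m + sd T (con (car T) ph ta xi) [X, Y, Z] m = xi [curv A ph ta X Y Z] m"
proof -
 let ?om = "pbk (car S) sndm xi"
 define x y w where "x = gr ph X" and "y = gr ph Y" and "w = gr ph Z"
 note h = hat_ta
 have om: "?om : AF S" "!!l. length l ~= 1 ==> ?om l = (%m. 0)" using AF_sndS[OF xi(1)] xi(2) by (auto simp: pbk_def)
 have xc: "x : car S" "y : car S" "w : car S" unfolding x_def y_def w_def by (rule shom_car[OF shom_grS] X)+
 note c = slie_br[OF S'(1)] alt2_car[OF h]
 have az: "sanc S (hat ta u v) m f = 0" if "f : rng T" for u v :: "'m => 't \<times> 'v" and m f using sanc_z that by (simp add: hat_def)
 have r: "?om l : rng T" for l using AF_rng[OF om(1)] by simp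
 define N where "N a = ?om [a]" for a
 have N: "N (sadd S a b) m = N a m + N b m" if "a : car S" "b : car S" for a b using AF_add1[OF om(1)] that by (simp add: N_def)
 have N0: "N n m = 0" if "snull S n" for n unfolding N_def by (rule AF_snull1[OF S'(2) om(1) that]) simp
 note sw = bracket_swap[OF S'(1), where N="%a. N a m", OF N N0] and sw' = alt2_swap[OF S'(2) S'(2) h, where N="%a. N a m", OF N N0]
 have sd2: "sd S ?om [a, b] m = sanc S a m (N b) - sanc S b m (N a) - N (sbr S a b) m" if "a : car S" "b : car S" for a b m
  using that unfolding sd_def N_def by (simp del: slprod_sel)
 have con2: "con (car S) (%x. x) (hat ta) ?om [a, b] = N (hat ta a b)" if "a : car S" "b : car S" for a b
  using that unfolding con_def N_def by (simp del: slprod_sel)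
 have e1: "con (car S) (%x. x) (hat ta) (sd S ?om) [x, y, w] m =
   sd S ?om [hat ta x y, w] m - sd S ?om [hat ta x w, y] m + sd S ?om [hat ta y w, x] m"
  using xc unfolding con_def by (simp del: slprod_sel)
 have e2: "sd S th [x, y, w] m = sanc S x m (th [y, w]) - sanc S y m (th [x, w]) + sanc S w m (th [x, y])
   - th [sbr S x y, w] m + th [sbr S x w, y] m - th [sbr S y w, x] m" for th
  using xc unfolding sd_def by (simp del: slprod_sel)
 have "gcomm S (hat ta) ?om [x, y, w] m =
   (- N (sbr S (hat ta x y) w) m + N (sbr S (hat ta x w) y) m - N (sbr S (hat ta y w) x) m)
   + (- N (hat ta (sbr S x y) w) m + N (hat ta (sbr S x w) y) m - N (hat ta (sbr S y w) x) m)"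
  unfolding gcomm_def[OF S'(1) h] e1 e2 using xc c az r unfolding N_def[symmetric]
  by (simp add: sd2 con2 N_def[of "_ :: 'm => 't \<times> 'v"] del: slprod_sel)
 also have "... = N (sbr S x (hat ta y w)) m - N (hat ta y (sbr S x w)) m - N (hat ta (sbr S x y) w) m
  - N (sbr S (hat ta x y) w) m - N (sbr S y (hat ta x w)) m + N (hat ta x (sbr S y w)) m"
  using sw[of x "hat ta y w"] sw[of y "hat ta x w"] sw'[of y "sbr S x w"] sw'[of x "sbr S y w"] xc c by (simp del: slprod_sel)
 also have "... = N (pairm z (curv A ph ta X Y Z)) m"
  using gcomm_terms_curv[OF X om(1), of "[]" m] unfolding N_def x_def y_def w_def by simp
 also have "... = xi [curv A ph ta X Y Z] m"
 proof -
  have t: "sadd S (sbr S u (hat ta v v')) (sscl S (%_. - 1) (hat ta (sbr S u v) v')) : car S"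
   if "u : car S" "v : car S" "v' : car S" for u v v'
   by (intro smodule_closed[OF S'(2)] c that) (simp add: func_ring_const[OF T'(4)])
  have "pairm z (curv A ph ta X Y Z) : car S" unfolding curv_S[OF X, symmetric] x_def[symmetric] y_def[symmetric] w_def[symmetric]
   by (intro smodule_closed(1)[OF S'(2)] t xc)
  then show ?thesis unfolding N_def pbk_def by (simp del: slprod_sel)
 qed
 finally have g: "gcomm S (hat ta) ?om [x, y, w] m = xi [curv A ph ta X Y Z] m" .
 have B: "BB A ph ta si xi [X, Y, Z] m = 0"
 proof -
  let ?S = "sprod T A" and ?et = "pbk (car (sprod T A)) sndm xi"
  note hs = alt2_hat[OF si] and ht = alt2_hat[OF ta]
  have xs: "x : car ?S" "y : car ?S" "w : car ?S" using xc by auto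
  have et: "?et : AF ?S" by (rule AF_snd[OF A'(2) R xi(1)])
  have 0: "iot A si ?et [hat ta a b, c] m = 0" if "a : car ?S" "b : car ?S" "c : car ?S" for a b c
  proof -
   have n: "snull ?S (hat si (hat ta a b) c)" using that alt2_zero[OF si, of "fstm c"] z(1) z(3)[OF zero_rng] by (auto simp: hat_def snull_def)
   have "iot A si ?et [hat ta a b, c] m = ?et [hat si (hat ta a b) c] m"
    using that alt2_car[OF ht that(1,2)] unfolding iot_def con_def by (simp del: sprod_sel)
   then show ?thesis using AF_snull1[OF smodule_sprod[OF A'(2) R] et n] by simp
  qed
  have "iot A ta th [x, y, w] m = th [hat ta x y, w] m - th [hat ta x w, y] m + th [hat ta y w, x] m" for th :: "('m, 'm => 't \<times> 'v) sform"
   using xs unfolding iot_def con_def by (simp del: sprod_sel)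
  from this[of "iot A si ?et"] have "iot A ta (iot A si ?et) [x, y, w] m = 0" using 0 xs by (simp del: sprod_sel)
  then show ?thesis using X unfolding BB_def by (simp add: pbk_def[of "car T"] x_def y_def w_def)
 qed
 have "set [X, Y, Z] <= car T" using X by simp
 from gcomm_eq[OF xi(1) this, of m] show ?thesis unfolding B using g by (simp add: x_def y_def w_def)
qed

end

end

section \<open>Forms as alternating function-multilinear maps\<close>

definition mod_of :: "('m, 'e::euclidean_space, 'v, 'z) vbundle_scheme => ('m, 'm => 'v) smod" where
 "mod_of E = \<lparr>rng = cinf (vbase E), car = secs E, sadd = secadd E, sscl = secscale E\<rparr>"

lemma mod_of_sel [simp]: "rng (mod_of E) = cinf (vbase E)" "car (mod_of E) = secs E" "sadd (mod_of E) = secadd E"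
 "sscl (mod_of E) = secscale E"
 by (simp_all add: mod_of_def)

lemma mod_of_slie: "AF (slie_of E) = AF (mod_of E)" "smodule (slie_of E) = smodule (mod_of E)"
 "shom X (slie_of E) = shom X (mod_of E)" "shom (slie_of E) Y = shom (mod_of E) Y"
 "alt2 X (slie_of E) = alt2 X (mod_of E)" "snull (slie_of E) = snull (mod_of E)"
 by (auto simp: AF_def smodule_def shom_def alt2_def snull_def fun_eq_iff)

text \<open>Transpositions of neighbours bring the two equal arguments together.\<close>

lemma AF_alt_far:
 assumes "smodule E" "om : AF E" "set l2 <= car E" "set l3 <= car E" "a : car E"
 shows "set l1 <= car E ==> om (l1 @ a # l2 @ a # l3) m = 0"
 using assms(3)
proof (induction l2 arbitrary: l1)
 case Nil then show ?case using AF_alt[OF assms(2) _ assms(4,5)] by simp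
next
 case (Cons b l2)
 have "om (l1 @ a # b # (l2 @ a # l3)) m = - om (l1 @ b # a # (l2 @ a # l3)) m"
  by (rule AF_swap[OF assms(1,2)]) (use Cons.prems assms in auto)
 also have "om (l1 @ b # a # (l2 @ a # l3)) m = 0" using Cons.IH[of "l1 @ [b]"] Cons.prems by simp
 finally show ?case by simp
qed

text \<open>The bridge between updating a list at position i and splitting it there. A form of
  degree k is an inhomogeneous one whose components of other lengths are 0.\<close>

lemma forms_iff:
 assumes E: "smodule (mod_of E)"
 shows "om : forms E k \<longleftrightarrow> om : AF (mod_of E) & (ALL l. length l ~= k --> om l = (%m. 0))"
proof
 assume om: "om : forms E k"
 have 0: "om l = (%m. 0)" if "~ (length l = k & set l <= secs E)" for l using om that unfolding forms_def by blast
 have 1: "om l : cinf (vbase E) &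
    (ALL i<k. ALL a:secs E. ALL b:secs E. om (l[i := secadd E a b]) = (%m. om (l[i := a]) m + om (l[i := b]) m)) &
    (ALL i<k. ALL g:cinf (vbase E). ALL a:secs E. om (l[i := secscale E g a]) = (%m. g m * om (l[i := a]) m)) &
    (ALL i<k. ALL j<k. i ~= j & l ! i = l ! j --> om l = (%m. 0))"
  if "length l = k & set l <= secs E" for l using om that unfolding forms_def by blast
 have c: "(%m. 0) : cinf (vbase E)" using func_ring_const[OF smodule_closed(3)[OF E], of 0] by simp
 have "om : AF (mod_of E)" unfolding AF_def mem_Collect_eq mod_of_sel
 proof (intro conjI allI impI)
  show "om l = (%m. 0)" if "~ set l <= secs E" for l using 0 that by blast
  show "om l : cinf (vbase E)" for l using 0[of l] 1[of l] c by metis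
  fix l1 l2 a assume l: "set l1 <= secs E" "set l2 <= secs E"
  have u: "(l1 @ a # l2)[length l1 := x] = l1 @ x # l2" for x by simp
  { fix b assume ab: "a : secs E" "b : secs E"
   show "om (l1 @ secadd E a b # l2) = (%m. om (l1 @ a # l2) m + om (l1 @ b # l2) m)"
   proof (cases "Suc (length l1 + length l2) = k")
    case True
    then have "length (l1 @ a # l2) = k & set (l1 @ a # l2) <= secs E" "length l1 < k" using l ab by auto
    from 1[OF this(1), THEN conjunct2, THEN conjunct1, rule_format, OF this(2) ab] show ?thesis by (simp only: u)
   qed (simp add: 0) }
  { fix g assume ab: "g : cinf (vbase E)" "a : secs E"
   show "om (l1 @ secscale E g a # l2) = (%m. g m * om (l1 @ a # l2) m)"
   proof (cases "Suc (length l1 + length l2) = k")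
    case True
    then have "length (l1 @ a # l2) = k & set (l1 @ a # l2) <= secs E" "length l1 < k" using l ab by auto
    from 1[OF this(1), THEN conjunct2, THEN conjunct2, THEN conjunct1, rule_format, OF this(2) ab] show ?thesis by (simp only: u)
   qed (simp add: 0) }
  assume a: "a : secs E"
  show "om (l1 @ a # a # l2) = (%m. 0)"
  proof (cases "Suc (Suc (length l1 + length l2)) = k")
   case True
   then have *: "length (l1 @ a # a # l2) = k & set (l1 @ a # a # l2) <= secs E" "length l1 < k" "Suc (length l1) < k" using l a by auto
   have "length l1 ~= Suc (length l1) & (l1 @ a # a # l2) ! length l1 = (l1 @ a # a # l2) ! Suc (length l1)" by (simp add: nth_append)
   then show ?thesis using 1[OF *(1), THEN conjunct2, THEN conjunct2, THEN conjunct2, rule_format, OF *(2,3)] by blast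
  qed (simp add: 0)
 qed
 then show "om : AF (mod_of E) & (ALL l. length l ~= k --> om l = (%m. 0))" using 0 by blast
next
 assume om: "om : AF (mod_of E) & (ALL l. length l ~= k --> om l = (%m. 0))"
 then have A: "om : AF (mod_of E)" by simp
 show "om : forms E k" unfolding forms_def mem_Collect_eq
 proof (intro conjI allI impI ballI)
  fix l assume "~ (length l = k & set l <= secs E)"
  then show "om l = (%m. 0)" using om AF_off[OF A] by (metis mod_of_sel(2))
 next
  fix l assume l: "length l = k & set l <= secs E"
  show "om l : cinf (vbase E)" using AF_rng[OF A, of l] by simp
  have s: "set (take i l) <= secs E" "set (drop i l) <= secs E" for i
   using l set_take_subset[of i l] set_drop_subset[of i l] by auto
  { fix i assume i: "i < k"
   have u: "l[i := x] = take i l @ x # drop (Suc i) l" for x using upd_conv_take_nth_drop[of i l x] i l by simp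
   show "om (l[i := secadd E a b]) = (%m. om (l[i := a]) m + om (l[i := b]) m)" if "a : secs E" "b : secs E" for a b
    unfolding u using AF_add[OF A, of "take i l" "drop (Suc i) l" a b] s that by auto
   show "om (l[i := secscale E g a]) = (%m. g m * om (l[i := a]) m)" if "g : cinf (vbase E)" "a : secs E" for g a
    unfolding u using AF_scl[OF A, of "take i l" "drop (Suc i) l" g a] s that by auto }
  have far: "om l = (%m. 0)" if ij: "i < j" "j < k" "l ! i = l ! j" for i j
  proof -
   have 1: "l = take j l @ l ! j # drop (Suc j) l" using ij l by (intro id_take_nth_drop) simp
   have 2: "take j l = take i l @ l ! i # drop (Suc i) (take j l)" using ij l id_take_nth_drop[of i "take j l"] by simp
   have "l = (take i l @ l ! i # drop (Suc i) (take j l)) @ l ! i # drop (Suc j) l"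
    unfolding 2[symmetric] unfolding ij(3) by (rule 1)
   then have e: "l = take i l @ l ! i # drop (Suc i) (take j l) @ l ! i # drop (Suc j) l" by simp
   have d: "set (drop (Suc i) (take j l)) <= secs E" using subset_trans[OF set_drop_subset s(1)] .
   have li: "l ! i : secs E" using l ij by auto
   have "om (take i l @ l ! i # drop (Suc i) (take j l) @ l ! i # drop (Suc j) l) m = 0" for m
    by (rule AF_alt_far[OF E A]) (unfold mod_of_sel, (rule d s li)+)
   then have "om l m = 0" for m unfolding e[symmetric] .
   then show ?thesis by auto
  qed
  fix i j assume "i < k" "j < k" "i ~= j & l ! i = l ! j"
  then show "om l = (%m. 0)" using far[of i j] far[of j i] by (metis nat_neq_iff)
 qed
qed

lemma nths_remove: "nths (x # l) (- {0}) = l" "nths (x # l) (- {Suc i}) = x # nths l (- {i})"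
 "nths (x # l) (- {0, Suc j}) = nths l (- {j})" "nths (x # l) (- {Suc i, Suc j}) = x # nths l (- {i, j})"
proof -
 have "{j. Suc j : - {0}} = UNIV" "{j. Suc j : - {Suc i}} = - {i}" "{i. Suc i : - {0, Suc j}} = - {j}"
  "{k. Suc k : - {Suc i, Suc j}} = - {i, j}" by auto
 then show "nths (x # l) (- {0}) = l" "nths (x # l) (- {Suc i}) = x # nths l (- {i})"
  "nths (x # l) (- {0, Suc j}) = nths l (- {j})" "nths (x # l) (- {Suc i, Suc j}) = x # nths l (- {i, j})"
  by (simp_all add: nths_Cons nths_all)
qed

lemma ssum_sum: "ssum l G = (\<Sum>i<length l. (-1) ^ i * G (l ! i) (nths l (- {i})))"
proof (induction l arbitrary: G)
 case (Cons x l)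
 show ?case unfolding length_Cons sum.lessThan_Suc_shift by (simp add: Cons nths_remove sum_negf)
qed simp

lemma psum_sum: "psum l G = (\<Sum>(i, j) | i < j & j < length l. (-1) ^ (i + j) * G (l ! i) (l ! j) (nths l (- {i, j})))"
proof (induction l arbitrary: G)
 case (Cons x l)
 let ?P = "%n. {(i, j). i < j & j < (n::nat)}"
 let ?f = "%(i, j). (-1) ^ (i + j) * G ((x # l) ! i) ((x # l) ! j) (nths (x # l) (- {i, j}))"
 have "?P n <= {..<n} \<times> {..<n}" for n by auto
 then have fin: "finite (?P n)" for n by (rule finite_subset) simp
 have e: "?P (Suc n) = (%j. (0, Suc j)) ` {..<n} Un (%(i, j). (Suc i, Suc j)) ` ?P n" for n
 proof (rule subset_antisym; rule subsetI)
  fix p assume "p : ?P (Suc n)"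
  then obtain i j where p: "p = (i, j)" "i < j" "j < Suc n" by auto
  then show "p : (%j. (0, Suc j)) ` {..<n} Un (%(i, j). (Suc i, Suc j)) ` ?P n"
   by (cases i; cases j) (auto intro!: image_eqI[of _ _ "(i - 1, j - 1)"])
 qed auto
 have "sum ?f (?P (Suc (length l))) = sum ?f ((%j. (0, Suc j)) ` {..<length l}) + sum ?f ((%(i, j). (Suc i, Suc j)) ` ?P (length l))"
  unfolding e by (rule sum.union_disjoint) (use fin in auto)
 also have "sum ?f ((%j. (0, Suc j)) ` {..<length l}) = - ssum l (%b r. G x b r)"
  by (subst sum.reindex) (auto simp: inj_on_def ssum_sum nths_remove sum_negf)
 also have "sum ?f ((%(i, j). (Suc i, Suc j)) ` ?P (length l)) = psum l (%a b r. G a b (x # r))"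
  by (subst sum.reindex) (auto simp: inj_on_def Cons nths_remove intro!: sum.cong)
 finally show ?case by simp
qed simp

section \<open>The operations on graded algebras in terms of alternating forms\<close>

lemma pullback_pbk: "pullback E ph = pbk (secs E) (secmap ph)"
 by (simp add: pullback_def pbk_def fun_eq_iff)

lemma ce_diff_sd: "ce_diff E = sd (slie_of E)"
 by (intro ext) (simp add: ce_diff_def sd_def ssum_sum psum_sum)

lemma contract2_con: "contract2 E F ta = con (secs E) (secmap F) (secmap2 ta)"
proof (intro ext)
 fix om l m
 show "contract2 E F ta om l m = con (secs E) (secmap F) (secmap2 ta) om l m"
  unfolding contract2_def con_def psum_sum sum_negf[symmetric] by (auto intro!: sum.cong)
qed

lemma form_alg_sel [simp]: "gdeg (form_alg E) = forms E" "gzero (form_alg E) = (%l m. 0)"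
 "gone (form_alg E) = (%l m. if l = [] then 1 else 0)" "gadd (form_alg E) om et = (%l m. om l m + et l m)"
 "gscale (form_alg E) c om = (%l m. c * om l m)" "gmul (form_alg E) = wedge"
 by (simp_all add: form_alg_def)

lemma shift_sel [simp]: "fun0 (shift_groupoid L) = form_alg (obj L)" "fun1 (shift_groupoid L) = form_alg (arr L)"
 "fun2 (shift_groupoid L) = form_alg (composables L)"
 "gsrc (shift_groupoid L) = pbk (secs (arr L)) (secmap (vsrc L))"
 "gtgt (shift_groupoid L) = pbk (secs (arr L)) (secmap (vtgt L))"
 "gunt (shift_groupoid L) = pbk (secs (obj L)) (secmap (vunt L))"
 "gcomp (shift_groupoid L) = pbk (secs (composables L)) (secmap (%m (x, y). vcomp L m x y))"
 "gpr1 (shift_groupoid L) = pbk (secs (composables L)) (secmap (%m. fst))"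
 "gpr2 (shift_groupoid L) = pbk (secs (composables L)) (secmap (%m. snd))"
 "gQ0 (shift_groupoid L) = sd (slie_of (obj L))" "gQ1 (shift_groupoid L) = sd (slie_of (arr L))"
 by (simp_all add: shift_groupoid_def pullback_pbk ce_diff_sd)

lemma galt_deg: "(!!l. length l ~= k ==> om l = (%m. 0)) ==> galt om = (%l m. gsign k * om l m)"
 unfolding galt_def gsign_def by (intro ext) (metis mult_zero_right)

lemma con_deg:
 assumes "!!l. length l ~= k ==> om l = (%m. 0)" "length l ~= Suc k" shows "con A ph ta om l = (%m. 0)"
proof
 fix m
 have "psum l (%a b r. om (ta a b # map ph r) m) = psum l (%a b r. 0)"
  by (rule psum_cong[OF subset_refl]) (use assms in auto)
 then show "con A ph ta om l m = 0" by (simp add: con_def)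
qed

lemma sd_deg:
 assumes E: "slie_alg E" and "!!l. length l ~= k ==> om l = (%m. 0)" "length l ~= Suc k" shows "sd E om l = (%m. 0)"
proof
 fix m
 have 1: "psum l (%a b r. om (sbr E a b # r) m) = psum l (%a b r. 0)"
  by (rule psum_cong[OF subset_refl]) (use assms in auto)
 have 2: "ssum l (%a r. sanc E a m (om r)) = ssum l (%a r. 0)" if "set l <= car E"
  by (rule ssum_cong[OF that]) (use assms slie_anc_0[OF E] in auto)
 show "sd E om l m = 0" unfolding sd_def 1 using 2 by simp
qed

lemma pbk_deg: "(!!l. length l ~= k ==> om l = (%m. 0)) ==> length l ~= k ==> pbk A ph om l = (%m. 0)"
 by (simp add: pbk_def)

lemma pbk_linear: "pbk A ph (%l m. om l m + et l m) = (%l m. pbk A ph om l m + pbk A ph et l m)"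
 "pbk A ph (%l m. c * om l m) = (%l m. c * pbk A ph om l m)"
 by (auto simp: pbk_def fun_eq_iff)

lemma con_linear: "con A ph ta (%l m. om l m + et l m) = (%l m. con A ph ta om l m + con A ph ta et l m)"
 "con A ph ta (%l m. c * om l m) = (%l m. c * con A ph ta om l m)"
 using con_plus[of A ph ta om et] con_mult[of A ph ta "%_. c" om] by (auto simp: fun_eq_iff)

lemma galg_hom_pbk:
 assumes E: "smodule (mod_of E)" and V: "smodule (mod_of V)" and R: "cinf (vbase V) = cinf (vbase E)"
  and ph: "shom (mod_of E) (mod_of V) ph"
 shows "galg_hom (form_alg V) (form_alg E) (pbk (secs E) ph)"
proof -
 have f: "pbk (secs E) ph a : forms E k" if "a : forms V k" for a k
 proof -
  have a: "a : AF (mod_of V)" "!!l. length l ~= k ==> a l = (%m. 0)" using that unfolding forms_iff[OF V] by auto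
  have "pbk (secs E) ph a l = (%m. 0)" if "length l ~= k" for l by (rule pbk_deg[OF a(2) that])
  then show ?thesis using AF_pbk[OF ph _ E a(1)] R unfolding forms_iff[OF E] by simp
 qed
 have one: "pbk (secs E) ph (%l m. if l = [] then 1 else 0) = (%l m. if l = [] then 1 else 0)"
  by (auto simp: pbk_def fun_eq_iff)
 show ?thesis unfolding galg_hom_def graded_linear_def form_alg_sel by (simp add: f pbk_linear pbk_wedge one)
qed

context coherence
begin

text \<open>A module map \<open>q\<close> acts on the data alone: the pair (\<open>g\<close>,
  \<open>r\<close>) becomes the pair of composites with \<open>q\<close>. It is applied to the two
  projections and the composition of composable pairs.\<close>

lemma natural_con:
 assumes V: "smodule V" and R: "rng V = rng T" and A: "smodule A" "rng A = rng T" and q: "shom V A q" and g: "shom T V g" and r: "alt2 T V r"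
 shows "pbk (car T) g (pbk (car V) q om) = pbk (car T) (%x. q (g x)) om"
  "con (car T) g r (pbk (car V) q om) = con (car T) (%x. q (g x)) (%x y. q (r x y)) om"
proof -
 show "pbk (car T) g (pbk (car V) q om) = pbk (car T) (%x. q (g x)) om"
  using shom_map[OF g] by (intro ext) (simp add: pbk_def o_def)
 have "con (car T) g r (pbk (car V) q om) l m = con (car T) (%x. q (g x)) (%x y. q (r x y)) om l m" for l m
 proof (cases "set l <= car T")
  case True then show ?thesis by (rule con_pbk[OF q]) (use shom_car[OF g] alt2_car[OF r] in auto)
 qed (simp add: con_off)
 then show "con (car T) g r (pbk (car V) q om) = con (car T) (%x. q (g x)) (%x y. q (r x y)) om" by (intro ext)
qed

lemma W1_natural:
 assumes "smodule V" "rng V = rng T" "smodule A" "rng A = rng T" "shom V A q" "shom T V g" "alt2 T V r"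
 shows "W1 g r (pbk (car V) q om) = W1 (%x. q (g x)) (%x y. q (r x y)) om"
 unfolding W1_def natural_con[OF assms] by (rule refl)

lemma W12_natural:
 assumes "smodule V" "rng V = rng T" "smodule A" "rng A = rng T" "shom V A q" "shom T V g" "alt2 T V r" and s: "alt2 T V s" "om : AF A"
 shows "W12 V g r s (pbk (car V) q om) = W12 A (%x. q (g x)) (%x y. q (r x y)) (%x y. q (s x y)) om"
 unfolding W12_def natural_con(2)[OF assms(1-7)] natural_con(2)[OF assms(1-6) s(1)]
  BB_natural[OF assms(1-7) s] by (rule refl)

lemma W1_cong:
 assumes A: "smodule A" "rng A = rng T" and "!!x. x : car T ==> g x = g' x" "!!x y. x : car T ==> y : car T ==> r x y = r' x y"
 shows "W1 g r om = W1 g' r' om"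
proof -
 have "map g l = map g' l" if "set l <= car T" for l by (rule map_cong) (use that assms(3) in auto)
 then have "pbk (car T) g om l = pbk (car T) g' om l" for l by (cases "set l <= car T") (simp_all only: pbk_def if_True if_False)
 then have "pbk (car T) g om = pbk (car T) g' om" by (rule ext)
 then show ?thesis unfolding W1_def using con_fun_cong[of "car T" g g' r r' om] assms(3,4) by simp
qed

lemma W12_cong:
 fixes om :: "('m, 'm => 'v) sform" and A :: "('m, 'm => 'v, 'y) smod_scheme"
 assumes A: "smodule A" "rng A = rng T" and "!!x. x : car T ==> g x = g' x" "!!x y. x : car T ==> y : car T ==> r x y = r' x y"
  "!!x y. x : car T ==> y : car T ==> s x y = s' x y"
 shows "W12 A g r s om = W12 A g' r' s' om"
proof -
 have "con (car T) g r om = con (car T) g' r' om" "con (car T) g s om = con (car T) g' s' om" by (rule con_fun_cong; use assms in simp)+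
 moreover have "BB A g r s om = BB A g' r' s' om" by (rule BB_cong[OF A]) (use assms in auto)
 ultimately show ?thesis unfolding W12_def by simp
qed

end

context
 fixes E :: "('m, 'e::euclidean_space, 'v) lie_algebroid" and z and V :: "('m, 'e, 'w, 'y) vbundle_scheme" and g r s
 assumes co: "coherence (slie_of E) z" and V: "smodule (mod_of V)" and R: "cinf (vbase V) = cinf (vbase E)"
  and g: "shom (slie_of E) (mod_of V) g" and r: "alt2 (slie_of E) (mod_of V) r" and s: "alt2 (slie_of E) (mod_of V) s"
begin

interpretation coherence "slie_of E" z by (rule co)

lemma R': "rng (mod_of V) = rng (slie_of E)" and E': "smodule (mod_of E)"
 using R T'(2) by (simp_all add: mod_of_slie)

text \<open>On forms of one degree the involution \<open>galt\<close> is the scalar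
  \<open>gsign\<close>, which gives the product rules the shape asked for by \<open>T1_map\<close>
  and \<open>T11_map\<close>.\<close>

lemma wedge_gsign:
 assumes a: "a : forms V i" and b: "b : forms V j"
 shows "W1 g r (wedge a b) = (%l m. wedge (W1 g r a) (pbk (secs E) g b) l m + gsign i * wedge (pbk (secs E) g a) (W1 g r b) l m)"
  "W12 (mod_of V) g r s (wedge a b) = (%l m. wedge (W12 (mod_of V) g r s a) (pbk (secs E) g b) l m + wedge (pbk (secs E) g a) (W12 (mod_of V) g r s b) l m
   + gsign i * (wedge (W1 g r a) (W1 g s b) l m + - 1 * wedge (W1 g s a) (W1 g r b) l m))"
proof -
 have a': "a : AF (mod_of V)" and b': "b : AF (mod_of V)" and ga: "galt a = (%l m. gsign i * a l m)"
  using a b galt_deg[of i a] unfolding forms_iff[OF V] by auto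
 note AW = AF_wedge[OF T'(2)] and A1 = AF_W1[OF V R' g] and Ap = AF_pbkT[OF V R' g] and A12 = AF_W12[OF V R' g r s]
  and ga' = AF_galt[OF V a'] and ab = AF_wedge[OF V a' b']
 have l1: "W1 g r' (%l m. c * a l m) = (%l m. c * W1 g r' a l m)" if "alt2 (slie_of E) (mod_of V) r'" for c r'
  unfolding W1_def pbk_linear con_linear
  by (intro ext) (simp only: sd_lin(3)[OF T'(1) Ap[OF a'] Ap[OF a']] right_diff_distrib)
 have "W1 g r (wedge a b) = (%l m. wedge (W1 g r a) (pbk (car (slie_of E)) g b) l m + wedge (pbk (car (slie_of E)) g (galt a)) (W1 g r b) l m)"
  by (rule AF_ext[OF A1[OF r ab] AF_plus[OF T'(2) AW[OF A1[OF r a'] Ap[OF b']] AW[OF Ap[OF ga'] A1[OF r b']]]])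
   (rule W1_wedge[OF V R' g r s a' b'])
 then show "W1 g r (wedge a b) = (%l m. wedge (W1 g r a) (pbk (secs E) g b) l m + gsign i * wedge (pbk (secs E) g a) (W1 g r b) l m)"
  unfolding ga pbk_linear wedge_mult1 by simp
 have "W12 (mod_of V) g r s (wedge a b) = (%l m. (wedge (W12 (mod_of V) g r s a) (pbk (car (slie_of E)) g b) l m + wedge (pbk (car (slie_of E)) g a) (W12 (mod_of V) g r s b) l m)
   + (wedge (W1 g r (galt a)) (W1 g s b) l m - wedge (W1 g s (galt a)) (W1 g r b) l m))"
  by (rule AF_ext[OF A12[OF ab] AF_plus[OF T'(2) AF_plus[OF T'(2) AW[OF A12[OF a'] Ap[OF b']] AW[OF Ap[OF a'] A12[OF b']]]
    AF_minus[OF T'(2) AW[OF A1[OF r ga'] A1[OF s b']] AW[OF A1[OF s ga'] A1[OF r b']]]]])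
   (rule W12_wedge[OF V R' g r s a' b'])
 then show "W12 (mod_of V) g r s (wedge a b) = (%l m. wedge (W12 (mod_of V) g r s a) (pbk (secs E) g b) l m + wedge (pbk (secs E) g a) (W12 (mod_of V) g r s b) l m
   + gsign i * (wedge (W1 g r a) (W1 g s b) l m + - 1 * wedge (W1 g s a) (W1 g r b) l m))"
  unfolding ga l1[OF r] l1[OF s] wedge_mult1 by (simp add: right_diff_distrib)
qed

lemma T1_map_W1: "T1_map (form_alg V) (form_alg E) (pbk (secs E) g, W1 g r)"
proof -
 note Ap = AF_pbkT[OF V R' g] and A1 = AF_W1[OF V R' g r]
 have d: "W1 g r a : forms E (k + 1)" if "a : forms V k" for a k
 proof -
  have a: "a : AF (mod_of V)" "!!l. length l ~= k ==> a l = (%m. 0)" using that unfolding forms_iff[OF V] by auto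
  have "W1 g r a l = (%m. 0)" if "length l ~= k + 1" for l
  proof -
   have "length l ~= Suc k" using that by simp
   have 1: "sd (slie_of E) (pbk (car (slie_of E)) g a) l = (%m. 0)"
    by (rule sd_deg[OF T'(1) pbk_deg[where k=k] \<open>length l ~= Suc k\<close>]) (rule a(2))
   have "con (car (slie_of E)) g r a l = (%m. 0)" by (rule con_deg[where k=k]) (use a(2) that in auto)
   with 1 show ?thesis unfolding W1_def by (simp add: fun_eq_iff)
  qed
  then show ?thesis using A1[OF a(1)] unfolding forms_iff[OF E'] mod_of_slie by simp
 qed
 have l: "W1 g r (%l m. a l m + b l m) = (%l m. W1 g r a l m + W1 g r b l m)" "W1 g r (%l m. c * a l m) = (%l m. c * W1 g r a l m)"
  if "a : forms V k" "b : forms V k" for a b c k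
 proof -
  have a: "a : AF (mod_of V)" "b : AF (mod_of V)" using that unfolding forms_iff[OF V] by auto
  show "W1 g r (%l m. a l m + b l m) = (%l m. W1 g r a l m + W1 g r b l m)" "W1 g r (%l m. c * a l m) = (%l m. c * W1 g r a l m)"
   unfolding W1_def pbk_linear con_linear
   by (intro ext, simp only: sd_lin[OF T'(1) Ap[OF a(1)] Ap[OF a(2)]] right_diff_distrib add_diff_add)+
 qed
 have h: "galg_hom (form_alg V) (form_alg E) (pbk (secs E) g)" by (rule galg_hom_pbk[OF E' V R g[unfolded mod_of_slie]])
 show ?thesis unfolding T1_map_def prod.case graded_linear_def form_alg_sel
 proof (intro conjI allI ballI)
  show "W1 g r (wedge a b) = (%l m. wedge (W1 g r a) (pbk (secs E) g b) l m + gsign i * wedge (pbk (secs E) g a) (W1 g r b) l m)"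
   if "a : forms V i" "b : forms V j" for i j a b by (rule wedge_gsign(1)[OF that])
 qed (use h d l in auto)
qed

lemma graded_linear_W12: "graded_linear 2 (form_alg V) (form_alg E) (W12 (mod_of V) g r s)"
proof -
 note A12 = AF_W12[OF V R' g r s]
 let ?e = "%a l m. con (car (slie_of E)) g r a l m - con (car (slie_of E)) g s a l m"
 have B: "BB (mod_of V) g r s (%l m. a l m + b l m) = (%l m. BB (mod_of V) g r s a l m + BB (mod_of V) g r s b l m)"
  "BB (mod_of V) g r s (%l m. c * a l m) = (%l m. c * BB (mod_of V) g r s a l m)" for a b c
  unfolding BB_def iot_def pbk_linear con_linear by (rule refl)+
 show ?thesis unfolding graded_linear_def form_alg_sel
 proof (intro allI ballI conjI)
  fix k a assume ak: "a : forms V k"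
  then have a: "a : AF (mod_of V)" "!!l. length l ~= k ==> a l = (%m. 0)" unfolding forms_iff[OF V] by auto
  have e: "?e x : AF (slie_of E)" if "x : AF (mod_of V)" for x by (intro AF_minus[OF T'(2)] AF_conT[OF V R' g] r s that)
  have ed: "?e a l = (%m. 0)" if "length l ~= Suc k" for l
  proof -
   have "con (car (slie_of E)) g r' a l = (%m. 0)" for r' by (rule con_deg[where k=k]) (use a(2) that in auto)
   from this[of r] this[of s] show ?thesis by (simp add: fun_eq_iff)
  qed
  have B0: "BB (mod_of V) g r s a l = (%m. 0)" if "length l ~= Suc (Suc k)" for l
   unfolding BB_def iot_def by (intro pbk_deg[OF _ that] con_deg[where k="Suc k"] con_deg[where k=k] pbk_deg[where k=k] a(2))
  have "W12 (mod_of V) g r s a l = (%m. 0)" if "length l ~= k + 2" for l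
  proof -
   have l: "length l ~= Suc (Suc k)" using that by simp
   have "sd (slie_of E) (?e a) l = (%m. 0)" by (rule sd_deg[OF T'(1) ed l])
   then show ?thesis unfolding W12_def using B0[OF l] by (simp add: fun_eq_iff)
  qed
  then show "W12 (mod_of V) g r s a : forms E (k + 2)" using A12[OF a(1)] unfolding forms_iff[OF E'] mod_of_slie by simp
  show "W12 (mod_of V) g r s (%l m. c * a l m) = (%l m. c * W12 (mod_of V) g r s a l m)" for c
   unfolding W12_def B con_linear right_diff_distrib[symmetric]
   by (intro ext) (simp only: sd_lin(3)[OF T'(1) e[OF a(1)] e[OF a(1)]] distrib_left)
  fix b assume "b : forms V k"
  then have b: "b : AF (mod_of V)" unfolding forms_iff[OF V] by auto
  show "W12 (mod_of V) g r s (%l m. a l m + b l m) = (%l m. W12 (mod_of V) g r s a l m + W12 (mod_of V) g r s b l m)"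
   unfolding W12_def B con_linear add_diff_add
   by (intro ext) (simp only: sd_lin(1)[OF T'(1) e[OF a(1)] e[OF b]] add_ac)
 qed
qed

end

text \<open>The order of the entries matters: \<open>s\<close> gives the underlying map into the
  first shifted tangent bundle and \<open>r\<close> the derivation along it, in agreement with the
  signs of the cross terms.\<close>

lemma T11_map_W12:
 fixes E :: "('m, 'e::euclidean_space, 'v) lie_algebroid" and V :: "('m, 'e, 'w, 'y) vbundle_scheme"
 assumes "coherence (slie_of E) z" "smodule (mod_of V)" "cinf (vbase V) = cinf (vbase E)" "shom (slie_of E) (mod_of V) g"
  and r: "alt2 (slie_of E) (mod_of V) r" and s: "alt2 (slie_of E) (mod_of V) s"
 shows "T11_map (form_alg V) (form_alg E) (pbk (secs E) g, coherence.W1 (slie_of E) g s, coherence.W1 (slie_of E) g r, coherence.W12 (slie_of E) z (mod_of V) g r s)"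
 unfolding T11_map_def prod.case using T1_map_W1[OF assms(1-4) s s] T1_map_W1[OF assms(1-4) r r] graded_linear_W12[OF assms] wedge_gsign(2)[OF assms]
 by simp

section \<open>The theorem\<close>

lemma alt2_comp:
 assumes r: "alt2 E V r" and q: "shom V W q" and R: "rng E = rng V" "(%_. 0) : rng V"
 shows "alt2 E W (%x y. q (r x y))"
proof -
 have "snull W (q n)" if "snull V n" for n using that q R(2) unfolding snull_def shom_def by metis
 then show ?thesis using r q R(1) unfolding alt2_def shom_def by auto
qed

lemma smodule_bundle_map:
 assumes ph: "bundle_map E V ph" and s: "!!a m. a : secs E ==> a m : fibre E m"
 shows "shom (mod_of E) (mod_of V) (secmap ph)"
 using ph s unfolding shom_def bundle_map_def by (auto simp: secmap_def secadd_def secscale_def fun_eq_iff)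

context principal_action
begin

lemma sections_fibre: "al : secs \<A> ==> al m : fibre \<A> m"
 by (metis fibre_iff sections_iff inv_fieldsD(3))

lemma zero_fibre: "vzero \<A> m : fibre \<A> m"
 unfolding fibre_iff using equivariant_closed(3) by auto

lemma zero_section: "vzero \<A> : secs \<A>" "secscale \<A> g (vzero \<A>) = vzero \<A>"
proof -
 have e: "vzero \<A> = (%m. graph m (%p f. 0))" by (rule ext) simp
 have "(%p f. 0) : inv_fields"
  using tangent_closed(3)[OF P] func_ring_cinf(1)[OF P] by (auto simp: inv_fields_def vector_fields_def R_def tmap_def)
 then show "vzero \<A> : secs \<A>" unfolding e by (rule sec_sections)
 show "secscale \<A> g (vzero \<A>) = vzero \<A>" unfolding e by (simp add: sec_ops)
qed

lemma anchor_zero: "anchor \<A> m (vzero \<A> m) = (%f. 0)"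
proof -
 obtain p where "pq p = m" using pq(4) by blast
 from anchor_graph[OF equivariant_closed(3) this] show ?thesis by (simp add: tmap_def)
qed

lemma fibre_arith:
 assumes x: "x : fibre \<A> m" and y: "y : fibre \<A> m"
 shows "vadd \<A> x (vzero \<A> m) = x" "vscale \<A> 0 x = vzero \<A> m" "vscale \<A> c (vzero \<A> m) = vzero \<A> m"
  "vadd \<A> (vzero \<A> m) (vzero \<A> m) = vzero \<A> m"
  "vadd \<A> (vadd \<A> x y) (vscale \<A> (-1) x) = y" "vadd \<A> y (vadd \<A> x (vscale \<A> (-1) y)) = x"
  "vadd \<A> x y : fibre \<A> m" "vscale \<A> c x : fibre \<A> m"
proof -
 obtain X where X: "equivariant m X" "x = graph m X" using x unfolding fibre_iff by blast
 obtain Y where Y: "equivariant m Y" "y = graph m Y" using y unfolding fibre_iff by blast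
 show "vadd \<A> x (vzero \<A> m) = x" "vscale \<A> 0 x = vzero \<A> m" "vscale \<A> c (vzero \<A> m) = vzero \<A> m"
  "vadd \<A> (vzero \<A> m) (vzero \<A> m) = vzero \<A> m"
  "vadd \<A> (vadd \<A> x y) (vscale \<A> (-1) x) = y" "vadd \<A> y (vadd \<A> x (vscale \<A> (-1) y)) = x"
  unfolding X(2) Y(2) by simp_all
 show "vadd \<A> x y : fibre \<A> m" "vscale \<A> c x : fibre \<A> m"
  unfolding X(2) Y(2) algebroid_sel fibre_iff using equivariant_closed(1)[OF X(1) Y(1)] equivariant_closed(2)[OF X(1), of c] by blast+
qed

text \<open>These identities express that x + y + c u is additive and homogeneous in (x, y, u). With
  c = -1 and u the unit of the source of x, this is linearity of the composition.\<close>

lemma fibre_interchange: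
 assumes "x : fibre \<A> m" "y : fibre \<A> m" "u : fibre \<A> m" "x' : fibre \<A> m" "y' : fibre \<A> m" "u' : fibre \<A> m"
 shows "vadd \<A> (vadd \<A> (vadd \<A> x x') (vadd \<A> y y')) (vscale \<A> c (vadd \<A> u u')) =
   vadd \<A> (vadd \<A> (vadd \<A> x y) (vscale \<A> c u)) (vadd \<A> (vadd \<A> x' y') (vscale \<A> c u'))"
  "vadd \<A> (vadd \<A> (vscale \<A> g x) (vscale \<A> g y)) (vscale \<A> c (vscale \<A> g u)) = vscale \<A> g (vadd \<A> (vadd \<A> x y) (vscale \<A> c u))"
 using assms unfolding fibre_iff by (auto simp: algebra_simps)

end

lemma T1_product_agree:
 assumes "T1_product H X x y z" "T1_agree (fun1 H) x x'" "T1_agree (fun1 H) y y'" "T1_agree (fun1 H) z z'"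
 shows "T1_product H X x' y' z'"
proof -
 have tr: "T1_agree A a c" if "T1_agree A a b" "T1_agree A b c" for A :: "'x galg" and a b c :: "('x => 'y) \<times> ('x => 'y)"
  using that by (auto simp: T1_agree_def agree_def split: prod.splits)
 show ?thesis using assms tr unfolding T1_product_def by metis
qed

locale two_connection_bundle = principal_two_bundle B
 for B :: "('p::{t2_space,second_countable_topology}, 'pe::euclidean_space,
   'q::{t2_space,second_countable_topology}, 'qe::euclidean_space,
   'm::{t2_space,second_countable_topology}, 'me::euclidean_space,
   'h::{t2_space,second_countable_topology}, 'he::euclidean_space,
   'k::{t2_space,second_countable_topology}, 'ke::euclidean_space) two_bundle" +
 fixes F0 ta0
 assumes conn: "two_connection B F0 ta0"
begin

abbreviation "\<T> == tangent_algebroid (Mman B)"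
abbreviation "Tm == slie_of \<T>"
abbreviation "Am == slie_of \<A>"
abbreviation "Em == slie_of \<E>"
abbreviation "V2 == composables \<L>"
abbreviation "zT == (%m f. 0)"
abbreviation "zA == vzero \<A>"
abbreviation "sA == secmap (vsrc \<L>)"
abbreviation "tA == secmap (vtgt \<L>)"
abbreviation "uA == secmap (vunt \<L>)"
abbreviation "cA == secmap (%m (x, y). vcomp \<L> m x y)"
abbreviation "f0 == secmap F0"
abbreviation "ph == secmap (F1_of B F0)"
abbreviation "ta == secmap2 ta0"
abbreviation (input) "pT == pbk (car Tm)"
abbreviation (input) "pV == pbk (secs V2)"
abbreviation (input) "\<X> == VF (Mman B)"
abbreviation (input) "\<S> == shift_groupoid \<L>"
abbreviation (input) "p1 == secmap (%m. fst)"
abbreviation (input) "p2 == secmap (%m. snd)"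
definition "si X Y = uA (tA (ta X Y))"
definition "WW X = (%m. (ph X m, ph X m))"
definition "rh X Y = (%m. (ta X Y m, zA m))"
definition "\<mu> X Y = (%m. (si X Y m, ta X Y m))"

lemma conn': "bundle_map \<T> \<E> F0" "!!m v. v : TS (Mman B) m ==> anchor \<E> m (F0 m v) = v"
 "!!m v w. v : TS (Mman B) m ==> w : TS (Mman B) m ==> ta0 m v w : core_fibre \<L> m"
 "!!m v w w'. v : TS (Mman B) m ==> w : TS (Mman B) m ==> w' : TS (Mman B) m ==>
  ta0 m v (%f. w f + w' f) = vadd \<A> (ta0 m v w) (ta0 m v w')"
 "!!m v w w'. v : TS (Mman B) m ==> w : TS (Mman B) m ==> w' : TS (Mman B) m ==>
  ta0 m (%f. w f + w' f) v = vadd \<A> (ta0 m w v) (ta0 m w' v)"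
 "!!m v w c. v : TS (Mman B) m ==> w : TS (Mman B) m ==> ta0 m (%f. c * v f) w = vscale \<A> c (ta0 m v w)"
 "!!m v w c. v : TS (Mman B) m ==> w : TS (Mman B) m ==> ta0 m v (%f. c * w f) = vscale \<A> c (ta0 m v w)"
 "!!m v. v : TS (Mman B) m ==> ta0 m v v = vzero \<A> m"
 "!!X Y. X : \<X> ==> Y : \<X> ==> ta X Y : secs \<A>"
 "!!X Y. X : \<X> ==> Y : \<X> ==>
  secdiff \<E> (bracket \<E> (f0 X) (f0 Y)) (f0 (vf_bracket X Y)) = tA (ta X Y)"
 using conn unfolding two_connection_def Let_def by simp_all
 lemmas vft = vf_tangent[OF manifolds(3)]

lemma jac: "slie_jacobi Tm" "slie_jacobi Am" "slie_jacobi Em"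
 using slie_jacobi_tangent[OF manifolds(3)] PA.slie_jacobi_atiyah QA.slie_jacobi_atiyah unfolding LA_sel by auto

lemma base [simp]: "vbase \<A> = Mman B" "vbase \<E> = Mman B" "vbase V2 = Mman B"
 by (simp_all add: LA_sel composables_def Let_def)

lemma mods: "smodule (mod_of \<T>)" "smodule (mod_of \<A>)" "smodule (mod_of \<E>)"
 using jac by (auto simp: slie_jacobi_def slie_smodule mod_of_slie[symmetric])

lemma zero0: "(%_. 0) : cinf (Mman B)" "(%_. - 1) : cinf (Mman B)"
 by (rule func_ring_cinf(1)[OF manifolds(3)])+

lemma fib: "a : secs \<A> ==> a m : fibre \<A> m" "b : secs \<E> ==> b m : fibre \<E> m"
 using PA.sections_fibre QA.sections_fibre unfolding LA_sel by auto

lemma shoms: "shom (mod_of \<A>) (mod_of \<E>) sA" "shom (mod_of \<A>) (mod_of \<E>) tA" "shom (mod_of \<E>) (mod_of \<A>) uA"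
 "shom (mod_of \<T>) (mod_of \<E>) f0"
 using LA_maps conn'(1) fib vft by (auto intro!: smodule_bundle_map)

lemma ph_um: "ph X = uA (f0 X)"
 by (simp add: secmap_def F1_of_def)

lemma shom_ph: "shom (mod_of \<T>) (mod_of \<A>) ph"
 using shoms(3,4) unfolding ph_um[abs_def] by (auto simp: shom_def)

lemma zeros: "zA : secs \<A>" "secscale \<A> g zA = zA" "secadd \<A> zA zA = zA" "vzero \<E> : secs \<E>" "secscale \<E> g (vzero \<E>) = vzero \<E>"
 using PA.zero_section QA.zero_section PA.fibre_arith(4)[OF PA.zero_fibre PA.zero_fibre] unfolding LA_sel by (auto simp: secadd_def fun_eq_iff)

lemma snulls: "snull (mod_of \<A>) zA" "snull (mod_of \<E>) (vzero \<E>)"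
 using zeros by (simp_all add: snull_def)

lemma alt2_ta: "alt2 Tm (mod_of \<A>) ta"
 unfolding alt2_def shom_def
proof (intro conjI ballI)
 fix X assume "X : car Tm"
 then have X: "X : \<X>" by simp
 have "ta X X = zA" using conn'(8)[OF vft[OF X]] by (simp add: secmap2_def fun_eq_iff)
 then show "snull (mod_of \<A>) (ta X X)" using snulls by simp
 fix Y assume "Y : car Tm"
 then have Y: "Y : \<X>" by simp
 show "ta X Y : car (mod_of \<A>)" "ta Y X : car (mod_of \<A>)" using conn'(9) X Y by simp_all
 { fix Z assume "Z : car Tm"
  then have Z: "Z : \<X>" by simp
  show "ta X (sadd Tm Y Z) = sadd (mod_of \<A>) (ta X Y) (ta X Z)" "ta (sadd Tm Y Z) X = sadd (mod_of \<A>) (ta Y X) (ta Z X)"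
   using conn'(4,5)[OF vft[OF X] vft[OF Y] vft[OF Z]] by (simp_all add: secmap2_def secadd_def fun_eq_iff) }
next
 fix X g Y assume "X : car Tm" "Y : car Tm"
 then have X: "X : \<X>" "Y : \<X>" by simp_all
 show "ta X (sscl Tm g Y) = sscl (mod_of \<A>) g (ta X Y)" "ta (sscl Tm g Y) X = sscl (mod_of \<A>) g (ta Y X)"
  using conn'(6)[OF vft[OF X(2)] vft[OF X(1)]] conn'(7)[OF vft[OF X(1)] vft[OF X(2)]] by (simp_all add: secmap2_def secscale_def fun_eq_iff)
qed

lemma alt2_tta: "alt2 Tm (mod_of \<E>) (%X Y. tA (ta X Y))"
 by (rule alt2_comp[OF alt2_ta shoms(2)]) (simp_all add: zero0)

lemma alt2_si: "alt2 Tm (mod_of \<A>) si"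
 unfolding si_def[abs_def] by (rule alt2_comp[OF alt2_tta shoms(3)]) (simp_all add: zero0)

lemma alt2_zA: "alt2 Tm (mod_of \<A>) (%X Y. zA)"
 using zeros snulls by (simp add: alt2_def shom_def)

lemma units: "b : secs \<E> ==> sA (uA b) = b" "b : secs \<E> ==> tA (uA b) = b"
 using LA_units fib(2) by (auto simp: secmap_def fun_eq_iff)

lemma f0_sec: "X : \<X> ==> f0 X : secs \<E>" "X : \<X> ==> ph X : secs \<A>"
 using shom_car[OF shoms(4)] shom_car[OF shom_ph] by simp_all

lemma sta: "X : \<X> ==> Y : \<X> ==> sA (ta X Y) = vzero \<E>"
 using conn'(3)[OF vft vft] by (auto simp: core_fibre_def secmap_def secmap2_def fun_eq_iff)

lemma tta_sec: "X : \<X> ==> Y : \<X> ==> tA (ta X Y) : secs \<E>"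
 using shom_car[OF shoms(2)] conn'(9) by simp

lemma ssi: "X : \<X> ==> Y : \<X> ==> sA (si X Y) = tA (ta X Y)"
 "X : \<X> ==> Y : \<X> ==> tA (si X Y) = tA (ta X Y)"
 unfolding si_def using units tta_sec by auto

lemma sph: "X : \<X> ==> sA (ph X) = f0 X" "X : \<X> ==> tA (ph X) = f0 X"
 unfolding ph_um using units f0_sec by auto

lemma zero_maps: "sA zA = vzero \<E>" "tA zA = vzero \<E>" "uA (vzero \<E>) = zA"
proof -
 have z: "secscale \<A> (%_. 0) a = zA" if "a : secs \<A>" for a
  using PA.fibre_arith(2)[OF fib(1)[OF that, unfolded LA_sel] fib(1)[OF that, unfolded LA_sel]] by (simp add: secscale_def fun_eq_iff LA_sel)
 have zE: "secscale \<E> (%_. 0) a = vzero \<E>" if "a : secs \<E>" for a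
  using QA.fibre_arith(2)[OF fib(2)[OF that, unfolded LA_sel] fib(2)[OF that, unfolded LA_sel]] by (simp add: secscale_def fun_eq_iff LA_sel)
 show "sA zA = vzero \<E>"
  using shom_scl[OF shoms(1), of "%_. 0" zA] zE[of "sA zA"] shom_car[OF shoms(1), of zA] zeros(1) zero0(1)
  unfolding mod_of_sel base zeros(2) by metis
 show "tA zA = vzero \<E>"
  using shom_scl[OF shoms(2), of "%_. 0" zA] zE[of "tA zA"] shom_car[OF shoms(2), of zA] zeros(1) zero0(1)
  unfolding mod_of_sel base zeros(2) by metis
 show "uA (vzero \<E>) = zA"
  using shom_scl[OF shoms(3), of "%_. 0" "vzero \<E>"] z[of "uA (vzero \<E>)"] shom_car[OF shoms(3), of "vzero \<E>"] zeros(4) zero0(1)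
  unfolding mod_of_sel base zeros(5) by metis
qed

lemma cm_sec: "a : secs \<A> ==> b : secs \<A> ==> sA a = tA b ==>
  cA (%m. (a m, b m)) = secadd \<A> (secadd \<A> a b) (secscale \<A> (%_. - 1) (uA (sA a)))"
 using LA_comp[OF fib(1) fib(1)] by (auto simp: secmap_def secadd_def secscale_def fun_eq_iff)

section \<open>Sections of composable pairs and their composition\<close>

lemma V2_car: "w : secs V2 \<longleftrightarrow> (EX a:secs \<A>. EX b:secs \<A>. sA a = tA b & w = (%m. (a m, b m)))"
 by (auto simp: composables_def Let_def)

lemma V2_ops: "secadd V2 (%m. (a m, b m)) (%m. (a' m, b' m)) = (%m. (secadd \<A> a a' m, secadd \<A> b b' m))"
 "secscale V2 g (%m. (a m, b m)) = (%m. (secscale \<A> g a m, secscale \<A> g b m))"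
 by (simp_all add: composables_def Let_def secadd_def secscale_def)

lemma secmap_pair: "p1 (%m. (a m, b m)) = a" "p2 (%m. (a m, b m)) = b"
 by (simp_all add: secmap_def)

lemma V2_add: "a : secs \<A> ==> b : secs \<A> ==> sA a = tA b ==> a' : secs \<A> ==> b' : secs \<A> ==> sA a' = tA b' ==>
  secadd \<A> a a' : secs \<A> & secadd \<A> b b' : secs \<A> & sA (secadd \<A> a a') = tA (secadd \<A> b b')"
 "g : cinf (Mman B) ==> a : secs \<A> ==> b : secs \<A> ==> sA a = tA b ==>
  secscale \<A> g a : secs \<A> & secscale \<A> g b : secs \<A> & sA (secscale \<A> g a) = tA (secscale \<A> g b)"
 using smodule_closed[OF mods(2)] shom_add[OF shoms(1)] shom_add[OF shoms(2)] shom_scl[OF shoms(1)] shom_scl[OF shoms(2)] by simp_all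

lemma mod_V2: "smodule (mod_of V2)"
 unfolding smodule_def mod_of_sel base
proof (intro conjI ballI)
 show "func_ring (cinf (Mman B))" using smodule_closed(3)[OF mods(1)] by simp
 fix w assume "w : secs V2"
 then obtain a b where w: "a : secs \<A>" "b : secs \<A>" "sA a = tA b" "w = (%m. (a m, b m))" unfolding V2_car by blast
 { fix g assume "g : cinf (Mman B)"
  from V2_add(2)[OF this w(1-3)] show "secscale V2 g w : secs V2" unfolding w(4) V2_ops V2_car by blast }
 fix w' assume "w' : secs V2"
 then obtain a' b' where w': "a' : secs \<A>" "b' : secs \<A>" "sA a' = tA b'" "w' = (%m. (a' m, b' m))" unfolding V2_car by blast
 show "secadd V2 w w' : secs V2" using V2_add(1)[OF w(1-3) w'(1-3)] unfolding w(4) w'(4) V2_ops V2_car by blast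
qed

lemma shom_pr: "shom (mod_of V2) (mod_of \<A>) p1" "shom (mod_of V2) (mod_of \<A>) p2"
 unfolding shom_def mod_of_sel by (auto simp: V2_car V2_ops secmap_pair simp del: split_paired_All)

lemma shom_cm: "shom (mod_of V2) (mod_of \<A>) cA"
 unfolding shom_def mod_of_sel base
proof (intro conjI ballI)
 note cl = smodule_closed[OF mods(2), unfolded mod_of_sel base]
 have us: "uA (sA a) : secs \<A>" if "a : secs \<A>" for a using shom_car[OF shoms(3)] shom_car[OF shoms(1)] that by simp
 fix w assume "w : secs V2"
 then obtain a b where w: "a : secs \<A>" "b : secs \<A>" "sA a = tA b" "w = (%m. (a m, b m))" unfolding V2_car by blast
 show "cA w : secs \<A>" unfolding w(4) cm_sec[OF w(1-3)] by (intro cl us w zero0)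
 note fa = fib(1)[OF w(1), unfolded LA_sel] fib(1)[OF w(2), unfolded LA_sel] fib(1)[OF us[OF w(1)], unfolded LA_sel]
 { fix w' assume "w' : secs V2"
  then obtain a' b' where w': "a' : secs \<A>" "b' : secs \<A>" "sA a' = tA b'" "w' = (%m. (a' m, b' m))" unfolding V2_car by blast
  note fb = fib(1)[OF w'(1), unfolded LA_sel] fib(1)[OF w'(2), unfolded LA_sel] fib(1)[OF us[OF w'(1)], unfolded LA_sel]
  have u: "uA (sA (secadd \<A> a a')) = secadd \<A> (uA (sA a)) (uA (sA a'))"
   using shom_add[OF shoms(1), of a a'] shom_add[OF shoms(3), of "sA a" "sA a'"] shom_car[OF shoms(1)] shom_car[OF shoms(2)] w w' by simp
  show "cA (secadd V2 w w') = secadd \<A> (cA w) (cA w')"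
   unfolding w(4) w'(4) V2_ops cm_sec[OF V2_add(1)[OF w(1-3) w'(1-3), THEN conjunct1] V2_add(1)[OF w(1-3) w'(1-3), THEN conjunct2, THEN conjunct1]
    V2_add(1)[OF w(1-3) w'(1-3), THEN conjunct2, THEN conjunct2]] cm_sec[OF w(1-3)] cm_sec[OF w'(1-3)] u
   using PA.fibre_interchange(1)[OF fa fb] by (simp add: secadd_def secscale_def LA_sel) }
 fix g assume g: "g : cinf (Mman B)"
 have u: "uA (sA (secscale \<A> g a)) = secscale \<A> g (uA (sA a))"
  using shom_scl[OF shoms(1), of g a] shom_scl[OF shoms(3), of g "sA a"] shom_car[OF shoms(1)] shom_car[OF shoms(2)] w g by simp
 show "cA (secscale V2 g w) = secscale \<A> g (cA w)"
  unfolding w(4) V2_ops cm_sec[OF V2_add(2)[OF g w(1-3), THEN conjunct1] V2_add(2)[OF g w(1-3), THEN conjunct2, THEN conjunct1]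
   V2_add(2)[OF g w(1-3), THEN conjunct2, THEN conjunct2]] cm_sec[OF w(1-3)] u
  using PA.fibre_interchange(2)[OF fa fa] by (simp add: secadd_def secscale_def LA_sel)
qed

lemma alt2_pair:
 assumes r: "alt2 Tm (mod_of \<A>) r1" "alt2 Tm (mod_of \<A>) r2"
  and st: "!!X Y. X : \<X> ==> Y : \<X> ==> sA (r1 X Y) = tA (r2 X Y)"
 shows "alt2 Tm (mod_of V2) (%X Y m. (r1 X Y m, r2 X Y m))"
proof -
 have c: "(%m. (r1 X Y m, r2 X Y m)) : secs V2" if "X : \<X>" "Y : \<X>" for X Y
  unfolding V2_car using alt2_car[OF r(1)] alt2_car[OF r(2)] st that by (intro bexI[of _ "r1 X Y"] bexI[of _ "r2 X Y"] conjI refl) simp_all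
 then show ?thesis using r unfolding alt2_def shom_def snull_def by (simp add: V2_ops)
qed

lemma alt2_rh: "alt2 Tm (mod_of V2) rh"
 unfolding rh_def[abs_def] by (rule alt2_pair[OF alt2_ta alt2_zA]) (simp add: sta zero_maps)

lemma alt2_\<mu>: "alt2 Tm (mod_of V2) \<mu>"
 unfolding \<mu>_def[abs_def] by (rule alt2_pair[OF alt2_si alt2_ta]) (simp add: ssi)

lemma shom_WW: "shom (mod_of \<T>) (mod_of V2) WW"
proof -
 have "WW X : secs V2" if "X : \<X>" for X
  unfolding V2_car WW_def using f0_sec(2)[OF that] sph[OF that] by (intro bexI[of _ "ph X"] conjI refl) simp_all
 then show ?thesis using shom_ph unfolding shom_def by (simp add: V2_ops WW_def)
qed

text \<open>In x + y - u(s x) the first components of \<open>WW\<close> and \<open>\<mu>\<close> are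
  units and cancel against the unit of their source; for \<open>rh\<close> the source is
  zero.\<close>

lemma cm_values:
 assumes "X : \<X>"
 shows "cA (WW X) = ph X" "Y : \<X> ==> cA (rh X Y) = ta X Y" "Y : \<X> ==> cA (\<mu> X Y) = ta X Y"
proof -
 have ar: "secadd \<A> (secadd \<A> a b) (secscale \<A> (%_. - 1) a) = b" if "a : secs \<A>" "b : secs \<A>" for a b
  using PA.fibre_arith(5)[OF fib(1)[OF that(1), unfolded LA_sel] fib(1)[OF that(2), unfolded LA_sel]] by (simp add: secadd_def secscale_def LA_sel)
 have az: "secadd \<A> a zA = a" if "a : secs \<A>" for a
  using PA.fibre_arith(1)[OF fib(1)[OF that, unfolded LA_sel] fib(1)[OF that, unfolded LA_sel]] by (simp add: secadd_def LA_sel)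
 show "cA (WW X) = ph X" unfolding WW_def using cm_sec[OF f0_sec(2) f0_sec(2), of X X] assms sph[OF assms] ar[OF f0_sec(2) f0_sec(2)] by (simp add: ph_um)
 assume Y: "Y : \<X>"
 note tas = conn'(9)[OF assms Y]
 have sis: "si X Y : secs \<A>" using alt2_car[OF alt2_si] assms Y by simp
 show "cA (rh X Y) = ta X Y" unfolding rh_def using cm_sec[OF tas zeros(1)] by (simp add: sta[OF assms Y] zero_maps zeros(2) az[OF tas])
 show "cA (\<mu> X Y) = ta X Y" unfolding \<mu>_def cm_sec[OF sis tas ssi(1)[OF assms Y]] ssi(1)[OF assms Y] si_def[symmetric] by (rule ar[OF sis tas])
qed

lemma coh: "coherence Tm zT"
proof
 show "slie_jacobi Tm" by (rule jac)
 have z: "zT : \<X>" using tangent_closed(3)[OF manifolds(3)] zero0 by (simp add: vector_fields_def)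
 then show "zT : car Tm" by simp
 fix X assume "X : car Tm"
 then have X: "X : \<X>" by simp
 show "sadd Tm X zT = X" by (simp add: secadd_def)
 show "sbr Tm X zT = zT" "sbr Tm zT X = zT" using tangent_const[OF manifolds(3) vft[OF X]] by (auto simp: vf_bracket_def fun_eq_iff)
next
 fix g show "sscl Tm g zT = zT" by (simp add: secscale_def)
qed

sublocale coherence Tm zT
 by (rule coh)

abbreviation (input) "Nta == (pT ph, W1 ph ta)"

lemma anchors: "X : \<X> ==> sanc Am (ph X) m f = sanc Tm X m f"
 "X : \<X> ==> Y : \<X> ==> sanc Am (ta X Y) m f = 0"
 "X : \<X> ==> Y : \<X> ==> sanc Am (si X Y) m f = 0"
 "X : \<X> ==> sanc Em (f0 X) m f = sanc Tm X m f"
proof -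
 have z: "anchor \<E> m (vzero \<E> m) = (%f. 0)" using QA.anchor_zero unfolding LA_sel .
 show 4: "sanc Em (f0 X) m f = sanc Tm X m f" if "X : \<X>" using conn'(2)[OF vft[OF that]] by (simp add: secmap_def)
 show "sanc Am (ph X) m f = sanc Tm X m f" if "X : \<X>"
  using LA_anchors(3)[OF fib(2)[OF f0_sec(1)[OF that]]] 4[OF that] by (simp add: ph_um secmap_def[of "vunt \<L>"])
 assume XY: "X : \<X>" "Y : \<X>"
 have a: "anchor \<A> m (ta X Y m) = (%f. 0)"
  using LA_anchors(1)[OF fib(1)[OF conn'(9)[OF XY]], of m] fun_cong[OF sta[OF XY], of m] z by (simp add: secmap_def)
 then show "sanc Am (ta X Y) m f = 0" by simp
 show "sanc Am (si X Y) m f = 0" using a LA_anchors(3)[OF fib(2)[OF tta_sec[OF XY]], of m] LA_anchors(2)[OF fib(1)[OF conn'(9)[OF XY]], of m]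
  by (simp add: si_def secmap_def)
qed

lemma f0_bracket: "X : \<X> ==> Y : \<X> ==>
  bracket \<E> (f0 X) (f0 Y) = secadd \<E> (f0 (vf_bracket X Y)) (tA (ta X Y))"
proof -
 assume XY: "X : \<X>" "Y : \<X>"
 have 1: "bracket \<E> (f0 X) (f0 Y) : secs \<E>" "f0 (vf_bracket X Y) : secs \<E>"
  using slie_br[of Em "f0 X" "f0 Y"] jac(3) f0_sec(1) XY vector_fields_closed(3)[OF manifolds(3) XY] by (auto simp: slie_jacobi_def)
 show ?thesis unfolding conn'(10)[OF XY, symmetric]
  using QA.fibre_arith(6)[OF fib(2)[OF 1(1), unfolded LA_sel] fib(2)[OF 1(2), unfolded LA_sel]]
  by (simp add: secdiff_def secadd_def secscale_def LA_sel)
qed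

lemma ph_bracket: "X : \<X> ==> Y : \<X> ==>
  bracket \<A> (ph X) (ph Y) = secadd \<A> (ph (vf_bracket X Y)) (si X Y)"
 using shom_add[OF shoms(3), of "f0 (vf_bracket X Y)" "tA (ta X Y)"] f0_sec(1) vector_fields_closed(3)[OF manifolds(3), of X Y] tta_sec[of X Y]
 by (simp add: ph_um LA_brackets(3)[symmetric] f0_bracket si_def)

lemma tm_anchor: "X : \<X> ==> Y : \<X> ==> sanc Em (tA (ta X Y)) m f = 0"
 using anchors(2)[of X Y m f] LA_anchors(2)[OF fib(1)[OF conn'(9)], of X Y m] by (simp add: secmap_def)

lemma A_hyps: "rng Am = rng Tm" "shom Tm Am ph" "alt2 Tm Am ta" "alt2 Tm Am si"
 "!!x f m. x : car Tm ==> f : rng Tm ==> sanc Am (ph x) m f = sanc Tm x m f"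
 "!!x y f m. x : car Tm ==> y : car Tm ==> f : rng Tm ==> sanc Am (ta x y) m f = 0"
 "!!x y f m. x : car Tm ==> y : car Tm ==> f : rng Tm ==> sanc Am (si x y) m f = 0"
 "!!x y. x : car Tm ==> y : car Tm ==> sbr Am (ph x) (ph y) = sadd Am (ph (sbr Tm x y)) (si x y)"
 "snull Am zA"
 using shom_ph alt2_ta alt2_si anchors(1-3) ph_bracket snulls(1) by (simp_all add: mod_of_slie del: slie_of_sel(5))

lemma E_hyps: "rng Em = rng Tm" "shom Tm Em f0" "alt2 Tm Em (%X Y. tA (ta X Y))"
 "!!x f m. x : car Tm ==> f : rng Tm ==> sanc Em (f0 x) m f = sanc Tm x m f"
 "!!x y f m. x : car Tm ==> y : car Tm ==> f : rng Tm ==> sanc Em (tA (ta x y)) m f = 0"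
 "!!x y. x : car Tm ==> y : car Tm ==> sbr Em (f0 x) (f0 y) = sadd Em (f0 (sbr Tm x y)) (tA (ta x y))"
 "snull Em (vzero \<E>)"
 using shoms(4) alt2_tta anchors(4) tm_anchor f0_bracket snulls(2) by (simp_all add: mod_of_slie del: slie_of_sel(5))

text \<open>The vector field along \<open>F1\<close> is again of the form \<open>W1\<close>, with
  \<open>si\<close> in the place of \<open>ta\<close>. So both functors and the natural
  transformation are described by the same kind of data.\<close>

lemma Q_ph: "om : AF Am ==> pT ph (sd Am om) = W1 ph si om"
 by (rule pbk_sd_ph[OF jac(2) A_hyps(1-4), where nA=zA]) (assumption | rule A_hyps)+

lemma Q_f0: "om : AF Em ==> pT f0 (sd Em om) = W1 f0 (%X Y. tA (ta X Y)) om"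
 by (rule pbk_sd_ph[OF jac(3) E_hyps(1-3,3), where nA="vzero \<E>"]) (assumption | rule E_hyps)+

lemma key:
 assumes 0: "!!X Y Z. X : car Tm ==> Y : car Tm ==> Z : car Tm ==> snull Am (curv Am ph ta X Y Z)"
  and om: "om : AF Am" and l: "set l <= car Tm"
 shows "con (car Tm) ph ta (sd Am om) l m + sd Tm (con (car Tm) ph ta om) l m + BB Am ph ta si om l m = 0"
 by (rule key_identity[OF jac(2) A_hyps(1-4), where nA=zA, OF _ _ _ _ _ 0 om l]) (assumption | rule A_hyps)+

lemma one_form:
 assumes xi: "xi : AF Am" "!!l. length l ~= 1 ==> xi l = (%m. 0)" and X: "X : car Tm" "Y : car Tm" "Z : car Tm"
 shows "con (car Tm) ph ta (sd Am xi) [X, Y, Z] m + sd Tm (con (car Tm) ph ta xi) [X, Y, Z] m = xi [curv Am ph ta X Y Z] m"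
 by (rule gcomm_one_form[OF jac(2) A_hyps(1-4), where nA=zA, OF _ _ _ _ _ xi X]) (assumption | rule A_hyps)+

lemma curvature3_curv: "curvature3 B F0 ta0 X Y Z = curv Am ph ta X Y Z"
 unfolding curvature3_def curv_def Let_def secdiff_def by (simp add: ph_um)

lemma nat_trans_eq: "nat_trans_of B F0 ta0 = Nta"
 unfolding nat_trans_of_def Let_def W1_def pullback_pbk ce_diff_sd contract2_con by simp

lemma graded_map_eq: "graded_map_of B F0 = (pT f0, pT ph)"
 unfolding graded_map_of_def Let_def pullback_pbk by simp

section \<open>The underlying morphism of graded groupoids\<close>

abbreviation "TT == tangent_LA_groupoid (Mman B)"
abbreviation "CT == composables TT"
text \<open>The splitting on composable pairs of the unit groupoid. Sections of those are diagonal,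
  and on them it is \<open>WW\<close>.\<close>

definition "WW' w = (%m. (F1_of B F0 m (fst (w m)), F1_of B F0 m (snd (w m))))"

lemma TT_sel: "arr TT = \<T>" "obj TT = \<T>" "vsrc TT = (%m v. v)" "vtgt TT = (%m v. v)" "vunt TT = (%m v. v)" "vcomp TT = (%m v w. v)"
 by (simp_all add: tangent_LA_groupoid_def)

lemma secmap_id: "secmap (%m v. v) X = X"
 by (simp add: secmap_def)

lemma CT_car: "w : secs CT \<longleftrightarrow> (EX X:\<X>. w = (%m. (X m, X m)))"
 unfolding composables_def Let_def TT_sel by (auto simp: secmap_id)

lemma CT_ops: "secadd CT (%m. (a m, b m)) (%m. (a' m, b' m)) = (%m. (secadd \<T> a a' m, secadd \<T> b b' m))"
 "secscale CT g (%m. (a m, b m)) = (%m. (secscale \<T> g a m, secscale \<T> g b m))" "vbase CT = Mman B"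
 by (simp_all add: composables_def Let_def secadd_def secscale_def TT_sel)

lemma mod_CT: "smodule (mod_of CT)"
 unfolding smodule_def mod_of_sel CT_ops
proof (intro conjI ballI)
 note cl = smodule_closed[OF mods(1), unfolded mod_of_sel tangent_algebroid_sel]
 show "func_ring (cinf (Mman B))" by (rule cl(3))
 fix w assume "w : secs CT"
 then obtain X where w: "X : \<X>" "w = (%m. (X m, X m))" unfolding CT_car by blast
 { fix g assume "g : cinf (Mman B)"
  from cl(2)[OF this w(1)] show "secscale CT g w : secs CT" unfolding w(2) CT_ops CT_car by blast }
 fix w' assume "w' : secs CT"
 then obtain X' where w': "X' : \<X>" "w' = (%m. (X' m, X' m))" unfolding CT_car by blast
 show "secadd CT w w' : secs CT" using cl(1)[OF w(1) w'(1)] unfolding w(2) w'(2) CT_ops CT_car by blast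
qed

lemma WW'_WW: "WW' (%m. (X m, X m)) = WW X"
 by (simp add: WW'_def WW_def secmap_def)

lemma shom_WW': "shom (mod_of CT) (mod_of V2) WW'"
 unfolding shom_def mod_of_sel CT_ops
proof (intro conjI ballI)
 fix w assume "w : secs CT"
 then obtain X where w: "X : \<X>" "w = (%m. (X m, X m))" unfolding CT_car by blast
 show "WW' w : secs V2" unfolding w(2) WW'_WW using shom_car[OF shom_WW] w(1) by simp
 { fix w' assume "w' : secs CT"
  then obtain X' where w': "X' : \<X>" "w' = (%m. (X' m, X' m))" unfolding CT_car by blast
  show "WW' (secadd CT w w') = secadd V2 (WW' w) (WW' w')"
   unfolding w(2) w'(2) CT_ops WW'_WW using shom_add[OF shom_WW, of X X'] w(1) w'(1) by simp }
 fix g assume "g : cinf (Mman B)"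
 then show "WW' (secscale CT g w) = secscale V2 g (WW' w)"
  unfolding w(2) CT_ops WW'_WW using shom_scl[OF shom_WW, of g X] w(1) by simp
qed

lemma pbk_pbk: "(!!x. x : A ==> g x : C) ==> (!!x. x : A ==> q (g x) = h x) ==> pbk A g (pbk C q om) = pbk A h om"
proof
 fix l assume g: "!!x. x : A ==> g x : C" and h: "!!x. x : A ==> q (g x) = h x"
 have "map (%x. q (g x)) l = map h l" if "set l <= A" by (rule map_cong) (use h that in auto)
 moreover have "set (map g l) <= C" if "set l <= A" using g that by auto
 ultimately show "pbk A g (pbk C q om) l = pbk A h om l" unfolding pbk_def map_map o_def by (cases "set l <= A") (simp_all only: if_True if_False)
qed

lemma id_pbk: "om : AF Tm ==> pbk (secs \<T>) (secmap (%m v. v)) om = om"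
 by (rule ext) (auto simp: pbk_def secmap_id map_idI AF_off)

lemma forms_AF: "a : forms \<A> k ==> a : AF Am" "b : forms \<E> k ==> b : AF Em" "c : forms V2 k ==> c : AF (mod_of V2)"
 "d : forms \<T> k ==> d : AF Tm"
 by (auto simp only: mod_of_slie forms_iff[OF mods(2)] forms_iff[OF mods(3)] forms_iff[OF mod_V2] forms_iff[OF mods(1)])

lemma homs: "galg_hom (form_alg \<E>) (form_alg \<T>) (pT f0)" "galg_hom (form_alg \<A>) (form_alg \<T>) (pT ph)"
 "galg_hom (form_alg V2) (form_alg CT) (pbk (secs CT) WW')"
 using galg_hom_pbk[OF mods(1,3) _ shoms(4)] galg_hom_pbk[OF mods(1,2) _ shom_ph] galg_hom_pbk[OF mod_CT mod_V2 _ shom_WW'] by (simp_all add: CT_ops)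

lemma morphism: "ggroupoid_morphism (shift_groupoid TT) \<S> (pT f0, pT ph)"
proof -
 have W: "w : secs CT ==> WW' w : secs V2" for w using shom_car[OF shom_WW'] by simp
 have st: "pT ph (pbk (secs \<A>) sA a) = pT f0 a" "pT ph (pbk (secs \<A>) tA a) = pT f0 a" for a
  by (rule pbk_pbk; simp add: f0_sec sph)+
 have u: "pT f0 (pbk (secs \<E>) uA a) = pT ph a" for a
  by (rule pbk_pbk) (simp_all add: f0_sec ph_um)
 have c: "pbk (secs CT) WW' (pV p1 a) = pbk (secs CT) p1 (pT ph a)"
  "pbk (secs CT) WW' (pV p2 a) = pbk (secs CT) p2 (pT ph a)"
  "pbk (secs CT) WW' (pV cA a) = pbk (secs CT) (secmap (%m (x, y). x)) (pT ph a)" for a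
 proof -
  have r: "pbk (secs CT) q (pT ph a) = pbk (secs CT) (%w. ph (fst \<circ> w)) a" if "!!X. q (%m. (X m, X m)) = X" for q
   by (rule pbk_pbk) (auto simp: CT_car that o_def)
  have l: "pbk (secs CT) WW' (pV q a) = pbk (secs CT) (%w. ph (fst \<circ> w)) a"
   if "!!X. X : \<X> ==> q (WW X) = ph X" for q
   by (rule pbk_pbk[OF W]) (auto simp: CT_car WW'_WW that o_def)
  show "pbk (secs CT) WW' (pV p1 a) = pbk (secs CT) p1 (pT ph a)"
   "pbk (secs CT) WW' (pV p2 a) = pbk (secs CT) p2 (pT ph a)"
   "pbk (secs CT) WW' (pV cA a) = pbk (secs CT) (secmap (%m (x, y). x)) (pT ph a)"
   by ((subst l, simp add: WW_def secmap_pair cm_values(1)[unfolded WW_def], subst r, simp_all add: secmap_def)[1])+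
 qed
 have id: "pbk (secs \<T>) (secmap (%m v. v)) (pT f0 b) = pT f0 b" if "b : forms \<E> k" for b k
  by (rule id_pbk[OF AF_pbkT[OF _ E_hyps(1,2) forms_AF(2)[OF that]]]) (simp add: mod_of_slie mods)
 have id': "pbk (secs \<T>) (secmap (%m v. v)) (pT ph b) = pT ph b" if "b : forms \<A> k" for b k
  by (rule id_pbk[OF AF_pbkT[OF _ A_hyps(1,2) forms_AF(1)[OF that]]]) (simp add: mod_of_slie mods)
 show ?thesis unfolding ggroupoid_morphism_def prod.case agree_def shift_sel TT_sel form_alg_sel
 proof (intro conjI exI)
  show "galg_hom (form_alg V2) (form_alg CT) (pbk (secs CT) WW')" by (rule homs)
 qed (use homs st u c id id' in "auto simp: o_def")
qed

section \<open>The natural transformation\<close>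

lemma W1_null:
 assumes "smodule V" "om : AF V" "shom Tm V g" "!!x y. x : car Tm ==> y : car Tm ==> snull V (r x y)"
 shows "W1 g r om = sd Tm (pT g om)"
proof -
 have "con (car Tm) g r om l m = 0" for l m by (rule con_null[OF assms(1,2) _ assms(4)]) (use shom_car[OF assms(3)] in auto)
 then show ?thesis unfolding W1_def by (intro ext) simp
qed

lemma As: "smodule (slie_of \<A>)" "smodule (slie_of \<E>)" "rng (mod_of V2) = rng Tm" "rng (mod_of \<A>) = rng Tm" "shom Tm (mod_of V2) WW" "shom Tm (mod_of \<A>) ph"
 "AF Am = AF (mod_of \<A>)"
 using mods shom_WW shom_ph by (simp_all add: mod_of_slie)

lemma pr_values: "p1 (WW X) = ph X" "p2 (WW X) = ph X" "p1 (rh X Y) = ta X Y"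
 "p2 (rh X Y) = zA" "p1 (\<mu> X Y) = si X Y" "p2 (\<mu> X Y) = ta X Y"
 unfolding WW_def rh_def \<mu>_def by (rule secmap_pair)+

lemma pull_WW: "pT WW (pV p1 om) = pT ph om"
 "pT WW (pV p2 om) = pT ph om"
 "pT WW (pV cA om) = pT ph om"
 by (rule pbk_pbk; use shom_car[OF shom_WW] in "simp add: pr_values cm_values")+

text \<open>A multiplication table. The data \<open>rh\<close> project to the natural transformation
  and to the differential of \<open>F1\<close>; the data \<open>\<mu>\<close> project to the vector
  field along \<open>F1\<close> and to the natural transformation. Both products are the natural
  transformation.\<close>

lemma W1_values:
 assumes om: "om : AF Am"
 shows "W1 WW rh (pV p1 om) = W1 ph ta om"
  "W1 WW rh (pV p2 om) = sd Tm (pT ph om)"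
  "W1 WW rh (pV cA om) = W1 ph ta om"
  "W1 WW \<mu> (pV p1 om) = pT ph (sd Am om)"
  "W1 WW \<mu> (pV p2 om) = W1 ph ta om"
  "W1 WW \<mu> (pV cA om) = W1 ph ta om"
proof -
 note n = W1_natural[OF mod_V2 As(3) mods(2) As(4) _ As(5), unfolded mod_of_sel(2)]
 show "W1 WW rh (pV p1 om) = W1 ph ta om" unfolding n[OF shom_pr(1) alt2_rh] pr_values by (rule refl)
 show "W1 WW rh (pV p2 om) = sd Tm (pT ph om)" unfolding n[OF shom_pr(2) alt2_rh] pr_values
  by (rule W1_null[OF mods(2) om[unfolded mod_of_slie] As(6)]) (rule snulls)
 show "W1 WW rh (pV cA om) = W1 ph ta om" unfolding n[OF shom_cm alt2_rh]
  by (rule W1_cong[OF mods(2) As(4)]) (simp_all add: cm_values)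
 show "W1 WW \<mu> (pV p1 om) = pT ph (sd Am om)" unfolding n[OF shom_pr(1) alt2_\<mu>] pr_values
  by (rule Q_ph[OF om, symmetric])
 show "W1 WW \<mu> (pV p2 om) = W1 ph ta om" unfolding n[OF shom_pr(2) alt2_\<mu>] pr_values by (rule refl)
 show "W1 WW \<mu> (pV cA om) = W1 ph ta om" unfolding n[OF shom_cm alt2_\<mu>]
  by (rule W1_cong[OF mods(2) As(4)]) (simp_all add: cm_values)
qed

text \<open>The left side of the naturality square. Together with \<open>product2\<close>, its right
  side, it says that both composites equal the natural transformation itself.\<close>

lemma product1: "T1_product \<S> (form_alg \<T>) Nta (pT ph, %om. sd Tm (pT ph om)) Nta"
 unfolding T1_product_def
proof (intro exI conjI)
 show "T1_map (fun2 \<S>) (form_alg \<T>) (pbk (secs \<T>) WW, W1 WW rh)"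
  unfolding shift_sel by (rule T1_map_W1[OF coh mod_V2 _ As(5) alt2_rh alt2_rh]) simp
qed (auto simp: T1_agree_def T1_push_def agree_def pull_WW[simplified] W1_values forms_AF(1) o_def simp del: slie_of_sel(2), auto simp: pull_WW[simplified] W1_values forms_AF(1))

lemma product2: "T1_product \<S> (form_alg \<T>) (pT ph, %om. pT ph (sd Am om)) Nta Nta"
 unfolding T1_product_def
proof (intro exI conjI)
 show "T1_map (fun2 \<S>) (form_alg \<T>) (pbk (secs \<T>) WW, W1 WW \<mu>)"
  unfolding shift_sel by (rule T1_map_W1[OF coh mod_V2 _ As(5) alt2_\<mu> alt2_\<mu>]) simp
qed (auto simp: T1_agree_def T1_push_def agree_def pull_WW[simplified] W1_values forms_AF(1) o_def simp del: slie_of_sel(2), auto simp: pull_WW[simplified] W1_values forms_AF(1))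

text \<open>The source is the differential after F because \<open>ta\<close> is core-valued; the
  target is the vector field after F because the boundary of \<open>ta\<close> is the curvature of
  \<open>f0\<close>, the equation of a 2-connection.\<close>

lemma transformation: "nat_transformation (shift_groupoid TT) \<S>
  ((pT f0, sd Tm \<circ> pT f0), (pT ph, sd Tm \<circ> pT ph))
  ((pT f0, pT f0 \<circ> sd Em), (pT ph, pT ph \<circ> sd Am)) Nta"
proof -
 note n = W1_natural[OF mods(2) As(4) mods(3) _ _ As(6) alt2_ta, unfolded mod_of_sel(2)]
 have s: "pT ph (pbk (secs \<A>) sA a) = pT f0 a" "pT ph (pbk (secs \<A>) tA a) = pT f0 a" for a
  by (rule pbk_pbk; simp add: f0_sec sph)+
 have ds: "W1 ph ta (pbk (secs \<A>) sA a) = sd Tm (pT f0 a)" if a: "a : forms \<E> k" for a k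
 proof -
  have "W1 ph ta (pbk (secs \<A>) sA a) = W1 f0 (%X Y. vzero \<E>) a"
   unfolding n[OF _ shoms(1), simplified] by (rule W1_cong[OF mods(3)]) (simp_all add: sph sta)
  also have "... = sd Tm (pT f0 a)"
   by (rule W1_null[OF As(2) forms_AF(2)[OF a] E_hyps(2)]) (rule E_hyps)
  finally show ?thesis .
 qed
 have dt: "W1 ph ta (pbk (secs \<A>) tA a) = pT f0 (sd Em a)" if a: "a : forms \<E> k" for a k
  unfolding Q_f0[OF forms_AF(2)[OF a]] n[OF _ shoms(2), simplified] by (rule W1_cong[OF mods(3)]) (simp_all add: sph)
 have iA: "pbk (secs \<T>) (secmap (%m v. v)) (pT ph b) = pT ph b"
  "pbk (secs \<T>) (secmap (%m v. v)) (W1 ph ta b) = W1 ph ta b" if "b : forms \<A> k" for b k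
  using id_pbk AF_pbkT[OF As(1) A_hyps(1,2) forms_AF(1)[OF that]] AF_W1[OF As(1) A_hyps(1-3) forms_AF(1)[OF that]] by auto
 have ag: "T1_agree (fun1 \<S>) Nta (T1_pull (pbk (secs \<T>) (secmap (%m v. v))) Nta)"
  unfolding T1_agree_def T1_pull_def prod.case agree_def shift_sel form_alg_sel o_def using iA by metis
 have rf: "T1_agree A x x" for A :: "'x galg" and x :: "('x => 'y) \<times> ('x => 'y)" by (auto simp: T1_agree_def agree_def split: prod.splits)
 show ?thesis unfolding nat_transformation_def prod.case shift_sel TT_sel
 proof (intro conjI exI)
  show "T1_map (form_alg \<A>) (form_alg \<T>) Nta"
   using T1_map_W1[OF coh mods(2) _ As(6) alt2_ta alt2_ta] by simp
  show "T1_agree (form_alg \<E>) (T1_push (pbk (secs \<A>) sA) Nta) (pT f0, sd Tm \<circ> pT f0)"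
   unfolding T1_agree_def T1_push_def prod.case agree_def form_alg_sel o_def using s ds by metis
  show "T1_agree (form_alg \<E>) (T1_push (pbk (secs \<A>) tA) Nta) (pT f0, pT f0 \<circ> sd Em)"
   unfolding T1_agree_def T1_push_def prod.case agree_def form_alg_sel o_def using s dt by metis
  show "T1_product \<S> (form_alg \<T>) (T1_pull (pbk (secs \<T>) (secmap (%m v. v))) Nta)
   (pT ph, sd Tm \<circ> pT ph) Nta"
   unfolding o_def by (rule T1_product_agree[OF product1 ag rf rf])
  show "T1_product \<S> (form_alg \<T>) (pT ph, pT ph \<circ> sd Am)
   (T1_pull (pbk (secs \<T>) (secmap (%m v. v))) Nta) Nta"
   unfolding o_def by (rule T1_product_agree[OF product2 rf ag rf])
 qed
qed

section \<open>The coherence law\<close>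

lemma sd_W1: "om : AF Am ==> alt2 Tm Am r ==> sd Tm (W1 ph r om) l m = - sd Tm (con (car Tm) ph r om) l m"
proof -
 assume om: "om : AF Am" and r: "alt2 Tm Am r"
 note a = AF_pbkT[OF As(1) A_hyps(1,2) om] and c = AF_conT[OF As(1) A_hyps(1,2) r om]
 show ?thesis unfolding W1_def using sd_lin(2)[OF T'(1) AF_sd[OF T'(1) a] c, of l m] sd_sd[OF jac(1) a, of l m] by simp
qed

text \<open>The natural transformation on a differential: by \<open>Q_ph\<close> the pullback of
  \<open>sd Am om\<close> is \<open>W1 ph si om\<close>, whose exact part disappears under
  \<open>sd\<close>.\<close>

lemma W1_Q: "om : AF Am ==> W1 ph ta (sd Am om) l m = - sd Tm (con (car Tm) ph si om) l m - con (car Tm) ph ta (sd Am om) l m"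
 using sd_W1[OF _ A_hyps(4), of om l m] Q_ph[of om] by (simp add: W1_def[of ph ta] del: slie_of_sel)

text \<open>The three projections of the witness have three different reasons. The first is
  \<open>key\<close>, where the curvature enters; the second is that \<open>sd\<close> squares to
  zero; the third is the antisymmetry of the quadratic term in equal entries.\<close>

lemma W12_values:
 assumes 0: "!!X Y Z. X : car Tm ==> Y : car Tm ==> Z : car Tm ==> snull Am (curv Am ph ta X Y Z)" and om: "om : AF Am"
 shows "W12 (mod_of V2) WW rh \<mu> (pV p1 om) = W1 ph ta (sd Am om)"
  "W12 (mod_of V2) WW rh \<mu> (pV p2 om) = sd Tm (W1 ph ta om)"
  "W12 (mod_of V2) WW rh \<mu> (pV cA om) = (%l m. 0)"
proof -
 note A'' = slie_jacobi_def[of Am, THEN iffD1, OF jac(2), THEN conjunct1]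
 note n = W12_natural[OF mod_V2 As(3) As(1) A_hyps(1) _ As(5) alt2_rh alt2_\<mu> om, unfolded mod_of_sel(2)]
 note sh = shom_pr[folded mod_of_slie(3)] shom_cm[folded mod_of_slie(3)]
 note a12 = AF_W12[OF As(1) A_hyps(1,2)] and a1 = AF_W1[OF As(1) A_hyps(1,2)] and ac = AF_conT[OF As(1) A_hyps(1,2)]
 have zA: "alt2 Tm Am (%X Y. zA)" using alt2_zA by (simp add: mod_of_slie)
 have "W12 Am ph ta si om = W1 ph ta (sd Am om)"
 proof (rule AF_ext[OF a12[OF A_hyps(3,4) om] a1[OF A_hyps(3) AF_sd[OF A'' om]]])
  fix l m assume "set l <= car Tm"
  from key[OF 0 om this, of m] show "W12 Am ph ta si om l m = W1 ph ta (sd Am om) l m"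
   unfolding W12_def W1_Q[OF om] sd_lin(2)[OF T'(1) ac[OF A_hyps(3) om] ac[OF A_hyps(4) om]] by simp
 qed
 then show "W12 (mod_of V2) WW rh \<mu> (pV p1 om) = W1 ph ta (sd Am om)"
  unfolding n[OF sh(1)] pr_values .
 have cz: "con (car Tm) ph (%X Y. zA) om l m = 0" for l m
  by (rule con_null[OF As(1) om]) (use shom_car[OF A_hyps(2)] A_hyps(9) in auto)
 have cz': "con (car Tm) ph (%X Y. zA) om = (%l m. 0)" by (intro ext cz)
 have "W12 Am ph (%X Y. zA) ta om l m = sd Tm (W1 ph ta om) l m" for l m
  unfolding W12_def sd_W1[OF om A_hyps(3)] BB_null[OF As(1) A_hyps(1,2) zA A_hyps(3) om A_hyps(9)]
   sd_lin(2)[OF T'(1) ac[OF zA om] ac[OF A_hyps(3) om]]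
  using sd_lin(3)[OF T'(1) ac[OF zA om] ac[OF zA om], of 0 l m] unfolding cz' by simp
 then show "W12 (mod_of V2) WW rh \<mu> (pV p2 om) = sd Tm (W1 ph ta om)"
  unfolding n[OF sh(2)] pr_values by (intro ext)
 have "W12 (mod_of V2) WW rh \<mu> (pV cA om) = W12 Am ph ta ta om"
  unfolding n[OF sh(3)] by (rule W12_cong[OF As(1) A_hyps(1)]) (simp_all add: cm_values)
 moreover have "W12 Am ph ta ta om l m = 0" for l m
  unfolding W12_def using BB_swap[OF As(1) A_hyps(1,2,3,3) om, of l m] sd_lin(2)[OF T'(1) ac[OF A_hyps(3) om] ac[OF A_hyps(3) om], of l m] by simp
 ultimately show "W12 (mod_of V2) WW rh \<mu> (pV cA om) = (%l m. 0)" by (intro ext) simp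
qed

lemma coherent:
 assumes 0: "!!X Y Z. X : car Tm ==> Y : car Tm ==> Z : car Tm ==> snull Am (curv Am ph ta X Y Z)"
 shows "T11_product \<S> (form_alg \<T>) (T1_Q_after (sd Am) Nta) (T1_before_Q (sd Tm) Nta)
  (pT ph, W1 ph ta, W1 ph ta, %_. (%l m. 0))"
 unfolding T11_product_def
proof (intro exI conjI)
 \<comment> \<open>In a vector field after the natural transformation the underlying map comes from
   the vector field, so \<open>\<mu>\<close>, whose first entry is \<open>si\<close>, stands first
   and \<open>rh\<close> second.\<close>
 show "T11_map (fun2 \<S>) (form_alg \<T>) (pbk (secs \<T>) WW, W1 WW \<mu>, W1 WW rh, W12 (mod_of V2) WW rh \<mu>)"
  unfolding shift_sel by (rule T11_map_W12[OF coh mod_V2 _ As(5) alt2_rh alt2_\<mu>]) simp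
 note v = pull_WW[unfolded slie_of_sel(2)] W1_values[unfolded slie_of_sel(2)] W12_values[OF 0]
 show "T11_agree (fun1 \<S>) (T11_push (gpr1 \<S>) (pbk (secs \<T>) WW, W1 WW \<mu>, W1 WW rh, W12 (mod_of V2) WW rh \<mu>))
  (T1_Q_after (sd Am) Nta)"
  unfolding T11_agree_def T11_push_def T1_Q_after_def prod.case agree_def shift_sel form_alg_sel o_def slie_of_sel(2)
  by (intro conjI allI ballI v forms_AF) (assumption | rule forms_AF(1))+
 show "T11_agree (fun1 \<S>) (T11_push (gpr2 \<S>) (pbk (secs \<T>) WW, W1 WW \<mu>, W1 WW rh, W12 (mod_of V2) WW rh \<mu>))
  (T1_before_Q (sd Tm) Nta)"
  unfolding T11_agree_def T11_push_def T1_before_Q_def prod.case agree_def shift_sel form_alg_sel o_def slie_of_sel(2)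
  by (intro conjI allI ballI v forms_AF) (assumption | rule forms_AF(1))+
 show "T11_agree (fun1 \<S>) (T11_push (gcomp \<S>) (pbk (secs \<T>) WW, W1 WW \<mu>, W1 WW rh, W12 (mod_of V2) WW rh \<mu>))
  (pT ph, W1 ph ta, W1 ph ta, %_. (%l m. 0))"
  unfolding T11_agree_def T11_push_def prod.case agree_def shift_sel form_alg_sel o_def slie_of_sel(2)
  by (intro conjI allI ballI v forms_AF) (assumption | rule forms_AF(1))+
qed

lemma us: "a : secs \<A> ==> uA (sA a) : secs \<A>" "shom Am Am (%a. uA (sA a))"
 using shoms(1,3) by (auto simp: shom_def mod_of_slie)

text \<open>On 1-forms, composition is the sum of the projections, up to a correction that factors through
 the units. The coherence law therefore determines its value on 1-forms.\<close>

lemma one_forms_vanish: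
 assumes P: "T11_product \<S> (form_alg \<T>) (T1_Q_after (sd Am) Nta) (T1_before_Q (sd Tm) Nta) (f, D1, D2, D12)"
  and D12: "agree (form_alg \<A>) D12 (%_. (%l m. 0))"
  and xi: "xi : forms \<A> 1" and X: "X : car Tm" "Y : car Tm" "Z : car Tm"
 shows "xi [curv Am ph ta X Y Z] = (%m. 0)"
proof -
 obtain W Wa Wb Wab where w: "T11_map (form_alg V2) (form_alg \<T>) (W, Wa, Wb, Wab)"
  "T11_agree (form_alg \<A>) (T11_push (pV p1) (W, Wa, Wb, Wab)) (T1_Q_after (sd Am) Nta)"
  "T11_agree (form_alg \<A>) (T11_push (pV p2) (W, Wa, Wb, Wab)) (T1_before_Q (sd Tm) Nta)"
  "T11_agree (form_alg \<A>) (T11_push (pV cA) (W, Wa, Wb, Wab)) (f, D1, D2, D12)"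
  using P unfolding T11_product_def shift_sel by (metis prod_cases4)
 have gl: "graded_linear 2 (form_alg V2) (form_alg \<T>) Wab" using w(1) unfolding T11_map_def by simp
 have p1: "Wab (pV p1 a) = W1 ph ta (sd Am a)"
  and p2: "Wab (pV p2 a) = sd Tm (W1 ph ta a)"
  and pc: "Wab (pV cA a) = (%l m. 0)" if "a : forms \<A> k" for a k
  using w(2)[unfolded T11_agree_def T11_push_def T1_Q_after_def prod.case agree_def form_alg_sel o_def, THEN conjunct2, THEN conjunct2, THEN conjunct2, rule_format, OF that]
   w(3)[unfolded T11_agree_def T11_push_def T1_before_Q_def prod.case agree_def form_alg_sel o_def, THEN conjunct2, THEN conjunct2, THEN conjunct2, rule_format, OF that]
   w(4)[unfolded T11_agree_def T11_push_def prod.case agree_def form_alg_sel o_def, THEN conjunct2, THEN conjunct2, THEN conjunct2, rule_format, OF that]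
   D12[unfolded agree_def form_alg_sel, rule_format, OF that] by simp_all
 note A'' = slie_jacobi_def[of Am, THEN iffD1, OF jac(2), THEN conjunct1]
 let ?us = "%a. uA (sA a)"
 \<comment> \<open>The projection to units applied to the argument of \<open>xi\<close>. Pulled back
   to the left factor, this is the term by which composition differs from the sum of the two
   projections on 1-forms.\<close>
 define ze where "ze = pbk (secs \<A>) ?us xi"
 have xi': "xi : AF Am" "!!l. length l ~= 1 ==> xi l = (%m. 0)" using xi unfolding mod_of_slie forms_iff[OF mods(2)] by auto
 have zeA: "ze : AF Am" unfolding ze_def using AF_pbk[OF us(2) _ As(1) xi'(1)] by simp
 have ze: "ze : forms \<A> 1" using zeA pbk_deg[OF xi'(2)] unfolding mod_of_slie forms_iff[OF mods(2)] ze_def by auto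
 let ?p1 = "pV p1" and ?p2 = "pV p2" and ?pc = "pV cA"
 have fV: "pV q a : forms V2 1" if a: "a : forms \<A> 1" and q: "shom (mod_of V2) (mod_of \<A>) q" for q a
  using galg_hom_pbk[OF mod_V2 mods(2) _ q] a unfolding galg_hom_def graded_linear_def form_alg_sel by simp
 note m = fV[OF xi shom_pr(1)] fV[OF xi shom_pr(2)] fV[OF ze shom_pr(1)]
 have e: "?pc xi = (%l m. (%l m. ?p1 xi l m + ?p2 xi l m) l m + (%l m. - 1 * ?p1 ze l m) l m)"
 proof (intro ext)
  fix l m
  show "?pc xi l m = (%l m. ?p1 xi l m + ?p2 xi l m) l m + (%l m. - 1 * ?p1 ze l m) l m"
  proof (cases "length l = 1 & set l <= secs V2")
   case False then show ?thesis using xi'(2) by (auto simp: pbk_def ze_def)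
  next
   case True
   then obtain w where l: "l = [w]" "w : secs V2" by (cases l) auto
   then obtain a b where ab: "a : secs \<A>" "b : secs \<A>" "sA a = tA b" "w = (%m. (a m, b m))" unfolding V2_car by blast
   note cl = smodule_closed[OF mods(2), unfolded mod_of_sel base]
   have "?pc xi l m = xi [secadd \<A> (secadd \<A> a b) (secscale \<A> (%_. - 1) (?us a))] m"
    using l by (simp add: pbk_def ab(4) cm_sec[OF ab(1-3)])
   also have "... = xi [a] m + xi [b] m - xi [?us a] m"
    using AF_add1[OF xi'(1), of "[]" "secadd \<A> a b" "secscale \<A> (%_. - 1) (?us a)" m] AF_add1[OF xi'(1), of "[]" a b m]
     AF_scl1[OF xi'(1), of "[]" "%_. - 1" "?us a" m] cl ab(1,2) us(1) zero0 by simp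
   finally show ?thesis using l ab(1) us(1)[OF ab(1)] by (simp add: pbk_def ze_def ab(4)[symmetric]) (simp add: ab(4) secmap_pair)
  qed
 qed
 have s: "(%l m. ?p1 xi l m + ?p2 xi l m) : forms V2 1" "(%l m. - 1 * ?p1 ze l m) : forms V2 1"
  using m AF_plus[OF mod_V2] AF_mult[OF mod_V2, of _ "%_. -1"] zero0 unfolding forms_iff[OF mod_V2] by auto
 have L: "Wab (%l m. a l m + b l m) = (%l m. Wab a l m + Wab b l m)" if "a : forms V2 1" "b : forms V2 1" for a b
  using gl that unfolding graded_linear_def form_alg_sel by blast
 have "(%l m. 0) = Wab (?pc xi)" using pc[OF xi] by simp
 also have "... = (%l m. Wab (%l m. ?p1 xi l m + ?p2 xi l m) l m + Wab (%l m. - 1 * ?p1 ze l m) l m)"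
  unfolding e by (rule L[OF s])
 also have "Wab (%l m. ?p1 xi l m + ?p2 xi l m) = (%l m. Wab (?p1 xi) l m + Wab (?p2 xi) l m)"
  by (rule L[OF m(1,2)])
 also have "Wab (%l m. - 1 * ?p1 ze l m) = (%l m. - 1 * Wab (?p1 ze) l m)"
  using gl m(3) unfolding graded_linear_def form_alg_sel by blast
 finally have E: "W1 ph ta (sd Am xi) l m + sd Tm (W1 ph ta xi) l m - W1 ph ta (sd Am ze) l m = 0" for l m
  unfolding p1[OF xi] p2[OF xi] p1[OF ze] by (simp add: fun_eq_iff)
 \<comment> \<open>\<open>si\<close> is unit-valued, so the projection to units leaves it alone,
   whereas it kills the core-valued \<open>ta\<close> (see \<open>cta\<close>). Subtracting
   \<open>ze\<close> therefore removes the \<open>si\<close> terms and leaves the \<open>ta\<close>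
   terms untouched.\<close>
 have csi: "con (car Tm) ph si ze = con (car Tm) ph si xi"
 proof -
  have "con (car Tm) ph si ze = con (car Tm) (%X. ?us (ph X)) (%X Y. ?us (si X Y)) xi"
   unfolding ze_def using natural_con(2)[OF As(1) A_hyps(1) As(1) A_hyps(1) us(2) A_hyps(2,4)] by simp
  also have "... = con (car Tm) ph si xi" by (rule con_fun_cong) (simp_all add: sph ssi ph_um, simp add: units f0_sec, simp add: ssi flip: si_def)
  finally show ?thesis .
 qed
 \<comment> \<open>The projection to units preserves anchors and brackets, so it commutes with the
   differential; in \<open>pbk_sd\<close> its defect is the zero section.\<close>
 have Qze: "sd Am ze = pbk (secs \<A>) ?us (sd Am xi)"
 proof (rule AF_ext[OF AF_sd[OF A'' zeA]])
  show "pbk (secs \<A>) ?us (sd Am xi) : AF Am" using AF_pbk[OF us(2) _ As(1) AF_sd[OF A'' xi'(1)]] by simp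
  fix l m assume l: "set l <= car Am"
  have "pbk (car Am) ?us (sd Am xi) l m = sd Am (pbk (car Am) ?us xi) l m - con (car Am) ?us (%X Y. zA) xi l m"
  proof (rule pbk_sd[OF slie_br_closed[OF A''] slie_br_closed[OF A''] _ _ AF_pbk[OF us(2) refl As(1)] _ _ xi'(1) l])
   show "?us ` car Am <= car Am" using us(1) by auto
   show "ALL x:car Am. ALL y:car Am. zA : car Am" using zeros by simp
   fix x f m assume x: "x : car Am"
   have "sA x : secs \<E>" using shom_car[OF shoms(1)] x by simp
   then show "sanc Am (?us x) m f = sanc Am x m f"
    using LA_anchors(3)[OF fib(2), of "sA x" m] LA_anchors(1)[OF fib(1), of x m] x by (simp add: secmap_def)
  next
   fix x y om l m assume *: "x : car Am" "y : car Am" "om : AF Am" "set l <= car Am"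
   have "bracket \<A> (?us x) (?us y) = ?us (bracket \<A> x y)"
    using LA_brackets(1)[of x y] LA_brackets(3)[of "sA x" "sA y"] shom_car[OF shoms(1)] * by simp
   then show "om (sbr Am (?us x) (?us y) # l) m = om (?us (sbr Am x y) # l) m + om (zA # l) m"
    using AF_snull1[OF As(1) *(3) A_hyps(9) *(4)] by simp
  qed
  moreover have "con (car Am) ?us (%X Y. zA) xi l m = 0" by (rule con_null[OF As(1) xi'(1)]) (use us(1) A_hyps(9) in auto)
  ultimately show "sd Am ze l m = pbk (secs \<A>) ?us (sd Am xi) l m" unfolding ze_def by simp
 qed
 have cta: "con (car Tm) ph ta (sd Am ze) l m = 0" for l m
 proof -
  have "con (car Tm) ph ta (sd Am ze) = con (car Tm) (%X. ?us (ph X)) (%X Y. ?us (ta X Y)) (sd Am xi)"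
   unfolding Qze using natural_con(2)[OF As(1) A_hyps(1) As(1) A_hyps(1) us(2) A_hyps(2,3)] by simp
  moreover have "con (car Tm) (%X. ?us (ph X)) (%X Y. ?us (ta X Y)) (sd Am xi) l m = 0"
   by (rule con_null[OF As(1) AF_sd[OF A'' xi'(1)]]) (use us(1) f0_sec(2) A_hyps(9) in "auto simp: sta zero_maps")
  ultimately show ?thesis by simp
 qed
 show ?thesis
 proof
  fix m
  have "con (car Tm) ph ta (sd Am xi) [X, Y, Z] m + sd Tm (con (car Tm) ph ta xi) [X, Y, Z] m = 0"
   using E[of "[X, Y, Z]" m] unfolding W1_Q[OF xi'(1)] W1_Q[OF zeA] sd_W1[OF xi'(1) A_hyps(3)] csi cta by simp
  moreover have "con (car Tm) ph ta (sd Am xi) [X, Y, Z] m + sd Tm (con (car Tm) ph ta xi) [X, Y, Z] m = xi [curv Am ph ta X Y Z] m"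
   by (rule one_form[OF xi'(1) _ X]) (rule xi'(2))
  ultimately show "xi [curv Am ph ta X Y Z] m = 0" by simp
 qed
qed

lemma curv_section: "X : car Tm ==> Y : car Tm ==> Z : car Tm ==> curv Am ph ta X Y Z : secs \<A>"
proof -
 assume X: "X : car Tm" "Y : car Tm" "Z : car Tm"
 note A'' = slie_jacobi_def[of Am, THEN iffD1, OF jac(2), THEN conjunct1]
 have m1: "(%_. - 1) : rng Am" using zero0 by simp
 have "curv Am ph ta X Y Z : car Am" unfolding curv_def Let_def
  by (intro smodule_closed(1,2)[OF As(1)] slie_br[OF A''] shom_car[OF A_hyps(2)] alt2_car[OF A_hyps(3)] slie_br[OF T'(1)] X m1)
 then show ?thesis by simp
qed

lemma curvature_vanishes:
 assumes "!!xi X Y Z. xi : forms \<A> 1 ==> X : car Tm ==> Y : car Tm ==> Z : car Tm ==> xi [curv Am ph ta X Y Z] = (%m. 0)"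
 shows "curvature3_vanishes B F0 ta0"
 unfolding curvature3_vanishes_def curvature3_curv
proof (intro ballI)
 fix X Y Z assume X: "X : \<X>" "Y : \<X>" "Z : \<X>"
 let ?c = "curv Am ph ta X Y Z"
 have c: "?c : secs \<A>" by (rule curv_section) (use X in simp_all)
 show "?c = zA"
 proof (rule PA.sections_separate[folded LA_sel(1), OF c])
  fix et assume et: "ALL b:secs \<A>. et b : cinf (Mman B)"
   "ALL b:secs \<A>. ALL c:secs \<A>. et (secadd \<A> b c) = (%m. et b m + et c m)"
   "ALL g:cinf (Mman B). ALL b:secs \<A>. et (secscale \<A> g b) = (%m. g m * et b m)"
  \<comment> \<open>The function-linear map \<open>et\<close> as a 1-form: lists of any other length
    are sent to 0.\<close>
  define xi where "xi = (%l. case l of [a] => if a : secs \<A> then et a else (%m. 0) | _ => (%m. 0))"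
  have xi1: "xi [a] = (if a : secs \<A> then et a else (%m. 0))" and xi0: "length l ~= 1 ==> xi l = (%m. 0)" for a l
   by (auto simp: xi_def split: list.splits)
  note cl = smodule_closed[OF mods(2), unfolded mod_of_sel base]
  have "xi : AF (mod_of \<A>)" unfolding AF_def mem_Collect_eq mod_of_sel base
  proof (intro conjI allI impI)
   fix l show "xi l = (%m. 0)" if "~ set l <= secs \<A>"
    using that by (cases "length l = 1") (auto simp: xi0 xi1 length_Suc_conv)
   show "xi l : cinf (Mman B)" using et(1) zero0
    by (cases "length l = 1") (auto simp: xi0 xi1 length_Suc_conv)
  next
   fix l1 l2 a b assume "a : secs \<A>" "b : secs \<A>"
   then show "xi (l1 @ secadd \<A> a b # l2) = (%m. xi (l1 @ a # l2) m + xi (l1 @ b # l2) m)"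
    using et(2) cl by (cases "l1 = [] & l2 = []") (auto simp: xi0 xi1)
  next
   fix l1 l2 g a assume "g : cinf (Mman B)" "a : secs \<A>"
   then show "xi (l1 @ secscale \<A> g a # l2) = (%m. g m * xi (l1 @ a # l2) m)"
    using et(3) cl by (cases "l1 = [] & l2 = []") (auto simp: xi0 xi1)
  qed (simp add: xi0)
  then have "xi : forms \<A> 1" unfolding forms_iff[OF mods(2)] using xi0 by blast
  from assms[OF this, of X Y Z] show "et ?c = (%m. 0)" using X c by (simp add: xi1)
 qed
qed

lemma main: "quasi_LA_morphism (shift_groupoid TT) \<S> (graded_map_of B F0) (nat_trans_of B F0 ta0)
  \<longleftrightarrow> curvature3_vanishes B F0 ta0"
proof -
 let ?P = "%f D1 D2 D12. T11_product \<S> (form_alg \<T>) (T1_Q_after (sd Am) Nta)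
  (T1_before_Q (sd Tm) Nta) (f, D1, D2, D12) & agree (form_alg \<A>) D1 D2 & agree (form_alg \<A>) D12 (%_. (%l m. 0))"
 have u: "pT f0 (pbk (secs \<E>) uA a) = pT ph a" for a
  by (rule pbk_pbk) (simp_all add: f0_sec ph_um)
 have ag: "agree (form_alg \<A>) (pT ph) (pT f0 \<circ> pbk (secs \<E>) uA)" unfolding agree_def o_def u by simp
 \<comment> \<open>The groupoid morphism, the naturality square and the condition over the units
   hold for every 2-connection, so only the coherence law remains.\<close>
 have "quasi_LA_morphism (shift_groupoid TT) \<S> (graded_map_of B F0) (nat_trans_of B F0 ta0) \<longleftrightarrow> (EX f D1 D2 D12. ?P f D1 D2 D12)"
  unfolding quasi_LA_morphism_def graded_map_eq nat_trans_eq prod.case shift_sel TT_sel form_alg_sel fst_conv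
  using morphism transformation ag by blast
 also have "... \<longleftrightarrow> curvature3_vanishes B F0 ta0"
 proof
  assume "EX f D1 D2 D12. ?P f D1 D2 D12"
  then obtain f D1 D2 D12 where P: "?P f D1 D2 D12" by blast
  show "curvature3_vanishes B F0 ta0"
   by (rule curvature_vanishes) (rule one_forms_vanish[OF P[THEN conjunct1] P[THEN conjunct2, THEN conjunct2]])
 next
  assume v: "curvature3_vanishes B F0 ta0"
  have 0: "snull Am (curv Am ph ta X Y Z)" if "X : car Tm" "Y : car Tm" "Z : car Tm" for X Y Z
   using v that A_hyps(9) unfolding curvature3_vanishes_def curvature3_curv by simp
  have "?P (pT ph) (W1 ph ta) (W1 ph ta) (%_. (%l m. 0))"
   using coherent[OF 0] by (simp add: agree_def)
  then show "EX f D1 D2 D12. ?P f D1 D2 D12" by blast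
 qed
 finally show ?thesis .
qed

end

theorem proposition3p38:
  fixes B :: "('p::{t2_space,second_countable_topology}, 'pe::euclidean_space,
      'q::{t2_space,second_countable_topology}, 'qe::euclidean_space,
      'm::{t2_space,second_countable_topology}, 'me::euclidean_space,
      'h::{t2_space,second_countable_topology}, 'he::euclidean_space,
      'k::{t2_space,second_countable_topology}, 'ke::euclidean_space) two_bundle"
    and F0 :: "'m \<Rightarrow> 'm tvec \<Rightarrow> ('q \<times> 'q tvec) set"
    and \<tau>0 :: "'m \<Rightarrow> 'm tvec \<Rightarrow> 'm tvec \<Rightarrow> ('p \<times> 'p tvec) set"
  assumes "principal_2_bundle B"
    and "two_connection B F0 \<tau>0"
  shows "quasi_LA_morphism
           (shift_groupoid (tangent_LA_groupoid (Mman B)))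
           (shift_groupoid (atiyah_LA_groupoid B))
           (graded_map_of B F0) (nat_trans_of B F0 \<tau>0)
         \<longleftrightarrow> curvature3_vanishes B F0 \<tau>0"
proof -
  interpret two_connection_bundle B F0 \<tau>0
    using assms by (intro two_connection_bundle.intro principal_two_bundle.intro two_connection_bundle_axioms.intro)
  show ?thesis by (rule main)
qed

end
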